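(* Let $n\ge 1$, $T>0$ and $s>1$. Let $M>2$, $R>0$ and denote $$\eta_0(M,R,T)=2sM^2e^{4M^2}R\,T^{1+\frac1s}+4M^2 .$$ Suppose that $u_0,u_1\in\gamma^s_{L^2}(\mathbb{R}^n)$ satisfy, for some $\eta>\eta_0(M,R,T)$, the conditions $$2\mathscr{H}(u;0)<\frac{M^2}{4}-1,$$ $$\left\|\big((-\Delta)^{3/4}u_0,(-\Delta)^{1/4}u_1\big)\right\|^2_{\gamma^s_{\eta,L^2}\times\gamma^s_{\eta,L^2}}\le R .$$ Then the Cauchy problem for the Kirchhoff equation $$\partial_t^2u-\left(1+\int_{\mathbb{R}^n}|\nabla u(t,y)|^2\,dy\right)\Delta u=0,\quad x\in\mathbb{R}^n,\qquad u(0,x)=u_0(x),\quad \partial_tu(0,x)=u_1(x),$$ admits a unique solution $u\in C^1([0,T];\gamma^s_{L^2}(\mathbb{R}^n))$ on $[0,T]$.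
   Context: The Fourier transform is $\widehat f(\xi)=(2\pi)^{-n/2}\int_{\mathbb{R}^n}e^{-ix\cdot\xi}f(x)\,dx$, and $(-\Delta)^{a}$ is the Fourier multiplier with symbol $|\xi|^{2a}$. For $s\ge1$ and $\eta>0$, $f\in\gamma^s_{\eta,L^2}(\mathbb{R}^n)$ if and only if $\|f\|_{\gamma^s_{\eta,L^2}}=\left[\int_{\mathbb{R}^n}e^{\eta|\xi|^{1/s}}|\widehat f(\xi)|^2\,d\xi\right]^{1/2}<\infty$, and $$\|(f,g)\|_{\gamma^s_{\eta,L^2}\times\gamma^s_{\eta,L^2}}=\left[\int_{\mathbb{R}^n}e^{\eta|\xi|^{1/s}}\{|\widehat f(\xi)|^2+|\widehat g(\xi)|^2\}\,d\xi\right]^{1/2}.$$ The Roumieu–Gevrey class of $L^2$ type is $\gamma^s_{L^2}(\mathbb{R}^n)=\bigcup_{\eta>0}\gamma^s_{\eta,L^2}(\mathbb{R}^n)$, endowed with the inductive limit topology. The energy is $\mathscr{H}(u;t)=\frac12\{\|\nabla u(t)\|_{L^2}^2+\|\partial_tu(t)\|_{L^2}^2\}+\frac14\|\nabla u(t)\|_{L^2}^4$; thus $\mathscr{H}(u;0)=\frac12\{\|\nabla u_0\|_{L^2}^2+\|u_1\|_{L^2}^2\}+\frac14\|\nabla u_0\|_{L^2}^4$. *)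

theory Defs
  imports "HOL-Analysis.Analysis"
begin

section \<open>Square-integrable functions on \<open>\<real>\<^sup>n\<close>\<close>

text \<open>
  Elements of function spaces are represented by (Borel measurable) functions
  \<open>real^'n \<Rightarrow> complex\<close>, and equality of elements is equality almost everywhere.
\<close>

type_synonym 'n cfun = "real^'n \<Rightarrow> complex"

definition L2 :: "('n::finite) cfun set" where
  "L2 = {f. f \<in> borel_measurable lborel \<and> integrable lborel (\<lambda>x. (cmod (f x))\<^sup>2)}"

definition L2_norm :: "('n::finite) cfun \<Rightarrow> real" where
  "L2_norm f = sqrt (\<integral>x. (cmod (f x))\<^sup>2 \<partial>lborel)"

definition L2_tendsto :: "('b \<Rightarrow> ('n::finite) cfun) \<Rightarrow> 'n cfun \<Rightarrow> 'b filter \<Rightarrow> bool" where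
  "L2_tendsto f l F \<longleftrightarrow>
     ((\<lambda>a. \<integral>\<^sup>+x. ennreal ((cmod (f a x - l x))\<^sup>2) \<partial>lborel) \<longlongrightarrow> 0) F"

section \<open>Fourier transform and Fourier multipliers\<close>

definition fourier_integral :: "('n::finite) cfun \<Rightarrow> 'n cfun" where
  "fourier_integral f \<xi> =
     of_real ((2 * pi) powr (- (real CARD('n) / 2))) *
     (\<integral>x. exp (- (\<i> * of_real (x \<bullet> \<xi>))) * f x \<partial>lborel)"

text \<open>
  A function in \<open>L2\<close> need not be integrable, so its Fourier transform is taken in the sense of
  Plancherel, as the \<open>L2\<close> limit of the Fourier integrals of the truncations to balls.
  It is determined up to a null set and agrees almost everywhere with
  \<open>fourier_integral f\<close> if \<open>f\<close> is also integrable.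
\<close>

definition fourier :: "('n::finite) cfun \<Rightarrow> 'n cfun" where
  "fourier f = (SOME g. g \<in> L2 \<and>
     L2_tendsto (\<lambda>N::nat. fourier_integral (\<lambda>x. if norm x \<le> real N then f x else 0)) g sequentially)"

definition fourier_multiplier :: "(real^'n \<Rightarrow> complex) \<Rightarrow> ('n::finite) cfun \<Rightarrow> 'n cfun" where
  "fourier_multiplier m f =
     (SOME g. g \<in> L2 \<and> (AE \<xi> in lborel. fourier g \<xi> = m \<xi> * fourier f \<xi>))"

text \<open>\<open>frac_laplacian a\<close> is the operator \<open>(-\<Delta>)\<^sup>a\<close>.\<close>

definition frac_laplacian :: "real \<Rightarrow> ('n::finite) cfun \<Rightarrow> 'n cfun" where
  "frac_laplacian a = fourier_multiplier (\<lambda>\<xi>. of_real (norm \<xi> powr (2 * a)))"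

section \<open>Weak derivatives\<close>

definition C1_compact_support :: "(real^'n \<Rightarrow> real) \<Rightarrow> bool" where
  "C1_compact_support \<phi> \<longleftrightarrow>
     (\<forall>x. \<phi> differentiable (at x)) \<and>
     (\<forall>i. continuous_on UNIV (\<lambda>x. frechet_derivative \<phi> (at x) (axis i 1))) \<and>
     compact (closure {x. \<phi> x \<noteq> 0})"

definition weak_partial :: "'n \<Rightarrow> ('n::finite) cfun \<Rightarrow> 'n cfun" where
  "weak_partial i f = (SOME g. g \<in> L2 \<and>
     (\<forall>\<phi>. C1_compact_support \<phi> \<longrightarrow>
        (\<integral>x. f x * of_real (frechet_derivative \<phi> (at x) (axis i 1)) \<partial>lborel)
          = - (\<integral>x. g x * of_real (\<phi> x) \<partial>lborel)))"

definition gradient :: "('n::finite) cfun \<Rightarrow> real^'n \<Rightarrow> complex^'n" where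
  "gradient f x = (\<chi> i. weak_partial i f x)"

definition laplacian :: "('n::finite) cfun \<Rightarrow> 'n cfun" where
  "laplacian f x = (\<Sum>i\<in>UNIV. weak_partial i (weak_partial i f) x)"

section \<open>Gevrey classes of \<open>L2\<close> type\<close>

definition gevrey_weight :: "real \<Rightarrow> real \<Rightarrow> real^('n::finite) \<Rightarrow> real" where
  "gevrey_weight s \<eta> \<xi> = exp (\<eta> * norm \<xi> powr (1 / s))"

text \<open>\<open>gevrey_eta s \<eta>\<close> is \<open>\<gamma>\<^sup>s\<close> with fixed \<open>\<eta>\<close>; \<open>gevrey s\<close> is the Roumieu class, their union.\<close>

definition gevrey_eta :: "real \<Rightarrow> real \<Rightarrow> ('n::finite) cfun set" where
  "gevrey_eta s \<eta> =
     {f \<in> L2. integrable lborel (\<lambda>\<xi>. gevrey_weight s \<eta> \<xi> * (cmod (fourier f \<xi>))\<^sup>2)}"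

definition gevrey_norm :: "real \<Rightarrow> real \<Rightarrow> ('n::finite) cfun \<Rightarrow> real" where
  "gevrey_norm s \<eta> f =
     sqrt (\<integral>\<xi>. gevrey_weight s \<eta> \<xi> * (cmod (fourier f \<xi>))\<^sup>2 \<partial>lborel)"

definition gevrey_pair_norm :: "real \<Rightarrow> real \<Rightarrow> ('n::finite) cfun \<times> 'n cfun \<Rightarrow> real" where
  "gevrey_pair_norm s \<eta> = (\<lambda>(f, g).
     sqrt (\<integral>\<xi>. gevrey_weight s \<eta> \<xi> *
        ((cmod (fourier f \<xi>))\<^sup>2 + (cmod (fourier g \<xi>))\<^sup>2) \<partial>lborel))"

definition gevrey :: "real \<Rightarrow> ('n::finite) cfun set" where
  "gevrey s = (\<Union>\<eta>\<in>{0<..}. gevrey_eta s \<eta>)"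

text \<open>
  The (locally convex) inductive limit topology on \<open>gevrey s\<close>: the absolutely convex sets whose
  trace on every step \<open>gevrey_eta s \<eta>\<close> is a neighbourhood of 0 in that step form a base of
  neighbourhoods of 0. As null functions have norm 0, open sets are invariant under changes
  on null sets.
\<close>

definition absolutely_convex :: "('n::finite) cfun set \<Rightarrow> bool" where
  "absolutely_convex U \<longleftrightarrow>
     (\<forall>f\<in>U. \<forall>g\<in>U. \<forall>a b. cmod a + cmod b \<le> 1 \<longrightarrow> (\<lambda>x. a * f x + b * g x) \<in> U)"

definition gevrey_nhd_0 :: "real \<Rightarrow> ('n::finite) cfun set \<Rightarrow> bool" where
  "gevrey_nhd_0 s U \<longleftrightarrow> U \<subseteq> gevrey s \<and> absolutely_convex U \<and>
     (\<forall>\<eta>>0. \<exists>\<epsilon>>0. {f \<in> gevrey_eta s \<eta>. gevrey_norm s \<eta> f < \<epsilon>} \<subseteq> U)"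

definition gevrey_topology :: "real \<Rightarrow> ('n::finite) cfun topology" where
  "gevrey_topology s = topology (\<lambda>V. V \<subseteq> gevrey s \<and>
     (\<forall>f\<in>V. \<exists>U. gevrey_nhd_0 s U \<and> (\<forall>g\<in>U. (\<lambda>x. f x + g x) \<in> V)))"

lemma gevrey_nhd_0_Int:
  assumes "gevrey_nhd_0 s U" "gevrey_nhd_0 s V"
  shows "gevrey_nhd_0 s (U \<inter> V)"
proof -
  have U: "U \<subseteq> gevrey s" "absolutely_convex U"
      "\<And>\<eta>. \<eta> > 0 \<Longrightarrow> \<exists>\<epsilon>>0. {f \<in> gevrey_eta s \<eta>. gevrey_norm s \<eta> f < \<epsilon>} \<subseteq> U"
    and V: "absolutely_convex V"
      "\<And>\<eta>. \<eta> > 0 \<Longrightarrow> \<exists>\<epsilon>>0. {f \<in> gevrey_eta s \<eta>. gevrey_norm s \<eta> f < \<epsilon>} \<subseteq> V"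
    using assms by (simp_all add: gevrey_nhd_0_def)
  have "\<exists>\<epsilon>>0. {f \<in> gevrey_eta s \<eta>. gevrey_norm s \<eta> f < \<epsilon>} \<subseteq> U \<inter> V" if pos: "\<eta> > 0" for \<eta>
  proof -
    obtain d where d: "d > 0" "{f \<in> gevrey_eta s \<eta>. gevrey_norm s \<eta> f < d} \<subseteq> U"
      using U(3)[OF pos] by (elim exE conjE)
    obtain e where e: "e > 0" "{f \<in> gevrey_eta s \<eta>. gevrey_norm s \<eta> f < e} \<subseteq> V"
      using V(2)[OF pos] by (elim exE conjE)
    have "{f \<in> gevrey_eta s \<eta>. gevrey_norm s \<eta> f < min d e} \<subseteq> U \<inter> V"
      using d(2) e(2) by (simp add: subset_eq)
    with d(1) e(1) show ?thesis
      by (intro exI[of _ "min d e"] conjI) simp_all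
  qed
  moreover have "absolutely_convex (U \<inter> V)"
    using U(2) V(1) by (simp add: absolutely_convex_def)
  ultimately show ?thesis
    using U(1) by (auto simp only: gevrey_nhd_0_def)
qed

lemma openin_gevrey_topology:
  fixes V :: "('n::finite) cfun set"
  shows "openin (gevrey_topology s) V \<longleftrightarrow> V \<subseteq> gevrey s \<and>
     (\<forall>f\<in>V. \<exists>U. gevrey_nhd_0 s U \<and> (\<forall>g\<in>U. (\<lambda>x. f x + g x) \<in> V))"
proof -
  let ?P = "\<lambda>V :: 'n cfun set. V \<subseteq> gevrey s \<and>
     (\<forall>f\<in>V. \<exists>U. gevrey_nhd_0 s U \<and> (\<forall>g\<in>U. (\<lambda>x. f x + g x) \<in> V))"
  have "?P (V \<inter> W)" if V: "?P V" and W: "?P W" for V W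
  proof (intro conjI ballI)
    fix f assume "f \<in> V \<inter> W"
    then obtain U1 U2 where
      "gevrey_nhd_0 s U1" "\<forall>g\<in>U1. (\<lambda>x. f x + g x) \<in> V"
      "gevrey_nhd_0 s U2" "\<forall>g\<in>U2. (\<lambda>x. f x + g x) \<in> W"
      using V W by blast
    then show "\<exists>U. gevrey_nhd_0 s U \<and> (\<forall>g\<in>U. (\<lambda>x. f x + g x) \<in> V \<inter> W)"
      by (intro exI[of _ "U1 \<inter> U2"]) (auto intro: gevrey_nhd_0_Int)
  qed (use V in blast)
  moreover have "?P (\<Union>\<K>)" if UN: "\<forall>K\<in>\<K>. ?P K" for \<K>
  proof (intro conjI ballI)
    show "\<Union>\<K> \<subseteq> gevrey s" using UN by blast
    fix f assume "f \<in> \<Union>\<K>"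
    then obtain K where K: "K \<in> \<K>" "f \<in> K" by blast
    then obtain U where "gevrey_nhd_0 s U" "\<forall>g\<in>U. (\<lambda>x. f x + g x) \<in> K"
      using bspec[OF UN K(1)] by blast
    then show "\<exists>U. gevrey_nhd_0 s U \<and> (\<forall>g\<in>U. (\<lambda>x. f x + g x) \<in> \<Union>\<K>)"
      using K by blast
  qed
  ultimately have "istopology ?P"
    unfolding istopology_def by (intro conjI allI impI) simp_all
  from topology_inverse'[OF this] show ?thesis
    unfolding gevrey_topology_def by (rule fun_cong)
qed

section \<open>The Kirchhoff equation\<close>

definition diff_quot :: "(real \<Rightarrow> ('n::finite) cfun) \<Rightarrow> real \<Rightarrow> real \<Rightarrow> 'n cfun" where
  "diff_quot u t \<tau> = (\<lambda>x. (u \<tau> x - u t x) / of_real (\<tau> - t))"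

text \<open>
  \<open>u \<in> C\<^sup>1([0,T]; gevrey s)\<close> with time derivative \<open>u'\<close>, all limits being taken in the inductive
  limit topology (one-sided at the end points of the interval).
\<close>

definition C1_gevrey :: "real \<Rightarrow> real \<Rightarrow> (real \<Rightarrow> ('n::finite) cfun) \<Rightarrow> (real \<Rightarrow> 'n cfun) \<Rightarrow> bool" where
  "C1_gevrey s T u u' \<longleftrightarrow>
     continuous_map (top_of_set {0..T}) (gevrey_topology s) u \<and>
     continuous_map (top_of_set {0..T}) (gevrey_topology s) u' \<and>
     (\<forall>t\<in>{0..T}. limitin (gevrey_topology s) (diff_quot u t) (u' t) (at t within {0..T}))"

definition has_L2_derivative ::
    "(real \<Rightarrow> ('n::finite) cfun) \<Rightarrow> 'n cfun \<Rightarrow> real \<Rightarrow> real set \<Rightarrow> bool" where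
  "has_L2_derivative u w t S \<longleftrightarrow>
     w \<in> L2 \<and> L2_tendsto (diff_quot u t) w (at t within S)"

text \<open>
  For \<open>u\<close> merely of class \<open>C\<^sup>1\<close> in time, the second time derivative in the equation is the
  derivative of \<open>\<partial>\<^sub>t u\<close> in \<open>L2\<close>, so that the equation is an identity in \<open>L2\<close> for each
  time in \<open>[0,T]\<close>.
\<close>

definition kirchhoff_solution ::
    "real \<Rightarrow> real \<Rightarrow> ('n::finite) cfun \<Rightarrow> 'n cfun \<Rightarrow> (real \<Rightarrow> 'n cfun) \<Rightarrow> bool" where
  "kirchhoff_solution s T u0 u1 u \<longleftrightarrow> (\<exists>u'. C1_gevrey s T u u' \<and>
     (\<forall>t\<in>{0..T}. has_L2_derivative u'
        (\<lambda>x. of_real (1 + (\<integral>y. (norm (gradient (u t) y))\<^sup>2 \<partial>lborel)) * laplacian (u t) x)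
        t {0..T}) \<and>
     (AE x in lborel. u 0 x = u0 x) \<and> (AE x in lborel. u' 0 x = u1 x))"

definition gradient_L2_norm :: "('n::finite) cfun \<Rightarrow> real" where
  "gradient_L2_norm f = sqrt (\<integral>x. (norm (gradient f x))\<^sup>2 \<partial>lborel)"

text \<open>The energy at time \<open>t\<close> is \<open>kirchhoff_energy (u t) (\<partial>\<^sub>t u t)\<close>.\<close>

definition kirchhoff_energy :: "('n::finite) cfun \<Rightarrow> 'n cfun \<Rightarrow> real" where
  "kirchhoff_energy f g =
     1/2 * ((gradient_L2_norm f)\<^sup>2 + (L2_norm g)\<^sup>2) + 1/4 * (gradient_L2_norm f) ^ 4"

definition eta_0 :: "real \<Rightarrow> real \<Rightarrow> real \<Rightarrow> real \<Rightarrow> real" where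
  "eta_0 s M R T = 2 * s * M\<^sup>2 * exp (4 * M\<^sup>2) * R * T powr (1 + 1 / s) + 4 * M\<^sup>2"

end

theory Submission
  imports Defs "HOL-Probability.Probability"
begin

text \<open>
  In Fourier variables the equation splits into scalar wave equations
  \<open>y'' = - a(t) |\<xi>|\<^sup>2 y\<close>, one for each frequency \<open>\<xi>\<close>, coupled only through the single real
  function \<open>a(t) = 1 + \<integral> |\<xi>|\<^sup>2 |y(t, \<xi>)|\<^sup>2 d\<xi>\<close>. A solution is therefore a fixed point
  of the map that sends a coefficient \<open>a\<close> to the coefficient computed from the modes which \<open>a\<close>
  drives. The proof finds a class of coefficients that this map preserves and on which it is
  contracting.

  Write \<open>E = |y'|\<^sup>2 + |\<xi>|\<^sup>2 |y|\<^sup>2\<close> for the energy of a mode, and suppose that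
  \<open>1 \<le> a \<le> A\<close> and \<open>|a'| \<le> K\<close>. Then \<open>E\<close> grows at most by the factor \<open>A e\<^bsup>K t\<^esup>\<close>
  (\<open>mode_energy_lipschitz_bound\<close>) and, whatever the derivative of \<open>a\<close>, at most by
  \<open>e\<^bsup>(A - 1) |\<xi>| t\<^esup>\<close> (\<open>mode_energy_elliptic_bound\<close>). If \<open>K T\<^bsup>1 + 1/s\<^esup> \<le> \<eta>\<close> then
  \<open>K t \<le> \<eta> |\<xi>|\<^bsup>1/s\<^esup>\<close> for every frequency with \<open>|\<xi>| T \<ge> 1\<close>, so that the first growth factor is
  absorbed by the Gevrey weight, while the second one is at most \<open>e\<^bsup>A\<^esup>\<close> for the other
  frequencies. Together, \<open>E(t) \<le> A e\<^bsup>A\<^esup> e\<^bsup>\<eta> |\<xi>|\<^bsup>1/s\<^esup>\<^esup> E(0)\<close> (\<open>mode_energy_gevrey_bound\<close>).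
  On the other hand the derivative of the new coefficient is at most \<open>\<integral> |\<xi>| E(t) d\<xi>\<close>, and
  \<open>\<integral> e\<^bsup>\<eta> |\<xi>|\<^bsup>1/s\<^esup>\<^esup> |\<xi>| E(0) d\<xi>\<close> is exactly the square of the Gevrey norm that the hypothesis
  bounds by \<open>R\<close>. Hence the bound \<open>|a'| \<le> K\<close> reproduces itself for \<open>K = A e\<^bsup>A\<^esup> R\<close>; with
  \<open>A = M\<^sup>2 / 4\<close> the condition \<open>K T\<^bsup>1 + 1/s\<^esup> \<le> \<eta>\<close> follows from \<open>\<eta> > \<eta>\<^sub>0\<close>.

  The upper bound \<open>a \<le> A\<close> comes from conservation of energy: \<open>1 + \<parallel>\<nabla>u\<parallel>\<^sup>2 \<le> 1 + 2 H < A\<close>.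
  Only a true solution conserves the energy, so the iteration runs with the coefficient cut off
  smoothly below \<open>A\<close>. The fixed point conserves a modified energy, in which a primitive of the
  cut-off function, taken at \<open>\<parallel>\<nabla>u\<parallel>\<^sup>2\<close>, replaces the terms in the gradient, and this already shows that
  the cut-off is never active (\<open>grad_sq_bound\<close>). Convergence of the iteration follows from an energy estimate for
  the difference of two modes with the same data and different coefficients
  (\<open>mode_energy_difference_bound\<close>): it makes the fixed point map a contraction of Volterra type
  (\<open>update_contraction\<close>).

  Uniqueness is an energy estimate as well. Every Sobolev seminorm is continuous for the inductive
  limit topology (\<open>openin_gevrey_sobolev_ball\<close>), so a \<open>C\<^sup>1\<close> function with values in the Gevrey
  class is \<open>C\<^sup>1\<close> with values in every Sobolev space, and Gronwall's lemma applies to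
  \<open>\<parallel>w'\<parallel>\<^sup>2 + a \<parallel>\<nabla>w\<parallel>\<^sup>2\<close> for the difference \<open>w\<close> of two solutions (\<open>kirchhoff_fourier_unique\<close>).

  Both parts rest on the \<open>L2\<close> theory of the Fourier transform. One identity, \<open>gaussian_pairing\<close>,
  gives that the Fourier integral is a contraction in \<open>L2\<close>, hence the existence of the transform
  (\<open>fourier_spec\<close>), and Parseval's formula against continuous functions of bounded support. With
  the fundamental lemma of the calculus of variations this yields inversion, Plancherel's theorem
  and the symbols of the weak derivatives.
\<close>

section \<open>The Hilbert space of square-integrable functions\<close>

lemma borel_measurable_cnj [measurable]:
  "f \<in> borel_measurable M \<Longrightarrow> (\<lambda>x. cnj (f x)) \<in> borel_measurable M"
  by (rule measurable_compose[OF _ borel_measurable_continuous_onI]) (auto intro: continuous_intros)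

definition sq_norm :: "('n::finite) cfun \<Rightarrow> real" where
  "sq_norm f = (\<integral>x. (cmod (f x))\<^sup>2 \<partial>lborel)"

lemma sq_norm_nonneg [simp]: "0 \<le> sq_norm f"
  by (simp add: sq_norm_def)

lemma L2_measurable [measurable_dest]: "f \<in> L2 \<Longrightarrow> f \<in> borel_measurable borel"
  by (simp add: L2_def)

lemma L2_integrable: "f \<in> L2 \<Longrightarrow> integrable lborel (\<lambda>x. (cmod (f x))\<^sup>2)"
  by (simp add: L2_def)

lemma L2I: "f \<in> borel_measurable borel \<Longrightarrow> integrable lborel (\<lambda>x. (cmod (f x))\<^sup>2) \<Longrightarrow> f \<in> L2"
  by (simp add: L2_def)

lemma L2_bound:
  assumes "integrable lborel B" and "f \<in> borel_measurable borel"
    and "AE x in lborel. (cmod (f x))\<^sup>2 \<le> B x"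
  shows "f \<in> L2"
proof (rule L2I)
  show "integrable lborel (\<lambda>x. (cmod (f x))\<^sup>2)"
    using assms by (intro Bochner_Integration.integrable_bound[OF assms(1)]) auto
qed fact

lemma sq_norm_mono:
  assumes "integrable lborel B" and "f \<in> L2" and "AE x in lborel. (cmod (f x))\<^sup>2 \<le> B x"
  shows "sq_norm f \<le> (\<integral>x. B x \<partial>lborel)"
  unfolding sq_norm_def using assms by (intro integral_mono_AE L2_integrable) auto

lemma L2_iff_nn_integral:
  "f \<in> L2 \<longleftrightarrow> f \<in> borel_measurable borel \<and> (\<integral>\<^sup>+x. ennreal ((cmod (f x))\<^sup>2) \<partial>lborel) < \<infinity>"
  by (auto simp: L2_def integrable_iff_bounded)

lemma nn_sq_norm: "f \<in> L2 \<Longrightarrow> (\<integral>\<^sup>+x. ennreal ((cmod (f x))\<^sup>2) \<partial>lborel) = ennreal (sq_norm f)"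
  unfolding sq_norm_def by (rule nn_integral_eq_integral) (auto intro: L2_integrable)

lemma cmod_add_sq_le: "(cmod (a + b))\<^sup>2 \<le> 2 * (cmod a)\<^sup>2 + 2 * (cmod b)\<^sup>2"
proof -
  have "(cmod (a + b))\<^sup>2 \<le> (cmod a + cmod b)\<^sup>2"
    by (intro power_mono norm_triangle_ineq) auto
  also have "\<dots> \<le> 2 * (cmod a)\<^sup>2 + 2 * (cmod b)\<^sup>2"
    using sum_squares_bound[of "cmod a" "cmod b"] by (simp add: power2_sum)
  finally show ?thesis .
qed

lemma L2_add: assumes "f \<in> L2" "g \<in> L2" shows "(\<lambda>x. f x + g x) \<in> L2"
proof (rule L2_bound)
  show "integrable lborel (\<lambda>x. 2 * (cmod (f x))\<^sup>2 + 2 * (cmod (g x))\<^sup>2)"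
    using assms[THEN L2_integrable] by simp
qed (use assms in \<open>auto simp: cmod_add_sq_le\<close>)

lemma L2_cmult: assumes "f \<in> L2" shows "(\<lambda>x. c * f x) \<in> L2"
proof (rule L2_bound)
  show "integrable lborel (\<lambda>x. (cmod c)\<^sup>2 * (cmod (f x))\<^sup>2)"
    using assms[THEN L2_integrable] by simp
qed (use assms in \<open>auto simp: norm_mult power_mult_distrib\<close>)

lemma L2_uminus: "f \<in> L2 \<Longrightarrow> (\<lambda>x. - f x) \<in> L2"
  using L2_cmult[of f "-1"] by simp

lemma L2_diff: "f \<in> L2 \<Longrightarrow> g \<in> L2 \<Longrightarrow> (\<lambda>x. f x - g x) \<in> L2"
  using L2_add[of f "\<lambda>x. - g x"] L2_uminus[of g] by simp

lemma L2_zero: "(\<lambda>x. 0) \<in> L2" by (auto simp: L2_def)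

lemma L2_sum: "(\<And>i. i \<in> I \<Longrightarrow> f i \<in> L2) \<Longrightarrow> (\<lambda>x. \<Sum>i\<in>I. f i x) \<in> L2"
  by (induction I rule: infinite_finite_induct) (auto intro: L2_zero L2_add)

lemma L2_cnj: "f \<in> L2 \<Longrightarrow> (\<lambda>x. cnj (f x)) \<in> L2"
  by (auto simp: L2_def)

lemma sq_norm_cnj: "sq_norm (\<lambda>x. cnj (f x)) = sq_norm f"
  by (simp add: sq_norm_def)

lemma sq_norm_cmult: "sq_norm (\<lambda>x. c * f x) = (cmod c)\<^sup>2 * sq_norm f"
  by (simp add: sq_norm_def norm_mult power_mult_distrib)

lemma L2_AE_cong: "f \<in> L2 \<Longrightarrow> g \<in> borel_measurable borel \<Longrightarrow> AE x in lborel. f x = g x \<Longrightarrow> g \<in> L2"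
  by (rule L2_bound[OF L2_integrable[of f]]) (auto elim: eventually_mono)

lemma sq_norm_AE_cong: "f \<in> L2 \<Longrightarrow> g \<in> borel_measurable borel \<Longrightarrow> AE x in lborel. f x = g x \<Longrightarrow> sq_norm f = sq_norm g"
  unfolding sq_norm_def by (intro integral_cong_AE) (auto elim: eventually_mono)

lemma sq_norm_eq_0: assumes "f \<in> L2" "sq_norm f = 0" shows "AE x in lborel. f x = 0"
  using integral_nonneg_eq_0_iff_AE[OF L2_integrable[OF assms(1)]] assms(2)
  by (auto simp: sq_norm_def)

lemma L2_mult_integrable:
  assumes "f \<in> L2" "g \<in> L2" shows "integrable lborel (\<lambda>x. f x * g x)"
proof (rule Bochner_Integration.integrable_bound)
  show "integrable lborel (\<lambda>x. (cmod (f x))\<^sup>2 + (cmod (g x))\<^sup>2)"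
    using assms[THEN L2_integrable] by simp
  have "cmod (f x * g x) \<le> norm ((cmod (f x))\<^sup>2 + (cmod (g x))\<^sup>2)" for x
  proof -
    have "0 \<le> cmod (f x) * cmod (g x)" by simp
    then have "cmod (f x) * cmod (g x) \<le> (cmod (f x))\<^sup>2 + (cmod (g x))\<^sup>2"
      using sum_squares_bound[of "cmod (f x)" "cmod (g x)"] by linarith
    then show ?thesis by (simp add: norm_mult)
  qed
  then show "AE x in lborel. cmod (f x * g x) \<le> norm ((cmod (f x))\<^sup>2 + (cmod (g x))\<^sup>2)" by simp
qed (use assms in auto)

lemma Cauchy_Schwarz_L2_abs:
  assumes "f \<in> L2" "g \<in> L2"
  shows "(\<integral>x. cmod (f x) * cmod (g x) \<partial>lborel)\<^sup>2 \<le> sq_norm f * sq_norm g"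
proof -
  have i: "integrable lborel (\<lambda>x. cmod (f x) * cmod (g x))"
    using integrable_norm[OF L2_mult_integrable[OF assms]] by (simp add: norm_mult)
  have "ennreal ((\<integral>x. cmod (f x) * cmod (g x) \<partial>lborel)\<^sup>2)
      = (\<integral>\<^sup>+x. ennreal (cmod (f x)) * ennreal (cmod (g x)) \<partial>lborel)\<^sup>2"
    by (subst ennreal_power[symmetric])
      (simp_all add: nn_integral_eq_integral[OF i, symmetric] ennreal_mult)
  also have "\<dots> \<le> (\<integral>\<^sup>+x. (ennreal (cmod (f x)))\<^sup>2 \<partial>lborel) * (\<integral>\<^sup>+x. (ennreal (cmod (g x)))\<^sup>2 \<partial>lborel)"
    using assms by (intro Cauchy_Schwarz_nn_integral) auto
  also have "\<dots> = ennreal (sq_norm f * sq_norm g)"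
    using assms by (simp add: nn_sq_norm ennreal_power ennreal_mult)
  finally show ?thesis by (simp add: ennreal_le_iff)
qed

lemma Cauchy_Schwarz_L2:
  assumes "f \<in> L2" "g \<in> L2"
  shows "cmod (\<integral>x. f x * g x \<partial>lborel) \<le> sqrt (sq_norm f) * sqrt (sq_norm g)"
proof -
  have "cmod (\<integral>x. f x * g x \<partial>lborel) \<le> (\<integral>x. cmod (f x) * cmod (g x) \<partial>lborel)"
    using integral_norm_bound[of lborel "\<lambda>x. f x * g x"] by (simp add: norm_mult)
  also have "\<dots> \<le> sqrt (sq_norm f * sq_norm g)"
    by (rule real_le_rsqrt[OF Cauchy_Schwarz_L2_abs[OF assms]])
  finally show ?thesis by (simp add: real_sqrt_mult)
qed

lemma sq_norm_inner: "complex_of_real (sq_norm f) = (\<integral>x. f x * cnj (f x) \<partial>lborel)"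
  by (simp add: sq_norm_def complex_norm_square[symmetric] flip: of_real_power)

lemma sq_norm_add:
  assumes "f \<in> L2" "g \<in> L2"
  shows "sq_norm (\<lambda>x. f x + g x) = sq_norm f + sq_norm g + 2 * Re (\<integral>x. f x * cnj (g x) \<partial>lborel)"
proof -
  have i: "integrable lborel (\<lambda>x. f x * cnj (g x))"
    using assms by (intro L2_mult_integrable L2_cnj)
  have "(cmod (f x + g x))\<^sup>2 = (cmod (f x))\<^sup>2 + (cmod (g x))\<^sup>2 + 2 * Re (f x * cnj (g x))" for x
    by (simp add: cmod_power2 power2_sum algebra_simps)
  then have "sq_norm (\<lambda>x. f x + g x)
      = (\<integral>x. (cmod (f x))\<^sup>2 + (cmod (g x))\<^sup>2 + 2 * Re (f x * cnj (g x)) \<partial>lborel)"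
    unfolding sq_norm_def by presburger
  also have "\<dots> = sq_norm f + sq_norm g + 2 * (\<integral>x. Re (f x * cnj (g x)) \<partial>lborel)"
    using assms[THEN L2_integrable] integrable_Re[OF i] unfolding sq_norm_def
    by (simp del: times_complex.sel)
  finally show ?thesis by (simp only: integral_Re[OF i])
qed

lemma L2_tendsto_iff:
  assumes "\<And>a. f a \<in> L2" "l \<in> L2"
  shows "L2_tendsto f l F \<longleftrightarrow> ((\<lambda>a. sq_norm (\<lambda>x. f a x - l x)) \<longlongrightarrow> 0) F"
proof -
  have "(\<integral>\<^sup>+x. ennreal ((cmod (f a x - l x))\<^sup>2) \<partial>lborel) = ennreal (sq_norm (\<lambda>x. f a x - l x))" for a
    using assms by (intro nn_sq_norm L2_diff)
  then have "L2_tendsto f l F \<longleftrightarrow> ((\<lambda>a. ennreal (sq_norm (\<lambda>x. f a x - l x))) \<longlongrightarrow> ennreal 0) F"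
    by (simp add: L2_tendsto_def)
  also have "\<dots> \<longleftrightarrow> ((\<lambda>a. sq_norm (\<lambda>x. f a x - l x)) \<longlongrightarrow> 0) F"
    by (rule tendsto_ennreal_iff) auto
  finally show ?thesis .
qed

text \<open>
  Norm convergence implies weak convergence, by the Cauchy-Schwarz inequality.
\<close>

lemma L2_tendsto_inner:
  assumes lim: "L2_tendsto f l F" and f: "\<And>a. f a \<in> L2" and l: "l \<in> L2" and g: "g \<in> L2"
  shows "((\<lambda>a. \<integral>x. f a x * g x \<partial>lborel) \<longlongrightarrow> (\<integral>x. l x * g x \<partial>lborel)) F"
proof (rule Lim_null[THEN iffD2], rule Lim_null_comparison)
  have "(\<integral>x. f a x * g x \<partial>lborel) - (\<integral>x. l x * g x \<partial>lborel) = (\<integral>x. (f a x - l x) * g x \<partial>lborel)" for a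
    using L2_mult_integrable[OF f[of a] g] L2_mult_integrable[OF l g]
    by (simp add: left_diff_distrib)
  then show "\<forall>\<^sub>F a in F. cmod ((\<integral>x. f a x * g x \<partial>lborel) - (\<integral>x. l x * g x \<partial>lborel))
      \<le> sqrt (sq_norm (\<lambda>x. f a x - l x)) * sqrt (sq_norm g)"
    using Cauchy_Schwarz_L2[OF L2_diff[OF f l] g] by simp
  have "((\<lambda>a. sq_norm (\<lambda>x. f a x - l x)) \<longlongrightarrow> 0) F"
    using lim L2_tendsto_iff[of f l F] f l by simp
  from tendsto_mult_left_zero[OF tendsto_real_sqrt[OF this, simplified]]
  show "((\<lambda>a. sqrt (sq_norm (\<lambda>x. f a x - l x)) * sqrt (sq_norm g)) \<longlongrightarrow> 0) F" .
qed

text \<open>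
  Convergence of the norm: expanding \<open>\<parallel>f\<^sub>a\<parallel>\<^sup>2 = \<parallel>(f\<^sub>a - l) + l\<parallel>\<^sup>2\<close> leaves a cross term, which
  vanishes in the limit by weak convergence.
\<close>

lemma L2_tendsto_sq_norm:
  assumes lim: "L2_tendsto f l F" and f: "\<And>a. f a \<in> L2" and l: "l \<in> L2"
  shows "((\<lambda>a. sq_norm (f a)) \<longlongrightarrow> sq_norm l) F"
proof -
  have z: "((\<lambda>a. sq_norm (\<lambda>x. f a x - l x)) \<longlongrightarrow> 0) F"
    using lim L2_tendsto_iff[of f l F] f l by simp
  have eq: "sq_norm (f a) = sq_norm (\<lambda>x. f a x - l x) + sq_norm l
      + 2 * Re ((\<integral>x. f a x * cnj (l x) \<partial>lborel) - (\<integral>x. l x * cnj (l x) \<partial>lborel))" for a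
  proof -
    have "(\<integral>x. f a x * cnj (l x) \<partial>lborel) - (\<integral>x. l x * cnj (l x) \<partial>lborel)
        = (\<integral>x. (f a x - l x) * cnj (l x) \<partial>lborel)"
      using L2_mult_integrable[OF f[of a] L2_cnj[OF l]]
        L2_mult_integrable[OF l L2_cnj[OF l]]
      by (simp add: left_diff_distrib)
    then show ?thesis
      using sq_norm_add[OF L2_diff[OF f l] l, of a] by simp
  qed
  have "((\<lambda>a. sq_norm (\<lambda>x. f a x - l x) + sq_norm l
      + 2 * Re ((\<integral>x. f a x * cnj (l x) \<partial>lborel) - (\<integral>x. l x * cnj (l x) \<partial>lborel))) \<longlongrightarrow>
     0 + sq_norm l + 2 * Re ((\<integral>x. l x * cnj (l x) \<partial>lborel) - (\<integral>x. l x * cnj (l x) \<partial>lborel))) F"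
    by (intro tendsto_intros z L2_tendsto_inner[OF lim f l L2_cnj[OF l]])
  then show ?thesis unfolding eq by simp
qed

lemma sq_norm_diff_le:
  assumes "f \<in> L2" "g \<in> L2" "h \<in> L2"
  shows "sq_norm (\<lambda>x. f x - g x) \<le> 2 * sq_norm (\<lambda>x. f x - h x) + 2 * sq_norm (\<lambda>x. g x - h x)"
proof -
  have i: "integrable lborel (\<lambda>x. 2 * (cmod (f x - h x))\<^sup>2 + 2 * (cmod (g x - h x))\<^sup>2)"
    using L2_integrable[OF L2_diff[OF assms(1,3)]] L2_integrable[OF L2_diff[OF assms(2,3)]] by simp
  have "sq_norm (\<lambda>x. f x - g x) \<le> (\<integral>x. 2 * (cmod (f x - h x))\<^sup>2 + 2 * (cmod (g x - h x))\<^sup>2 \<partial>lborel)"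
    using cmod_add_sq_le[of "f x - h x" "h x - g x" for x]
    by (intro sq_norm_mono i L2_diff assms) (auto simp: norm_minus_commute)
  then show ?thesis
    using L2_integrable[OF L2_diff[OF assms(1,3)]] L2_integrable[OF L2_diff[OF assms(2,3)]]
    by (simp add: sq_norm_def)
qed

lemma L2_tendsto_unique:
  assumes "L2_tendsto f g F" "L2_tendsto f h F" "F \<noteq> bot" and L: "\<And>a. f a \<in> L2" "g \<in> L2" "h \<in> L2"
  shows "AE x in lborel. g x = h x"
proof -
  have "sq_norm (\<lambda>x. g x - h x) \<le> 2 * 0 + 2 * 0"
  proof (rule tendsto_le[OF assms(3) _ tendsto_const])
    show "((\<lambda>a. 2 * sq_norm (\<lambda>x. f a x - g x) + 2 * sq_norm (\<lambda>x. f a x - h x)) \<longlongrightarrow> 2 * 0 + 2 * 0) F"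
      using assms L2_tendsto_iff[of f g F] L2_tendsto_iff[of f h F] by (intro tendsto_intros) auto
    show "\<forall>\<^sub>F a in F. sq_norm (\<lambda>x. g x - h x) \<le> 2 * sq_norm (\<lambda>x. f a x - g x) + 2 * sq_norm (\<lambda>x. f a x - h x)"
      using sq_norm_diff_le[OF L(2,3,1)] by (simp add: sq_norm_def norm_minus_commute)
  qed
  then have "sq_norm (\<lambda>x. g x - h x) = 0" using sq_norm_nonneg[of "\<lambda>x. g x - h x"] by simp
  from sq_norm_eq_0[OF L2_diff[OF L(2,3)] this] show ?thesis by simp
qed

text \<open>
  The Riesz-Fischer argument. A rapidly converging subsequence converges almost everywhere, and
  Fatou's lemma transfers the Cauchy estimates to the pointwise limit.
\<close>

lemma L2_complete:
  fixes f :: "nat \<Rightarrow> ('n::finite) cfun"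
  assumes f: "\<And>k. f k \<in> L2"
    and Cauchy: "\<And>e. e > 0 \<Longrightarrow> \<exists>K. \<forall>m\<ge>K. \<forall>n\<ge>K. sq_norm (\<lambda>x. f m x - f n x) \<le> e"
  obtains g where "g \<in> L2" "L2_tendsto f g sequentially"
proof -
  have [measurable]: "f k \<in> borel_measurable borel" for k using f L2_measurable by blast
  have "\<exists>K. \<forall>m\<ge>K. \<forall>n\<ge>K. sq_norm (\<lambda>x. f m x - f n x) \<le> (1/4)^j" for j :: nat
    by (rule Cauchy) simp
  then obtain K where K: "\<And>j m n. m \<ge> K j \<Longrightarrow> n \<ge> K j \<Longrightarrow> sq_norm (\<lambda>x. f m x - f n x) \<le> (1/4)^j"
    by metis
  \<comment> \<open>A subsequence along which consecutive squared distances are at most \<open>(1/4)\<^bsup>j\<^esup>\<close>; adding \<open>j\<close>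
    makes it unbounded.\<close>
  define r where "r j = (\<Sum>i\<le>j. K i) + j" for j
  have rK: "K j \<le> r j" "K j \<le> r (Suc j)" "j \<le> r j" for j
    unfolding r_def using member_le_sum[of j "{..j}" K] by auto
  define d where "d j x = cmod (f (r (Suc j)) x - f (r j) x)" for j x
  have [measurable]: "d j \<in> borel_measurable borel" for j unfolding d_def by measurable
  have "(\<integral>\<^sup>+x. (\<Sum>j. ennreal (2^j * (d j x)\<^sup>2)) \<partial>lborel) = (\<Sum>j. \<integral>\<^sup>+x. ennreal (2^j * (d j x)\<^sup>2) \<partial>lborel)"
    by (rule nn_integral_suminf) auto
  also have "\<dots> \<le> (\<Sum>j. ennreal ((1/2)^j))"
  proof (intro suminf_le summableI)
    fix j
    have "(\<integral>\<^sup>+x. ennreal (2^j * (d j x)\<^sup>2) \<partial>lborel) = ennreal (2^j) * (\<integral>\<^sup>+x. ennreal ((d j x)\<^sup>2) \<partial>lborel)"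
      by (subst nn_integral_cmult[symmetric]) (auto simp: ennreal_mult)
    also have "(\<integral>\<^sup>+x. ennreal ((d j x)\<^sup>2) \<partial>lborel) = ennreal (sq_norm (\<lambda>x. f (r (Suc j)) x - f (r j) x))"
      unfolding d_def by (rule nn_sq_norm[OF L2_diff[OF f f]])
    also have "ennreal (2^j) * \<dots> \<le> ennreal (2^j) * ennreal ((1/4)^j)"
      by (intro mult_left_mono ennreal_leI K rK) auto
    also have "\<dots> = ennreal ((1/2)^j)"
      by (simp add: power_divide field_simps flip: ennreal_mult power_mult_distrib)
    finally show "(\<integral>\<^sup>+x. ennreal (2^j * (d j x)\<^sup>2) \<partial>lborel) \<le> ennreal ((1/2)^j)" .
  qed
  also have "\<dots> = ennreal (\<Sum>j. (1/2)^j)"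
    by (intro suminf_ennreal2 summable_geometric) auto
  also have "\<dots> < \<infinity>" by simp
  finally have "(\<integral>\<^sup>+x. (\<Sum>j. ennreal (2^j * (d j x)\<^sup>2)) \<partial>lborel) \<noteq> \<infinity>" by simp
  then have "AE x in lborel. (\<Sum>j. ennreal (2^j * (d j x)\<^sup>2)) \<noteq> \<infinity>"
    by (intro nn_integral_noteq_infinite) auto
  then have AEconv: "AE x in lborel. convergent (\<lambda>j. f (r j) x)"
  proof eventually_elim
    case (elim x)
    have s: "summable (\<lambda>j. 2^j * (d j x)\<^sup>2)"
      using elim by (intro summable_suminf_not_top) auto
    \<comment> \<open>The inequality \<open>2 x \<le> 1 + x\<^sup>2\<close> for \<open>x = 2\<^bsup>j\<^esup> d\<^sub>j\<close>.\<close>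
    have "d j x \<le> (1/2)^j + 2^j * (d j x)\<^sup>2" for j
    proof -
      have "0 \<le> (1 - 2^j * d j x)\<^sup>2" by simp
      also have "\<dots> = 1 - 2 * (2^j * d j x) + 2^j * (2^j * (d j x)\<^sup>2)" by (simp add: power2_eq_square algebra_simps)
      finally have le: "2 * (2^j * d j x) \<le> 1 + 2^j * (2^j * (d j x)\<^sup>2)" by simp
      have "0 \<le> 2^j * d j x" by (simp add: d_def)
      with le have "2^j * d j x \<le> 1 + 2^j * (2^j * (d j x)\<^sup>2)" by linarith
      then have "2^j * d j x \<le> 2^j * ((1/2)^j + 2^j * (d j x)\<^sup>2)" by (simp add: power_divide algebra_simps)
      then show ?thesis by (subst (asm) mult_le_cancel_left_pos) auto
    qed
    then have "summable (\<lambda>j. f (r (Suc j)) x - f (r j) x)"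
      by (intro summable_comparison_test[OF _ summable_add[OF summable_geometric s]])
        (auto simp: d_def)
    then have "convergent (\<lambda>n. \<Sum>j<n. f (r (Suc j)) x - f (r j) x)" by (simp add: summable_iff_convergent)
    then have "convergent (\<lambda>n. f (r n) x - f (r 0) x)"
      by (simp only: sum_lessThan_telescope[of "\<lambda>j. f (r j) x"])
    then show ?case by (simp add: convergent_diff_const_right_iff)
  qed
  define g where "g x = lim (\<lambda>j. f (r j) x)" for x
  have [measurable]: "g \<in> borel_measurable borel" unfolding g_def by measurable
  have lim: "AE x in lborel. (\<lambda>j. f (r j) x) \<longlonglongrightarrow> g x"
    using AEconv by (simp add: g_def convergent_LIMSEQ_iff)
  have main: "(\<integral>\<^sup>+x. ennreal ((cmod (f m x - g x))\<^sup>2) \<partial>lborel) \<le> ennreal e"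
    if m: "\<And>n. n \<ge> k \<Longrightarrow> sq_norm (\<lambda>x. f m x - f n x) \<le> e" for m e k
  proof -
    have "AE x in lborel. liminf (\<lambda>j. ennreal ((cmod (f m x - f (r j) x))\<^sup>2)) = ennreal ((cmod (f m x - g x))\<^sup>2)"
      using lim
    proof eventually_elim
      case (elim x)
      then have "(\<lambda>j. ennreal ((cmod (f m x - f (r j) x))\<^sup>2)) \<longlonglongrightarrow> ennreal ((cmod (f m x - g x))\<^sup>2)"
        by (intro tendsto_intros)
      then show ?case by (rule lim_imp_Liminf[OF sequentially_bot])
    qed
    then have "(\<integral>\<^sup>+x. ennreal ((cmod (f m x - g x))\<^sup>2) \<partial>lborel)
        = (\<integral>\<^sup>+x. liminf (\<lambda>j. ennreal ((cmod (f m x - f (r j) x))\<^sup>2)) \<partial>lborel)"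
      by (intro nn_integral_cong_AE) auto
    also have "\<dots> \<le> liminf (\<lambda>j. \<integral>\<^sup>+x. ennreal ((cmod (f m x - f (r j) x))\<^sup>2) \<partial>lborel)"
      by (intro nn_integral_liminf) auto
    also have "\<dots> \<le> limsup (\<lambda>j. \<integral>\<^sup>+x. ennreal ((cmod (f m x - f (r j) x))\<^sup>2) \<partial>lborel)"
      by (rule Liminf_le_Limsup) simp
    also have "\<dots> \<le> ennreal e"
    proof (rule Limsup_bounded)
      show "\<forall>\<^sub>F j in sequentially. (\<integral>\<^sup>+x. ennreal ((cmod (f m x - f (r j) x))\<^sup>2) \<partial>lborel) \<le> ennreal e"
        using eventually_ge_at_top[of k]
        by eventually_elim (auto simp: nn_sq_norm[OF L2_diff[OF f f]] intro!: ennreal_leI m order_trans[OF _ rK(3)])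
    qed
    finally show ?thesis .
  qed
  have gL2: "g \<in> L2"
  proof -
    obtain k where k: "\<forall>m\<ge>k. \<forall>n\<ge>k. sq_norm (\<lambda>x. f m x - f n x) \<le> 1" using Cauchy[of 1] by auto
    have "(\<integral>\<^sup>+x. ennreal ((cmod (f k x - g x))\<^sup>2) \<partial>lborel) \<le> ennreal 1"
      using k by (intro main[of k]) auto
    also have "\<dots> < \<infinity>" by simp
    finally have "(\<lambda>x. f k x - g x) \<in> L2" unfolding L2_iff_nn_integral by simp
    from L2_diff[OF f[of k] this] show ?thesis by simp
  qed
  moreover have "L2_tendsto f g sequentially"
    unfolding L2_tendsto_iff[of f, OF f gL2]
  proof (rule LIMSEQ_I)
    fix e :: real assume "e > 0"
    then obtain k where k: "\<forall>m\<ge>k. \<forall>n\<ge>k. sq_norm (\<lambda>x. f m x - f n x) \<le> e / 2"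
      using Cauchy[of "e/2"] by auto
    have "norm (sq_norm (\<lambda>x. f m x - g x) - 0) < e" if "m \<ge> k" for m
    proof -
      have "ennreal (sq_norm (\<lambda>x. f m x - g x)) \<le> ennreal (e/2)"
        using main[of k m "e/2"] k that by (subst nn_sq_norm[symmetric]) (auto intro: L2_diff f gL2)
      then show ?thesis using \<open>e > 0\<close> by simp
    qed
    then show "\<exists>k. \<forall>m\<ge>k. norm (sq_norm (\<lambda>x. f m x - g x) - 0) < e" by blast
  qed
  ultimately show ?thesis using that by blast
qed

section \<open>Lebesgue integrals under affine substitution and over products\<close>

lemma lborel_nn_integral_affine:
  fixes f :: "'a::euclidean_space \<Rightarrow> ennreal"
  assumes [measurable]: "f \<in> borel_measurable borel" and c: "c \<noteq> 0"
  shows "(\<integral>\<^sup>+x. f x \<partial>lborel) = ennreal (\<bar>c\<bar>^DIM('a)) * (\<integral>\<^sup>+x. f (t + c *\<^sub>R x) \<partial>lborel)"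
  by (subst lborel_affine[OF c, of t])
     (simp add: nn_integral_density nn_integral_distr nn_integral_cmult)

lemma lborel_integral_affine:
  fixes f :: "'a::euclidean_space \<Rightarrow> 'b::{banach, second_countable_topology}"
  assumes [measurable]: "f \<in> borel_measurable borel" and c: "c \<noteq> 0"
  shows "(\<integral>x. f x \<partial>lborel) = \<bar>c\<bar>^DIM('a) *\<^sub>R (\<integral>x. f (t + c *\<^sub>R x) \<partial>lborel)"
  by (subst lborel_affine[OF c, of t])
     (simp add: integral_density integral_distr)

lemma lborel_integrable_affine:
  fixes f :: "'a::euclidean_space \<Rightarrow> 'b::{banach, second_countable_topology}"
  assumes f: "integrable lborel f" and c: "c \<noteq> 0"
  shows "integrable lborel (\<lambda>x. f (t + c *\<^sub>R x))"
proof -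
  have [measurable]: "f \<in> borel_measurable borel" using f by auto
  show ?thesis
    using f c unfolding integrable_iff_bounded
    by (subst (asm) lborel_nn_integral_affine[where c=c and t=t]) (auto simp: ennreal_mult_less_top)
qed

lemma
  fixes f :: "'a::euclidean_space \<Rightarrow> real \<Rightarrow> complex"
  assumes f: "\<And>b. b \<in> Basis \<Longrightarrow> integrable lborel (f b)"
  shows lborel_integrable_prod: "integrable lborel (\<lambda>x. \<Prod>b\<in>Basis. f b (x \<bullet> b))" (is ?I)
    and lborel_integral_prod: "(\<integral>x. (\<Prod>b\<in>Basis. f b (x \<bullet> b)) \<partial>lborel) = (\<Prod>b\<in>Basis. \<integral>x. f b x \<partial>lborel)" (is ?E)
proof -
  interpret product_sigma_finite "\<lambda>_::'a. lborel :: real measure" ..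
  have [measurable]: "b \<in> Basis \<Longrightarrow> f b \<in> borel_measurable borel" for b using f by auto
  have m: "(\<lambda>g. \<Sum>b\<in>Basis. g b *\<^sub>R b) \<in> (\<Pi>\<^sub>M b\<in>(Basis::'a set). lborel) \<rightarrow>\<^sub>M borel"
    by measurable
  have fm: "(\<lambda>x::'a. \<Prod>b\<in>Basis. f b (x \<bullet> b)) \<in> borel_measurable borel" by measurable
  have eq: "(\<Prod>b\<in>(Basis::'a set). f b ((\<Sum>b\<in>Basis. g b *\<^sub>R b) \<bullet> b)) = (\<Prod>b\<in>Basis. f b (g b))" for g
    by (intro prod.cong refl) (simp add: inner_sum_left_Basis)
  show ?I
    unfolding lborel_eq[where 'a='a] integrable_distr_eq[OF m fm] eq
    by (rule product_integrable_prod) (auto intro: f)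
  show ?E
    unfolding lborel_eq[where 'a='a] integral_distr[OF m fm] eq
    by (rule product_integral_prod) (auto intro: f)
qed

section \<open>The standard Gaussian\<close>

text \<open>
  Written as a product over the coordinates so that its characteristic function factorises into
  the one-dimensional ones.
\<close>

definition gaussian :: "real^('n::finite) \<Rightarrow> real" where
  "gaussian x = (\<Prod>b\<in>Basis. std_normal_density (x \<bullet> b))"

lemma gaussian_nonneg [simp]: "0 \<le> gaussian x"
  by (simp add: gaussian_def prod_nonneg)

lemma gaussian_measurable [measurable]: "gaussian \<in> borel_measurable borel"
  unfolding gaussian_def by measurable

lemma gaussian_eq: "gaussian (x::real^'n::finite) = (2 * pi) powr - (real CARD('n) / 2) * exp (- (norm x)\<^sup>2 / 2)"
proof -
  have "gaussian x = (\<Prod>b\<in>(Basis::(real^'n) set). (1 / sqrt (2 * pi)) * exp (- (x \<bullet> b)\<^sup>2 / 2))"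
    by (simp add: gaussian_def std_normal_density_def)
  also have "\<dots> = (1 / sqrt (2 * pi)) ^ CARD('n) * exp (\<Sum>b\<in>(Basis::(real^'n) set). - (x \<bullet> b)\<^sup>2 / 2)"
    by (simp add: prod_dividef exp_sum power_divide)
  also have "(\<Sum>b\<in>(Basis::(real^'n) set). - (x \<bullet> b)\<^sup>2 / 2) = - (norm x)\<^sup>2 / 2"
    unfolding power2_norm_eq_inner euclidean_inner[of x x]
    by (simp add: sum_negf sum_divide_distrib power2_eq_square)
  also have "(1 / sqrt (2 * pi)) ^ CARD('n) = (2 * pi) powr - (real CARD('n) / 2)"
  proof -
    have "(1 / sqrt (2 * pi)) ^ CARD('n) = ((2 * pi) powr (- (1/2))) powr real CARD('n)"
      by (simp add: powr_minus powr_half_sqrt field_simps powr_realpow)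
    also have "\<dots> = (2 * pi) powr - (real CARD('n) / 2)"
      by (subst powr_powr) simp
    finally show ?thesis .
  qed
  finally show ?thesis .
qed

lemma std_normal_char:
  "(\<integral>x. complex_of_real (std_normal_density x) * exp (\<i> * complex_of_real (t * x)) \<partial>lborel)
    = complex_of_real (exp (- (t\<^sup>2) / 2))"
  "integrable lborel (\<lambda>x. complex_of_real (std_normal_density x) * exp (\<i> * complex_of_real (t * x)))"
proof -
  have "char std_normal_distribution t = (\<integral>x. std_normal_density x *\<^sub>R exp (\<i> * complex_of_real (t * x)) \<partial>lborel)"
    unfolding char_def by (subst integral_density) (auto simp: normal_density_nonneg)
  then show "(\<integral>x. complex_of_real (std_normal_density x) * exp (\<i> * complex_of_real (t * x)) \<partial>lborel)
    = complex_of_real (exp (- (t\<^sup>2) / 2))"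
    by (simp add: char_std_normal_distribution scaleR_conv_of_real)
  have i: "integrable lborel (\<lambda>x. std_normal_density x)" by (simp add: integrable_normal_density)
  show "integrable lborel (\<lambda>x. complex_of_real (std_normal_density x) * exp (\<i> * complex_of_real (t * x)))"
    by (rule Bochner_Integration.integrable_bound[OF i])
      (auto simp: norm_mult normal_density_nonneg)
qed

lemma gaussian_char:
  fixes t :: "real^'n::finite"
  shows "(\<integral>x. complex_of_real (gaussian x) * exp (\<i> * complex_of_real (t \<bullet> x)) \<partial>lborel)
      = complex_of_real (exp (- (norm t)\<^sup>2 / 2))"
    and "integrable lborel (\<lambda>x. complex_of_real (gaussian x) * exp (\<i> * complex_of_real (t \<bullet> x)))"
proof -
  have eq: "complex_of_real (gaussian x) * exp (\<i> * complex_of_real (t \<bullet> x))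
      = (\<Prod>b\<in>Basis. complex_of_real (std_normal_density (x \<bullet> b)) * exp (\<i> * complex_of_real ((t \<bullet> b) * (x \<bullet> b))))" for x :: "real^'n"
  proof -
    have "exp (\<i> * complex_of_real (t \<bullet> x)) = (\<Prod>b\<in>Basis. exp (\<i> * complex_of_real ((t \<bullet> b) * (x \<bullet> b))))"
      by (subst euclidean_inner) (simp add: sum_distrib_left exp_sum)
    then show ?thesis by (simp add: gaussian_def prod.distrib)
  qed
  show "integrable lborel (\<lambda>x. complex_of_real (gaussian x) * exp (\<i> * complex_of_real (t \<bullet> x)))"
    unfolding eq by (rule lborel_integrable_prod[OF std_normal_char(2)])
  have "(\<integral>x. complex_of_real (gaussian x) * exp (\<i> * complex_of_real (t \<bullet> x)) \<partial>lborel)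
      = (\<Prod>b\<in>(Basis::(real^'n) set). complex_of_real (exp (- ((t \<bullet> b)\<^sup>2) / 2)))"
    unfolding eq by (subst lborel_integral_prod[OF std_normal_char(2)]) (simp only: std_normal_char(1))
  also have "\<dots> = complex_of_real (exp (\<Sum>b\<in>(Basis::(real^'n) set). - ((t \<bullet> b)\<^sup>2) / 2))"
    by (subst exp_sum) auto
  also have "(\<Sum>b\<in>(Basis::(real^'n) set). - ((t \<bullet> b)\<^sup>2) / 2) = - (norm t)\<^sup>2 / 2"
    unfolding power2_norm_eq_inner euclidean_inner[of t t]
    by (simp add: sum_negf sum_divide_distrib power2_eq_square)
  finally show "(\<integral>x. complex_of_real (gaussian x) * exp (\<i> * complex_of_real (t \<bullet> x)) \<partial>lborel)
      = complex_of_real (exp (- (norm t)\<^sup>2 / 2))" .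
qed

lemma gaussian_integrable: "integrable lborel (gaussian :: real^'n::finite \<Rightarrow> real)"
  using integrable_Re[OF gaussian_char(2)[of "0::real^'n"]] by simp

lemma gaussian_integral: "(\<integral>x. gaussian (x::real^'n::finite) \<partial>lborel) = 1"
  using gaussian_char(1)[of "0::real^'n"] by (simp del: of_real_eq_1_iff add: of_real_eq_1_iff[symmetric, where 'a=complex])

lemma gaussian_nn_integral: "(\<integral>\<^sup>+x. ennreal (gaussian (x::real^'n::finite)) \<partial>lborel) = 1"
  by (subst nn_integral_eq_integral[OF gaussian_integrable]) (auto simp: gaussian_integral)

section \<open>Fourier integrals\<close>

definition fourier_const :: "'n::finite itself \<Rightarrow> real" where
  "fourier_const _ = (2 * pi) powr - (real CARD('n) / 2)"

lemma fourier_integral_eq: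
  "fourier_integral (f :: 'n::finite cfun) \<xi> = complex_of_real (fourier_const TYPE('n)) * (\<integral>x. exp (- (\<i> * complex_of_real (x \<bullet> \<xi>))) * f x \<partial>lborel)"
  by (simp add: fourier_integral_def fourier_const_def)

lemma fourier_const_nonneg [simp]: "0 \<le> fourier_const TYPE('n::finite)"
  by (simp add: fourier_const_def)

lemma cmod_fourier_char [simp]: "cmod (exp (- (\<i> * complex_of_real r))) = 1"
  using norm_exp_i_times[of "-r"] by simp

lemma fourier_kernel_integrable:
  fixes f :: "'n::finite cfun"
  assumes f: "integrable lborel f"
  shows "integrable lborel (\<lambda>x. exp (- (\<i> * complex_of_real (x \<bullet> \<xi>))) * f x)"
proof -
  have [measurable]: "f \<in> borel_measurable borel" using f by auto
  show ?thesis
    by (rule Bochner_Integration.integrable_bound[OF f]) (auto simp: norm_mult)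
qed

lemma fourier_integral_measurable:
  fixes f :: "'n::finite cfun"
  assumes f: "f \<in> borel_measurable borel"
  shows "fourier_integral f \<in> borel_measurable borel"
proof -
  have [measurable]: "f \<in> borel_measurable lborel" using f by simp
  have "(\<lambda>\<xi>. \<integral>x. exp (- (\<i> * complex_of_real (x \<bullet> \<xi>))) * f x \<partial>lborel) \<in> borel_measurable lborel"
    by measurable
  then show ?thesis unfolding fourier_integral_eq[abs_def] by simp
qed

lemma fourier_integral_bound:
  fixes f :: "'n::finite cfun"
  assumes f: "integrable lborel f"
  shows "cmod (fourier_integral f \<xi>) \<le> fourier_const TYPE('n) * (\<integral>x. cmod (f x) \<partial>lborel)"
proof -
  have "cmod (\<integral>x. exp (- (\<i> * complex_of_real (x \<bullet> \<xi>))) * f x \<partial>lborel)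
      \<le> (\<integral>x. cmod (exp (- (\<i> * complex_of_real (x \<bullet> \<xi>))) * f x) \<partial>lborel)"
    by (rule integral_norm_bound)
  then show ?thesis
    unfolding fourier_integral_eq by (simp add: norm_mult mult_left_mono)
qed

lemma fourier_integral_diff:
  fixes f g :: "'n::finite cfun"
  assumes "integrable lborel f" "integrable lborel g"
  shows "fourier_integral (\<lambda>x. f x - g x) \<xi> = fourier_integral f \<xi> - fourier_integral g \<xi>"
  using fourier_kernel_integrable[OF assms(1), of \<xi>] fourier_kernel_integrable[OF assms(2), of \<xi>]
  unfolding fourier_integral_eq by (simp add: right_diff_distrib)

lemma fourier_kernel_pair_integrable:
  fixes f g :: "'n::finite cfun"
  assumes f: "integrable lborel f" and g: "integrable lborel g"
  shows "integrable (lborel \<Otimes>\<^sub>M lborel) (\<lambda>(x, y). exp (- (\<i> * complex_of_real (x \<bullet> y))) * (f x * g y))"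
proof -
  have [measurable]: "f \<in> borel_measurable borel" "g \<in> borel_measurable borel" using f g by auto
  show ?thesis
  proof (rule lborel_pair.Fubini_integrable)
    show "integrable lborel (\<lambda>x. \<integral>y. norm (case (x, y) of (x, y) \<Rightarrow> exp (- (\<i> * complex_of_real (x \<bullet> y))) * (f x * g y)) \<partial>lborel)"
      using integrable_norm[OF f] by (simp add: norm_mult)
    show "AE x in lborel. integrable lborel (\<lambda>y. case (x, y) of (x, y) \<Rightarrow> exp (- (\<i> * complex_of_real (x \<bullet> y))) * (f x * g y))"
    proof (rule AE_I2, simp)
      fix x
      show "integrable lborel (\<lambda>y. exp (- (\<i> * complex_of_real (x \<bullet> y))) * (f x * g y))"
        by (rule Bochner_Integration.integrable_bound[OF integrable_mult_right[OF g, of "f x"]])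
          (auto simp: norm_mult)
    qed
  qed measurable
qed

text \<open>
  Fubini's theorem: both sides are the integral of \<open>f(x) g(\<xi>) e\<^bsup>-i x \<xi>\<^esup>\<close> over the product space.
\<close>

lemma fourier_integral_multiplication_formula:
  fixes f g :: "'n::finite cfun"
  assumes f: "integrable lborel f" and g: "integrable lborel g"
  shows "(\<integral>\<xi>. fourier_integral f \<xi> * g \<xi> \<partial>lborel) = (\<integral>x. f x * fourier_integral g x \<partial>lborel)"
proof -
  let ?h = "\<lambda>x y. exp (- (\<i> * complex_of_real (x \<bullet> y))) * (f x * g y)"
  let ?c = "complex_of_real (fourier_const TYPE('n))"
  have i: "integrable (lborel \<Otimes>\<^sub>M lborel) (case_prod ?h)"
    by (rule fourier_kernel_pair_integrable[OF f g])
  have "(\<integral>y. fourier_integral f y * g y \<partial>lborel) = ?c * (\<integral>y. (\<integral>x. ?h x y \<partial>lborel) \<partial>lborel)"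
    using fourier_kernel_integrable[OF f]
    unfolding fourier_integral_eq integral_mult_right_zero[symmetric]
    by (intro Bochner_Integration.integral_cong refl)
      (simp add: mult.assoc integral_mult_left_zero[symmetric] del: integral_mult_left_zero)
  also have "(\<integral>y. (\<integral>x. ?h x y \<partial>lborel) \<partial>lborel) = (\<integral>x. (\<integral>y. ?h x y \<partial>lborel) \<partial>lborel)"
    by (rule lborel_pair.Fubini_integral[OF i])
  also have "?c * \<dots> = (\<integral>x. f x * fourier_integral g x \<partial>lborel)"
    using fourier_kernel_integrable[OF g]
    unfolding fourier_integral_eq integral_mult_right_zero[symmetric]
    by (intro Bochner_Integration.integral_cong refl)
      (simp add: mult_ac inner_commute)
  finally show ?thesis .
qed

section \<open>Gaussian regularisation of Fourier inversion\<close>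

text \<open>
  The convergence factor \<open>e\<^bsup>- c\<^sup>2 |\<xi>|\<^sup>2 / 2\<^esup>\<close>, which makes the inversion integral absolutely
  convergent and tends to 1 as \<open>c\<close> tends to 0.
\<close>

definition gauss_factor :: "real \<Rightarrow> real^('n::finite) \<Rightarrow> complex" where
  "gauss_factor c \<xi> = complex_of_real (exp (- (norm (c *\<^sub>R \<xi>))\<^sup>2 / 2))"

lemma gauss_factor_measurable [measurable]: "gauss_factor c \<in> borel_measurable borel"
  unfolding gauss_factor_def by measurable

lemma fourier_const_pos: "0 < fourier_const TYPE('n::finite)"
  by (simp add: fourier_const_def)

lemma gauss_factor_eq: "gauss_factor c (\<xi>::real^'n::finite) = complex_of_real (gaussian (c *\<^sub>R \<xi>) / fourier_const TYPE('n))"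
  using fourier_const_pos[where 'n='n] by (simp add: gauss_factor_def gaussian_eq fourier_const_def)

lemma gauss_factor_integrable: assumes "c \<noteq> 0" shows "integrable lborel (gauss_factor c :: 'n::finite cfun)"
  using lborel_integrable_affine[OF gaussian_integrable[where 'n='n] assms, of 0]
  unfolding gauss_factor_eq[abs_def] by (intro integrable_of_real integrable_divide) auto

lemma cmod_gauss_factor_le: "cmod (gauss_factor c \<xi>) \<le> 1"
  by (simp add: gauss_factor_def)

text \<open>
  A modulated wide Gaussian transforms into a narrow Gaussian centred at \<open>x\<close>. Up to the Fourier
  constant this is an approximate identity as \<open>c\<close> tends to 0.
\<close>

lemma fourier_integral_gauss_factor_shift:
  fixes x y :: "real^'n::finite"
  assumes c: "c > 0"
  shows "fourier_integral (\<lambda>\<xi>. exp (\<i> * complex_of_real (\<xi> \<bullet> x)) * gauss_factor c \<xi>) y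
    = complex_of_real (gaussian ((1/c) *\<^sub>R (y - x)) / (c ^ CARD('n) * fourier_const TYPE('n)))"
proof -
  let ?k = "fourier_const TYPE('n)"
  have e: "exp (- (\<i> * complex_of_real (\<xi> \<bullet> y))) * (exp (\<i> * complex_of_real (\<xi> \<bullet> x)) * gauss_factor c \<xi>)
     = complex_of_real (1/?k) * (complex_of_real (gaussian (c *\<^sub>R \<xi>)) * exp (\<i> * complex_of_real (((1/c) *\<^sub>R (x - y)) \<bullet> (c *\<^sub>R \<xi>))))" for \<xi>
    using c by (simp add: gauss_factor_eq exp_add[symmetric] inner_diff algebra_simps inner_commute flip: exp_add mult.assoc)
  have "(\<integral>\<xi>. complex_of_real (gaussian \<xi>) * exp (\<i> * complex_of_real (((1/c) *\<^sub>R (x - y)) \<bullet> \<xi>)) \<partial>lborel)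
    = c^CARD('n) *\<^sub>R (\<integral>\<xi>. complex_of_real (gaussian (c *\<^sub>R \<xi>)) * exp (\<i> * complex_of_real (((1/c) *\<^sub>R (x - y)) \<bullet> (c *\<^sub>R \<xi>))) \<partial>lborel)"
    using c by (subst lborel_integral_affine[where c=c and t=0]) simp_all
  then have "(\<integral>\<xi>. complex_of_real (gaussian (c *\<^sub>R \<xi>)) * exp (\<i> * complex_of_real (((1/c) *\<^sub>R (x - y)) \<bullet> (c *\<^sub>R \<xi>))) \<partial>lborel)
    = complex_of_real (exp (- (norm ((1/c) *\<^sub>R (x - y)))\<^sup>2 / 2) / c^CARD('n))"
    using c unfolding gaussian_char(1) by (simp add: scaleR_conv_of_real field_simps)
  also have "exp (- (norm ((1/c) *\<^sub>R (x - y)))\<^sup>2 / 2) = gaussian ((1/c) *\<^sub>R (y - x)) / ?k"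
    using fourier_const_pos[where 'n='n] by (simp add: gaussian_eq fourier_const_def norm_minus_commute)
  finally show ?thesis
    unfolding fourier_integral_eq e integral_mult_right_zero
    using fourier_const_pos[where 'n='n] by (simp add: field_simps)
qed

text \<open>
  Inversion with a convergence factor reproduces a Gaussian average of the function: the
  multiplication formula moves the transform from \<open>g\<close> to the modulated Gaussian. The complex
  conjugates turn the inverse transform into a forward one.
\<close>

lemma gaussian_regularisation:
  fixes g :: "'n::finite cfun"
  assumes g: "integrable lborel g" and c: "c > 0"
  shows "fourier_integral (\<lambda>\<xi>. cnj (fourier_integral g \<xi>) * gauss_factor c \<xi>) x
    = (\<integral>z. complex_of_real (gaussian z) * cnj (g (x + c *\<^sub>R z)) \<partial>lborel)"
proof -
  let ?k = "fourier_const TYPE('n)"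
  have [measurable]: "g \<in> borel_measurable borel" using g by auto
  have w: "integrable lborel (\<lambda>\<xi>. exp (\<i> * complex_of_real (\<xi> \<bullet> x)) * gauss_factor c \<xi>)"
    by (rule Bochner_Integration.integrable_bound[OF gauss_factor_integrable[of c]])
      (use c in \<open>auto simp: norm_mult\<close>)
  have "(\<integral>\<xi>. exp (- (\<i> * complex_of_real (\<xi> \<bullet> x))) * (cnj (fourier_integral g \<xi>) * gauss_factor c \<xi>) \<partial>lborel)
      = (\<integral>\<xi>. cnj (fourier_integral g \<xi> * (exp (\<i> * complex_of_real (\<xi> \<bullet> x)) * gauss_factor c \<xi>)) \<partial>lborel)"
    by (intro Bochner_Integration.integral_cong refl) (simp add: gauss_factor_def exp_cnj)
  also have "\<dots> = cnj (\<integral>\<xi>. fourier_integral g \<xi> * (exp (\<i> * complex_of_real (\<xi> \<bullet> x)) * gauss_factor c \<xi>) \<partial>lborel)"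
    by (rule Bochner_Integration.integral_cnj)
  also have "\<dots> = cnj (\<integral>y. g y * complex_of_real (gaussian ((1/c) *\<^sub>R (y - x)) / (c ^ CARD('n) * ?k)) \<partial>lborel)"
    unfolding fourier_integral_multiplication_formula[OF g w] fourier_integral_gauss_factor_shift[OF c] ..
  also have "(\<integral>y. g y * complex_of_real (gaussian ((1/c) *\<^sub>R (y - x)) / (c ^ CARD('n) * ?k)) \<partial>lborel)
     = c^CARD('n) *\<^sub>R (\<integral>z. g (x + c *\<^sub>R z) * complex_of_real (gaussian z / (c ^ CARD('n) * ?k)) \<partial>lborel)"
    using c by (subst lborel_integral_affine[where c=c and t=x]) simp_all
  also have "\<dots> = complex_of_real (1/?k) * (\<integral>z. complex_of_real (gaussian z) * g (x + c *\<^sub>R z) \<partial>lborel)"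
    unfolding integral_mult_right_zero[symmetric] integral_scaleR_right[symmetric] using c
    by (intro Bochner_Integration.integral_cong refl) (simp add: scaleR_conv_of_real field_simps)
  also have "cnj \<dots> = complex_of_real (1/?k) * (\<integral>z. complex_of_real (gaussian z) * cnj (g (x + c *\<^sub>R z)) \<partial>lborel)"
    by (simp flip: Bochner_Integration.integral_cnj)
  finally show ?thesis
    unfolding fourier_integral_eq[where \<xi>=x] using fourier_const_pos[where 'n='n] by simp
qed

text \<open>
  Fatou's lemma for a convergent sequence.
\<close>

lemma nn_integral_lim_le:
  fixes f :: "nat \<Rightarrow> 'a \<Rightarrow> ennreal"
  assumes [measurable]: "\<And>n. f n \<in> borel_measurable M"
    and lim: "AE x in M. (\<lambda>n. f n x) \<longlonglongrightarrow> g x" and le: "\<And>n. (\<integral>\<^sup>+x. f n x \<partial>M) \<le> C"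
  shows "(\<integral>\<^sup>+x. g x \<partial>M) \<le> C"
proof -
  have "(\<integral>\<^sup>+x. g x \<partial>M) = (\<integral>\<^sup>+x. liminf (\<lambda>n. f n x) \<partial>M)"
    using lim by (intro nn_integral_cong_AE)
      (auto elim!: eventually_mono dest: lim_imp_Liminf[OF sequentially_bot])
  also have "\<dots> \<le> liminf (\<lambda>n. \<integral>\<^sup>+x. f n x \<partial>M)"
    by (intro nn_integral_liminf) auto
  also have "\<dots> \<le> limsup (\<lambda>n. \<integral>\<^sup>+x. f n x \<partial>M)"
    by (rule Liminf_le_Limsup) simp
  also have "\<dots> \<le> C" by (rule Limsup_bounded) (simp add: le)
  finally show ?thesis .
qed

lemma norm_integral_le_nn:
  fixes f :: "'a \<Rightarrow> 'b::{banach, second_countable_topology}"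
  shows "ennreal (norm (integral\<^sup>L M f)) \<le> (\<integral>\<^sup>+x. ennreal (norm (f x)) \<partial>M)"
  by (cases "integrable M f") (auto simp: integral_norm_bound_ennreal not_integrable_integral_eq)

lemma integrable_bounded_mult:
  fixes f g :: "'a \<Rightarrow> complex"
  assumes f: "integrable M f" and [measurable]: "g \<in> borel_measurable M" and B: "\<And>x. cmod (g x) \<le> B"
  shows "integrable M (\<lambda>x. f x * g x)"
proof -
  have [measurable]: "f \<in> borel_measurable M" using f by auto
  have "0 \<le> B" using B[of undefined] norm_ge_zero order_trans by blast
  have "norm (f x * g x) \<le> norm (cmod (f x) * B)" for x
    using mult_left_mono[OF B norm_ge_zero, of "f x" x] \<open>0 \<le> B\<close> by (simp add: norm_mult)
  then show ?thesis
    using integrable_mult_left[OF integrable_norm[OF f], of B]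
    by (rule Bochner_Integration.integrable_bound[rotated 2, OF AE_I2]) simp
qed

text \<open>
  A regularised Parseval formula. It serves twice, with \<open>g = f\<close> for the \<open>L2\<close> bound and with a
  continuous \<open>g\<close> for Parseval's formula, each time as \<open>c\<close> tends to 0.
\<close>

lemma gaussian_pairing:
  fixes f g :: "'n::finite cfun"
  assumes f: "integrable lborel f" and g: "integrable lborel g" and c: "c > 0"
  shows "(\<integral>\<xi>. fourier_integral f \<xi> * (cnj (fourier_integral g \<xi>) * gauss_factor c \<xi>) \<partial>lborel)
     = (\<integral>x. f x * (\<integral>z. complex_of_real (gaussian z) * cnj (g (x + c *\<^sub>R z)) \<partial>lborel) \<partial>lborel)"
proof -
  have [measurable]: "f \<in> borel_measurable borel" "g \<in> borel_measurable borel" using f g by auto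
  note [measurable] = fourier_integral_measurable
  have i: "integrable lborel (\<lambda>\<xi>. cnj (fourier_integral g \<xi>) * gauss_factor c \<xi>)"
    using integrable_bounded_mult[OF gauss_factor_integrable[of c], of "\<lambda>\<xi>. cnj (fourier_integral g \<xi>)"
        "fourier_const TYPE('n) * (\<integral>x. cmod (g x) \<partial>lborel)"]
      fourier_integral_bound[OF g] c by (simp add: mult.commute)
  show ?thesis
    unfolding fourier_integral_multiplication_formula[OF f i] gaussian_regularisation[OF g c] ..
qed

text \<open>
  For \<open>g = f\<close> the right-hand side of \<open>gaussian_pairing\<close> is at most \<open>\<parallel>f\<parallel>\<^sup>2\<close>: by the arithmetic-geometric
  mean inequality \<open>|f(x)| |f(x + c z)|\<close> is at most the mean of the squares, and Lebesgue measure is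
  invariant under the translation by \<open>c z\<close>. The left-hand side tends to
  \<open>\<parallel>fourier_integral f\<parallel>\<^sup>2\<close>. Only the inequality is obtained here; equality follows once inversion
  is available.
\<close>

lemma fourier_integral_L2:
  fixes f :: "'n::finite cfun"
  assumes f: "integrable lborel f" and f2: "f \<in> L2"
  shows "fourier_integral f \<in> L2" "sq_norm (fourier_integral f) \<le> sq_norm f"
proof -
  have [measurable]: "f \<in> borel_measurable borel" "fourier_integral f \<in> borel_measurable borel"
    using f fourier_integral_measurable[of f] by auto
  define G where "G c x = (\<integral>z. complex_of_real (gaussian z) * cnj (f (x + c *\<^sub>R z)) \<partial>lborel)" for c x
  have weighted: "(\<integral>\<^sup>+\<xi>. ennreal ((cmod (fourier_integral f \<xi>))\<^sup>2 * cmod (gauss_factor c \<xi>)) \<partial>lborel) \<le> ennreal (sq_norm f)"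
    if c: "c > 0" for c
  proof -
    have i: "integrable lborel (\<lambda>\<xi>. (cmod (fourier_integral f \<xi>))\<^sup>2 * cmod (gauss_factor c \<xi>))"
      using integrable_norm[OF integrable_bounded_mult[OF gauss_factor_integrable[of c], of "\<lambda>\<xi>. (fourier_integral f \<xi>)\<^sup>2"
        "(fourier_const TYPE('n) * (\<integral>x. cmod (f x) \<partial>lborel))\<^sup>2"]]
        fourier_integral_bound[OF f] c by (simp add: mult.commute norm_mult norm_power power_mono)
    have nn: "0 \<le> (\<integral>\<xi>. (cmod (fourier_integral f \<xi>))\<^sup>2 * cmod (gauss_factor c \<xi>) \<partial>lborel)"
      by (intro Bochner_Integration.integral_nonneg) auto
    have "(\<integral>\<^sup>+\<xi>. ennreal ((cmod (fourier_integral f \<xi>))\<^sup>2 * cmod (gauss_factor c \<xi>)) \<partial>lborel)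
       = ennreal (\<integral>\<xi>. (cmod (fourier_integral f \<xi>))\<^sup>2 * cmod (gauss_factor c \<xi>) \<partial>lborel)"
      by (rule nn_integral_eq_integral[OF i]) simp
    also have "\<dots> = ennreal (cmod (\<integral>\<xi>. complex_of_real ((cmod (fourier_integral f \<xi>))\<^sup>2 * cmod (gauss_factor c \<xi>)) \<partial>lborel))"
      using nn by (simp add: integral_complex_of_real del: of_real_mult of_real_power)
    also have "(\<integral>\<xi>. complex_of_real ((cmod (fourier_integral f \<xi>))\<^sup>2 * cmod (gauss_factor c \<xi>)) \<partial>lborel)
       = (\<integral>\<xi>. fourier_integral f \<xi> * (cnj (fourier_integral f \<xi>) * gauss_factor c \<xi>) \<partial>lborel)"
      unfolding of_real_mult complex_norm_square by (simp add: gauss_factor_def mult.assoc)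
    also have "\<dots> = (\<integral>x. f x * G c x \<partial>lborel)"
      unfolding gaussian_pairing[OF f f c] G_def ..
    also have "ennreal (cmod \<dots>) \<le> (\<integral>\<^sup>+x. ennreal (cmod (f x * G c x)) \<partial>lborel)"
      by (rule norm_integral_le_nn)
    also have "\<dots> \<le> (\<integral>\<^sup>+x. (\<integral>\<^sup>+z. ennreal (gaussian z) * ennreal (1/2 * (cmod (f x))\<^sup>2 + 1/2 * (cmod (f (x + c *\<^sub>R z)))\<^sup>2) \<partial>lborel) \<partial>lborel)"
    proof (rule nn_integral_mono)
      fix x
      have "ennreal (cmod (f x * G c x)) \<le> ennreal (cmod (f x)) * (\<integral>\<^sup>+z. ennreal (cmod (complex_of_real (gaussian z) * cnj (f (x + c *\<^sub>R z)))) \<partial>lborel)"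
        unfolding norm_mult[of "f x"] ennreal_mult'[OF norm_ge_zero] G_def
        by (intro mult_left_mono norm_integral_le_nn) simp
      also have "\<dots> = (\<integral>\<^sup>+z. ennreal (cmod (f x)) * ennreal (cmod (complex_of_real (gaussian z) * cnj (f (x + c *\<^sub>R z)))) \<partial>lborel)"
        by (rule nn_integral_cmult[symmetric]) simp
      also have "\<dots> \<le> (\<integral>\<^sup>+z. ennreal (gaussian z) * ennreal (1/2 * (cmod (f x))\<^sup>2 + 1/2 * (cmod (f (x + c *\<^sub>R z)))\<^sup>2) \<partial>lborel)"
      proof (rule nn_integral_mono)
        fix z
        have "cmod (f x) * (gaussian z * cmod (f (x + c *\<^sub>R z))) = gaussian z * (cmod (f x) * cmod (f (x + c *\<^sub>R z)))"
          by simp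
        also have "\<dots> \<le> gaussian z * (1/2 * (cmod (f x))\<^sup>2 + 1/2 * (cmod (f (x + c *\<^sub>R z)))\<^sup>2)"
          using sum_squares_bound[of "cmod (f x)" "cmod (f (x + c *\<^sub>R z))"]
          by (intro mult_left_mono) auto
        finally have "ennreal (cmod (f x) * (gaussian z * cmod (f (x + c *\<^sub>R z)))) \<le> \<dots>"
          by (rule ennreal_leI)
        then show "ennreal (cmod (f x)) * ennreal (cmod (complex_of_real (gaussian z) * cnj (f (x + c *\<^sub>R z))))
           \<le> ennreal (gaussian z) * ennreal (1/2 * (cmod (f x))\<^sup>2 + 1/2 * (cmod (f (x + c *\<^sub>R z)))\<^sup>2)"
          by (simp add: norm_mult ennreal_mult' del: mult_minus_right)
      qed
      finally show "ennreal (cmod (f x * G c x)) \<le> (\<integral>\<^sup>+z. ennreal (gaussian z) * ennreal (1/2 * (cmod (f x))\<^sup>2 + 1/2 * (cmod (f (x + c *\<^sub>R z)))\<^sup>2) \<partial>lborel)" .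
    qed
    also have "\<dots> = (\<integral>\<^sup>+z. (\<integral>\<^sup>+x. ennreal (gaussian z) * ennreal (1/2 * (cmod (f x))\<^sup>2 + 1/2 * (cmod (f (x + c *\<^sub>R z)))\<^sup>2) \<partial>lborel) \<partial>lborel)"
      by (rule lborel_pair.Fubini') measurable
    also have "\<dots> = (\<integral>\<^sup>+z. ennreal (gaussian (z::real^'n)) * ennreal (sq_norm f) \<partial>lborel)"
    proof (rule nn_integral_cong)
      fix z :: "real^'n"
      have a: "(\<integral>\<^sup>+x. ennreal ((cmod (f (x + c *\<^sub>R z)))\<^sup>2) \<partial>lborel) = ennreal (sq_norm f)"
        using lborel_nn_integral_affine[of "\<lambda>x. ennreal ((cmod (f x))\<^sup>2)" 1 "c *\<^sub>R z"] nn_sq_norm[OF f2]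
        by (simp add: add.commute)
      have "(\<integral>\<^sup>+x. ennreal (gaussian z) * ennreal (1/2 * (cmod (f x))\<^sup>2 + 1/2 * (cmod (f (x + c *\<^sub>R z)))\<^sup>2) \<partial>lborel)
        = ennreal (gaussian z) * (\<integral>\<^sup>+x. ennreal (1/2) * ennreal ((cmod (f x))\<^sup>2) + ennreal (1/2) * ennreal ((cmod (f (x + c *\<^sub>R z)))\<^sup>2) \<partial>lborel)"
        by (subst nn_integral_cmult[symmetric])
          (simp_all only: ennreal_plus[OF mult_nonneg_nonneg mult_nonneg_nonneg] ennreal_mult zero_le_power2
            zero_le_divide_1_iff zero_le_numeral, measurable)
      also have "\<dots> = ennreal (gaussian z) * (ennreal (1/2) * ennreal (sq_norm f) + ennreal (1/2) * ennreal (sq_norm f))"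
        by (subst nn_integral_add) (simp_all add: nn_integral_cmult a nn_sq_norm[OF f2] del: ennreal_half)
      also have "ennreal (1/2) * ennreal (sq_norm f) + ennreal (1/2) * ennreal (sq_norm f) = ennreal (sq_norm f)"
        by (simp flip: ennreal_mult ennreal_plus del: ennreal_half)
      finally show "(\<integral>\<^sup>+x. ennreal (gaussian z) * ennreal (1/2 * (cmod (f x))\<^sup>2 + 1/2 * (cmod (f (x + c *\<^sub>R z)))\<^sup>2) \<partial>lborel) = ennreal (gaussian z) * ennreal (sq_norm f)" .
    qed
    also have "\<dots> = ennreal (sq_norm f)"
      by (subst nn_integral_multc) (simp_all add: gaussian_nn_integral)
    finally show ?thesis .
  qed
  have le: "(\<integral>\<^sup>+\<xi>. ennreal ((cmod (fourier_integral f \<xi>))\<^sup>2) \<partial>lborel) \<le> ennreal (sq_norm f)"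
  proof (rule nn_integral_lim_le)
    show "(\<integral>\<^sup>+\<xi>. ennreal ((cmod (fourier_integral f \<xi>))\<^sup>2 * cmod (gauss_factor (1 / real (Suc n)) \<xi>)) \<partial>lborel) \<le> ennreal (sq_norm f)" for n
      by (rule weighted) simp
    have "(\<lambda>n. (cmod (fourier_integral f \<xi>))\<^sup>2 * cmod (gauss_factor (1 / real (Suc n)) \<xi>)) \<longlonglongrightarrow> (cmod (fourier_integral f \<xi>))\<^sup>2 * cmod (complex_of_real (exp (- (norm (0 *\<^sub>R \<xi>))\<^sup>2 / 2)))" for \<xi>
      unfolding gauss_factor_def by (intro tendsto_intros LIMSEQ_Suc[OF lim_1_over_n]) simp_all
    then show "AE \<xi> in lborel. (\<lambda>n. ennreal ((cmod (fourier_integral f \<xi>))\<^sup>2 * cmod (gauss_factor (1 / real (Suc n)) \<xi>)))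
       \<longlonglongrightarrow> ennreal ((cmod (fourier_integral f \<xi>))\<^sup>2)"
      by (intro AE_I2 tendsto_ennrealI) simp
  qed measurable
  then show L: "fourier_integral f \<in> L2"
    unfolding L2_iff_nn_integral by (auto intro: le_less_trans)
  show "sq_norm (fourier_integral f) \<le> sq_norm f"
    using le unfolding nn_sq_norm[OF L] by simp
qed

text \<open>
  Continuity of \<open>g\<close> makes its Gaussian averages converge at every point, and boundedness makes the
  convergence dominated, so the regularisation can be removed from \<open>gaussian_pairing\<close>.
\<close>

lemma fourier_integral_parseval:
  fixes f g :: "'n::finite cfun"
  assumes f: "integrable lborel f" "f \<in> L2" and g: "integrable lborel g" "g \<in> L2"
    and cont: "continuous_on UNIV g" and B: "\<And>x. cmod (g x) \<le> B"
  shows "(\<integral>\<xi>. fourier_integral f \<xi> * cnj (fourier_integral g \<xi>) \<partial>lborel) = (\<integral>x. f x * cnj (g x) \<partial>lborel)"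
proof (rule LIMSEQ_unique)
  define c :: "nat \<Rightarrow> real" where "c n = 1 / real (Suc n)" for n
  have c: "c n > 0" for n by (simp add: c_def)
  have c0: "c \<longlonglongrightarrow> 0" unfolding c_def by (intro LIMSEQ_Suc[OF lim_1_over_n])
  have [measurable]: "f \<in> borel_measurable borel" "g \<in> borel_measurable borel" using f g by auto
  note [measurable] = fourier_integral_measurable
  let ?I = "\<lambda>n. \<integral>\<xi>. fourier_integral f \<xi> * (cnj (fourier_integral g \<xi>) * gauss_factor (c n) \<xi>) \<partial>lborel"
  show "?I \<longlonglongrightarrow> (\<integral>\<xi>. fourier_integral f \<xi> * cnj (fourier_integral g \<xi>) \<partial>lborel)"
  proof (rule integral_dominated_convergence)
    have "(\<lambda>n. fourier_integral f \<xi> * (cnj (fourier_integral g \<xi>) * gauss_factor (c n) \<xi>)) \<longlonglongrightarrow> fourier_integral f \<xi> * (cnj (fourier_integral g \<xi>) * complex_of_real (exp (- (norm (0 *\<^sub>R \<xi>))\<^sup>2 / 2)))" for \<xi>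
      unfolding gauss_factor_def by (intro tendsto_intros c0) simp_all
    then show "AE \<xi> in lborel. (\<lambda>n. fourier_integral f \<xi> * (cnj (fourier_integral g \<xi>) * gauss_factor (c n) \<xi>)) \<longlonglongrightarrow> fourier_integral f \<xi> * cnj (fourier_integral g \<xi>)"
      by simp
    show "integrable lborel (\<lambda>\<xi>. cmod (fourier_integral f \<xi> * cnj (fourier_integral g \<xi>)))"
      by (intro integrable_norm L2_mult_integrable L2_cnj fourier_integral_L2 f g)
    show "AE \<xi> in lborel. norm (fourier_integral f \<xi> * (cnj (fourier_integral g \<xi>) * gauss_factor (c n) \<xi>)) \<le> cmod (fourier_integral f \<xi> * cnj (fourier_integral g \<xi>))" for n
    proof (rule AE_I2)
      fix \<xi> :: "real^'n"
      have "cmod (fourier_integral f \<xi> * cnj (fourier_integral g \<xi>)) * cmod (gauss_factor (c n) \<xi>)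
          \<le> cmod (fourier_integral f \<xi> * cnj (fourier_integral g \<xi>))"
        by (intro mult_left_le cmod_gauss_factor_le norm_ge_zero)
      then show "norm (fourier_integral f \<xi> * (cnj (fourier_integral g \<xi>) * gauss_factor (c n) \<xi>)) \<le> cmod (fourier_integral f \<xi> * cnj (fourier_integral g \<xi>))"
        by (simp add: norm_mult mult.assoc)
    qed
  qed measurable
  let ?G = "\<lambda>n x. \<integral>z. complex_of_real (gaussian z) * cnj (g (x + c n *\<^sub>R z)) \<partial>lborel"
  have "0 \<le> B" using B[of undefined] norm_ge_zero order_trans by blast
  have GB: "cmod (?G n x) \<le> B" for n x
  proof -
    have "ennreal (cmod (?G n x)) \<le> (\<integral>\<^sup>+z. ennreal (cmod (complex_of_real (gaussian z) * cnj (g (x + c n *\<^sub>R z)))) \<partial>lborel)"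
      by (rule norm_integral_le_nn)
    also have "\<dots> \<le> (\<integral>\<^sup>+z. ennreal (gaussian (z::real^'n)) * ennreal B \<partial>lborel)"
      using \<open>0 \<le> B\<close>
      by (intro nn_integral_mono) (simp add: norm_mult ennreal_mult'[symmetric] mult_left_mono ennreal_leI B)
    also have "\<dots> = ennreal B" by (subst nn_integral_multc) (simp_all add: gaussian_nn_integral)
    finally show ?thesis using \<open>0 \<le> B\<close> by simp
  qed
  have Gm [measurable]: "?G n \<in> borel_measurable borel" for n
  proof -
    have "?G n \<in> borel_measurable lborel" by measurable
    then show ?thesis by simp
  qed
  have Glim: "(\<lambda>n. ?G n x) \<longlonglongrightarrow> cnj (g x)" for x
  proof -
    have "(\<lambda>n. ?G n x) \<longlonglongrightarrow> (\<integral>z. complex_of_real (gaussian z) * cnj (g (x + 0 *\<^sub>R z)) \<partial>lborel)"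
    proof (rule integral_dominated_convergence)
      have "(\<lambda>n. g (x + c n *\<^sub>R z)) \<longlonglongrightarrow> g (x + 0 *\<^sub>R z)" for z
        by (rule continuous_on_tendsto_compose[OF cont]) (auto intro!: tendsto_eq_intros c0)
      then show "AE z in lborel. (\<lambda>n. complex_of_real (gaussian z) * cnj (g (x + c n *\<^sub>R z))) \<longlonglongrightarrow> complex_of_real (gaussian z) * cnj (g (x + 0 *\<^sub>R z))"
        by (intro AE_I2 tendsto_intros)
      show "integrable lborel (\<lambda>z::real^'n. gaussian z * B)" using gaussian_integrable[where 'n='n] by simp
      show "AE z in lborel. norm (complex_of_real (gaussian z) * cnj (g (x + c n *\<^sub>R z))) \<le> gaussian z * B" for n
        using B by (simp add: norm_mult mult_left_mono)
    qed measurable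
    also have "(\<integral>z. complex_of_real (gaussian z) * cnj (g (x + 0 *\<^sub>R z)) \<partial>lborel) = cnj (g x)"
      by (simp add: integral_complex_of_real gaussian_integral)
    finally show ?thesis .
  qed
  have "(\<lambda>n. \<integral>x. f x * ?G n x \<partial>lborel) \<longlonglongrightarrow> (\<integral>x. f x * cnj (g x) \<partial>lborel)"
  proof (rule integral_dominated_convergence)
    show "AE x in lborel. (\<lambda>n. f x * ?G n x) \<longlonglongrightarrow> f x * cnj (g x)"
      by (intro AE_I2 tendsto_intros Glim)
    show "integrable lborel (\<lambda>x. cmod (f x) * B)" using integrable_norm[OF f(1)] by simp
    show "AE x in lborel. norm (f x * ?G n x) \<le> cmod (f x) * B" for n
      using GB by (simp add: norm_mult mult_left_mono)
  qed measurable
  then show "?I \<longlonglongrightarrow> (\<integral>x. f x * cnj (g x) \<partial>lborel)"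
    unfolding gaussian_pairing[OF f(1) g(1) c] .
qed

section \<open>Test functions\<close>

text \<open>
  The simplest continuously differentiable function that is positive exactly on the positive reals.
\<close>

definition sqpos :: "real \<Rightarrow> real" where "sqpos t = (max 0 t)\<^sup>2"

lemma sqpos_has_real_derivative: "(sqpos has_real_derivative 2 * max 0 t) (at t)"
proof -
  consider "t > 0" | "t < 0" | "t = 0" by linarith
  then show ?thesis
  proof cases
    case 1
    have "((\<lambda>t. t\<^sup>2) has_real_derivative 2 * t) (at t)" by (auto intro!: derivative_eq_intros)
    then have "(sqpos has_real_derivative 2 * t) (at t)"
      by (rule has_field_derivative_transform_within_open[of _ _ _ "{0<..}"]) (use 1 in \<open>auto simp: sqpos_def max_def\<close>)
    with 1 show ?thesis by simp
  next
    case 2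
    have "((\<lambda>t. 0) has_real_derivative 0) (at t)" by simp
    then have "(sqpos has_real_derivative 0) (at t)"
      by (rule has_field_derivative_transform_within_open[of _ _ _ "{..<0}"]) (use 2 in \<open>auto simp: sqpos_def max_def\<close>)
    with 2 show ?thesis by simp
  next
    case 3
    have "((\<lambda>h. sqpos h / h) \<longlongrightarrow> 0) (at 0)"
    proof (rule Lim_null_comparison)
      show "\<forall>\<^sub>F h in at (0::real). norm (sqpos h / h) \<le> \<bar>h\<bar>"
        by (intro always_eventually) (auto simp: sqpos_def max_def power2_eq_square)
      show "((\<lambda>h::real. \<bar>h\<bar>) \<longlongrightarrow> 0) (at 0)" by (auto intro!: tendsto_eq_intros)
    qed
    then show ?thesis using 3 by (simp add: has_field_derivative_iff sqpos_def)
  qed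
qed

lemma sqpos_has_derivative [derivative_intros]:
  fixes f :: "'a::real_normed_vector \<Rightarrow> real"
  assumes "(f has_derivative f') (at x within S)"
  shows "((\<lambda>x. sqpos (f x)) has_derivative (\<lambda>h. 2 * max 0 (f x) * f' h)) (at x within S)"
  using has_derivative_compose[OF assms sqpos_has_real_derivative[of "f x", unfolded has_field_derivative_def]]
  by simp

lemma sqpos_nonneg [simp]: "0 \<le> sqpos t" and sqpos_pos_iff [simp]: "0 < sqpos t \<longleftrightarrow> 0 < t"
  and sqpos_eq_0_iff [simp]: "sqpos t = 0 \<longleftrightarrow> t \<le> 0"
  by (auto simp: sqpos_def max_def)

text \<open>
  A continuously differentiable function that is positive exactly on the open box.
\<close>

definition box_fun :: "real^'n \<Rightarrow> real^'n \<Rightarrow> real^('n::finite) \<Rightarrow> real" where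
  "box_fun a b x = (\<Prod>i\<in>UNIV. sqpos (x $ i - a $ i) * sqpos (b $ i - x $ i))"

lemma box_fun_nonneg [simp]: "0 \<le> box_fun a b x"
  by (simp add: box_fun_def prod_nonneg)

lemma box_fun_pos_iff: "0 < box_fun a b x \<longleftrightarrow> x \<in> box a b"
proof -
  have "box_fun a b x \<noteq> 0 \<longleftrightarrow> (\<forall>i. a $ i < x $ i \<and> x $ i < b $ i)"
    by (auto simp: box_fun_def not_le)
  then show ?thesis using box_fun_nonneg[of a b x] by (auto simp: mem_box_cart less_le)
qed

text \<open>
  Test functions that increase to the indicator function of the open box as \<open>k\<close> grows.
\<close>

definition box_bump :: "real \<Rightarrow> real^'n \<Rightarrow> real^'n \<Rightarrow> real^('n::finite) \<Rightarrow> real" where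
  "box_bump k a b x = 1 - inverse (1 + k * box_fun a b x)"

lemma box_bump_C1:
  fixes a b :: "real^'n::finite"
  assumes k: "k \<ge> 0"
  shows "C1_compact_support (box_bump k a b)"
proof -
  define q where "q i x = sqpos (x $ i - a $ i) * sqpos (b $ i - x $ i)" for i and x :: "real^'n"
  define q' where "q' i x h = sqpos (x $ i - a $ i) * (2 * max 0 (b $ i - x $ i) * (- h $ i))
     + 2 * max 0 (x $ i - a $ i) * h $ i * sqpos (b $ i - x $ i)" for i and x h :: "real^'n"
  define P' where "P' x h = (\<Sum>i\<in>UNIV. q' i x h * (\<Prod>j\<in>UNIV - {i}. q j x))" for x h
  have q: "(q i has_derivative q' i x) (at x)" for i x
    unfolding q_def q'_def
    by (auto intro!: derivative_eq_intros bounded_linear.has_derivative[OF bounded_linear_vec_nth])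
  have P: "(box_fun a b has_derivative P' x) (at x)" for x
  proof -
    have "((\<lambda>x. \<Prod>i\<in>UNIV. q i x) has_derivative P' x) (at x)"
      unfolding P'_def by (rule has_derivative_prod) (rule q)
    moreover have "box_fun a b = (\<lambda>x. \<Prod>i\<in>UNIV. q i x)" by (rule ext) (simp add: box_fun_def q_def)
    ultimately show ?thesis by simp
  qed
  have pos: "0 < 1 + k * box_fun a b x" for x using k by (simp add: add_pos_nonneg)
  define D where "D x h = inverse (1 + k * box_fun a b x) * (k * P' x h) * inverse (1 + k * box_fun a b x)" for x h
  have D: "(box_bump k a b has_derivative D x) (at x)" for x
    unfolding box_bump_def[abs_def] D_def
    using pos[of x] by (auto intro!: derivative_eq_intros P)
  have fd: "frechet_derivative (box_bump k a b) (at x) = D x" for x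
    using frechet_derivative_at[OF D] by simp
  have cq: "continuous_on UNIV (q i)" for i
    using q by (meson has_derivative_continuous continuous_at_imp_continuous_on)
  have cs: "continuous_on UNIV (\<lambda>x::real^'n. sqpos (x $ i - a $ i))" "continuous_on UNIV (\<lambda>x::real^'n. sqpos (b $ i - x $ i))" for i
    unfolding sqpos_def by (intro continuous_intros)+
  have cP: "continuous_on UNIV (box_fun a b)"
    using P by (meson has_derivative_continuous continuous_at_imp_continuous_on)
  have cP': "continuous_on UNIV (\<lambda>x. P' x h)" for h
    unfolding P'_def q'_def by (intro continuous_intros cq cs)
  have "continuous_on UNIV (\<lambda>x. D x h)" for h
    unfolding D_def using pos by (intro continuous_intros cP cP') (auto simp: less_imp_neq[symmetric])
  moreover have "box_bump k a b differentiable (at x)" for x using D by (auto simp: differentiable_def)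
  moreover have "compact (closure {x. box_bump k a b x \<noteq> 0})"
  proof -
    have "{x. box_bump k a b x \<noteq> 0} \<subseteq> cbox a b"
    proof
      fix x assume "x \<in> {x. box_bump k a b x \<noteq> 0}"
      then have "box_fun a b x \<noteq> 0" by (auto simp: box_bump_def)
      then have "0 < box_fun a b x" using box_fun_nonneg[of a b x] by linarith
      then show "x \<in> cbox a b" using box_subset_cbox[of a b] by (auto simp: box_fun_pos_iff)
    qed
    then have "closure {x. box_bump k a b x \<noteq> 0} \<subseteq> cbox a b" by (intro closure_minimal) auto
    then show ?thesis
      by (metis bounded_cbox bounded_subset closed_closure compact_eq_bounded_closed)
  qed
  ultimately show ?thesis by (simp add: C1_compact_support_def fd)
qed

lemma box_bump_bounds: "k \<ge> 0 \<Longrightarrow> 0 \<le> box_bump k a b x" "k \<ge> 0 \<Longrightarrow> box_bump k a b x \<le> indicator (box a b) x"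
proof -
  assume k: "k \<ge> 0"
  have 1: "1 \<le> 1 + k * box_fun a b x" using k by simp
  then have "inverse (1 + k * box_fun a b x) \<le> 1" and "0 < inverse (1 + k * box_fun a b x)"
    using 1 by (simp_all add: inverse_le_1_iff)
  moreover have "box_fun a b x = 0" if "x \<notin> box a b"
    using that box_fun_pos_iff[of a b x] box_fun_nonneg[of a b x] by linarith
  ultimately show "0 \<le> box_bump k a b x" "box_bump k a b x \<le> indicator (box a b) x"
    by (auto simp: box_bump_def indicator_def)
qed

lemma box_bump_tendsto: "(\<lambda>k. box_bump (real k) a b x) \<longlonglongrightarrow> indicator (box a b) x"
proof (cases "x \<in> box a b")
  case True
  then have p: "0 < box_fun a b x" by (simp add: box_fun_pos_iff)
  have "filterlim (\<lambda>k. 1 + real k * box_fun a b x) at_top sequentially"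
    by (rule filterlim_tendsto_add_at_top[OF tendsto_const])
       (use p in \<open>auto intro: filterlim_at_top_mult_tendsto_pos[OF tendsto_const] filterlim_real_sequentially\<close>)
  then have "(\<lambda>k. 1 - inverse (1 + real k * box_fun a b x)) \<longlonglongrightarrow> 1 - 0"
    by (intro tendsto_intros tendsto_inverse_0_at_top)
  then show ?thesis using True by (simp add: box_bump_def)
next
  case False
  then have "box_fun a b x = 0" using box_fun_pos_iff[of a b x] box_fun_nonneg[of a b x] by linarith
  then show ?thesis using False by (simp add: box_bump_def)
qed

lemma enn2real_inj: "enn2real x = enn2real y \<Longrightarrow> x \<noteq> \<infinity> \<Longrightarrow> y \<noteq> \<infinity> \<Longrightarrow> x = y"
  by (cases x rule: ennreal_cases; cases y rule: ennreal_cases) auto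

text \<open>
  The positive and the negative part of \<open>u\<close> are densities of two measures which agree on all boxes.
  Boxes generate the Borel sets and are closed under intersection, so the measures, and hence the
  densities, coincide.
\<close>

lemma AE_eq_0_if_box_integrals_0:
  fixes u :: "'a::euclidean_space \<Rightarrow> real"
  assumes u[measurable]: "u \<in> borel_measurable borel"
    and int: "\<And>a b. integrable lborel (\<lambda>x. u x * indicator (box a b) x)"
    and zero: "\<And>a b. (\<integral>x. u x * indicator (box a b) x \<partial>lborel) = 0"
  shows "AE x in lborel. u x = 0"
proof -
  define M where "M v = density lborel (\<lambda>x. ennreal (v x))" for v :: "'a \<Rightarrow> real"
  have em: "emeasure (M v) (box a b) = (\<integral>\<^sup>+x. ennreal (v x * indicator (box a b) x) \<partial>lborel)"
    if "v \<in> borel_measurable borel" for v a b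
    using that unfolding M_def by (subst emeasure_density) (auto intro!: nn_integral_cong simp: indicator_def)
  have eqbox: "emeasure (M u) (box a b) = emeasure (M (\<lambda>x. - u x)) (box a b)"
    and fin: "emeasure (M u) (box a b) \<noteq> \<infinity>" for a b
  proof -
    have 1: "(\<integral>\<^sup>+x. ennreal (u x * indicator (box a b) x) \<partial>lborel) \<noteq> \<infinity>"
      "(\<integral>\<^sup>+x. ennreal (- (u x * indicator (box a b) x)) \<partial>lborel) \<noteq> \<infinity>"
      using int[of a b] unfolding real_integrable_def by auto
    have "enn2real (\<integral>\<^sup>+x. ennreal (u x * indicator (box a b) x) \<partial>lborel)
        = enn2real (\<integral>\<^sup>+x. ennreal (- (u x * indicator (box a b) x)) \<partial>lborel)"
      using real_lebesgue_integral_def[OF int[of a b]] zero[of a b] by simp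
    then have "(\<integral>\<^sup>+x. ennreal (u x * indicator (box a b) x) \<partial>lborel)
       = (\<integral>\<^sup>+x. ennreal (- (u x * indicator (box a b) x)) \<partial>lborel)"
      using 1 by (rule enn2real_inj)
    then show "emeasure (M u) (box a b) = emeasure (M (\<lambda>x. - u x)) (box a b)"
      by (simp add: em)
    show "emeasure (M u) (box a b) \<noteq> \<infinity>" using 1 by (simp add: em)
  qed
  have "M u = M (\<lambda>x. - u x)"
  proof (rule measure_eqI_generator_eq)
    let ?E = "range (\<lambda>(a, b). box a b::'a set)"
    show "Int_stable ?E" by (auto simp: Int_stable_def box_Int_box)
    show "?E \<subseteq> Pow UNIV" "sets (M u) = sigma_sets UNIV ?E" "sets (M (\<lambda>x. - u x)) = sigma_sets UNIV ?E"
      by (simp_all add: borel_eq_box M_def)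
    let ?A = "\<lambda>n::nat. box (- (real n *\<^sub>R One)) (real n *\<^sub>R One) :: 'a set"
    show "range ?A \<subseteq> ?E" "(\<Union>i. ?A i) = UNIV" unfolding UN_box_eq_UNIV by auto
    show "emeasure (M u) (?A i) \<noteq> \<infinity>" for i by (rule fin)
    show "emeasure (M u) X = emeasure (M (\<lambda>x. - u x)) X" if "X \<in> ?E" for X
      using that eqbox by auto
  qed
  then have "AE x in lborel. ennreal (u x) = ennreal (- u x)"
    unfolding M_def by (intro sigma_finite_measure.density_unique) (auto intro: sigma_finite_lborel)
  then show ?thesis
  proof eventually_elim
    case (elim x)
    then show ?case by (cases "u x \<ge> 0") (auto simp: ennreal_eq_0_iff ennreal_neg dest: sym)
  qed
qed

lemma indicator_box_L2: "(\<lambda>x. indicator (box a b) x) \<in> L2"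
proof (rule L2I)
  have "(\<lambda>x. (cmod (indicator (box a b) x))\<^sup>2) = indicat_real (box a b)"
    by (auto simp: indicator_def)
  then show "integrable lborel (\<lambda>x. (cmod (indicator (box a b) x))\<^sup>2)"
    using emeasure_lborel_box_finite[of a b] by (simp add: integrable_indicator_iff less_top)
qed simp

text \<open>
  The fundamental lemma of the calculus of variations. The test functions \<open>box_bump k a b\<close> converge
  to indicators of boxes, dominated by them.
\<close>

lemma fundamental_lemma:
  fixes h :: "'n::finite cfun"
  assumes h: "h \<in> L2"
    and zero: "\<And>\<phi>. C1_compact_support \<phi> \<Longrightarrow> (\<integral>x. h x * complex_of_real (\<phi> x) \<partial>lborel) = 0"
  shows "AE x in lborel. h x = 0"
proof -
  have [measurable]: "h \<in> borel_measurable borel" using h by auto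
  have i: "integrable lborel (\<lambda>x. h x * indicator (box a b) x)" for a b
    by (rule L2_mult_integrable[OF h indicator_box_L2])
  have m: "box_bump (real k) a b \<in> borel_measurable borel" for k and a b :: "real^'n"
    unfolding box_bump_def box_fun_def sqpos_def by measurable
  have z: "(\<integral>x. h x * indicator (box a b) x \<partial>lborel) = 0" for a b
  proof (rule LIMSEQ_unique)
    show "(\<lambda>k. \<integral>x. h x * complex_of_real (box_bump (real k) a b x) \<partial>lborel) \<longlonglongrightarrow> (\<integral>x. h x * indicator (box a b) x \<partial>lborel)"
    proof (rule integral_dominated_convergence)
      have "(\<lambda>k. h x * complex_of_real (box_bump (real k) a b x)) \<longlonglongrightarrow> h x * complex_of_real (indicator (box a b) x)" for x
        by (intro tendsto_intros box_bump_tendsto)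
      then show "AE x in lborel. (\<lambda>k. h x * complex_of_real (box_bump (real k) a b x)) \<longlonglongrightarrow> h x * indicator (box a b) x"
        by (simp add: of_real_indicator)
      show "integrable lborel (\<lambda>x. cmod (h x * indicator (box a b) x))" by (rule integrable_norm[OF i])
      show "AE x in lborel. norm (h x * complex_of_real (box_bump (real k) a b x)) \<le> cmod (h x * indicator (box a b) x)" for k
      proof (rule AE_I2)
        fix x
        have "\<bar>box_bump (real k) a b x\<bar> \<le> cmod (indicator (box a b) x)"
          using box_bump_bounds[of "real k" a b x] by (auto simp: indicator_def split: if_splits)
        then show "norm (h x * complex_of_real (box_bump (real k) a b x)) \<le> cmod (h x * indicator (box a b) x)"
          by (simp add: norm_mult mult_left_mono)
      qed
    qed (use m in measurable)
    show "(\<lambda>k. \<integral>x. h x * complex_of_real (box_bump (real k) a b x) \<partial>lborel) \<longlonglongrightarrow> 0"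
      using zero[OF box_bump_C1] by simp
  qed
  have eqs: "Re (h x * indicator (box a b) x) = Re (h x) * indicator (box a b) x"
    "Im (h x * indicator (box a b) x) = Im (h x) * indicator (box a b) x" for x a b
    by (auto simp: indicator_def)
  have "AE x in lborel. Re (h x) = 0"
    using integrable_Re[OF i] integral_Re[OF i] z
    by (intro AE_eq_0_if_box_integrals_0) (simp_all only: eqs zero_complex.sel, measurable)
  moreover have "AE x in lborel. Im (h x) = 0"
    using integrable_Im[OF i] integral_Im[OF i] z
    by (intro AE_eq_0_if_box_integrals_0) (simp_all only: eqs zero_complex.sel, measurable)
  ultimately show ?thesis by eventually_elim (simp add: complex_eq_iff)
qed

section \<open>The Fourier transform of square-integrable functions\<close>

lemma L2_lincomb: "f \<in> L2 \<Longrightarrow> g \<in> L2 \<Longrightarrow> (\<lambda>x. a * f x + b * g x) \<in> L2"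
  by (rule L2_add[OF L2_cmult L2_cmult])

lemma sq_norm_lincomb_le:
  assumes "f \<in> L2" "g \<in> L2"
  shows "sq_norm (\<lambda>x. a * f x + b * g x) \<le> 2 * ((cmod a)\<^sup>2 * sq_norm f) + 2 * ((cmod b)\<^sup>2 * sq_norm g)"
proof -
  have "integrable lborel (\<lambda>x. 2 * ((cmod a)\<^sup>2 * (cmod (f x))\<^sup>2) + 2 * ((cmod b)\<^sup>2 * (cmod (g x))\<^sup>2))"
    using assms[THEN L2_integrable] by simp
  then have "sq_norm (\<lambda>x. a * f x + b * g x)
     \<le> (\<integral>x. 2 * ((cmod a)\<^sup>2 * (cmod (f x))\<^sup>2) + 2 * ((cmod b)\<^sup>2 * (cmod (g x))\<^sup>2) \<partial>lborel)"
    using cmod_add_sq_le[of "a * f x" "b * g x" for x]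
    by (intro sq_norm_mono L2_lincomb assms AE_I2) (auto simp: norm_mult power_mult_distrib)
  also have "\<dots> = 2 * ((cmod a)\<^sup>2 * sq_norm f) + 2 * ((cmod b)\<^sup>2 * sq_norm g)"
    using assms[THEN L2_integrable] unfolding sq_norm_def by simp
  finally show ?thesis .
qed

lemma L2_tendsto_lincomb:
  assumes lim: "L2_tendsto f l F" "L2_tendsto g m F"
    and L: "\<And>k. f k \<in> L2" "\<And>k. g k \<in> L2" "l \<in> L2" "m \<in> L2"
  shows "L2_tendsto (\<lambda>k x. a * f k x + b * g k x) (\<lambda>x. a * l x + b * m x) F"
proof -
  define N where "N k = sq_norm (\<lambda>x. (a * f k x + b * g k x) - (a * l x + b * m x))" for k
  have f0: "((\<lambda>k. sq_norm (\<lambda>x. f k x - l x)) \<longlongrightarrow> 0) F" "((\<lambda>k. sq_norm (\<lambda>x. g k x - m x)) \<longlongrightarrow> 0) F"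
    using lim L2_tendsto_iff[of f l F] L2_tendsto_iff[of g m F] L by simp_all
  have 1: "((\<lambda>k. 2 * ((cmod a)\<^sup>2 * sq_norm (\<lambda>x. f k x - l x)) + 2 * ((cmod b)\<^sup>2 * sq_norm (\<lambda>x. g k x - m x))) \<longlongrightarrow> 0) F"
    using tendsto_add[OF tendsto_mult_right_zero[OF tendsto_mult_right_zero[OF f0(1)]] tendsto_mult_right_zero[OF tendsto_mult_right_zero[OF f0(2)]]]
    by simp
  have le: "N k \<le> 2 * ((cmod a)\<^sup>2 * sq_norm (\<lambda>x. f k x - l x)) + 2 * ((cmod b)\<^sup>2 * sq_norm (\<lambda>x. g k x - m x))" for k
    using sq_norm_lincomb_le[OF L2_diff[OF L(1)[of k] L(3)] L2_diff[OF L(2)[of k] L(4)], of a b]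
    by (simp add: N_def algebra_simps)
  have "\<forall>\<^sub>F k in F. norm (N k) \<le> 2 * ((cmod a)\<^sup>2 * sq_norm (\<lambda>x. f k x - l x)) + 2 * ((cmod b)\<^sup>2 * sq_norm (\<lambda>x. g k x - m x))"
    using le by (simp add: N_def)
  from Lim_null_comparison[OF this 1] have "(N \<longlongrightarrow> 0) F" .
  moreover have "(\<lambda>x. a * f k x + b * g k x) \<in> L2" for k by (rule L2_lincomb[OF L(1,2)])
  moreover have "(\<lambda>x. a * l x + b * m x) \<in> L2" by (rule L2_lincomb[OF L(3,4)])
  ultimately show ?thesis
    unfolding N_def using L2_tendsto_iff[of "\<lambda>k x. a * f k x + b * g k x" "\<lambda>x. a * l x + b * m x" F] by blast
qed

text \<open>
  The truncation through which \<open>fourier\<close> is defined.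
\<close>

definition truncate :: "nat \<Rightarrow> ('n::finite) cfun \<Rightarrow> 'n cfun" where
  "truncate N f x = (if norm x \<le> real N then f x else 0)"

lemma truncate_L2: assumes "f \<in> L2" shows "truncate N f \<in> L2"
proof (rule L2_bound[OF L2_integrable[OF assms]])
  have [measurable]: "f \<in> borel_measurable borel" using assms by auto
  show "truncate N f \<in> borel_measurable borel" unfolding truncate_def by measurable
qed (simp add: truncate_def)

lemma indicator_cball_L2: "(\<lambda>x. indicator (cball a r) x) \<in> L2"
proof (rule L2I)
  have "(\<lambda>x. (cmod (indicator (cball a r) x))\<^sup>2) = indicat_real (cball a r)"
    by (auto simp: indicator_def)
  then show "integrable lborel (\<lambda>x. (cmod (indicator (cball a r) x))\<^sup>2)"
    using emeasure_lborel_cball_finite[of a r] by (simp add: integrable_indicator_iff less_top)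
qed (rule borel_measurable_indicator, simp)

lemma L2_bounded_support_integrable:
  assumes f: "f \<in> L2" and supp: "\<And>x. r < norm x \<Longrightarrow> f x = 0" shows "integrable lborel f"
proof -
  have "(\<lambda>x. f x * indicator (cball 0 r) x) = f"
    using supp by (auto simp: indicator_def fun_eq_iff not_le)
  then show ?thesis
    using L2_mult_integrable[OF f indicator_cball_L2[of 0 r]] by simp
qed

lemma truncate_integrable: "f \<in> L2 \<Longrightarrow> integrable lborel (truncate N f)"
  by (rule L2_bounded_support_integrable[OF truncate_L2, of _ "real N"]) (auto simp: truncate_def)

lemma truncate_tendsto: assumes f: "f \<in> L2" shows "L2_tendsto (\<lambda>N. truncate N f) f sequentially"
proof -
  have [measurable]: "f \<in> borel_measurable borel" "\<And>N. truncate N f \<in> borel_measurable borel"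
    using f truncate_L2[OF f] by auto
  have "(\<lambda>N. \<integral>x. (cmod (truncate N f x - f x))\<^sup>2 \<partial>lborel) \<longlonglongrightarrow> (\<integral>x. 0 \<partial>(lborel :: (real^'a) measure))"
  proof (rule integral_dominated_convergence)
    show "AE x in lborel. (\<lambda>N. (cmod (truncate N f x - f x))\<^sup>2) \<longlonglongrightarrow> 0"
    proof (rule AE_I2)
      fix x :: "real^'a"
      obtain N where "norm x \<le> real N" using real_arch_simple by blast
      then have "(cmod (truncate n f x - f x))\<^sup>2 = 0" if "n \<ge> N" for n
        using that by (simp add: truncate_def)
      then have "\<forall>\<^sub>F n in sequentially. (cmod (truncate n f x - f x))\<^sup>2 = 0"
        by (rule eventually_sequentiallyI)
      then show "(\<lambda>N. (cmod (truncate N f x - f x))\<^sup>2) \<longlonglongrightarrow> 0"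
        by (rule tendsto_eventually)
    qed
    show "integrable lborel (\<lambda>x. (cmod (f x))\<^sup>2)" by (rule L2_integrable[OF f])
    show "AE x in lborel. norm ((cmod (truncate N f x - f x))\<^sup>2) \<le> (cmod (f x))\<^sup>2" for N
      by (simp add: truncate_def)
  qed measurable
  then show ?thesis
    using f truncate_L2[OF f] by (subst L2_tendsto_iff) (auto simp: sq_norm_def)
qed

lemma L2_Cauchy_if_tendsto:
  assumes lim: "L2_tendsto f l sequentially" and f: "\<And>k. f k \<in> L2" and l: "l \<in> L2" and e: "e > 0"
  shows "\<exists>K. \<forall>m\<ge>K. \<forall>n\<ge>K. sq_norm (\<lambda>x. f m x - f n x) \<le> e"
proof -
  have "(\<lambda>k. sq_norm (\<lambda>x. f k x - l x)) \<longlonglongrightarrow> 0"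
    using lim f l by (simp add: L2_tendsto_iff)
  then have "\<forall>\<^sub>F k in sequentially. sq_norm (\<lambda>x. f k x - l x) < e / 4"
    using e by (intro order_tendstoD) auto
  then obtain K where K: "\<And>k. k \<ge> K \<Longrightarrow> sq_norm (\<lambda>x. f k x - l x) < e / 4"
    by (auto simp: eventually_sequentially)
  have "sq_norm (\<lambda>x. f m x - f n x) \<le> e" if "m \<ge> K" "n \<ge> K" for m n
    using sq_norm_diff_le[OF f[of m] f[of n] l] K[OF that(1)] K[OF that(2)] by linarith
  then show ?thesis by blast
qed

text \<open>
  The Fourier integrals of the truncations form a Cauchy sequence in \<open>L2\<close>, because the Fourier
  integral is a contraction there and the truncations converge.
\<close>

lemma fourier_spec:
  fixes f :: "'n::finite cfun"
  assumes f: "f \<in> L2"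
  shows "fourier f \<in> L2 \<and> L2_tendsto (\<lambda>N. fourier_integral (truncate N f)) (fourier f) sequentially"
proof -
  have L: "fourier_integral (truncate N f) \<in> L2" for N
    using fourier_integral_L2(1)[OF truncate_integrable truncate_L2] f by blast
  have le: "sq_norm (\<lambda>\<xi>. fourier_integral (truncate m f) \<xi> - fourier_integral (truncate n f) \<xi>)
      \<le> sq_norm (\<lambda>x. truncate m f x - truncate n f x)" for m n
    using fourier_integral_L2(2)[OF Bochner_Integration.integrable_diff[OF truncate_integrable[OF f] truncate_integrable[OF f]]
      L2_diff[OF truncate_L2[OF f] truncate_L2[OF f]], of m n]
    by (simp only: fourier_integral_diff[OF truncate_integrable[OF f] truncate_integrable[OF f]] sq_norm_def)
  obtain g where "g \<in> L2" "L2_tendsto (\<lambda>N. fourier_integral (truncate N f)) g sequentially"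
  proof (rule L2_complete[of "\<lambda>N. fourier_integral (truncate N f)", OF L])
    fix e :: real assume "e > 0"
    have "\<exists>K. \<forall>m\<ge>K. \<forall>n\<ge>K. sq_norm (\<lambda>x. truncate m f x - truncate n f x) \<le> e"
      using truncate_tendsto[OF f] by (rule L2_Cauchy_if_tendsto) (simp_all add: truncate_L2 f \<open>e > 0\<close>)
    then show "\<exists>K. \<forall>m\<ge>K. \<forall>n\<ge>K. sq_norm (\<lambda>x. fourier_integral (truncate m f) x - fourier_integral (truncate n f) x) \<le> e"
      using order_trans[OF le] by meson
  qed
  then have "\<exists>g. g \<in> L2 \<and> L2_tendsto (\<lambda>N. fourier_integral (truncate N f)) g sequentially" by blast
  from someI_ex[OF this] show ?thesis
    unfolding fourier_def truncate_def[abs_def] .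
qed

lemma fourier_L2: "f \<in> L2 \<Longrightarrow> fourier f \<in> L2"
  and fourier_tendsto: "f \<in> L2 \<Longrightarrow> L2_tendsto (\<lambda>N. fourier_integral (truncate N f)) (fourier f) sequentially"
  using fourier_spec by blast+

lemma fourier_integral_truncate_L2: "f \<in> L2 \<Longrightarrow> fourier_integral (truncate N f) \<in> L2"
  using fourier_integral_L2(1)[OF truncate_integrable truncate_L2] by blast

lemma fourier_integral_lincomb:
  fixes f g :: "'n::finite cfun"
  assumes "integrable lborel f" "integrable lborel g"
  shows "fourier_integral (\<lambda>x. a * f x + b * g x) \<xi> = a * fourier_integral f \<xi> + b * fourier_integral g \<xi>"
proof -
  have "exp (- (\<i> * complex_of_real (x \<bullet> \<xi>))) * (a * f x + b * g x)
    = a * (exp (- (\<i> * complex_of_real (x \<bullet> \<xi>))) * f x) + b * (exp (- (\<i> * complex_of_real (x \<bullet> \<xi>))) * g x)" for x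
    by (simp add: algebra_simps)
  then show ?thesis
    using fourier_kernel_integrable[OF assms(1), of \<xi>] fourier_kernel_integrable[OF assms(2), of \<xi>]
    unfolding fourier_integral_eq by (simp add: algebra_simps)
qed

lemma fourier_lincomb:
  fixes f g :: "'n::finite cfun"
  assumes f: "f \<in> L2" and g: "g \<in> L2"
  shows "AE \<xi> in lborel. fourier (\<lambda>x. a * f x + b * g x) \<xi> = a * fourier f \<xi> + b * fourier g \<xi>"
proof -
  define h where "h = (\<lambda>x. a * f x + b * g x)"
  define l where "l = (\<lambda>\<xi>. a * fourier f \<xi> + b * fourier g \<xi>)"
  have h: "h \<in> L2" unfolding h_def by (rule L2_add[OF L2_cmult[OF f] L2_cmult[OF g]])
  have l: "l \<in> L2" unfolding l_def by (rule L2_add[OF L2_cmult[OF fourier_L2[OF f]] L2_cmult[OF fourier_L2[OF g]]])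
  have t: "truncate N h = (\<lambda>x. a * truncate N f x + b * truncate N g x)" for N
    by (auto simp: truncate_def h_def)
  have eq: "fourier_integral (truncate N h)
      = (\<lambda>\<xi>. a * fourier_integral (truncate N f) \<xi> + b * fourier_integral (truncate N g) \<xi>)" for N
    unfolding t using fourier_integral_lincomb[OF truncate_integrable[OF f] truncate_integrable[OF g]] by (rule ext)
  have "L2_tendsto (\<lambda>N \<xi>. a * fourier_integral (truncate N f) \<xi> + b * fourier_integral (truncate N g) \<xi>) l sequentially"
    unfolding l_def
    using fourier_tendsto[OF f] fourier_tendsto[OF g]
    by (rule L2_tendsto_lincomb) (simp_all add: fourier_integral_truncate_L2 fourier_L2 f g)
  then have "L2_tendsto (\<lambda>N. fourier_integral (truncate N h)) l sequentially"
    by (simp only: eq)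
  with fourier_tendsto[OF h] have "AE \<xi> in lborel. fourier h \<xi> = l \<xi>"
    by (rule L2_tendsto_unique) (simp_all add: fourier_integral_truncate_L2 fourier_L2 h l)
  then show ?thesis by (simp add: h_def l_def)
qed

text \<open>
  An equality of functions, not merely almost everywhere: the Fourier integrals of the truncations
  do not see null sets, so \<open>fourier f\<close> and \<open>fourier g\<close> are chosen by the same predicate.
\<close>

lemma fourier_AE_cong:
  fixes f g :: "'n::finite cfun"
  assumes f: "f \<in> L2" and g: "g \<in> L2" and eq: "AE x in lborel. f x = g x"
  shows "fourier f = fourier g"
proof -
  have [measurable]: "f \<in> borel_measurable borel" "g \<in> borel_measurable borel" using f g by auto
  have "fourier_integral (\<lambda>x. if norm x \<le> real N then f x else 0) = fourier_integral (\<lambda>x. if norm x \<le> real N then g x else 0)" for N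
  proof
    fix \<xi>
    have "(\<integral>x. exp (- (\<i> * complex_of_real (x \<bullet> \<xi>))) * (if norm x \<le> real N then f x else 0) \<partial>lborel)
      = (\<integral>x. exp (- (\<i> * complex_of_real (x \<bullet> \<xi>))) * (if norm x \<le> real N then g x else 0) \<partial>lborel)"
      using eq by (intro integral_cong_AE) (auto elim!: eventually_mono)
    then show "fourier_integral (\<lambda>x. if norm x \<le> real N then f x else 0) \<xi> = fourier_integral (\<lambda>x. if norm x \<le> real N then g x else 0) \<xi>"
      unfolding fourier_integral_def by (rule arg_cong)
  qed
  then show ?thesis unfolding fourier_def by simp
qed

lemma truncate_pairing_tendsto:
  assumes f: "f \<in> L2" and g: "g \<in> L2"
  shows "(\<lambda>N. \<integral>x. truncate N f x * g x \<partial>lborel) \<longlonglongrightarrow> (\<integral>x. f x * g x \<partial>lborel)"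
  using truncate_tendsto[OF f] by (rule L2_tendsto_inner) (simp_all add: truncate_L2 f g)

lemma fourier_pairing_tendsto:
  assumes f: "f \<in> L2" and g: "g \<in> L2"
  shows "(\<lambda>N. \<integral>\<xi>. fourier_integral (truncate N f) \<xi> * g \<xi> \<partial>lborel) \<longlonglongrightarrow> (\<integral>\<xi>. fourier f \<xi> * g \<xi> \<partial>lborel)"
  using fourier_tendsto[OF f] by (rule L2_tendsto_inner) (simp_all add: fourier_integral_truncate_L2 fourier_L2 f g)

text \<open>
  The formula for integrable functions passes to the limit, first in the truncation of \<open>g\<close> and then
  in that of \<open>f\<close>.
\<close>

lemma fourier_multiplication_formula:
  fixes f g :: "'n::finite cfun"
  assumes f: "f \<in> L2" and g: "g \<in> L2"
  shows "(\<integral>\<xi>. fourier f \<xi> * g \<xi> \<partial>lborel) = (\<integral>x. f x * fourier g x \<partial>lborel)"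
proof -
  have 1: "(\<integral>\<xi>. fourier_integral (truncate N f) \<xi> * g \<xi> \<partial>lborel) = (\<integral>x. truncate N f x * fourier g x \<partial>lborel)" for N
  proof (rule LIMSEQ_unique)
    show "(\<lambda>M. \<integral>\<xi>. truncate M g \<xi> * fourier_integral (truncate N f) \<xi> \<partial>lborel) \<longlonglongrightarrow> (\<integral>\<xi>. fourier_integral (truncate N f) \<xi> * g \<xi> \<partial>lborel)"
      using truncate_pairing_tendsto[OF g fourier_integral_truncate_L2[OF f]] by (simp add: mult.commute)
    have "(\<integral>\<xi>. truncate M g \<xi> * fourier_integral (truncate N f) \<xi> \<partial>lborel) = (\<integral>x. fourier_integral (truncate M g) x * truncate N f x \<partial>lborel)" for M
      by (rule fourier_integral_multiplication_formula[OF truncate_integrable[OF g] truncate_integrable[OF f], symmetric])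
    then show "(\<lambda>M. \<integral>\<xi>. truncate M g \<xi> * fourier_integral (truncate N f) \<xi> \<partial>lborel) \<longlonglongrightarrow> (\<integral>x. truncate N f x * fourier g x \<partial>lborel)"
      using fourier_pairing_tendsto[OF g truncate_L2[OF f]] by (simp add: mult.commute)
  qed
  show ?thesis
  proof (rule LIMSEQ_unique)
    show "(\<lambda>N. \<integral>\<xi>. fourier_integral (truncate N f) \<xi> * g \<xi> \<partial>lborel) \<longlonglongrightarrow> (\<integral>\<xi>. fourier f \<xi> * g \<xi> \<partial>lborel)"
      by (rule fourier_pairing_tendsto[OF f g])
    show "(\<lambda>N. \<integral>\<xi>. fourier_integral (truncate N f) \<xi> * g \<xi> \<partial>lborel) \<longlonglongrightarrow> (\<integral>x. f x * fourier g x \<partial>lborel)"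
      unfolding 1 by (rule truncate_pairing_tendsto[OF f fourier_L2[OF g]])
  qed
qed

lemma fourier_bounded_support:
  fixes f :: "'n::finite cfun"
  assumes f: "f \<in> L2" and supp: "\<And>x. r < norm x \<Longrightarrow> f x = 0"
  shows "AE \<xi> in lborel. fourier f \<xi> = fourier_integral f \<xi>"
proof -
  have i: "integrable lborel f" by (rule L2_bounded_support_integrable[OF f supp])
  have L: "fourier_integral f \<in> L2" by (rule fourier_integral_L2(1)[OF i f])
  obtain K where K: "r \<le> real K" using real_arch_simple by blast
  have "truncate N f = f" if "N \<ge> K" for N
    using that K supp by (force simp: truncate_def fun_eq_iff)
  then have "sq_norm (\<lambda>\<xi>. fourier_integral (truncate N f) \<xi> - fourier_integral f \<xi>) = 0" if "N \<ge> K" for N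
    using that by (simp add: sq_norm_def)
  then have "(\<lambda>N. sq_norm (\<lambda>\<xi>. fourier_integral (truncate N f) \<xi> - fourier_integral f \<xi>)) \<longlonglongrightarrow> 0"
    by (intro tendsto_eventually eventually_sequentiallyI)
  then have "L2_tendsto (\<lambda>N. fourier_integral (truncate N f)) (fourier_integral f) sequentially"
    by (subst L2_tendsto_iff) (simp_all add: fourier_integral_truncate_L2 f L)
  with fourier_tendsto[OF f] show ?thesis
    by (rule L2_tendsto_unique) (simp_all add: fourier_integral_truncate_L2 fourier_L2 f L)
qed

text \<open>
  Compact support in the form in which it is used: a radius beyond which the function and its
  partial derivatives vanish.
\<close>

lemma C1_test_function:
  fixes \<phi> :: "real^'n::finite \<Rightarrow> real"
  assumes \<phi>: "C1_compact_support \<phi>"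
  shows "\<exists>r. \<forall>x. r < norm x \<longrightarrow> \<phi> x = 0 \<and> (\<forall>i. frechet_derivative \<phi> (at x) (axis i 1) = 0)"
proof -
  have "bounded (closure {x. \<phi> x \<noteq> 0})" using \<phi> by (auto simp: C1_compact_support_def compact_imp_bounded)
  then obtain r where r: "\<And>x. x \<in> closure {x. \<phi> x \<noteq> 0} \<Longrightarrow> norm x \<le> r" by (auto simp: bounded_iff)
  have z: "\<phi> x = 0" if "r < norm x" for x
    using r[of x] that closure_subset[of "{x. \<phi> x \<noteq> 0}"] by fastforce
  moreover have "frechet_derivative \<phi> (at x) (axis i 1) = 0" if "r < norm x" for x i
  proof -
    have "((\<lambda>x. 0) has_derivative (\<lambda>h. 0)) (at x)" by simp
    then have "(\<phi> has_derivative (\<lambda>h. 0)) (at x)"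
      by (rule has_derivative_transform_within_open[of _ _ _ _ "- cball 0 r"]) (use that z in auto)
    from frechet_derivative_at[OF this] show ?thesis by (simp add: fun_eq_iff)
  qed
  ultimately show ?thesis by blast
qed

lemma continuous_bounded_support_bounded:
  fixes g :: "real^'n::finite \<Rightarrow> real"
  assumes c: "continuous_on UNIV g" and supp: "\<And>x. r < norm x \<Longrightarrow> g x = 0"
  obtains B where "B \<ge> 0" "\<And>x. \<bar>g x\<bar> \<le> B"
proof -
  have "compact (g ` cball 0 r)" by (intro compact_continuous_image continuous_on_subset[OF c]) auto
  from compact_imp_bounded[OF this] obtain B where B: "\<And>x. x \<in> cball 0 r \<Longrightarrow> \<bar>g x\<bar> \<le> B"
    unfolding bounded_iff by (metis image_eqI real_norm_def)
  have "\<bar>g x\<bar> \<le> max B 0" for x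
    using B[of x] supp[of x] by (cases "r < norm x") (auto simp: not_less le_max_iff_disj)
  then show ?thesis using that[of "max B 0"] by auto
qed

lemma continuous_bounded_support_L2:
  fixes g :: "real^'n::finite \<Rightarrow> real"
  assumes c: "continuous_on UNIV g" and supp: "\<And>x. r < norm x \<Longrightarrow> g x = 0"
  shows "(\<lambda>x. complex_of_real (g x)) \<in> L2"
proof -
  obtain B where B: "B \<ge> 0" "\<And>x. \<bar>g x\<bar> \<le> B" using continuous_bounded_support_bounded[OF assms] by blast
  have [measurable]: "g \<in> borel_measurable borel" using c by (rule borel_measurable_continuous_onI)
  have i: "integrable lborel (\<lambda>x::real^'n. B\<^sup>2 * (cmod (indicator (cball 0 r) x))\<^sup>2)"
    using L2_integrable[OF indicator_cball_L2[of "0::real^'n" r]] by (rule integrable_mult_right)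
  show ?thesis
  proof (rule L2_bound[OF i])
    have "(cmod (complex_of_real (g x)))\<^sup>2 \<le> B\<^sup>2 * (cmod (indicator (cball 0 r) x))\<^sup>2" for x
      using B(2)[of x] supp[of x] power_mono[of "\<bar>g x\<bar>" B 2] by (auto simp: indicator_def)
    then show "AE x in lborel. (cmod (complex_of_real (g x)))\<^sup>2 \<le> B\<^sup>2 * (cmod (indicator (cball 0 r) x))\<^sup>2" by simp
  qed measurable
qed

lemma C1_continuous: "C1_compact_support \<phi> \<Longrightarrow> continuous_on UNIV \<phi>"
  by (simp add: C1_compact_support_def continuous_at_imp_continuous_on differentiable_imp_continuous_within)

text \<open>
  Stated for merely continuous \<open>\<phi>\<close>, so that it applies to a test function and to its partial
  derivatives alike.
\<close>

lemma fourier_parseval_test: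
  fixes f :: "'n::finite cfun"
  assumes f: "f \<in> L2" and \<phi>: "continuous_on UNIV \<phi>" "\<And>x. r < norm x \<Longrightarrow> \<phi> x = 0"
  shows "(\<integral>\<xi>. fourier f \<xi> * cnj (fourier_integral (\<lambda>x. complex_of_real (\<phi> x)) \<xi>) \<partial>lborel)
    = (\<integral>x. f x * complex_of_real (\<phi> x) \<partial>lborel)"
proof (rule LIMSEQ_unique)
  let ?\<phi> = "\<lambda>x. complex_of_real (\<phi> x)"
  have L: "?\<phi> \<in> L2" by (rule continuous_bounded_support_L2[OF \<phi>])
  have i: "integrable lborel ?\<phi>" by (rule L2_bounded_support_integrable[OF L, of r]) (simp add: \<phi>(2))
  have FL: "(\<lambda>\<xi>. cnj (fourier_integral ?\<phi> \<xi>)) \<in> L2" by (intro L2_cnj fourier_integral_L2 i L)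
  obtain B where B: "\<And>x. \<bar>\<phi> x\<bar> \<le> B" using continuous_bounded_support_bounded[OF \<phi>] by blast
  have c: "continuous_on UNIV ?\<phi>" using \<phi>(1) by (intro continuous_intros)
  show "(\<lambda>N. \<integral>\<xi>. fourier_integral (truncate N f) \<xi> * cnj (fourier_integral ?\<phi> \<xi>) \<partial>lborel)
     \<longlonglongrightarrow> (\<integral>\<xi>. fourier f \<xi> * cnj (fourier_integral ?\<phi> \<xi>) \<partial>lborel)"
    by (rule fourier_pairing_tendsto[OF f FL])
  have "(\<integral>\<xi>. fourier_integral (truncate N f) \<xi> * cnj (fourier_integral ?\<phi> \<xi>) \<partial>lborel) = (\<integral>x. truncate N f x * ?\<phi> x \<partial>lborel)" for N
    using fourier_integral_parseval[OF truncate_integrable[OF f] truncate_L2[OF f] i L c, of B] B by simp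
  then show "(\<lambda>N. \<integral>\<xi>. fourier_integral (truncate N f) \<xi> * cnj (fourier_integral ?\<phi> \<xi>) \<partial>lborel)
     \<longlonglongrightarrow> (\<integral>x. f x * ?\<phi> x \<partial>lborel)"
    using truncate_pairing_tendsto[OF f L] by simp
qed

section \<open>Fourier inversion and Plancherel's theorem\<close>

text \<open>
  The inverse transform \<open>(2 \<pi>)\<^bsup>-n/2\<^esup> \<integral> e\<^bsup>i x \<xi>\<^esup> h(\<xi>) d\<xi>\<close>, expressed through the forward one.
\<close>

definition inv_fourier :: "('n::finite) cfun \<Rightarrow> 'n cfun" where
  "inv_fourier h x = cnj (fourier (\<lambda>\<xi>. cnj (h \<xi>)) x)"

lemma inv_fourier_L2: "h \<in> L2 \<Longrightarrow> inv_fourier h \<in> L2"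
  unfolding inv_fourier_def[abs_def] by (intro L2_cnj fourier_L2)

text \<open>
  By the multiplication formula, \<open>inv_fourier\<close> is the adjoint of \<open>fourier\<close>.
\<close>

lemma inv_fourier_pairing:
  fixes g h :: "'n::finite cfun"
  assumes g: "g \<in> L2" and h: "h \<in> L2"
  shows "(\<integral>x. inv_fourier h x * cnj (g x) \<partial>lborel) = (\<integral>\<xi>. h \<xi> * cnj (fourier g \<xi>) \<partial>lborel)"
proof -
  have "(\<integral>x. inv_fourier h x * cnj (g x) \<partial>lborel) = cnj (\<integral>x. fourier (\<lambda>\<xi>. cnj (h \<xi>)) x * g x \<partial>lborel)"
    unfolding Bochner_Integration.integral_cnj[symmetric] by (simp add: inv_fourier_def)
  also have "\<dots> = cnj (\<integral>x. cnj (h x) * fourier g x \<partial>lborel)"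
    by (simp only: fourier_multiplication_formula[OF L2_cnj[OF h] g])
  also have "\<dots> = (\<integral>\<xi>. h \<xi> * cnj (fourier g \<xi>) \<partial>lborel)"
    unfolding Bochner_Integration.integral_cnj[symmetric] by simp
  finally show ?thesis .
qed

text \<open>
  Tested against \<open>\<phi>\<close>, the left-hand side becomes the pairing of \<open>fourier f\<close> with \<open>fourier \<phi>\<close> by
  adjointness, and this is the pairing of \<open>f\<close> with \<open>\<phi>\<close> by Parseval's formula.
\<close>

lemma inv_fourier_fourier:
  fixes f :: "'n::finite cfun"
  assumes f: "f \<in> L2"
  shows "AE x in lborel. inv_fourier (fourier f) x = f x"
proof -
  have L: "inv_fourier (fourier f) \<in> L2" by (intro inv_fourier_L2 fourier_L2 f)
  have "AE x in lborel. inv_fourier (fourier f) x - f x = 0"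
  proof (rule fundamental_lemma)
    show "(\<lambda>x. inv_fourier (fourier f) x - f x) \<in> L2" by (intro L2_diff L f)
    fix \<phi> :: "real^'n \<Rightarrow> real" assume \<phi>: "C1_compact_support \<phi>"
    let ?\<phi> = "\<lambda>x. complex_of_real (\<phi> x)"
    obtain r where r: "\<And>x. r < norm x \<Longrightarrow> \<phi> x = 0"
      using C1_test_function[OF \<phi>] by blast
    have c: "continuous_on UNIV \<phi>" by (rule C1_continuous[OF \<phi>])
    have P: "?\<phi> \<in> L2" by (rule continuous_bounded_support_L2[OF c r])
    have "(\<integral>x. inv_fourier (fourier f) x * ?\<phi> x \<partial>lborel) = (\<integral>\<xi>. fourier f \<xi> * cnj (fourier ?\<phi> \<xi>) \<partial>lborel)"
      using inv_fourier_pairing[OF P fourier_L2[OF f]] by simp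
    also have "\<dots> = (\<integral>\<xi>. fourier f \<xi> * cnj (fourier_integral ?\<phi> \<xi>) \<partial>lborel)"
      using fourier_bounded_support[OF P, of r] r fourier_L2[OF f] fourier_L2[OF P]
        fourier_integral_measurable[OF L2_measurable[OF P]]
      by (intro integral_cong_AE) (auto elim!: eventually_mono)
    also have "\<dots> = (\<integral>x. f x * ?\<phi> x \<partial>lborel)" by (rule fourier_parseval_test[OF f c r])
    finally show "(\<integral>x. (inv_fourier (fourier f) x - f x) * ?\<phi> x \<partial>lborel) = 0"
      using L2_mult_integrable[OF L P] L2_mult_integrable[OF f P] by (simp add: left_diff_distrib)
  qed
  then show ?thesis by simp
qed

text \<open>
  The other composition is the same identity for the conjugate of \<open>h\<close>, since conjugation exchanges
  \<open>fourier\<close> and \<open>inv_fourier\<close>.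
\<close>

lemma fourier_inv_fourier:
  fixes h :: "'n::finite cfun"
  assumes h: "h \<in> L2"
  shows "AE \<xi> in lborel. fourier (inv_fourier h) \<xi> = h \<xi>"
proof -
  have "AE \<xi> in lborel. inv_fourier (fourier (\<lambda>\<xi>. cnj (h \<xi>))) \<xi> = cnj (h \<xi>)"
    by (rule inv_fourier_fourier[OF L2_cnj[OF h]])
  then show ?thesis
    by eventually_elim (simp add: inv_fourier_def[abs_def])
qed

theorem plancherel_inner:
  fixes f g :: "'n::finite cfun"
  assumes f: "f \<in> L2" and g: "g \<in> L2"
  shows "(\<integral>\<xi>. fourier f \<xi> * cnj (fourier g \<xi>) \<partial>lborel) = (\<integral>x. f x * cnj (g x) \<partial>lborel)"
proof -
  have "(\<integral>\<xi>. fourier f \<xi> * cnj (fourier g \<xi>) \<partial>lborel) = (\<integral>x. inv_fourier (fourier f) x * cnj (g x) \<partial>lborel)"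
    by (rule inv_fourier_pairing[OF g fourier_L2[OF f], symmetric])
  also have "\<dots> = (\<integral>x. f x * cnj (g x) \<partial>lborel)"
    using inv_fourier_fourier[OF f] inv_fourier_L2[OF fourier_L2[OF f]] f g
    by (intro integral_cong_AE) (auto elim!: eventually_mono)
  finally show ?thesis .
qed

theorem plancherel:
  fixes f :: "'n::finite cfun"
  assumes f: "f \<in> L2" shows "sq_norm (fourier f) = sq_norm f"
  using plancherel_inner[OF f f] unfolding sq_norm_inner[symmetric] by simp

lemma fourier_inject:
  fixes f g :: "'n::finite cfun"
  assumes f: "f \<in> L2" and g: "g \<in> L2" and eq: "AE \<xi> in lborel. fourier f \<xi> = fourier g \<xi>"
  shows "AE x in lborel. f x = g x"
proof -
  have L: "(\<lambda>x. 1 * f x + (-1) * g x) \<in> L2" by (rule L2_add[OF L2_cmult[OF f] L2_cmult[OF g]])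
  have "AE \<xi> in lborel. 0 = fourier (\<lambda>x. 1 * f x + (-1) * g x) \<xi>"
    using fourier_lincomb[OF f g, of 1 "-1"] eq by eventually_elim simp
  from sq_norm_AE_cong[OF L2_zero L2_measurable[OF fourier_L2[OF L]] this]
  have "sq_norm (\<lambda>x. 1 * f x + (-1) * g x) = 0"
    unfolding plancherel[OF L] by (simp add: sq_norm_def)
  from sq_norm_eq_0[OF L this] show ?thesis by simp
qed

section \<open>Weak derivatives as Fourier multipliers\<close>

abbreviation partial_deriv :: "'n \<Rightarrow> (real^'n::finite \<Rightarrow> real) \<Rightarrow> real^'n \<Rightarrow> real" where
  "partial_deriv i \<phi> x \<equiv> frechet_derivative \<phi> (at x) (axis i 1)"

lemma has_vector_derivative_slope:
  fixes f :: "real \<Rightarrow> 'a::real_normed_vector"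
  assumes "(f has_vector_derivative D) (at t within S)"
  shows "((\<lambda>u. (f u - f t) /\<^sub>R (u - t)) \<longlongrightarrow> D) (at t within S)"
proof (rule Lim_null[THEN iffD2], rule tendsto_norm_zero_cancel)
  have "((\<lambda>u. norm (f u - f t - (u - t) *\<^sub>R D) / norm (u - t)) \<longlongrightarrow> 0) (at t within S)"
    using assms unfolding has_vector_derivative_def has_derivative_iff_norm by blast
  moreover have "\<forall>\<^sub>F u in at t within S. norm (f u - f t - (u - t) *\<^sub>R D) / norm (u - t) = norm ((f u - f t) /\<^sub>R (u - t) - D)"
    unfolding eventually_at_filter
  proof (rule always_eventually, intro allI impI)
    fix u assume "u \<noteq> t"
    then have "(f u - f t) /\<^sub>R (u - t) - D = (f u - f t - (u - t) *\<^sub>R D) /\<^sub>R (u - t)"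
      by (simp add: scaleR_diff_right)
    then show "norm (f u - f t - (u - t) *\<^sub>R D) / norm (u - t) = norm ((f u - f t) /\<^sub>R (u - t) - D)"
      by (simp add: divide_inverse mult.commute)
  qed
  ultimately show "((\<lambda>u. norm ((f u - f t) /\<^sub>R (u - t) - D)) \<longlongrightarrow> 0) (at t within S)"
    by (rule Lim_transform_eventually)
qed

text \<open>
  By translation invariance the difference quotients of \<open>\<psi>\<close> in direction \<open>e\<close> have integral 0, and
  they converge dominatedly to the derivative. This replaces integration by parts.
\<close>

lemma integral_directional_derivative_0:
  fixes \<psi> :: "real^'n::finite \<Rightarrow> complex"
  assumes d: "\<And>x t. ((\<lambda>t. \<psi> (x + t *\<^sub>R e)) has_vector_derivative \<psi>' (x + t *\<^sub>R e)) (at t)"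
    and m: "continuous_on UNIV \<psi>" "continuous_on UNIV \<psi>'"
    and supp: "\<And>x. r < norm x \<Longrightarrow> \<psi> x = 0" and B: "\<And>x. norm (\<psi>' x) \<le> B"
  shows "(\<integral>x. \<psi>' x \<partial>lborel) = 0"
proof (rule LIMSEQ_unique)
  define h :: "nat \<Rightarrow> real" where "h n = 1 / real (Suc n)" for n
  have h: "h n > 0" "h n \<le> 1" for n by (simp_all add: h_def)
  have h0: "h \<longlonglongrightarrow> 0" unfolding h_def by (intro LIMSEQ_Suc[OF lim_1_over_n])
  have B0: "0 \<le> B" using B[of 0] norm_ge_zero order_trans by blast
  have [measurable]: "\<psi> \<in> borel_measurable borel" "\<psi>' \<in> borel_measurable borel"
    using m by (auto intro: borel_measurable_continuous_onI)
  let ?q = "\<lambda>n x. (\<psi> (x + h n *\<^sub>R e) - \<psi> x) /\<^sub>R h n"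
  have bound: "norm (\<psi> (x + h n *\<^sub>R e) - \<psi> x) \<le> h n * B" for x n
  proof -
    have "norm (\<psi> (x + h n *\<^sub>R e) - \<psi> (x + 0 *\<^sub>R e)) \<le> B * norm (h n - 0)"
    proof (rule differentiable_bound[of "UNIV :: real set"])
      show "((\<lambda>t. \<psi> (x + t *\<^sub>R e)) has_derivative (\<lambda>s. s *\<^sub>R \<psi>' (x + t *\<^sub>R e))) (at t)" for t
        using d[of x t] by (simp add: has_vector_derivative_def)
      show "onorm (\<lambda>s. s *\<^sub>R \<psi>' (x + t *\<^sub>R e)) \<le> B" for t
        using B[of "x + t *\<^sub>R e"] by (intro onorm_le) (simp add: mult_left_mono mult.commute[of B])
    qed auto
    then show ?thesis using h(1)[of n] by (simp add: mult.commute)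
  qed
  have zero: "\<psi> (x + h n *\<^sub>R e) - \<psi> x = 0" if "norm x > r + norm e" for x n
  proof -
    have "norm (h n *\<^sub>R e) \<le> norm e" using h[of n] by (simp add: mult_left_le_one_le)
    moreover have "norm x \<le> norm (x + h n *\<^sub>R e) + norm (h n *\<^sub>R e)"
      using norm_triangle_ineq4[of "x + h n *\<^sub>R e" "h n *\<^sub>R e"] by simp
    ultimately have "r < norm (x + h n *\<^sub>R e)" "r < norm x" using that norm_ge_zero[of e] by linarith+
    then show ?thesis using supp by simp
  qed
  show "(\<lambda>n. \<integral>x. ?q n x \<partial>lborel) \<longlonglongrightarrow> (\<integral>x. \<psi>' x \<partial>lborel)"
  proof (rule integral_dominated_convergence)
    show "integrable lborel (\<lambda>x::real^'n. B * indicator (cball 0 (r + norm e)) x)"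
      using emeasure_lborel_cball_finite[of "0::real^'n" "r + norm e"]
      by (intro integrable_mult_right) (simp add: integrable_indicator_iff less_top)
    show "AE x in lborel. norm (?q n x) \<le> B * indicator (cball 0 (r + norm e)) x" for n
    proof (rule AE_I2)
      fix x
      show "norm (?q n x) \<le> B * indicator (cball 0 (r + norm e)) x"
      proof (cases "x \<in> cball 0 (r + norm e)")
        case True
        have "norm (?q n x) = norm (\<psi> (x + h n *\<^sub>R e) - \<psi> x) / h n"
          using h(1)[of n] by (simp add: divide_inverse mult.commute)
        also have "\<dots> \<le> B" using bound[of x n] h(1)[of n] by (simp add: pos_divide_le_eq mult.commute)
        finally show ?thesis using True by simp
      next
        case False
        then show ?thesis using zero[of x n] by (simp add: not_le)
      qed
    qed
    show "AE x in lborel. (\<lambda>n. ?q n x) \<longlonglongrightarrow> \<psi>' x"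
    proof (rule AE_I2)
      fix x
      have "((\<lambda>t. (\<psi> (x + t *\<^sub>R e) - \<psi> (x + 0 *\<^sub>R e)) /\<^sub>R (t - 0)) \<longlongrightarrow> \<psi>' (x + 0 *\<^sub>R e)) (at 0)"
        by (rule has_vector_derivative_slope[OF d])
      then have "((\<lambda>t. (\<psi> (x + t *\<^sub>R e) - \<psi> x) /\<^sub>R t) \<longlongrightarrow> \<psi>' x) (at 0)" by simp
      then show "(\<lambda>n. ?q n x) \<longlonglongrightarrow> \<psi>' x"
        by (rule filterlim_compose) (use h h0 in \<open>auto simp: filterlim_at less_imp_neq[symmetric]\<close>)
    qed
  qed measurable
  have i: "integrable lborel \<psi>"
  proof -
    have "compact (\<psi> ` cball 0 r)" by (intro compact_continuous_image continuous_on_subset[OF m(1)]) auto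
    from compact_imp_bounded[OF this] obtain C where C: "\<And>x. x \<in> cball 0 r \<Longrightarrow> norm (\<psi> x) \<le> C"
      unfolding bounded_iff by (metis image_eqI)
    show ?thesis
    proof (rule Bochner_Integration.integrable_bound)
      show "integrable lborel (\<lambda>x::real^'n. C * indicator (cball 0 r) x)"
        using emeasure_lborel_cball_finite[of "0::real^'n" r]
        by (intro integrable_mult_right) (simp add: integrable_indicator_iff less_top)
      show "AE x in lborel. norm (\<psi> x) \<le> norm (C * indicator (cball 0 r) x)"
      proof (rule AE_I2)
        fix x show "norm (\<psi> x) \<le> norm (C * indicator (cball 0 r) x)"
          using C[of x] supp[of x] by (cases "x \<in> cball 0 r") (auto simp: not_le)
      qed
    qed measurable
  qed
  have "(\<integral>x. ?q n x \<partial>lborel) = 0" for n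
  proof -
    have "(\<integral>x. \<psi> (x + h n *\<^sub>R e) \<partial>lborel) = (\<integral>x. \<psi> x \<partial>lborel)"
      using lborel_integral_affine[of \<psi> 1 "h n *\<^sub>R e"] by (simp add: add.commute)
    moreover have "integrable lborel (\<lambda>x. \<psi> (x + h n *\<^sub>R e))"
      using lborel_integrable_affine[OF i, of 1 "h n *\<^sub>R e"] by (simp add: add.commute)
    ultimately show ?thesis using i by simp
  qed
  then show "(\<lambda>n. \<integral>x. ?q n x \<partial>lborel) \<longlonglongrightarrow> 0" by (simp only: tendsto_const)
qed

text \<open>
  The integral of the \<open>i\<close>-th derivative of \<open>e\<^bsup>-i x \<xi>\<^esup> \<phi>(x)\<close> vanishes.
\<close>

lemma fourier_integral_partial_deriv:
  fixes \<phi> :: "real^'n::finite \<Rightarrow> real"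
  assumes \<phi>: "C1_compact_support \<phi>"
  shows "fourier_integral (\<lambda>x. complex_of_real (partial_deriv i \<phi> x)) \<xi>
    = \<i> * complex_of_real (\<xi> $ i) * fourier_integral (\<lambda>x. complex_of_real (\<phi> x)) \<xi>"
proof -
  let ?e = "axis i 1 :: real^'n"
  let ?E = "\<lambda>x. exp (- (\<i> * complex_of_real (x \<bullet> \<xi>)))"
  let ?d = "partial_deriv i \<phi>"
  obtain r where r: "\<And>x. r < norm x \<Longrightarrow> \<phi> x = 0" "\<And>x. r < norm x \<Longrightarrow> ?d x = 0"
    using C1_test_function[OF \<phi>] by blast
  have c: "continuous_on UNIV \<phi>" by (rule C1_continuous[OF \<phi>])
  have cd: "continuous_on UNIV ?d" using \<phi> by (simp add: C1_compact_support_def)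
  obtain B0 where B0: "B0 \<ge> 0" "\<And>x. \<bar>\<phi> x\<bar> \<le> B0" using continuous_bounded_support_bounded[OF c r(1)] by blast
  obtain B1 where B1: "B1 \<ge> 0" "\<And>x. \<bar>?d x\<bar> \<le> B1" using continuous_bounded_support_bounded[OF cd r(2)] by blast
  have d1: "((\<lambda>t. \<phi> (x + t *\<^sub>R ?e)) has_vector_derivative ?d (x + t *\<^sub>R ?e)) (at t)" for x t
  proof -
    let ?D = "frechet_derivative \<phi> (at (x + t *\<^sub>R ?e))"
    have D: "(\<phi> has_derivative ?D) (at (x + t *\<^sub>R ?e))"
      using \<phi> by (simp add: C1_compact_support_def frechet_derivative_works)
    have "((\<lambda>t. x + t *\<^sub>R ?e) has_derivative (\<lambda>s. s *\<^sub>R ?e)) (at t)"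
      by (auto intro!: derivative_eq_intros)
    from has_derivative_compose[OF this D]
    have "((\<lambda>t. \<phi> (x + t *\<^sub>R ?e)) has_derivative (\<lambda>s. ?D (s *\<^sub>R ?e))) (at t)" .
    also have "(\<lambda>s. ?D (s *\<^sub>R ?e)) = (\<lambda>s. s *\<^sub>R ?D ?e)"
      using linear_scale[OF has_derivative_linear[OF D]] by blast
    finally show ?thesis by (simp add: has_vector_derivative_def)
  qed
  have inner: "?e \<bullet> \<xi> = \<xi> $ i" by (simp add: inner_axis' )
  have d2: "((\<lambda>t. ?E (x + t *\<^sub>R ?e)) has_vector_derivative ?E (x + t *\<^sub>R ?e) * (- (\<i> * complex_of_real (\<xi> $ i)))) (at t)" for x t
  proof -
    have "((\<lambda>t. - (\<i> * complex_of_real ((x + t *\<^sub>R ?e) \<bullet> \<xi>))) has_vector_derivative (- (\<i> * complex_of_real (\<xi> $ i)))) (at t)"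
      unfolding inner_add_left inner_scaleR_left inner
      by (auto intro!: derivative_eq_intros)
    from field_vector_diff_chain_at[OF this DERIV_exp] show ?thesis
      by (simp add: o_def mult.commute)
  qed
  let ?\<psi>' = "\<lambda>x. ?E x * (complex_of_real (?d x) - \<i> * complex_of_real (\<xi> $ i) * complex_of_real (\<phi> x))"
  have "(\<integral>x. ?\<psi>' x \<partial>lborel) = 0"
  proof (rule integral_directional_derivative_0[where \<psi> = "\<lambda>x. ?E x * complex_of_real (\<phi> x)" and r = r and e = ?e and B = "B1 + \<bar>\<xi> $ i\<bar> * B0"])
    show "((\<lambda>t. ?E (x + t *\<^sub>R ?e) * complex_of_real (\<phi> (x + t *\<^sub>R ?e))) has_vector_derivative ?\<psi>' (x + t *\<^sub>R ?e)) (at t)" for x t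
      using has_vector_derivative_mult[OF d2 has_vector_derivative_of_real[OF d1[folded has_real_derivative_iff_has_vector_derivative]]]
      by (rule has_vector_derivative_eq_rhs) (simp add: algebra_simps)
    show "continuous_on UNIV (\<lambda>x. ?E x * complex_of_real (\<phi> x))" "continuous_on UNIV ?\<psi>'"
      by (intro continuous_intros c cd)+
    show "r < norm x \<Longrightarrow> ?E x * complex_of_real (\<phi> x) = 0" for x using r(1) by simp
    show "norm (?\<psi>' x) \<le> B1 + \<bar>\<xi> $ i\<bar> * B0" for x
    proof -
      have "norm (?\<psi>' x) = cmod (complex_of_real (?d x) - \<i> * complex_of_real (\<xi> $ i) * complex_of_real (\<phi> x))"
        unfolding norm_mult cmod_fourier_char by simp
      also have "\<dots> \<le> cmod (complex_of_real (?d x)) + cmod (\<i> * complex_of_real (\<xi> $ i) * complex_of_real (\<phi> x))"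
        by (rule norm_triangle_ineq4)
      also have "\<dots> = \<bar>?d x\<bar> + \<bar>\<xi> $ i\<bar> * \<bar>\<phi> x\<bar>" by (simp add: norm_mult)
      also have "\<dots> \<le> B1 + \<bar>\<xi> $ i\<bar> * B0" by (intro add_mono mult_left_mono B0 B1) auto
      finally show ?thesis .
    qed
  qed
  moreover have "integrable lborel (\<lambda>x. ?E x * complex_of_real (\<phi> x))" "integrable lborel (\<lambda>x. ?E x * complex_of_real (?d x))"
    using fourier_kernel_integrable[OF L2_bounded_support_integrable[where r = r, OF continuous_bounded_support_L2[OF c r(1)]]]
      fourier_kernel_integrable[OF L2_bounded_support_integrable[where r = r, OF continuous_bounded_support_L2[OF cd r(2)]]] r
    by simp_all
  moreover have "?\<psi>' x = ?E x * complex_of_real (?d x) - \<i> * complex_of_real (\<xi> $ i) * (?E x * complex_of_real (\<phi> x))" for x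
    by (simp add: algebra_simps)
  ultimately have "(\<integral>x. ?E x * complex_of_real (?d x) \<partial>lborel) = \<i> * complex_of_real (\<xi> $ i) * (\<integral>x. ?E x * complex_of_real (\<phi> x) \<partial>lborel)"
    by simp
  then show ?thesis unfolding fourier_integral_eq by simp
qed

text \<open>
  The inverse transform of \<open>i \<xi>\<^sub>i fourier f\<close> satisfies the defining identity of the weak derivative
  by Parseval's formula. The fundamental lemma makes such a function unique up to null sets, so the
  one selected in \<open>weak_partial\<close> has the same transform.
\<close>

lemma weak_partial_fourier:
  fixes f :: "'n::finite cfun"
  assumes f: "f \<in> L2" and d: "(\<lambda>\<xi>. complex_of_real (\<xi> $ i) * fourier f \<xi>) \<in> L2"
  shows "weak_partial i f \<in> L2 \<and> (AE \<xi> in lborel. fourier (weak_partial i f) \<xi> = \<i> * complex_of_real (\<xi> $ i) * fourier f \<xi>)"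
proof -
  define h where "h \<xi> = \<i> * (complex_of_real (\<xi> $ i) * fourier f \<xi>)" for \<xi>
  have h: "h \<in> L2" unfolding h_def by (rule L2_cmult[OF d])
  define P where "P g \<longleftrightarrow> g \<in> L2 \<and> (\<forall>\<phi>. C1_compact_support \<phi> \<longrightarrow>
        (\<integral>x. f x * complex_of_real (partial_deriv i \<phi> x) \<partial>lborel) = - (\<integral>x. g x * complex_of_real (\<phi> x) \<partial>lborel))" for g
  have wp: "weak_partial i f = (SOME g. P g)" by (simp add: weak_partial_def P_def)
  have iL: "inv_fourier h \<in> L2" by (rule inv_fourier_L2[OF h])
  have P: "P (inv_fourier h)" unfolding P_def
  proof (intro conjI allI impI iL)
    fix \<phi> :: "real^'n \<Rightarrow> real" assume \<phi>: "C1_compact_support \<phi>"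
    let ?d = "partial_deriv i \<phi>"
    obtain r where r: "\<And>x. r < norm x \<Longrightarrow> \<phi> x = 0" "\<And>x. r < norm x \<Longrightarrow> ?d x = 0"
      using C1_test_function[OF \<phi>] by blast
    have c: "continuous_on UNIV \<phi>" by (rule C1_continuous[OF \<phi>])
    have cd: "continuous_on UNIV ?d" using \<phi> by (simp add: C1_compact_support_def)
    have fm: "fourier_integral (\<lambda>x. complex_of_real (\<phi> x)) \<in> borel_measurable borel"
      by (intro fourier_integral_measurable L2_measurable continuous_bounded_support_L2[OF c r(1)])
    have "(\<integral>x. f x * complex_of_real (?d x) \<partial>lborel)
       = (\<integral>\<xi>. fourier f \<xi> * cnj (fourier_integral (\<lambda>x. complex_of_real (?d x)) \<xi>) \<partial>lborel)"
      by (rule fourier_parseval_test[OF f cd r(2), symmetric])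
    also have "\<dots> = (\<integral>\<xi>. - (h \<xi> * cnj (fourier_integral (\<lambda>x. complex_of_real (\<phi> x)) \<xi>)) \<partial>lborel)"
      unfolding fourier_integral_partial_deriv[OF \<phi>] by (simp add: h_def mult_ac)
    also have "\<dots> = - (\<integral>\<xi>. h \<xi> * cnj (fourier_integral (\<lambda>x. complex_of_real (\<phi> x)) \<xi>) \<partial>lborel)"
      by simp
    also have "(\<integral>\<xi>. h \<xi> * cnj (fourier_integral (\<lambda>x. complex_of_real (\<phi> x)) \<xi>) \<partial>lborel)
      = (\<integral>\<xi>. fourier (inv_fourier h) \<xi> * cnj (fourier_integral (\<lambda>x. complex_of_real (\<phi> x)) \<xi>) \<partial>lborel)"
      using fourier_inv_fourier[OF h] h fourier_L2[OF iL] fm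
      by (intro integral_cong_AE) (auto elim!: eventually_mono)
    also have "\<dots> = (\<integral>x. inv_fourier h x * complex_of_real (\<phi> x) \<partial>lborel)"
      by (rule fourier_parseval_test[OF iL c r(1)])
    finally show "(\<integral>x. f x * complex_of_real (?d x) \<partial>lborel) = - (\<integral>x. inv_fourier h x * complex_of_real (\<phi> x) \<partial>lborel)" .
  qed
  have Pw: "P (weak_partial i f)" unfolding wp by (rule someI[of P, OF P])
  then have wL: "weak_partial i f \<in> L2" by (simp add: P_def)
  have "AE x in lborel. weak_partial i f x - inv_fourier h x = 0"
  proof (rule fundamental_lemma[OF L2_diff[OF wL iL]])
    fix \<phi> :: "real^'n \<Rightarrow> real" assume \<phi>: "C1_compact_support \<phi>"
    obtain r where r: "\<And>x. r < norm x \<Longrightarrow> \<phi> x = 0" using C1_test_function[OF \<phi>] by blast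
    have L: "(\<lambda>x. complex_of_real (\<phi> x)) \<in> L2"
      by (rule continuous_bounded_support_L2[OF C1_continuous[OF \<phi>] r])
    have "(\<integral>x. weak_partial i f x * complex_of_real (\<phi> x) \<partial>lborel) = (\<integral>x. inv_fourier h x * complex_of_real (\<phi> x) \<partial>lborel)"
    proof -
      have "(\<integral>x. f x * complex_of_real (partial_deriv i \<phi> x) \<partial>lborel) = - (\<integral>x. weak_partial i f x * complex_of_real (\<phi> x) \<partial>lborel)"
        using Pw \<phi> unfolding P_def by blast
      moreover have "(\<integral>x. f x * complex_of_real (partial_deriv i \<phi> x) \<partial>lborel) = - (\<integral>x. inv_fourier h x * complex_of_real (\<phi> x) \<partial>lborel)"
        using P \<phi> unfolding P_def by blast
      ultimately show ?thesis by simp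
    qed
    then show "(\<integral>x. (weak_partial i f x - inv_fourier h x) * complex_of_real (\<phi> x) \<partial>lborel) = 0"
      using L2_mult_integrable[OF wL L] L2_mult_integrable[OF iL L] by (simp add: left_diff_distrib)
  qed
  then have "fourier (weak_partial i f) = fourier (inv_fourier h)"
    by (intro fourier_AE_cong wL iL) simp
  with fourier_inv_fourier[OF h] wL show ?thesis by (simp add: h_def mult.assoc)
qed

section \<open>Gevrey weights\<close>

lemma gevrey_weight_ge_1: "\<eta> \<ge> 0 \<Longrightarrow> 1 \<le> gevrey_weight s \<eta> \<xi>"
  by (simp add: gevrey_weight_def)

lemma gevrey_weight_pos: "0 < gevrey_weight s \<eta> \<xi>"
  by (simp add: gevrey_weight_def)

lemma gevrey_weight_nonneg [simp]: "0 \<le> gevrey_weight s \<eta> \<xi>"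
  by (simp add: gevrey_weight_def)

lemma gevrey_weight_mono: "\<eta> \<le> \<eta>' \<Longrightarrow> gevrey_weight s \<eta> \<xi> \<le> gevrey_weight s \<eta>' \<xi>"
  by (simp add: gevrey_weight_def mult_right_mono)

lemma gevrey_weight_measurable [measurable]: "gevrey_weight s \<eta> \<in> borel_measurable borel"
  unfolding gevrey_weight_def[abs_def] by measurable

text \<open>
  With \<open>y = |\<xi>|\<^bsup>1/s\<^esup>\<close> and an integer \<open>N \<ge> s k\<close>, the power \<open>|\<xi>|\<^bsup>k\<^esup>\<close> is at most \<open>y\<^bsup>N\<^esup>\<close> for
  \<open>|\<xi>| \<ge> 1\<close>, and \<open>(\<eta> y / N)\<^bsup>N\<^esup> \<le> e\<^bsup>\<eta> y\<^esup>\<close>.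
\<close>

lemma power_le_gevrey_weight:
  fixes \<xi> :: "real^'n::finite"
  assumes s: "s > 0" and \<eta>: "\<eta> > 0"
  shows "\<exists>C>0. \<forall>\<xi>::real^'n. norm \<xi> ^ k \<le> C * gevrey_weight s \<eta> \<xi>"
proof -
  obtain N :: nat where N: "s * real k \<le> real N" "N > 0"
    using real_arch_simple[of "s * real k + 1"] s
    by (metis add.commute add_le_same_cancel1 less_add_one mult_nonneg_nonneg not_gr_zero not_less of_nat_0 of_nat_0_le_iff order_less_imp_le order_trans le_add_same_cancel2 zero_le_one)
  define C where "C = 1 + (real N / \<eta>) ^ N"
  have C: "C > 0" "1 \<le> C" "(real N / \<eta>) ^ N \<le> C" using \<eta> by (auto simp: C_def intro!: add_pos_nonneg)
  have "norm \<xi> ^ k \<le> C * gevrey_weight s \<eta> \<xi>" for \<xi> :: "real^'n"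
  proof (cases "norm \<xi> \<le> 1")
    case True
    then have "norm \<xi> ^ k \<le> 1" by (simp add: power_le_one)
    also have "1 \<le> C * gevrey_weight s \<eta> \<xi>"
      using mult_mono[OF C(2) gevrey_weight_ge_1[of \<eta> s \<xi>]] \<eta> C by simp
    finally show ?thesis .
  next
    case False
    define y where "y = norm \<xi> powr (1 / s)"
    have x: "norm \<xi> > 1" using False by simp
    have y: "y \<ge> 1" unfolding y_def using x s by (simp add: ge_one_powr_ge_zero)
    have "norm \<xi> ^ k = norm \<xi> powr real k" using x by (subst powr_realpow) auto
    also have "\<dots> = y powr (s * real k)" using s by (simp add: y_def powr_powr)
    also have "\<dots> \<le> y powr real N" using y N by (intro powr_mono) auto
    also have "\<dots> = y ^ N" using y by (subst powr_realpow) auto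
    also have "\<dots> = (real N / \<eta>) ^ N * (\<eta> * y / real N) ^ N"
      using \<eta> N by (simp add: field_simps power_mult_distrib power_divide)
    also have "\<dots> \<le> (real N / \<eta>) ^ N * exp (\<eta> * y / real N) ^ N"
      using \<eta> y order_trans[OF _ exp_ge_add_one_self[of "\<eta> * y / real N"], of "\<eta> * y / real N"]
      by (intro mult_left_mono power_mono) simp_all
    also have "exp (\<eta> * y / real N) ^ N = exp (\<eta> * y)" using N by (simp flip: exp_of_nat_mult)
    also have "(real N / \<eta>) ^ N * \<dots> \<le> C * exp (\<eta> * y)" using C by (intro mult_right_mono) auto
    finally show ?thesis by (simp add: gevrey_weight_def y_def)
  qed
  with C(1) show ?thesis by blast
qed

lemma gevrey_etaD:
  assumes "f \<in> gevrey_eta s \<eta>"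
  shows "f \<in> L2" "integrable lborel (\<lambda>\<xi>. gevrey_weight s \<eta> \<xi> * (cmod (fourier f \<xi>))\<^sup>2)"
  using assms by (auto simp: gevrey_eta_def)

lemma gevrey_norm_sq: "(gevrey_norm s \<eta> f)\<^sup>2 = (\<integral>\<xi>. gevrey_weight s \<eta> \<xi> * (cmod (fourier f \<xi>))\<^sup>2 \<partial>lborel)"
  unfolding gevrey_norm_def
  by (intro real_sqrt_pow2 Bochner_Integration.integral_nonneg) simp

text \<open>
  The multiplier of \<open>(- \<Delta>)\<^bsup>k/2\<^esup>\<close>; the squared homogeneous Sobolev norm of order \<open>k\<close> of \<open>f\<close> is
  \<open>sq_norm (freq k (fourier f))\<close>.
\<close>

definition freq :: "nat \<Rightarrow> ('n::finite) cfun \<Rightarrow> 'n cfun" where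
  "freq k h \<xi> = complex_of_real (norm \<xi> ^ k) * h \<xi>"

lemma freq_0 [simp]: "freq 0 h = h" by (simp add: freq_def fun_eq_iff)

lemma freq_measurable [measurable]: "h \<in> borel_measurable borel \<Longrightarrow> freq k h \<in> borel_measurable borel"
  unfolding freq_def[abs_def] by measurable

lemma freq_gevrey:
  fixes s \<eta> :: real
  assumes s: "s > 0" and \<eta>: "\<eta> > 0"
  shows "\<exists>C>0. \<forall>f\<in>gevrey_eta s \<eta>. freq k (fourier f) \<in> L2 \<and> sq_norm (freq k (fourier f :: 'n::finite cfun)) \<le> C * (gevrey_norm s \<eta> f)\<^sup>2"
proof -
  obtain C where C: "C > 0" "\<And>\<xi>::real^'n. norm \<xi> ^ (2 * k) \<le> C * gevrey_weight s \<eta> \<xi>"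
    using power_le_gevrey_weight[OF s \<eta>, of "2 * k"] by blast
  have "freq k (fourier f) \<in> L2 \<and> sq_norm (freq k (fourier f)) \<le> C * (gevrey_norm s \<eta> f)\<^sup>2" if f: "f \<in> gevrey_eta s \<eta>" for f :: "'n cfun"
  proof -
    have i: "integrable lborel (\<lambda>\<xi>. C * (gevrey_weight s \<eta> \<xi> * (cmod (fourier f \<xi>))\<^sup>2))"
      by (rule integrable_mult_right[OF gevrey_etaD(2)[OF f]])
    have le: "AE \<xi> in lborel. (cmod (freq k (fourier f) \<xi>))\<^sup>2 \<le> C * (gevrey_weight s \<eta> \<xi> * (cmod (fourier f \<xi>))\<^sup>2)"
      using mult_right_mono[OF C(2) zero_le_power2]
      by (simp add: freq_def norm_mult power_mult_distrib norm_power power_mult[symmetric] mult.commute[of k] mult.assoc)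
    have L: "freq k (fourier f) \<in> L2"
      using L2_measurable[OF fourier_L2[OF gevrey_etaD(1)[OF f]]] by (intro L2_bound[OF i _ le]) measurable
    show ?thesis using sq_norm_mono[OF i L le] by (simp add: L gevrey_norm_sq)
  qed
  with C(1) show ?thesis by blast
qed

lemma gevrey_L2: "f \<in> gevrey s \<Longrightarrow> f \<in> L2"
  by (auto simp: gevrey_def gevrey_eta_def)

lemma gevrey_freq: "s > 0 \<Longrightarrow> f \<in> gevrey s \<Longrightarrow> freq k (fourier f) \<in> L2"
  using freq_gevrey[of s _ k] by (fastforce simp: gevrey_def)

lemma gevrey_eta_mono:
  assumes "\<eta> \<le> \<eta>'" "f \<in> gevrey_eta s \<eta>'" shows "f \<in> gevrey_eta s \<eta>"
proof -
  have [measurable]: "fourier f \<in> borel_measurable borel" by (rule L2_measurable[OF fourier_L2[OF gevrey_etaD(1)[OF assms(2)]]])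
  have "integrable lborel (\<lambda>\<xi>. gevrey_weight s \<eta> \<xi> * (cmod (fourier f \<xi>))\<^sup>2)"
  proof (rule Bochner_Integration.integrable_bound[OF gevrey_etaD(2)[OF assms(2)]])
    show "AE \<xi> in lborel. norm (gevrey_weight s \<eta> \<xi> * (cmod (fourier f \<xi>))\<^sup>2) \<le> norm (gevrey_weight s \<eta>' \<xi> * (cmod (fourier f \<xi>))\<^sup>2)"
      by (intro AE_I2) (simp add: abs_mult mult_right_mono gevrey_weight_mono[OF assms(1)])
  qed measurable
  then show ?thesis using assms(2) by (simp add: gevrey_eta_def)
qed

lemma gevrey_eta_lincomb:
  assumes f: "f \<in> gevrey_eta s \<eta>" and g: "g \<in> gevrey_eta s \<eta>"
  shows "(\<lambda>x. a * f x + b * g x) \<in> gevrey_eta s \<eta>"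
proof -
  note L = gevrey_etaD(1)[OF f] gevrey_etaD(1)[OF g]
  have h: "(\<lambda>x. a * f x + b * g x) \<in> L2" by (rule L2_lincomb[OF L])
  have [measurable]: "fourier (\<lambda>x. a * f x + b * g x) \<in> borel_measurable borel" by (rule L2_measurable[OF fourier_L2[OF h]])
  have i: "integrable lborel (\<lambda>\<xi>. 2 * (cmod a)\<^sup>2 * (gevrey_weight s \<eta> \<xi> * (cmod (fourier f \<xi>))\<^sup>2)
       + 2 * (cmod b)\<^sup>2 * (gevrey_weight s \<eta> \<xi> * (cmod (fourier g \<xi>))\<^sup>2))"
    using gevrey_etaD(2)[OF f] gevrey_etaD(2)[OF g] by simp
  have "integrable lborel (\<lambda>\<xi>. gevrey_weight s \<eta> \<xi> * (cmod (fourier (\<lambda>x. a * f x + b * g x) \<xi>))\<^sup>2)"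
  proof (rule Bochner_Integration.integrable_bound[OF i])
    show "AE \<xi> in lborel. norm (gevrey_weight s \<eta> \<xi> * (cmod (fourier (\<lambda>x. a * f x + b * g x) \<xi>))\<^sup>2)
      \<le> norm (2 * (cmod a)\<^sup>2 * (gevrey_weight s \<eta> \<xi> * (cmod (fourier f \<xi>))\<^sup>2)
       + 2 * (cmod b)\<^sup>2 * (gevrey_weight s \<eta> \<xi> * (cmod (fourier g \<xi>))\<^sup>2))"
      using fourier_lincomb[OF L, of a b]
    proof eventually_elim
      case (elim \<xi>)
      have "gevrey_weight s \<eta> \<xi> * (cmod (a * fourier f \<xi> + b * fourier g \<xi>))\<^sup>2
        \<le> gevrey_weight s \<eta> \<xi> * (2 * (cmod (a * fourier f \<xi>))\<^sup>2 + 2 * (cmod (b * fourier g \<xi>))\<^sup>2)"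
        using gevrey_weight_pos[of s \<eta> \<xi>] by (intro mult_left_mono cmod_add_sq_le) simp
      also have "\<dots> = 2 * (cmod a)\<^sup>2 * (gevrey_weight s \<eta> \<xi> * (cmod (fourier f \<xi>))\<^sup>2)
       + 2 * (cmod b)\<^sup>2 * (gevrey_weight s \<eta> \<xi> * (cmod (fourier g \<xi>))\<^sup>2)"
        by (simp add: norm_mult power_mult_distrib algebra_simps)
      finally show ?case using elim gevrey_weight_pos[of s \<eta> \<xi>] by (simp add: abs_mult)
    qed
  qed measurable
  with h show ?thesis by (simp add: gevrey_eta_def)
qed

lemma gevrey_lincomb:
  assumes f: "f \<in> gevrey s" and g: "g \<in> gevrey s"
  shows "(\<lambda>x. a * f x + b * g x) \<in> gevrey s"
proof -
  obtain \<eta>1 \<eta>2 where e: "\<eta>1 > 0" "\<eta>2 > 0" "f \<in> gevrey_eta s \<eta>1" "g \<in> gevrey_eta s \<eta>2"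
    using f g by (auto simp: gevrey_def)
  have "f \<in> gevrey_eta s (min \<eta>1 \<eta>2)" "g \<in> gevrey_eta s (min \<eta>1 \<eta>2)"
    by (rule gevrey_eta_mono[OF _ e(3)], simp, rule gevrey_eta_mono[OF _ e(4)], simp)
  from gevrey_eta_lincomb[OF this] show ?thesis using e(1,2) unfolding gevrey_def
    by (intro UN_I[of "min \<eta>1 \<eta>2"]) auto
qed

lemma gevrey_add: "f \<in> gevrey s \<Longrightarrow> g \<in> gevrey s \<Longrightarrow> (\<lambda>x. f x + g x) \<in> gevrey s"
  and gevrey_diff: "f \<in> gevrey s \<Longrightarrow> g \<in> gevrey s \<Longrightarrow> (\<lambda>x. f x - g x) \<in> gevrey s"
  using gevrey_lincomb[of f s g 1 1] gevrey_lincomb[of f s g 1 "-1"] by simp_all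

section \<open>The inductive limit topology\<close>

lemma topspace_gevrey: "topspace (gevrey_topology s) = (gevrey s :: ('n::finite) cfun set)"
proof -
  have "gevrey_nhd_0 s (gevrey s :: 'n cfun set)"
    unfolding gevrey_nhd_0_def absolutely_convex_def
  proof (intro conjI ballI allI impI)
    fix f g :: "'n cfun" and a b assume "f \<in> gevrey s" "g \<in> gevrey s"
    then show "(\<lambda>x. a * f x + b * g x) \<in> gevrey s" by (rule gevrey_lincomb)
  next
    fix \<eta> :: real assume "\<eta> > 0"
    then show "\<exists>\<epsilon>>0. {f \<in> gevrey_eta s \<eta>. gevrey_norm s \<eta> f < \<epsilon>} \<subseteq> (gevrey s :: 'n cfun set)"
      by (intro exI[of _ 1]) (auto simp: gevrey_def)
  qed simp
  then have "openin (gevrey_topology s) (gevrey s :: 'n cfun set)"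
    unfolding openin_gevrey_topology using gevrey_add by blast
  moreover have "topspace (gevrey_topology s) \<subseteq> (gevrey s :: 'n cfun set)"
    using openin_topspace[of "gevrey_topology s :: 'n cfun topology"] unfolding openin_gevrey_topology by blast
  ultimately show ?thesis by (meson openin_subset subset_antisym)
qed

text \<open>
  The free parameter \<open>d\<close> lets the first factor be as close to 1 as needed; this is what shows that
  balls of squared seminorms are open.
\<close>

lemma sq_norm_add_le:
  assumes "f \<in> L2" "g \<in> L2" and d: "d > 0"
  shows "sq_norm (\<lambda>x. f x + g x) \<le> (1 + d) * sq_norm f + (1 + 1 / d) * sq_norm g"
proof -
  have i: "integrable lborel (\<lambda>x. (1 + d) * (cmod (f x))\<^sup>2 + (1 + 1 / d) * (cmod (g x))\<^sup>2)"
    using assms(1,2)[THEN L2_integrable] by simp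
  have le: "(cmod (f x + g x))\<^sup>2 \<le> (1 + d) * (cmod (f x))\<^sup>2 + (1 + 1 / d) * (cmod (g x))\<^sup>2" for x
  proof -
    have "(cmod (f x + g x))\<^sup>2 \<le> (cmod (f x) + cmod (g x))\<^sup>2"
      by (intro power_mono norm_triangle_ineq) auto
    also have "0 \<le> (d * cmod (f x) - cmod (g x))\<^sup>2 / d" using d by simp
    then have "(cmod (f x) + cmod (g x))\<^sup>2 \<le> (1 + d) * (cmod (f x))\<^sup>2 + (1 + 1 / d) * (cmod (g x))\<^sup>2"
      using d by (simp add: power2_eq_square field_simps)
    finally show ?thesis .
  qed
  have "sq_norm (\<lambda>x. f x + g x) \<le> (\<integral>x. (1 + d) * (cmod (f x))\<^sup>2 + (1 + 1 / d) * (cmod (g x))\<^sup>2 \<partial>lborel)"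
    by (rule sq_norm_mono[OF i L2_add[OF assms(1,2)]]) (simp add: le)
  also have "\<dots> = (1 + d) * sq_norm f + (1 + 1 / d) * sq_norm g"
    using assms(1,2)[THEN L2_integrable] by (simp add: sq_norm_def)
  finally show ?thesis .
qed

text \<open>
  Convexity of the square, for the coefficients that occur in absolutely convex sets.
\<close>

lemma sq_norm_convex:
  assumes "f \<in> L2" "g \<in> L2" and ab: "cmod a + cmod b \<le> 1"
  shows "sq_norm (\<lambda>x. a * f x + b * g x) \<le> cmod a * sq_norm f + cmod b * sq_norm g"
proof -
  have i: "integrable lborel (\<lambda>x. cmod a * (cmod (f x))\<^sup>2 + cmod b * (cmod (g x))\<^sup>2)"
    using assms(1,2)[THEN L2_integrable] by simp
  have le: "(cmod (a * f x + b * g x))\<^sup>2 \<le> cmod a * (cmod (f x))\<^sup>2 + cmod b * (cmod (g x))\<^sup>2" for x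
  proof -
    let ?p = "cmod a" and ?q = "cmod b" and ?u = "cmod (f x)" and ?v = "cmod (g x)"
    have "(cmod (a * f x + b * g x))\<^sup>2 \<le> (?p * ?u + ?q * ?v)\<^sup>2"
      using norm_triangle_ineq[of "a * f x" "b * g x"] by (intro power_mono) (auto simp: norm_mult)
    also have "\<dots> = (?p + ?q) * (?p * ?u\<^sup>2 + ?q * ?v\<^sup>2) - ?p * ?q * (?u - ?v)\<^sup>2"
      by (simp add: power2_eq_square algebra_simps)
    also have "\<dots> \<le> (?p + ?q) * (?p * ?u\<^sup>2 + ?q * ?v\<^sup>2)" by simp
    also have "\<dots> \<le> 1 * (?p * ?u\<^sup>2 + ?q * ?v\<^sup>2)" using ab by (intro mult_right_mono) auto
    finally show ?thesis by simp
  qed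
  have "sq_norm (\<lambda>x. a * f x + b * g x) \<le> (\<integral>x. cmod a * (cmod (f x))\<^sup>2 + cmod b * (cmod (g x))\<^sup>2 \<partial>lborel)"
    by (rule sq_norm_mono[OF i L2_lincomb[OF assms(1,2)]]) (simp add: le)
  also have "\<dots> = cmod a * sq_norm f + cmod b * sq_norm g"
    using assms(1,2)[THEN L2_integrable] by (simp add: sq_norm_def)
  finally show ?thesis .
qed

lemma freq_L2_AE_cong:
  assumes "freq k g \<in> L2" "h \<in> borel_measurable borel" "AE \<xi> in lborel. g \<xi> = h \<xi>"
  shows "freq k h \<in> L2" "sq_norm (freq k g) = sq_norm (freq k h)"
proof -
  have *: "AE \<xi> in lborel. freq k g \<xi> = freq k h \<xi>" using assms(3) by eventually_elim (simp add: freq_def)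
  have m: "freq k h \<in> borel_measurable borel" using assms(2) by measurable
  show "freq k h \<in> L2" by (rule L2_AE_cong[OF assms(1) m *])
  show "sq_norm (freq k g) = sq_norm (freq k h)" by (rule sq_norm_AE_cong[OF assms(1) m *])
qed

lemma freq_fourier_lincomb:
  assumes "f \<in> L2" "g \<in> L2" "freq k (fourier f) \<in> L2" "freq k (fourier g) \<in> L2"
  shows "sq_norm (freq k (fourier (\<lambda>x. a * f x + b * g x))) = sq_norm (\<lambda>\<xi>. a * freq k (fourier f) \<xi> + b * freq k (fourier g) \<xi>)"
proof -
  have "AE \<xi> in lborel. a * freq k (fourier f) \<xi> + b * freq k (fourier g) \<xi> = freq k (fourier (\<lambda>x. a * f x + b * g x)) \<xi>"
    using fourier_lincomb[OF assms(1,2), of a b] by eventually_elim (simp add: freq_def algebra_simps)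
  moreover have "freq k (fourier (\<lambda>x. a * f x + b * g x)) \<in> borel_measurable borel"
    using L2_measurable[OF fourier_L2[OF L2_lincomb[OF assms(1,2)]]] by (rule freq_measurable)
  ultimately show ?thesis
    by (intro sq_norm_AE_cong[OF L2_lincomb[OF assms(3,4)], symmetric])
qed

text \<open>
  The neighbourhood of 0 needed around a point of the Sobolev ball is again a Sobolev ball: it is absolutely convex, and on each step of the limit
  the Gevrey norm controls the Sobolev norm.
\<close>

lemma openin_gevrey_sobolev_ball:
  fixes l :: "('n::finite) cfun"
  assumes s: "s > 0" and l: "l \<in> gevrey s"
  shows "openin (gevrey_topology s) {f \<in> gevrey s. sq_norm (freq k (fourier (\<lambda>x. f x - l x))) < \<epsilon>}"
  unfolding openin_gevrey_topology
proof (intro conjI ballI)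
  define q where "q f = sq_norm (freq k (fourier f))" for f :: "'n cfun"
  fix f assume "f \<in> {f \<in> gevrey s. sq_norm (freq k (fourier (\<lambda>x. f x - l x))) < \<epsilon>}"
  then have f: "f \<in> gevrey s" and q0: "q (\<lambda>x. f x - l x) < \<epsilon>" by (auto simp: q_def)
  \<comment> \<open>\<open>d\<close> and, below, \<open>r\<close> are chosen so that \<open>(1 + d) q(f - l)\<close> stays below the midpoint between
    \<open>q(f - l)\<close> and \<open>\<epsilon>\<close>, and \<open>(1 + 1/d) r\<close> fills the rest.\<close>
  define d where "d = (\<epsilon> - q (\<lambda>x. f x - l x)) / (2 * (q (\<lambda>x. f x - l x) + 1))"
  have qn: "0 \<le> q g" for g by (simp add: q_def)
  have d: "d > 0" using q0 qn[of "\<lambda>x. f x - l x"] by (simp add: d_def add_nonneg_pos)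
  have d1: "(1 + d) * q (\<lambda>x. f x - l x) < (\<epsilon> + q (\<lambda>x. f x - l x)) / 2"
  proof -
    let ?q = "q (\<lambda>x. f x - l x)"
    have "d * ?q < d * (?q + 1)" using d by simp
    also have "\<dots> = (\<epsilon> - ?q) / 2" using qn[of "\<lambda>x. f x - l x"] unfolding d_def by (simp add: field_simps)
    finally show ?thesis by (simp add: field_simps)
  qed
  define r where "r = (\<epsilon> - q (\<lambda>x. f x - l x)) / 2 / (1 + 1 / d)"
  have dp: "1 + 1 / d > 0" using d by (simp add: add_pos_pos)
  have r: "r > 0" unfolding r_def using q0 by (intro divide_pos_pos dp) simp_all
  have r1: "(1 + 1 / d) * r = (\<epsilon> - q (\<lambda>x. f x - l x)) / 2"
    using dp unfolding r_def by (subst times_divide_eq_right) (simp only: nonzero_mult_div_cancel_left less_imp_neq[symmetric] not_False_eq_True)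
  define U where "U = {g \<in> gevrey s. q g < r}"
  have "gevrey_nhd_0 s U"
    unfolding gevrey_nhd_0_def
  proof (intro conjI allI impI)
    show "U \<subseteq> gevrey s" by (auto simp: U_def)
    show "absolutely_convex U" unfolding absolutely_convex_def
    proof (intro ballI allI impI)
      fix g h a b assume g: "g \<in> U" and h: "h \<in> U" and ab: "cmod a + cmod b \<le> 1"
      have gh: "g \<in> gevrey s" "h \<in> gevrey s" "q g < r" "q h < r" using g h by (auto simp: U_def)
      have "q (\<lambda>x. a * g x + b * h x) \<le> cmod a * q g + cmod b * q h"
        unfolding q_def freq_fourier_lincomb[OF gevrey_L2[OF gh(1)] gevrey_L2[OF gh(2)] gevrey_freq[OF s gh(1)] gevrey_freq[OF s gh(2)]]
        by (rule sq_norm_convex[OF gevrey_freq[OF s gh(1)] gevrey_freq[OF s gh(2)] ab])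
      also have "\<dots> \<le> cmod a * max (q g) (q h) + cmod b * max (q g) (q h)"
        by (intro add_mono mult_left_mono) auto
      also have "\<dots> \<le> 1 * max (q g) (q h)"
        unfolding distrib_right[symmetric] using ab qn[of g] by (intro mult_right_mono) auto
      also have "\<dots> < r" using gh by simp
      finally show "(\<lambda>x. a * g x + b * h x) \<in> U" using gevrey_lincomb[OF gh(1,2)] by (simp add: U_def)
    qed
    fix \<eta> :: real assume \<eta>: "\<eta> > 0"
    obtain C where C: "C > 0" "\<And>f :: 'n cfun. f \<in> gevrey_eta s \<eta> \<Longrightarrow> q f \<le> C * (gevrey_norm s \<eta> f)\<^sup>2"
      using freq_gevrey[OF s \<eta>, of k, where 'n='n] unfolding q_def by blast
    show "\<exists>\<epsilon>>0. {f \<in> gevrey_eta s \<eta>. gevrey_norm s \<eta> f < \<epsilon>} \<subseteq> U"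
    proof (intro exI[of _ "sqrt (r / C)"] conjI subsetI)
      show "0 < sqrt (r / C)" using r C by simp
      fix g :: "'n cfun" assume "g \<in> {f \<in> gevrey_eta s \<eta>. gevrey_norm s \<eta> f < sqrt (r / C)}"
      then have g: "g \<in> gevrey_eta s \<eta>" "gevrey_norm s \<eta> g < sqrt (r / C)" by auto
      have "0 \<le> gevrey_norm s \<eta> g"
        unfolding gevrey_norm_def
        by (intro real_sqrt_ge_zero Bochner_Integration.integral_nonneg) simp
      then have "(gevrey_norm s \<eta> g)\<^sup>2 < (sqrt (r / C))\<^sup>2" using g(2) by (intro power_strict_mono) auto
      then have "C * (gevrey_norm s \<eta> g)\<^sup>2 < r" using r C by (simp add: field_simps)
      with C(2)[OF g(1)] show "g \<in> U" using g(1) \<eta> by (auto simp: U_def gevrey_def)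
    qed
  qed
  moreover have "(\<lambda>x. f x + g x) \<in> {f \<in> gevrey s. sq_norm (freq k (fourier (\<lambda>x. f x - l x))) < \<epsilon>}" if "g \<in> U" for g
  proof -
    have g: "g \<in> gevrey s" "q g < r" using that by (auto simp: U_def)
    have fl: "(\<lambda>x. f x - l x) \<in> gevrey s" by (rule gevrey_diff[OF f l])
    have "q (\<lambda>x. 1 * (f x - l x) + 1 * g x) \<le> (1 + d) * q (\<lambda>x. f x - l x) + (1 + 1 / d) * q g"
      using sq_norm_add_le[OF gevrey_freq[OF s fl] gevrey_freq[OF s g(1)] d, of k k]
      unfolding q_def freq_fourier_lincomb[OF gevrey_L2[OF fl] gevrey_L2[OF g(1)] gevrey_freq[OF s fl] gevrey_freq[OF s g(1)]]
      by simp
    also have "\<dots> < (\<epsilon> + q (\<lambda>x. f x - l x)) / 2 + (1 + 1 / d) * r"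
      using d1 g(2) d by (intro add_strict_mono mult_strict_left_mono) (auto simp: add_pos_pos)
    also have "\<dots> = \<epsilon>" unfolding r1 by (simp add: field_simps)
    finally have "q (\<lambda>x. (f x + g x) - l x) < \<epsilon>" by (simp add: algebra_simps)
    then show ?thesis using gevrey_add[OF f g(1)] by (simp add: q_def)
  qed
  ultimately show "\<exists>U. gevrey_nhd_0 s U \<and> (\<forall>g\<in>U. (\<lambda>x. f x + g x) \<in> {f \<in> gevrey s. sq_norm (freq k (fourier (\<lambda>x. f x - l x))) < \<epsilon>})"
    by blast
qed auto

lemma fourier_diff_freq:
  assumes "f \<in> L2" "g \<in> L2" "freq k (fourier f) \<in> L2" "freq k (fourier g) \<in> L2"
  shows "sq_norm (freq k (fourier (\<lambda>x. f x - g x))) = sq_norm (\<lambda>\<xi>. freq k (fourier f) \<xi> - freq k (fourier g) \<xi>)"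
  using freq_fourier_lincomb[OF assms, of 1 "-1"] by simp

text \<open>
  All that uniqueness uses about the topology: a limit in the Gevrey class is a limit in every
  homogeneous Sobolev norm.
\<close>

lemma limitin_gevrey_sobolev:
  assumes s: "s > 0" and lim: "limitin (gevrey_topology s) f l F"
  shows "((\<lambda>a. sq_norm (\<lambda>\<xi>. freq k (fourier (f a)) \<xi> - freq k (fourier l) \<xi>)) \<longlongrightarrow> 0) F"
    and "l \<in> gevrey s" and "\<forall>\<^sub>F a in F. f a \<in> gevrey s"
proof -
  show l: "l \<in> gevrey s" using lim by (simp add: limitin_def topspace_gevrey)
  have *: "\<forall>\<^sub>F a in F. f a \<in> gevrey s \<and> sq_norm (freq k (fourier (\<lambda>x. f a x - l x))) < \<epsilon>" if "\<epsilon> > 0" for \<epsilon>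
  proof -
    have L: "freq k (fourier l) \<in> L2" by (rule gevrey_freq[OF s l])
    have "sq_norm (freq k (fourier (\<lambda>x. l x - l x))) = 0"
      using fourier_diff_freq[OF gevrey_L2[OF l] gevrey_L2[OF l] L L] by (simp add: sq_norm_def)
    then have "l \<in> {f \<in> gevrey s. sq_norm (freq k (fourier (\<lambda>x. f x - l x))) < \<epsilon>}"
      using that l by simp
    with lim openin_gevrey_sobolev_ball[OF s l, of k \<epsilon>] show ?thesis
      unfolding limitin_def by (auto dest!: spec elim!: eventually_mono)
  qed
  show "\<forall>\<^sub>F a in F. f a \<in> gevrey s" using *[of 1] by (auto elim: eventually_mono)
  show "((\<lambda>a. sq_norm (\<lambda>\<xi>. freq k (fourier (f a)) \<xi> - freq k (fourier l) \<xi>)) \<longlongrightarrow> 0) F"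
  proof (rule tendstoI)
    fix e :: real assume "e > 0"
    from *[OF this] show "\<forall>\<^sub>F a in F. dist (sq_norm (\<lambda>\<xi>. freq k (fourier (f a)) \<xi> - freq k (fourier l) \<xi>)) 0 < e"
    proof eventually_elim
      case (elim a)
      then have a: "f a \<in> gevrey s" by simp
      show ?case
        using elim fourier_diff_freq[OF gevrey_L2[OF a] gevrey_L2[OF l] gevrey_freq[OF s a] gevrey_freq[OF s l], of k] by simp
    qed
  qed
qed

text \<open>
  All that existence uses about the topology: convergence in the norm of a single step implies
  convergence in the inductive limit.
\<close>

lemma limitin_gevrey_eta:
  fixes f :: "'b \<Rightarrow> ('n::finite) cfun"
  assumes \<eta>: "\<eta> > 0" and l: "l \<in> gevrey s" and f: "\<forall>\<^sub>F a in F. (\<lambda>x. f a x - l x) \<in> gevrey_eta s \<eta>"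
    and lim: "((\<lambda>a. (gevrey_norm s \<eta> (\<lambda>x. f a x - l x))\<^sup>2) \<longlongrightarrow> 0) F"
  shows "limitin (gevrey_topology s) f l F"
  unfolding limitin_def
proof (intro conjI allI impI)
  show "l \<in> topspace (gevrey_topology s)" using l by (simp add: topspace_gevrey)
  fix V assume "openin (gevrey_topology s) V \<and> l \<in> V"
  then obtain U where U: "gevrey_nhd_0 s U" "\<And>g. g \<in> U \<Longrightarrow> (\<lambda>x. l x + g x) \<in> V"
    unfolding openin_gevrey_topology by blast
  obtain \<epsilon> where e: "\<epsilon> > 0" "{f \<in> gevrey_eta s \<eta>. gevrey_norm s \<eta> f < \<epsilon>} \<subseteq> U"
    using U(1) \<eta> unfolding gevrey_nhd_0_def by blast
  have "\<forall>\<^sub>F a in F. (gevrey_norm s \<eta> (\<lambda>x. f a x - l x))\<^sup>2 < \<epsilon>\<^sup>2"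
    using lim e(1) by (intro order_tendstoD(2)[OF lim]) auto
  with f show "\<forall>\<^sub>F a in F. f a \<in> V"
  proof eventually_elim
    case (elim a)
    then have "gevrey_norm s \<eta> (\<lambda>x. f a x - l x) < \<epsilon>" using e(1) by (simp add: power_less_imp_less_base)
    then have "(\<lambda>x. f a x - l x) \<in> U" using elim e(2) by blast
    from U(2)[OF this] show ?case by simp
  qed
qed

section \<open>Continuity with respect to a real parameter\<close>

lemma atin_top_of_set:
  fixes t :: real assumes "t \<in> S" shows "atin (top_of_set S) t = at t within S"
proof -
  have "eventually P (atin (top_of_set S) t) \<longleftrightarrow> eventually P (at t within S)" for P
    unfolding atin_subtopology_within[OF assms] eventually_atin_within eventually_at_topological by auto
  then show ?thesis by (intro filter_eq_iff[THEN iffD2]) blast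
qed

lemma continuous_map_real_set:
  fixes S :: "real set"
  shows "continuous_map (top_of_set S) Y f \<longleftrightarrow> (\<forall>t\<in>S. limitin Y f (f t) (at t within S))"
  by (simp add: continuous_map_atin atin_top_of_set)

section \<open>Gradient, Laplacian and energy in Fourier variables\<close>

lemma freq_le_L2:
  assumes "freq k h \<in> L2" "g \<in> borel_measurable borel" "\<And>\<xi>. cmod (g \<xi>) \<le> norm \<xi> ^ k * cmod (h \<xi>)"
  shows "g \<in> L2"
proof (rule L2_bound[OF L2_integrable[OF assms(1)] assms(2)])
  show "AE \<xi> in lborel. (cmod (g \<xi>))\<^sup>2 \<le> (cmod (freq k h \<xi>))\<^sup>2"
    using assms(3) by (intro AE_I2 power_mono) (auto simp: freq_def norm_mult norm_power)
qed

lemma norm_sq_components: "(norm (x :: real^'n::finite))\<^sup>2 = (\<Sum>i\<in>UNIV. (x $ i)\<^sup>2)"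
  by (simp add: norm_vec_def L2_set_def sum_nonneg)

lemma gradient_component:
  fixes f :: "'n::finite cfun"
  assumes f: "f \<in> L2" and f1: "freq 1 (fourier f) \<in> L2"
  shows "weak_partial i f \<in> L2"
    "AE \<xi> in lborel. fourier (weak_partial i f) \<xi> = \<i> * complex_of_real (\<xi> $ i) * fourier f \<xi>"
proof -
  have [measurable]: "fourier f \<in> borel_measurable borel" using f by (intro L2_measurable fourier_L2)
  have m: "(\<lambda>\<xi>. complex_of_real (\<xi> $ i) * fourier f \<xi>) \<in> borel_measurable borel" by measurable
  have "(\<lambda>\<xi>. complex_of_real (\<xi> $ i) * fourier f \<xi>) \<in> L2"
    by (rule freq_le_L2[OF f1 m]) (simp add: norm_mult mult_right_mono component_le_norm_cart)
  from weak_partial_fourier[OF f this] show "weak_partial i f \<in> L2"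
    "AE \<xi> in lborel. fourier (weak_partial i f) \<xi> = \<i> * complex_of_real (\<xi> $ i) * fourier f \<xi>" by auto
qed

text \<open>
  Plancherel's theorem in each coordinate, summed with \<open>\<Sum>\<^sub>i \<xi>\<^sub>i\<^sup>2 = |\<xi>|\<^sup>2\<close>.
\<close>

lemma gradient_integral:
  fixes f :: "'n::finite cfun"
  assumes f: "f \<in> L2" and f1: "freq 1 (fourier f) \<in> L2"
  shows "(\<integral>y. (norm (gradient f y))\<^sup>2 \<partial>lborel) = sq_norm (freq 1 (fourier f))"
proof -
  note g = gradient_component[OF f f1]
  have "(norm (gradient f y))\<^sup>2 = (\<Sum>i\<in>UNIV. (cmod (weak_partial i f y))\<^sup>2)" for y
    by (simp add: norm_vec_def L2_set_def sum_nonneg gradient_def)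
  then have "(\<integral>y. (norm (gradient f y))\<^sup>2 \<partial>lborel) = (\<Sum>i\<in>UNIV. sq_norm (weak_partial i f))"
    unfolding sq_norm_def by (simp add: Bochner_Integration.integral_sum L2_integrable g(1))
  also have "\<dots> = (\<Sum>i\<in>UNIV. \<integral>\<xi>. (\<xi> $ i)\<^sup>2 * (cmod (fourier f \<xi>))\<^sup>2 \<partial>lborel)"
  proof (intro sum.cong refl)
    fix i
    have [measurable]: "fourier f \<in> borel_measurable borel" "fourier (weak_partial i f) \<in> borel_measurable borel"
      using f g(1)[of i] by (auto intro: L2_measurable fourier_L2)
    have "sq_norm (weak_partial i f) = sq_norm (fourier (weak_partial i f))"
      by (rule plancherel[OF g(1), symmetric])
    also have "\<dots> = (\<integral>\<xi>. (\<xi> $ i)\<^sup>2 * (cmod (fourier f \<xi>))\<^sup>2 \<partial>lborel)"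
      unfolding sq_norm_def using g(2)[of i]
      by (intro integral_cong_AE) (auto elim!: eventually_mono simp: norm_mult power_mult_distrib)
    finally show "sq_norm (weak_partial i f) = (\<integral>\<xi>. (\<xi> $ i)\<^sup>2 * (cmod (fourier f \<xi>))\<^sup>2 \<partial>lborel)" .
  qed
  also have "\<dots> = (\<integral>\<xi>. (\<Sum>i\<in>UNIV. (\<xi> $ i)\<^sup>2 * (cmod (fourier f \<xi>))\<^sup>2) \<partial>lborel)"
  proof (rule Bochner_Integration.integral_sum[symmetric])
    fix i
    have [measurable]: "fourier f \<in> borel_measurable borel" using f by (intro L2_measurable fourier_L2)
    show "integrable lborel (\<lambda>\<xi>. (\<xi> $ i)\<^sup>2 * (cmod (fourier f \<xi>))\<^sup>2)"
    proof (rule Bochner_Integration.integrable_bound[OF L2_integrable[OF f1]])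
      have "(\<xi> $ i)\<^sup>2 \<le> (norm \<xi>)\<^sup>2" for \<xi> :: "real^'n"
        using component_le_norm_cart[of \<xi> i] by (metis abs_ge_zero power2_abs power_mono)
      then show "AE \<xi> in lborel. norm ((\<xi> $ i)\<^sup>2 * (cmod (fourier f \<xi>))\<^sup>2) \<le> norm ((cmod (freq 1 (fourier f) \<xi>))\<^sup>2)"
        by (intro AE_I2) (simp add: freq_def norm_mult power_mult_distrib mult_right_mono)
    qed measurable
  qed
  also have "\<dots> = sq_norm (freq 1 (fourier f))"
    unfolding sq_norm_def
    by (simp add: freq_def norm_mult power_mult_distrib norm_sq_components sum_distrib_right)
  finally show ?thesis .
qed

lemma fourier_sum:
  fixes f :: "'i \<Rightarrow> 'n::finite cfun"
  assumes "finite I" "\<And>i. i \<in> I \<Longrightarrow> f i \<in> L2"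
  shows "AE \<xi> in lborel. fourier (\<lambda>x. \<Sum>i\<in>I. f i x) \<xi> = (\<Sum>i\<in>I. fourier (f i) \<xi>)"
  using assms
proof (induction I rule: finite_induct)
  case empty
  have "AE \<xi> in lborel. fourier (\<lambda>x. 0 * (0::complex) + 0 * 0) \<xi> = 0 * fourier (\<lambda>x. 0) (\<xi> :: real^'n) + 0 * fourier (\<lambda>x. 0) \<xi>"
    by (rule fourier_lincomb[OF L2_zero L2_zero])
  then show ?case by simp
next
  case (insert i I)
  have S: "(\<lambda>x. \<Sum>i\<in>I. f i x) \<in> L2" by (rule L2_sum) (use insert in auto)
  have "AE \<xi> in lborel. fourier (\<lambda>x. 1 * f i x + 1 * (\<Sum>i\<in>I. f i x)) \<xi> = 1 * fourier (f i) \<xi> + 1 * fourier (\<lambda>x. \<Sum>i\<in>I. f i x) \<xi>"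
    by (rule fourier_lincomb) (use insert S in auto)
  moreover have "AE \<xi> in lborel. fourier (\<lambda>x. \<Sum>i\<in>I. f i x) \<xi> = (\<Sum>i\<in>I. fourier (f i) \<xi>)"
    using insert by auto
  ultimately show ?case using insert by (auto elim!: eventually_elim2)
qed

lemma laplacian_fourier:
  fixes f :: "'n::finite cfun"
  assumes f: "f \<in> L2" and f1: "freq 1 (fourier f) \<in> L2" and f2: "freq 2 (fourier f) \<in> L2"
  shows "laplacian f \<in> L2" "AE \<xi> in lborel. fourier (laplacian f) \<xi> = - freq 2 (fourier f) \<xi>"
proof -
  note g = gradient_component[OF f f1]
  have [measurable]: "fourier f \<in> borel_measurable borel" using f by (intro L2_measurable fourier_L2)
  have g1: "freq 1 (fourier (weak_partial i f)) \<in> L2" for i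
  proof -
    have m: "(\<lambda>\<xi>. \<i> * complex_of_real (\<xi> $ i) * fourier f \<xi>) \<in> borel_measurable borel" by measurable
    have m1: "freq 1 (\<lambda>\<xi>. \<i> * complex_of_real (\<xi> $ i) * fourier f \<xi>) \<in> borel_measurable borel" using m by (rule freq_measurable)
    have L: "freq 1 (\<lambda>\<xi>. \<i> * complex_of_real (\<xi> $ i) * fourier f \<xi>) \<in> L2"
    proof (rule freq_le_L2[OF f2 m1])
      fix \<xi> :: "real^'n"
      have "norm \<xi> * (\<bar>\<xi> $ i\<bar> * cmod (fourier f \<xi>)) \<le> norm \<xi> * (norm \<xi> * cmod (fourier f \<xi>))"
        by (intro mult_left_mono mult_right_mono component_le_norm_cart) simp_all
      then show "cmod (freq 1 (\<lambda>\<xi>. \<i> * complex_of_real (\<xi> $ i) * fourier f \<xi>) \<xi>) \<le> norm \<xi> ^ 2 * cmod (fourier f \<xi>)"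
        by (simp add: freq_def norm_mult power2_eq_square mult.assoc)
    qed
    have "AE \<xi> in lborel. \<i> * complex_of_real (\<xi> $ i) * fourier f \<xi> = fourier (weak_partial i f) \<xi>"
      using g(2)[of i] by eventually_elim simp
    with L L2_measurable[OF fourier_L2[OF g(1)[of i]]] show ?thesis by (rule freq_L2_AE_cong(1))
  qed
  note gg = gradient_component[OF g(1) g1]
  have lap: "laplacian f = (\<lambda>x. \<Sum>i\<in>UNIV. weak_partial i (weak_partial i f) x)" by (simp add: laplacian_def fun_eq_iff)
  show "laplacian f \<in> L2" unfolding lap by (rule L2_sum) (rule gg(1))
  have all: "AE \<xi> in lborel. \<forall>i\<in>UNIV. fourier (weak_partial i (weak_partial i f)) \<xi> = - complex_of_real ((\<xi> $ i)\<^sup>2) * fourier f \<xi>"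
  proof (rule AE_finite_allI)
    fix i :: 'n
    show "AE \<xi> in lborel. fourier (weak_partial i (weak_partial i f)) \<xi> = - complex_of_real ((\<xi> $ i)\<^sup>2) * fourier f \<xi>"
      using g(2)[of i] gg(2)[of i i] by eventually_elim (simp add: power2_eq_square mult_ac)
  qed simp
  have "AE \<xi> in lborel. fourier (laplacian f) \<xi> = (\<Sum>i\<in>UNIV. fourier (weak_partial i (weak_partial i f)) \<xi>)"
    unfolding lap by (rule fourier_sum) (auto intro: gg(1))
  with all show "AE \<xi> in lborel. fourier (laplacian f) \<xi> = - freq 2 (fourier f) \<xi>"
  proof eventually_elim
    case (elim \<xi>)
    then have "fourier (laplacian f) \<xi> = (\<Sum>i\<in>UNIV. - complex_of_real ((\<xi> $ i)\<^sup>2) * fourier f \<xi>)" by simp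
    also have "\<dots> = - (complex_of_real (\<Sum>i\<in>UNIV. (\<xi> $ i)\<^sup>2) * fourier f \<xi>)"
      by (simp add: sum_distrib_right sum_negf)
    also have "\<dots> = - freq 2 (fourier f) \<xi>" by (simp only: freq_def norm_sq_components)
    finally show ?case .
  qed
qed

lemma energy_fourier:
  fixes f g :: "'n::finite cfun"
  assumes f: "f \<in> L2" and f1: "freq 1 (fourier f) \<in> L2" and g: "g \<in> L2"
  shows "2 * kirchhoff_energy f g = sq_norm (fourier g) + sq_norm (freq 1 (fourier f)) + (sq_norm (freq 1 (fourier f)))\<^sup>2 / 2"
proof -
  have 1: "(gradient_L2_norm f)\<^sup>2 = sq_norm (freq 1 (fourier f))"
    by (simp add: gradient_L2_norm_def gradient_integral[OF f f1])
  have 2: "(L2_norm g)\<^sup>2 = sq_norm (fourier g)"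
    unfolding plancherel[OF g] L2_norm_def sq_norm_def[symmetric] by simp
  have "gradient_L2_norm f ^ 4 = ((gradient_L2_norm f)\<^sup>2)\<^sup>2" by (simp flip: power_mult)
  then show ?thesis unfolding kirchhoff_energy_def 1 2 by simp
qed

lemma frac_laplacian_fourier:
  fixes f :: "'n::finite cfun"
  assumes f: "f \<in> L2" and L: "(\<lambda>\<xi>. complex_of_real (norm \<xi> powr (2 * a)) * fourier f \<xi>) \<in> L2"
  shows "frac_laplacian a f \<in> L2"
    "AE \<xi> in lborel. fourier (frac_laplacian a f) \<xi> = complex_of_real (norm \<xi> powr (2 * a)) * fourier f \<xi>"
proof -
  define P where "P g \<longleftrightarrow> g \<in> L2 \<and> (AE \<xi> in lborel. fourier g \<xi> = complex_of_real (norm \<xi> powr (2 * a)) * fourier f \<xi>)" for g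
  have eq: "frac_laplacian a f = (SOME g. P g)"
    by (simp add: frac_laplacian_def fourier_multiplier_def P_def)
  have "P (inv_fourier (\<lambda>\<xi>. complex_of_real (norm \<xi> powr (2 * a)) * fourier f \<xi>))"
    unfolding P_def by (intro conjI inv_fourier_L2 L fourier_inv_fourier)
  then have "P (frac_laplacian a f)" unfolding eq by (rule someI[of P])
  then show "frac_laplacian a f \<in> L2"
    "AE \<xi> in lborel. fourier (frac_laplacian a f) \<xi> = complex_of_real (norm \<xi> powr (2 * a)) * fourier f \<xi>"
    by (auto simp: P_def)
qed

section \<open>Derivatives in \<open>L2\<close>\<close>

text \<open>
  A time derivative in \<open>L2\<close>. Unlike \<open>has_L2_derivative\<close> it is stated with the real-valued
  \<open>sq_norm\<close> and is applied to transforms.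
\<close>

definition L2_deriv :: "(real \<Rightarrow> ('n::finite) cfun) \<Rightarrow> 'n cfun \<Rightarrow> real \<Rightarrow> real set \<Rightarrow> bool" where
  "L2_deriv U W t S \<longleftrightarrow> ((\<lambda>\<tau>. sq_norm (\<lambda>\<xi>. diff_quot U t \<tau> \<xi> - W \<xi>)) \<longlongrightarrow> 0) (at t within S)"

lemma diff_quot_lincomb: "diff_quot U t \<tau> = (\<lambda>x. inverse (complex_of_real (\<tau> - t)) * U \<tau> x + (- inverse (complex_of_real (\<tau> - t))) * U t x)"
  by (auto simp: diff_quot_def fun_eq_iff divide_inverse algebra_simps)

lemma diff_quot_L2: "U \<tau> \<in> L2 \<Longrightarrow> U t \<in> L2 \<Longrightarrow> diff_quot U t \<tau> \<in> L2"
  unfolding diff_quot_lincomb by (rule L2_lincomb)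

lemma fourier_diff_quot:
  assumes "u \<tau> \<in> L2" "u t \<in> L2"
  shows "AE \<xi> in lborel. fourier (diff_quot u t \<tau>) \<xi> = diff_quot (\<lambda>t. fourier (u t)) t \<tau> \<xi>"
  unfolding diff_quot_lincomb by (rule fourier_lincomb[OF assms])

lemma eventually_at_within_in: "\<forall>\<^sub>F \<tau> in at t within S. \<tau> \<in> S \<and> \<tau> \<noteq> t"
  by (auto simp: eventually_at_filter)

lemma sq_norm_diff_AE_cong:
  assumes "f \<in> L2" "g \<in> L2" "h \<in> L2" "k \<in> L2" "AE x in lborel. f x = g x" "AE x in lborel. h x = k x"
  shows "sq_norm (\<lambda>x. f x - h x) = sq_norm (\<lambda>x. g x - k x)"
proof (rule sq_norm_AE_cong)
  show "(\<lambda>x. f x - h x) \<in> L2" by (rule L2_diff[OF assms(1,3)])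
  show "(\<lambda>x. g x - k x) \<in> borel_measurable borel" by (rule L2_measurable[OF L2_diff[OF assms(2,4)]])
  show "AE x in lborel. f x - h x = g x - k x" using assms(5,6) by eventually_elim simp
qed

lemma plancherel_diff:
  assumes "f \<in> L2" "g \<in> L2"
  shows "sq_norm (\<lambda>x. f x - g x) = sq_norm (\<lambda>\<xi>. fourier f \<xi> - fourier g \<xi>)"
proof -
  have "sq_norm (\<lambda>x. f x - g x) = sq_norm (fourier (\<lambda>x. f x - g x))"
    by (rule plancherel[OF L2_diff[OF assms], symmetric])
  also have "\<dots> = sq_norm (\<lambda>\<xi>. fourier f \<xi> - fourier g \<xi>)"
    using fourier_diff_freq[of f g 0] assms fourier_L2[OF assms(1)] fourier_L2[OF assms(2)] by simp
  finally show ?thesis .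
qed

lemma has_L2_derivative_fourier:
  assumes u: "\<And>\<tau>. \<tau> \<in> S \<Longrightarrow> u \<tau> \<in> L2" and t: "t \<in> S" and w: "w \<in> L2"
  shows "has_L2_derivative u w t S \<longleftrightarrow> L2_deriv (\<lambda>t. fourier (u t)) (fourier w) t S"
proof -
  have D: "diff_quot u t \<tau> \<in> L2" if "\<tau> \<in> S" for \<tau> by (rule diff_quot_L2[OF u[OF that] u[OF t]])
  have DF: "diff_quot (\<lambda>t. fourier (u t)) t \<tau> \<in> L2" if "\<tau> \<in> S" for \<tau>
    by (rule diff_quot_L2[OF fourier_L2[OF u[OF that]] fourier_L2[OF u[OF t]]])
  have eq: "(\<integral>\<^sup>+x. ennreal ((cmod (diff_quot u t \<tau> x - w x))\<^sup>2) \<partial>lborel)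
      = ennreal (sq_norm (\<lambda>\<xi>. diff_quot (\<lambda>t. fourier (u t)) t \<tau> \<xi> - fourier w \<xi>))" if "\<tau> \<in> S" for \<tau>
    unfolding nn_sq_norm[OF L2_diff[OF D[OF that] w]] plancherel_diff[OF D[OF that] w]
    by (intro arg_cong[where f=ennreal] sq_norm_diff_AE_cong fourier_diff_quot fourier_L2 D DF that w u t) simp
  have "has_L2_derivative u w t S \<longleftrightarrow>
    ((\<lambda>\<tau>. ennreal (sq_norm (\<lambda>\<xi>. diff_quot (\<lambda>t. fourier (u t)) t \<tau> \<xi> - fourier w \<xi>))) \<longlongrightarrow> ennreal 0) (at t within S)"
    unfolding has_L2_derivative_def L2_tendsto_def using w eq
    by (simp, intro tendsto_cong) (auto simp: eventually_at_filter)
  also have "\<dots> \<longleftrightarrow> L2_deriv (\<lambda>t. fourier (u t)) (fourier w) t S"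
    unfolding L2_deriv_def by (rule tendsto_ennreal_iff) auto
  finally show ?thesis .
qed

text \<open>
  With the difference quotient \<open>D\<close> at \<open>\<tau>\<close>,
  \<open>\<parallel>U(\<tau>)\<parallel>\<^sup>2 - \<parallel>U(t)\<parallel>\<^sup>2 = (\<tau> - t) (2 Re \<langle>D, U(t)\<rangle> + (\<tau> - t) \<parallel>D\<parallel>\<^sup>2)\<close>, and \<open>D\<close> converges in \<open>L2\<close>.
\<close>

lemma L2_deriv_sq_norm:
  assumes U: "\<And>\<tau>. \<tau> \<in> S \<Longrightarrow> U \<tau> \<in> L2" and t: "t \<in> S" and W: "W \<in> L2" and d: "L2_deriv U W t S"
  shows "((\<lambda>\<tau>. sq_norm (U \<tau>)) has_real_derivative 2 * Re (\<integral>\<xi>. W \<xi> * cnj (U t \<xi>) \<partial>lborel)) (at t within S)"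
proof -
  \<comment> \<open>Outside \<open>S\<close> the difference quotient need not be in \<open>L2\<close>.\<close>
  define D where "D \<tau> = (if \<tau> \<in> S then diff_quot U t \<tau> else W)" for \<tau>
  have D: "D \<tau> \<in> L2" for \<tau> using U t W by (auto simp: D_def intro: diff_quot_L2)
  have "((\<lambda>\<tau>. sq_norm (\<lambda>\<xi>. D \<tau> \<xi> - W \<xi>)) \<longlongrightarrow> 0) (at t within S)"
    by (rule Lim_transform_eventually[OF d[unfolded L2_deriv_def]]) (auto simp: eventually_at_filter D_def)
  then have lim: "L2_tendsto D W (at t within S)" by (subst L2_tendsto_iff) (simp_all add: D W)
  have c: "(\<lambda>\<xi>. cnj (U t \<xi>)) \<in> L2" by (rule L2_cnj[OF U[OF t]])
  have l1: "((\<lambda>\<tau>. \<integral>\<xi>. D \<tau> \<xi> * cnj (U t \<xi>) \<partial>lborel) \<longlongrightarrow> (\<integral>\<xi>. W \<xi> * cnj (U t \<xi>) \<partial>lborel)) (at t within S)"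
    using lim by (rule L2_tendsto_inner) (simp_all add: D W c)
  have l2: "((\<lambda>\<tau>. sq_norm (D \<tau>)) \<longlongrightarrow> sq_norm W) (at t within S)"
    using lim by (rule L2_tendsto_sq_norm) (simp_all add: D W)
  have "((\<lambda>\<tau>. (\<tau> - t) * sq_norm (D \<tau>) + 2 * Re (\<integral>\<xi>. D \<tau> \<xi> * cnj (U t \<xi>) \<partial>lborel)) \<longlongrightarrow>
      (t - t) * sq_norm W + 2 * Re (\<integral>\<xi>. W \<xi> * cnj (U t \<xi>) \<partial>lborel)) (at t within S)"
    by (intro tendsto_intros l1 l2)
  moreover have "\<forall>\<^sub>F \<tau> in at t within S. (\<tau> - t) * sq_norm (D \<tau>) + 2 * Re (\<integral>\<xi>. D \<tau> \<xi> * cnj (U t \<xi>) \<partial>lborel)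
      = (sq_norm (U \<tau>) - sq_norm (U t)) / (\<tau> - t)"
    using eventually_at_within_in
  proof eventually_elim
    case (elim \<tau>)
    have DU: "(\<lambda>\<xi>. complex_of_real (\<tau> - t) * D \<tau> \<xi> + U t \<xi>) = U \<tau>"
      using elim by (auto simp: D_def diff_quot_def fun_eq_iff simp flip: of_real_diff)
    have "sq_norm (U \<tau>) = (cmod (complex_of_real (\<tau> - t)))\<^sup>2 * sq_norm (D \<tau>) + sq_norm (U t)
       + 2 * Re (\<integral>\<xi>. complex_of_real (\<tau> - t) * D \<tau> \<xi> * cnj (U t \<xi>) \<partial>lborel)"
      using sq_norm_add[OF L2_cmult[OF D] U[OF t], of "complex_of_real (\<tau> - t)" \<tau>] unfolding DU sq_norm_cmult .
    also have "(\<integral>\<xi>. complex_of_real (\<tau> - t) * D \<tau> \<xi> * cnj (U t \<xi>) \<partial>lborel)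
       = complex_of_real (\<tau> - t) * (\<integral>\<xi>. D \<tau> \<xi> * cnj (U t \<xi>) \<partial>lborel)"
      unfolding mult.assoc by (rule integral_mult_right_zero)
    also have "(cmod (complex_of_real (\<tau> - t)))\<^sup>2 = (\<tau> - t) * (\<tau> - t)"
      by (simp only: norm_of_real power2_abs power2_eq_square)
    finally have "sq_norm (U \<tau>) - sq_norm (U t) = (\<tau> - t) * ((\<tau> - t) * sq_norm (D \<tau>) + 2 * Re (\<integral>\<xi>. D \<tau> \<xi> * cnj (U t \<xi>) \<partial>lborel))"
      by (simp add: algebra_simps)
    then show ?case using elim by simp
  qed
  ultimately have "((\<lambda>\<tau>. (sq_norm (U \<tau>) - sq_norm (U t)) / (\<tau> - t)) \<longlongrightarrow>
      (t - t) * sq_norm W + 2 * Re (\<integral>\<xi>. W \<xi> * cnj (U t \<xi>) \<partial>lborel)) (at t within S)"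
    by (rule Lim_transform_eventually)
  then show ?thesis unfolding has_field_derivative_iff by simp
qed

lemma L2_deriv_diff:
  assumes "\<And>\<tau>. \<tau> \<in> S \<Longrightarrow> U \<tau> \<in> L2" "\<And>\<tau>. \<tau> \<in> S \<Longrightarrow> V \<tau> \<in> L2" "t \<in> S" "W \<in> L2" "X \<in> L2" "L2_deriv U W t S" "L2_deriv V X t S"
  shows "L2_deriv (\<lambda>t \<xi>. U t \<xi> - V t \<xi>) (\<lambda>\<xi>. W \<xi> - X \<xi>) t S"
  unfolding L2_deriv_def
proof (rule Lim_null_comparison)
  show "\<forall>\<^sub>F \<tau> in at t within S. norm (sq_norm (\<lambda>\<xi>. diff_quot (\<lambda>t \<xi>. U t \<xi> - V t \<xi>) t \<tau> \<xi> - (W \<xi> - X \<xi>)))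
    \<le> 2 * sq_norm (\<lambda>\<xi>. diff_quot U t \<tau> \<xi> - W \<xi>) + 2 * sq_norm (\<lambda>\<xi>. diff_quot V t \<tau> \<xi> - X \<xi>)"
    using eventually_at_within_in
  proof eventually_elim
    case (elim \<tau>)
    have 1: "(\<lambda>\<xi>. diff_quot U t \<tau> \<xi> - W \<xi>) \<in> L2" "(\<lambda>\<xi>. diff_quot V t \<tau> \<xi> - X \<xi>) \<in> L2"
      using elim assms by (auto intro!: L2_diff diff_quot_L2)
    have "(\<lambda>\<xi>. diff_quot (\<lambda>t \<xi>. U t \<xi> - V t \<xi>) t \<tau> \<xi> - (W \<xi> - X \<xi>)) = (\<lambda>\<xi>. (diff_quot U t \<tau> \<xi> - W \<xi>) - (diff_quot V t \<tau> \<xi> - X \<xi>))"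
      by (auto simp: diff_quot_def fun_eq_iff diff_divide_distrib)
    then show ?case using sq_norm_diff_le[OF 1 L2_zero] by simp
  qed
  show "((\<lambda>\<tau>. 2 * sq_norm (\<lambda>\<xi>. diff_quot U t \<tau> \<xi> - W \<xi>) + 2 * sq_norm (\<lambda>\<xi>. diff_quot V t \<tau> \<xi> - X \<xi>)) \<longlongrightarrow> 0) (at t within S)"
    using tendsto_add[OF tendsto_mult_right_zero[OF assms(6)[unfolded L2_deriv_def], of 2] tendsto_mult_right_zero[OF assms(7)[unfolded L2_deriv_def], of 2]]
    by simp
qed

text \<open>
  \<open>f(t) e\<^bsup>- K t\<^esup>\<close> is nonincreasing.
\<close>

lemma gronwall:
  fixes f f' :: "real \<Rightarrow> real"
  assumes d: "\<And>t. t \<in> {0..T} \<Longrightarrow> (f has_real_derivative f' t) (at t within {0..T})"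
    and le: "\<And>t. t \<in> {0..T} \<Longrightarrow> f' t \<le> K * f t" and t: "t \<in> {0..T}"
  shows "f t \<le> f 0 * exp (K * t)"
proof -
  define g where "g t = f t * exp (- K * t)" for t
  have dg: "(g has_real_derivative (f' t - K * f t) * exp (- K * t)) (at t within {0..T})" if "t \<in> {0..T}" for t
    unfolding g_def by (rule derivative_eq_intros d[OF that] refl | simp add: algebra_simps)+
  have "g t \<le> g 0"
  proof (rule DERIV_nonpos_imp_decreasing_open[of 0 t g])
    show "0 \<le> t" using t by simp
    fix x assume "0 < x" "x < t"
    then have x: "x \<in> {0..T}" "0 < x" "x < T" using t by auto
    have "(g has_real_derivative (f' x - K * f x) * exp (- K * x)) (at x)"
      using dg[OF x(1)] at_within_Icc_at[OF x(2,3)] by simp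
    moreover have "(f' x - K * f x) * exp (- K * x) \<le> 0" using le[OF x(1)] by (simp add: mult_nonpos_nonneg)
    ultimately show "\<exists>y. (g has_real_derivative y) (at x) \<and> y \<le> 0" by blast
  next
    have "continuous_on {0..T} g" by (rule DERIV_continuous_on[OF dg])
    then show "continuous_on {0..t} g" by (rule continuous_on_subset) (use t in simp)
  qed
  then have "f t * exp (- K * t) * exp (K * t) \<le> f 0 * exp (K * t)"
    by (intro mult_right_mono) (auto simp: g_def)
  then show ?thesis by (simp add: mult.assoc flip: exp_add)
qed

lemma freq_diff_quot: "freq k (diff_quot U t \<tau>) = diff_quot (\<lambda>t. freq k (U t)) t \<tau>"
  by (simp add: freq_def diff_quot_def fun_eq_iff right_diff_distrib)

lemma L2_sq_norm_continuous:
  assumes U: "\<And>\<tau>. \<tau> \<in> S \<Longrightarrow> U \<tau> \<in> L2" and t: "t \<in> S"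
    and lim: "((\<lambda>\<tau>. sq_norm (\<lambda>\<xi>. U \<tau> \<xi> - U t \<xi>)) \<longlongrightarrow> 0) (at t within S)"
  shows "((\<lambda>\<tau>. sq_norm (U \<tau>)) \<longlongrightarrow> sq_norm (U t)) (at t within S)"
proof -
  define D where "D \<tau> = (if \<tau> \<in> S then U \<tau> else U t)" for \<tau>
  have D: "D \<tau> \<in> L2" for \<tau> using U t by (auto simp: D_def)
  have "((\<lambda>\<tau>. sq_norm (\<lambda>\<xi>. D \<tau> \<xi> - U t \<xi>)) \<longlongrightarrow> 0) (at t within S)"
    by (rule Lim_transform_eventually[OF lim]) (auto simp: eventually_at_filter D_def)
  then have "L2_tendsto D (U t) (at t within S)" by (subst L2_tendsto_iff) (simp_all add: D U t)
  then have "((\<lambda>\<tau>. sq_norm (D \<tau>)) \<longlongrightarrow> sq_norm (U t)) (at t within S)"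
    by (rule L2_tendsto_sq_norm) (simp_all add: D U t)
  then show ?thesis
    by (rule Lim_transform_eventually) (auto simp: eventually_at_filter D_def)
qed

lemma C1_gevrey_freq:
  assumes s: "s > 0" and c: "C1_gevrey s T u u'" and t: "t \<in> {0..T}"
  shows "u t \<in> gevrey s" "u' t \<in> gevrey s"
    and "L2_deriv (\<lambda>t. freq k (fourier (u t))) (freq k (fourier (u' t))) t {0..T}"
proof -
  have g: "u t \<in> gevrey s" if "t \<in> {0..T}" for t
    using c that unfolding C1_gevrey_def continuous_map_real_set limitin_def topspace_gevrey by blast
  show "u t \<in> gevrey s" by (rule g[OF t])
  show g': "u' t \<in> gevrey s"
    using c t unfolding C1_gevrey_def continuous_map_real_set limitin_def topspace_gevrey by blast
  have "limitin (gevrey_topology s) (diff_quot u t) (u' t) (at t within {0..T})"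
    using c t by (simp add: C1_gevrey_def)
  note lim = limitin_gevrey_sobolev(1)[OF s this, of k]
  show "L2_deriv (\<lambda>t. freq k (fourier (u t))) (freq k (fourier (u' t))) t {0..T}"
    unfolding L2_deriv_def
  proof (rule Lim_transform_eventually[OF lim])
    show "\<forall>\<^sub>F \<tau> in at t within {0..T}. sq_norm (\<lambda>\<xi>. freq k (fourier (diff_quot u t \<tau>)) \<xi> - freq k (fourier (u' t)) \<xi>)
       = sq_norm (\<lambda>\<xi>. diff_quot (\<lambda>t. freq k (fourier (u t))) t \<tau> \<xi> - freq k (fourier (u' t)) \<xi>)"
      using eventually_at_within_in
    proof eventually_elim
      case (elim \<tau>)
      have L: "u \<tau> \<in> L2" "u t \<in> L2" using elim t by (auto intro!: gevrey_L2[OF g])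
      have D: "diff_quot u t \<tau> \<in> gevrey s" unfolding diff_quot_lincomb using elim t by (intro gevrey_lincomb g) auto
      have DL: "diff_quot (\<lambda>t. freq k (fourier (u t))) t \<tau> \<in> L2"
        using elim t by (intro diff_quot_L2 gevrey_freq[OF s] g) auto
      have "AE \<xi> in lborel. freq k (fourier (diff_quot u t \<tau>)) \<xi> = diff_quot (\<lambda>t. freq k (fourier (u t))) t \<tau> \<xi>"
        using fourier_diff_quot[OF L] unfolding freq_diff_quot[symmetric] by eventually_elim (simp add: freq_def)
      then show ?case
        by (intro sq_norm_diff_AE_cong gevrey_freq[OF s] D DL g') simp_all
    qed
  qed
qed

lemma continuous_gevrey_freq:
  fixes T :: real
  assumes s: "s > 0" and c: "continuous_map (top_of_set {0..T}) (gevrey_topology s) u"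
  shows "continuous_on {0..T} (\<lambda>t. sq_norm (freq k (fourier (u t))))"
  unfolding continuous_on_def
proof
  fix t :: real assume t: "t \<in> {0..T}"
  have lim: "limitin (gevrey_topology s) u (u t) (at t within {0..T})" if "t \<in> {0..T}" for t
    using c that unfolding continuous_map_real_set by blast
  then have g: "u t \<in> gevrey s" if "t \<in> {0..T}" for t
    using that unfolding limitin_def topspace_gevrey by blast
  show "((\<lambda>t. sq_norm (freq k (fourier (u t)))) \<longlongrightarrow> sq_norm (freq k (fourier (u t)))) (at t within {0..T})"
    by (rule L2_sq_norm_continuous[where U = "\<lambda>t. freq k (fourier (u t))"])
      (use g t limitin_gevrey_sobolev(1)[OF s lim[OF t]] in \<open>auto intro: gevrey_freq[OF s]\<close>)
qed

section \<open>Uniqueness\<close>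

text \<open>
  The properties of the transform of a solution from which uniqueness follows: the equation, with
  derivatives in \<open>L2\<close>, and bounds that are uniform in time. The first component is differentiated
  after multiplication by \<open>|\<xi>|\<close>, since only the gradient enters the energy.
\<close>

definition kirchhoff_fourier :: "real \<Rightarrow> (real \<Rightarrow> ('n::finite) cfun) \<Rightarrow> (real \<Rightarrow> 'n cfun) \<Rightarrow> bool" where
  "kirchhoff_fourier T U U' \<longleftrightarrow>
     (\<forall>t\<in>{0..T}. U' t \<in> L2 \<and> (\<forall>k. freq k (U t) \<in> L2) \<and> (\<forall>k. freq k (U' t) \<in> L2) \<and>
        L2_deriv (\<lambda>t. freq 1 (U t)) (freq 1 (U' t)) t {0..T} \<and>
        L2_deriv U' (\<lambda>\<xi>. - complex_of_real (1 + sq_norm (freq 1 (U t))) * freq 2 (U t) \<xi>) t {0..T}) \<and>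
     (\<exists>B. \<forall>t\<in>{0..T}. sq_norm (freq 1 (U t)) \<le> B \<and> sq_norm (freq 2 (U t)) \<le> B \<and> sq_norm (freq 1 (U' t)) \<le> B)"

lemma L2_deriv_AE_cong:
  assumes U: "\<And>\<tau>. \<tau> \<in> S \<Longrightarrow> U \<tau> \<in> L2" and t: "t \<in> S" and W: "W \<in> L2" "X \<in> L2" "AE \<xi> in lborel. W \<xi> = X \<xi>"
    and d: "L2_deriv U W t S"
  shows "L2_deriv U X t S"
  unfolding L2_deriv_def
proof (rule Lim_transform_eventually[OF d[unfolded L2_deriv_def]])
  show "\<forall>\<^sub>F \<tau> in at t within S. sq_norm (\<lambda>\<xi>. diff_quot U t \<tau> \<xi> - W \<xi>) = sq_norm (\<lambda>\<xi>. diff_quot U t \<tau> \<xi> - X \<xi>)"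
    using eventually_at_within_in
  proof eventually_elim
    case (elim \<tau>)
    have D: "diff_quot U t \<tau> \<in> L2" by (rule diff_quot_L2) (use elim U t in auto)
    show ?case by (rule sq_norm_diff_AE_cong[OF D D W(1,2) _ W(3)]) simp
  qed
qed

lemma kirchhoff_rhs_fourier:
  fixes f :: "'n::finite cfun"
  assumes f: "f \<in> L2" and f1: "freq 1 (fourier f) \<in> L2" and f2: "freq 2 (fourier f) \<in> L2"
  defines "w \<equiv> (\<lambda>x. complex_of_real (1 + (\<integral>y. (norm (gradient f y))\<^sup>2 \<partial>lborel)) * laplacian f x)"
  shows "w \<in> L2" "AE \<xi> in lborel. fourier w \<xi> = - complex_of_real (1 + sq_norm (freq 1 (fourier f))) * freq 2 (fourier f) \<xi>"
proof -
  note lap = laplacian_fourier[OF f f1 f2]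
  let ?a = "complex_of_real (1 + sq_norm (freq 1 (fourier f)))"
  have w: "w = (\<lambda>x. ?a * laplacian f x + 0 * laplacian f x)"
    by (simp add: w_def gradient_integral[OF f f1])
  show "w \<in> L2" unfolding w by (rule L2_lincomb[OF lap(1) lap(1)])
  show "AE \<xi> in lborel. fourier w \<xi> = - ?a * freq 2 (fourier f) \<xi>"
    unfolding w using fourier_lincomb[OF lap(1) lap(1), of ?a 0] lap(2)
    by eventually_elim (simp only: mult_zero_left add_0_right mult_minus_left mult_minus_right minus_zero)
qed

text \<open>
  The uniform bounds hold because Sobolev norms are continuous along the solution and the time
  interval is compact.
\<close>

lemma kirchhoff_solution_fourier:
  fixes u :: "real \<Rightarrow> 'n::finite cfun"
  assumes s: "s > 0" and sol: "kirchhoff_solution s T u0 u1 u"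
  shows "\<exists>u'. kirchhoff_fourier T (\<lambda>t. fourier (u t)) (\<lambda>t. fourier (u' t)) \<and>
    (\<forall>t\<in>{0..T}. u t \<in> L2 \<and> u' t \<in> L2) \<and>
    (AE x in lborel. u 0 x = u0 x) \<and> (AE x in lborel. u' 0 x = u1 x)"
proof -
  obtain u' where c: "C1_gevrey s T u u'" and d: "\<And>t. t \<in> {0..T} \<Longrightarrow> has_L2_derivative u'
        (\<lambda>x. of_real (1 + (\<integral>y. (norm (gradient (u t) y))\<^sup>2 \<partial>lborel)) * laplacian (u t) x) t {0..T}"
     and i: "AE x in lborel. u 0 x = u0 x" "AE x in lborel. u' 0 x = u1 x"
    using sol unfolding kirchhoff_solution_def by blast
  note C = C1_gevrey_freq[OF s c]
  have L: "u t \<in> L2" "u' t \<in> L2" if "t \<in> {0..T}" for t using C(1,2)[OF that] by (auto intro: gevrey_L2)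
  have F: "freq k (fourier (u t)) \<in> L2" "freq k (fourier (u' t)) \<in> L2" if "t \<in> {0..T}" for t k
    using C(1,2)[OF that] by (auto intro: gevrey_freq[OF s])
  have cm: "continuous_map (top_of_set {0..T}) (gevrey_topology s) u" "continuous_map (top_of_set {0..T}) (gevrey_topology s) u'"
    using c by (simp_all add: C1_gevrey_def)
  have bd: "\<exists>B. \<forall>t\<in>{0..T}. f t \<le> B" if cf: "continuous_on {0..T} f" for f :: "real \<Rightarrow> real"
  proof -
    obtain B where B: "\<And>x. x \<in> f ` {0..T} \<Longrightarrow> norm x \<le> B"
      using compact_imp_bounded[OF compact_continuous_image[OF cf compact_Icc]] unfolding bounded_iff by blast
    have "f t \<le> B" if "t \<in> {0..T}" for t
      using B[OF imageI[OF that]] by (simp add: abs_le_iff)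
    then show ?thesis by blast
  qed
  obtain B1 B2 B3 where B: "\<forall>t\<in>{0..T}. sq_norm (freq 1 (fourier (u t))) \<le> B1"
      "\<forall>t\<in>{0..T}. sq_norm (freq 2 (fourier (u t))) \<le> B2" "\<forall>t\<in>{0..T}. sq_norm (freq 1 (fourier (u' t))) \<le> B3"
    using bd[OF continuous_gevrey_freq[OF s cm(1)]] bd[OF continuous_gevrey_freq[OF s cm(2)]] by metis
  have "kirchhoff_fourier T (\<lambda>t. fourier (u t)) (\<lambda>t. fourier (u' t))"
    unfolding kirchhoff_fourier_def
  proof (intro conjI ballI allI)
    fix t assume t: "t \<in> {0..T}"
    show "fourier (u' t) \<in> L2" by (rule fourier_L2[OF L(2)[OF t]])
    show "freq k (fourier (u t)) \<in> L2" "freq k (fourier (u' t)) \<in> L2" for k using F[OF t] by auto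
    show "L2_deriv (\<lambda>t. freq 1 (fourier (u t))) (freq 1 (fourier (u' t))) t {0..T}" by (rule C(3)[OF t])
    note w = kirchhoff_rhs_fourier[OF L(1)[OF t] F(1)[OF t] F(1)[OF t]]
    have "L2_deriv (\<lambda>t. fourier (u' t)) (fourier (\<lambda>x. of_real (1 + (\<integral>y. (norm (gradient (u t) y))\<^sup>2 \<partial>lborel)) * laplacian (u t) x)) t {0..T}"
      using d[OF t] has_L2_derivative_fourier[of "{0..T}" u' t, OF L(2) t w(1)] by simp
    then show "L2_deriv (\<lambda>t. fourier (u' t)) (\<lambda>\<xi>. - complex_of_real (1 + sq_norm (freq 1 (fourier (u t)))) * freq 2 (fourier (u t)) \<xi>) t {0..T}"
      by (rule L2_deriv_AE_cong[where U = "\<lambda>t. fourier (u' t)", rotated 5])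
        (use L t w F in \<open>auto intro: fourier_L2 L2_cmult\<close>)
  next
    show "\<exists>B. \<forall>t\<in>{0..T}. sq_norm (freq 1 (fourier (u t))) \<le> B \<and> sq_norm (freq 2 (fourier (u t))) \<le> B \<and> sq_norm (freq 1 (fourier (u' t))) \<le> B"
      by (intro exI[of _ "max B1 (max B2 B3)"]) (use B in \<open>auto simp: le_max_iff_disj\<close>)
  qed
  with L i show ?thesis by blast
qed

lemma abs_sq_norm_diff_le:
  assumes "f \<in> L2" "g \<in> L2"
  shows "\<bar>sq_norm f - sq_norm g\<bar> \<le> sqrt (sq_norm (\<lambda>x. f x - g x)) * (sqrt (sq_norm f) + sqrt (sq_norm g))"
proof -
  define p q r where "p = sqrt (sq_norm f)" and "q = sqrt (sq_norm g)" and "r = sqrt (sq_norm (\<lambda>x. f x - g x))"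
  have n: "p \<ge> 0" "q \<ge> 0" "r \<ge> 0" "sq_norm f = p\<^sup>2" "sq_norm g = q\<^sup>2" by (simp_all add: p_def q_def r_def)
  have tri: "sqrt (sq_norm h) \<le> sqrt (sq_norm k) + sqrt (sq_norm (\<lambda>x. h x - k x))" if L: "h \<in> L2" "k \<in> L2" for h k :: "'a cfun"
  proof -
    have "sq_norm h = sq_norm (\<lambda>x. k x + (h x - k x))" by simp
    also have "\<dots> = sq_norm k + sq_norm (\<lambda>x. h x - k x) + 2 * Re (\<integral>x. k x * cnj (h x - k x) \<partial>lborel)"
      by (rule sq_norm_add[OF L(2) L2_diff[OF L]])
    also have "Re (\<integral>x. k x * cnj (h x - k x) \<partial>lborel) \<le> sqrt (sq_norm k) * sqrt (sq_norm (\<lambda>x. h x - k x))"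
      using Cauchy_Schwarz_L2[OF L(2) L2_cnj[OF L2_diff[OF L]]] complex_Re_le_cmod[of "\<integral>x. k x * cnj (h x - k x) \<partial>lborel"]
        sq_norm_cnj[of "\<lambda>x. h x - k x"] by simp
    finally have "sq_norm h \<le> (sqrt (sq_norm k) + sqrt (sq_norm (\<lambda>x. h x - k x)))\<^sup>2" by (simp add: power2_sum)
    then show ?thesis by (rule real_le_lsqrt[rotated]) (simp add: add_nonneg_nonneg)
  qed
  have r2: "sqrt (sq_norm (\<lambda>x. g x - f x)) = r" by (simp add: r_def sq_norm_def norm_minus_commute)
  have "\<bar>p - q\<bar> \<le> r" using tri[OF assms] tri[OF assms(2,1)] r2 unfolding p_def q_def r_def by linarith
  then have "\<bar>p - q\<bar> * (p + q) \<le> r * (p + q)" using n by (intro mult_right_mono) auto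
  moreover have "\<bar>p\<^sup>2 - q\<^sup>2\<bar> = \<bar>p - q\<bar> * (p + q)"
  proof -
    have "p\<^sup>2 - q\<^sup>2 = (p - q) * (p + q)" by (simp add: power2_eq_square algebra_simps)
    then show ?thesis using n by (simp add: abs_mult)
  qed
  ultimately show ?thesis unfolding n(4,5) by (simp add: p_def q_def r_def)
qed

text \<open>
  Let \<open>w\<close> be the difference of the two solutions, \<open>P = \<parallel>w'\<parallel>\<^sup>2\<close> and \<open>Q = \<parallel>\<nabla>w\<parallel>\<^sup>2\<close>. In the derivative
  of \<open>P + a Q\<close> the terms with two derivatives of \<open>w\<close> cancel. What remains is \<open>a' Q\<close> and the error
  \<open>(a - b) \<langle>\<Delta>v, w'\<rangle>\<close> made by the different coefficients, and \<open>|a - b|\<close> is at most a multiple of the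
  square root of \<open>Q\<close>. Hence Gronwall's lemma applies.
\<close>

lemma kirchhoff_fourier_unique:
  fixes U V U' V' :: "real \<Rightarrow> 'n::finite cfun"
  assumes u: "kirchhoff_fourier T U U'" and v: "kirchhoff_fourier T V V'"
    and i0: "AE \<xi> in lborel. U 0 \<xi> = V 0 \<xi>" and i1: "AE \<xi> in lborel. U' 0 \<xi> = V' 0 \<xi>" and t: "t \<in> {0..T}"
  shows "AE \<xi> in lborel. U t \<xi> = V t \<xi>"
proof -
  let ?S = "{0..T}"
  have T0: "0 \<in> ?S" using t by auto
  obtain B where B: "\<And>t. t \<in> ?S \<Longrightarrow> sq_norm (freq 1 (U t)) \<le> B" "\<And>t. t \<in> ?S \<Longrightarrow> sq_norm (freq 1 (U' t)) \<le> B"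
      "\<And>t. t \<in> ?S \<Longrightarrow> sq_norm (freq 1 (V t)) \<le> B" "\<And>t. t \<in> ?S \<Longrightarrow> sq_norm (freq 2 (V t)) \<le> B" "B \<ge> 0"
  proof -
    obtain B1 where B1: "\<forall>t\<in>?S. sq_norm (freq 1 (U t)) \<le> B1 \<and> sq_norm (freq 2 (U t)) \<le> B1 \<and> sq_norm (freq 1 (U' t)) \<le> B1"
      using u unfolding kirchhoff_fourier_def by blast
    obtain B2 where B2: "\<forall>t\<in>?S. sq_norm (freq 1 (V t)) \<le> B2 \<and> sq_norm (freq 2 (V t)) \<le> B2 \<and> sq_norm (freq 1 (V' t)) \<le> B2"
      using v unfolding kirchhoff_fourier_def by blast
    show ?thesis by (rule that[of "max 0 (max B1 B2)"]) (use B1 B2 in \<open>auto simp: le_max_iff_disj\<close>)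
  qed
  have LU: "freq k (U t) \<in> L2" "freq k (U' t) \<in> L2" "freq k (V t) \<in> L2" "freq k (V' t) \<in> L2" "U' t \<in> L2" "V' t \<in> L2" if "t \<in> ?S" for t k
    using u v that unfolding kirchhoff_fourier_def by auto
  define a b where "a t = 1 + sq_norm (freq 1 (U t))" and "b t = 1 + sq_norm (freq 1 (V t))" for t
  define w w' where "w t \<xi> = freq 1 (U t) \<xi> - freq 1 (V t) \<xi>" and "w' t \<xi> = U' t \<xi> - V' t \<xi>" for t \<xi>
  define x where "x t \<xi> = freq 1 (U' t) \<xi> - freq 1 (V' t) \<xi>" for t \<xi>
  define X where "X t \<xi> = - complex_of_real (a t) * freq 2 (U t) \<xi> - (- complex_of_real (b t) * freq 2 (V t) \<xi>)" for t \<xi>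
  have L: "w t \<in> L2" "w' t \<in> L2" "x t \<in> L2" "X t \<in> L2" if "t \<in> ?S" for t
    unfolding w_def w'_def x_def X_def using LU[OF that] by (auto intro!: L2_diff L2_cmult)
  have dw: "L2_deriv w (x t) t ?S" if "t \<in> ?S" for t
    unfolding w_def x_def
    by (rule L2_deriv_diff[where U = "\<lambda>t. freq 1 (U t)" and V = "\<lambda>t. freq 1 (V t)"])
      (use u v that LU in \<open>auto simp: kirchhoff_fourier_def\<close>)
  have dw': "L2_deriv w' (X t) t ?S" if t: "t \<in> ?S" for t
    unfolding w'_def X_def a_def b_def
    by (rule L2_deriv_diff[where U = U' and V = V'])
      (use u v t LU(5,6) LU(1,3)[OF t] in \<open>auto simp: kirchhoff_fourier_def intro: L2_cmult\<close>)
  define P Q where "P t = sq_norm (w' t)" and "Q t = sq_norm (w t)" for t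
  define P' Q' a' where "P' t = 2 * Re (\<integral>\<xi>. X t \<xi> * cnj (w' t \<xi>) \<partial>lborel)"
    and "Q' t = 2 * Re (\<integral>\<xi>. x t \<xi> * cnj (w t \<xi>) \<partial>lborel)"
    and "a' t = 2 * Re (\<integral>\<xi>. freq 1 (U' t) \<xi> * cnj (freq 1 (U t) \<xi>) \<partial>lborel)" for t
  have dP: "(P has_real_derivative P' t) (at t within ?S)" if "t \<in> ?S" for t
    unfolding P_def P'_def by (rule L2_deriv_sq_norm[OF L(2) that L(4)[OF that] dw'[OF that]])
  have dQ: "(Q has_real_derivative Q' t) (at t within ?S)" if "t \<in> ?S" for t
    unfolding Q_def Q'_def by (rule L2_deriv_sq_norm[OF L(1) that L(3)[OF that] dw[OF that]])
  have da: "(a has_real_derivative a' t) (at t within ?S)" if "t \<in> ?S" for t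
  proof -
    have "((\<lambda>\<tau>. sq_norm (freq 1 (U \<tau>))) has_real_derivative a' t) (at t within ?S)"
      unfolding a'_def by (rule L2_deriv_sq_norm[where U = "\<lambda>t. freq 1 (U t)"]) (use u that LU in \<open>auto simp: kirchhoff_fourier_def\<close>)
    then show ?thesis unfolding a_def by (auto intro!: derivative_eq_intros)
  qed
  define K where "K = 2 * B + 4 * B"
  have E: "P' t + (a' t * Q t + a t * Q' t) \<le> K * (P t + a t * Q t)" if t: "t \<in> ?S" for t
  proof -
    note LUt = LU[OF t] and Lt = L[OF t]
    have pt: "X t \<xi> * cnj (w' t \<xi>) = - (complex_of_real (a t) * (cnj (x t \<xi>) * w t \<xi>)) - complex_of_real (a t - b t) * (freq 2 (V t) \<xi> * cnj (w' t \<xi>))" for \<xi>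
      by (simp add: X_def w_def w'_def x_def freq_def power2_eq_square algebra_simps)
    have i1: "integrable lborel (\<lambda>\<xi>. cnj (x t \<xi>) * w t \<xi>)" by (rule L2_mult_integrable[OF L2_cnj[OF Lt(3)] Lt(1)])
    have i2: "integrable lborel (\<lambda>\<xi>. freq 2 (V t) \<xi> * cnj (w' t \<xi>))" by (rule L2_mult_integrable[OF LUt(3) L2_cnj[OF Lt(2)]])
    have c: "(\<integral>\<xi>. cnj (x t \<xi>) * w t \<xi> \<partial>lborel) = cnj (\<integral>\<xi>. x t \<xi> * cnj (w t \<xi>) \<partial>lborel)"
      unfolding Bochner_Integration.integral_cnj[symmetric] by simp
    define I where "I = (\<integral>\<xi>. freq 2 (V t) \<xi> * cnj (w' t \<xi>) \<partial>lborel)"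
    have "(\<integral>\<xi>. X t \<xi> * cnj (w' t \<xi>) \<partial>lborel) = - (complex_of_real (a t) * cnj (\<integral>\<xi>. x t \<xi> * cnj (w t \<xi>) \<partial>lborel)) - complex_of_real (a t - b t) * I"
      unfolding pt I_def c[symmetric] using i1 i2 by simp
    \<comment> \<open>The first term cancels the contribution \<open>a Q'\<close> to the derivative of \<open>P + a Q\<close>.\<close>
    then have P': "P' t = - (a t * Q' t) - 2 * (a t - b t) * Re I"
      unfolding P'_def Q'_def by simp
    have I: "cmod I \<le> sqrt B * sqrt (P t)"
    proof -
      have "cmod I \<le> sqrt (sq_norm (freq 2 (V t))) * sqrt (sq_norm (\<lambda>\<xi>. cnj (w' t \<xi>)))"
        unfolding I_def by (rule Cauchy_Schwarz_L2[OF LUt(3) L2_cnj[OF Lt(2)]])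
      also have "\<dots> \<le> sqrt B * sqrt (P t)"
        unfolding sq_norm_cnj P_def using B(4)[OF t] by (intro mult_right_mono real_sqrt_le_mono) simp_all
      finally show ?thesis .
    qed
    have ab: "\<bar>a t - b t\<bar> \<le> sqrt (Q t) * (2 * sqrt B)"
    proof -
      have "\<bar>a t - b t\<bar> \<le> sqrt (Q t) * (sqrt (sq_norm (freq 1 (U t))) + sqrt (sq_norm (freq 1 (V t))))"
        using abs_sq_norm_diff_le[OF LUt(1,3), of 1 1] unfolding a_def b_def Q_def w_def by simp
      also have "\<dots> \<le> sqrt (Q t) * (sqrt B + sqrt B)"
        using B(1,3)[OF t] by (intro mult_left_mono add_mono real_sqrt_le_mono) (simp_all add: Q_def)
      finally show ?thesis by simp
    qed
    have a': "\<bar>a' t\<bar> \<le> 2 * B"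
    proof -
      have "cmod (\<integral>\<xi>. freq 1 (U' t) \<xi> * cnj (freq 1 (U t) \<xi>) \<partial>lborel) \<le> sqrt (sq_norm (freq 1 (U' t))) * sqrt (sq_norm (\<lambda>\<xi>. cnj (freq 1 (U t) \<xi>)))"
        by (rule Cauchy_Schwarz_L2[OF LUt(2) L2_cnj[OF LUt(1)]])
      also have "\<dots> \<le> sqrt B * sqrt B"
        unfolding sq_norm_cnj using B(1,2,5) t by (intro mult_mono real_sqrt_le_mono) simp_all
      also have "\<dots> = B" using B(5) by simp
      finally have "\<bar>Re (\<integral>\<xi>. freq 1 (U' t) \<xi> * cnj (freq 1 (U t) \<xi>) \<partial>lborel)\<bar> \<le> B"
        using abs_Re_le_cmod order_trans by blast
      then show ?thesis by (simp add: a'_def abs_mult)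
    qed
    have PQ: "P t \<ge> 0" "Q t \<ge> 0" by (simp_all add: P_def Q_def)
    have "\<bar>(a t - b t) * Re I\<bar> \<le> (sqrt (Q t) * (2 * sqrt B)) * (sqrt B * sqrt (P t))"
      unfolding abs_mult using ab I abs_Re_le_cmod[of I] PQ B(5) by (intro mult_mono) (simp_all add: order_trans[OF _ I])
    also have "\<dots> = 2 * B * (sqrt (Q t) * sqrt (P t))"
      using B(5) by (simp add: mult_ac flip: mult.assoc[of "sqrt B" "sqrt B"])
    also have "\<dots> \<le> 2 * B * (P t + Q t)"
    proof -
      have "sqrt (Q t) * sqrt (P t) \<le> P t + Q t"
        using arith_geo_mean_sqrt[OF PQ(2,1)] PQ by (simp add: real_sqrt_mult)
      then show ?thesis using B(5) by (intro mult_left_mono) auto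
    qed
    finally have le: "\<bar>(a t - b t) * Re I\<bar> \<le> 2 * B * (P t + Q t)" .
    have "- 2 * (a t - b t) * Re I \<le> 2 * \<bar>(a t - b t) * Re I\<bar>"
      using abs_ge_minus_self[of "(a t - b t) * Re I"] by (simp only: mult.assoc mult_minus_left)
    also have "\<dots> \<le> 4 * B * (P t + Q t)" using le by simp
    finally have "- 2 * (a t - b t) * Re I \<le> 4 * B * (P t + Q t)" .
    moreover have "a' t * Q t \<le> 2 * B * Q t" using a' PQ by (intro mult_right_mono) auto
    moreover have "Q t \<le> a t * Q t" using PQ mult_right_mono[of 1 "a t" "Q t"] by (simp add: a_def)
    ultimately have "P' t + (a' t * Q t + a t * Q' t) \<le> 2 * B * Q t + 4 * B * (P t + Q t)" unfolding P' by linarith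
    also have "\<dots> \<le> 2 * B * (P t + a t * Q t) + 4 * B * (P t + a t * Q t)"
      using \<open>Q t \<le> a t * Q t\<close> PQ B(5) by (intro add_mono mult_left_mono) auto
    finally show ?thesis by (simp add: K_def algebra_simps)
  qed
  have "P t + a t * Q t \<le> (P 0 + a 0 * Q 0) * exp (K * t)"
  proof (rule gronwall[OF _ E t])
    show "((\<lambda>t. P t + a t * Q t) has_real_derivative P' t + (a' t * Q t + a t * Q' t)) (at t within ?S)" if "t \<in> ?S" for t
      using dP[OF that] dQ[OF that] da[OF that] by (auto intro!: derivative_eq_intros)
  qed
  also have "P 0 = 0"
  proof -
    have "AE \<xi> in lborel. 0 = w' 0 \<xi>" using i1 by eventually_elim (simp add: w'_def)
    from sq_norm_AE_cong[OF L2_zero L2_measurable[OF L(2)[OF T0]] this] show ?thesis by (simp add: P_def sq_norm_def)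
  qed
  also have "Q 0 = 0"
  proof -
    have "AE \<xi> in lborel. 0 = w 0 \<xi>" using i0 by eventually_elim (simp add: w_def freq_def)
    from sq_norm_AE_cong[OF L2_zero L2_measurable[OF L(1)[OF T0]] this] show ?thesis by (simp add: Q_def sq_norm_def)
  qed
  finally have "P t + a t * Q t \<le> 0" by simp
  moreover have "P t \<ge> 0" "Q t \<ge> 0" "a t \<ge> 1" by (simp_all add: P_def Q_def a_def)
  ultimately have "Q t = 0" using mult_right_mono[of 1 "a t" "Q t"] by linarith
  then have "AE \<xi> in lborel. w t \<xi> = 0" unfolding Q_def by (intro sq_norm_eq_0[OF L(1)[OF t]])
  \<comment> \<open>The gradient determines the function off the frequency 0, which is a null set.\<close>
  moreover have "AE \<xi> in lborel. \<xi> \<noteq> (0 :: real^'n)" by (rule AE_lborel_singleton)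
  ultimately show ?thesis by eventually_elim (simp add: w_def freq_def)
qed

theorem kirchhoff_unique:
  fixes u v :: "real \<Rightarrow> 'n::finite cfun"
  assumes s: "s > 0" and u: "kirchhoff_solution s T u0 u1 u" and v: "kirchhoff_solution s T u0 u1 v" and t: "t \<in> {0..T}"
  shows "AE x in lborel. u t x = v t x"
proof -
  have T0: "0 \<in> {0..T}" using t by auto
  obtain u' where u': "kirchhoff_fourier T (\<lambda>t. fourier (u t)) (\<lambda>t. fourier (u' t))"
    "\<forall>t\<in>{0..T}. u t \<in> L2 \<and> u' t \<in> L2"
    "AE x in lborel. u 0 x = u0 x" "AE x in lborel. u' 0 x = u1 x"
    using kirchhoff_solution_fourier[OF s u] by blast
  obtain v' where v': "kirchhoff_fourier T (\<lambda>t. fourier (v t)) (\<lambda>t. fourier (v' t))"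
    "\<forall>t\<in>{0..T}. v t \<in> L2 \<and> v' t \<in> L2"
    "AE x in lborel. v 0 x = u0 x" "AE x in lborel. v' 0 x = u1 x"
    using kirchhoff_solution_fourier[OF s v] by blast
  have "AE x in lborel. u 0 x = v 0 x" using u'(3) v'(3) by eventually_elim simp
  then have "fourier (u 0) = fourier (v 0)" by (intro fourier_AE_cong) (use u'(2) v'(2) T0 in auto)
  moreover have "AE x in lborel. u' 0 x = v' 0 x" using u'(4) v'(4) by eventually_elim simp
  then have "fourier (u' 0) = fourier (v' 0)" by (intro fourier_AE_cong) (use u'(2) v'(2) T0 in auto)
  ultimately have "AE \<xi> in lborel. fourier (u t) \<xi> = fourier (v t) \<xi>"
    using kirchhoff_fourier_unique[OF u'(1) v'(1) _ _ t] by simp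
  then show ?thesis
    by (rule fourier_inject[rotated 2]) (use u'(2) v'(2) t in auto)
qed

section \<open>The scalar wave equation\<close>

lemma derivative_comparison:
  fixes f g f' g' :: "real \<Rightarrow> real"
  assumes "\<And>t. t \<in> {0..T} \<Longrightarrow> (f has_real_derivative f' t) (at t within {0..T})"
    and "\<And>t. t \<in> {0..T} \<Longrightarrow> (g has_real_derivative g' t) (at t within {0..T})"
    and "\<And>t. t \<in> {0..T} \<Longrightarrow> f' t \<le> g' t" and "f 0 \<le> g 0" and t: "t \<in> {0..T}"
  shows "f t \<le> g t"
proof -
  have "f t - g t \<le> (f 0 - g 0) * exp (0 * t)"
  proof (rule gronwall[where f = "\<lambda>t. f t - g t" and f' = "\<lambda>t. f' t - g' t", OF _ _ t])
    show "((\<lambda>t. f t - g t) has_real_derivative f' t - g' t) (at t within {0..T})" if "t \<in> {0..T}" for t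
      by (rule DERIV_diff[OF assms(1,2)[OF that]])
    show "f' t - g' t \<le> 0 * (f t - g t)" if "t \<in> {0..T}" for t using assms(3)[OF that] by simp
  qed
  then show ?thesis using assms(4) by simp
qed

lemma derivative_comparison_abs:
  fixes f g f' g' :: "real \<Rightarrow> real"
  assumes f: "\<And>t. t \<in> {0..T} \<Longrightarrow> (f has_real_derivative f' t) (at t within {0..T})"
    and g: "\<And>t. t \<in> {0..T} \<Longrightarrow> (g has_real_derivative g' t) (at t within {0..T})"
    and le: "\<And>t. t \<in> {0..T} \<Longrightarrow> \<bar>f' t\<bar> \<le> g' t" and "\<bar>f 0\<bar> \<le> g 0" and t: "t \<in> {0..T}"
  shows "\<bar>f t\<bar> \<le> g t"
proof -
  have "f t \<le> g t"
  proof (rule derivative_comparison[OF f g _ _ t])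
    show "f' t \<le> g' t" if "t \<in> {0..T}" for t using le[OF that] by simp
  qed (use assms(4) in simp_all)
  moreover have "- f t \<le> g t"
  proof (rule derivative_comparison[where f = "\<lambda>t. - f t" and f' = "\<lambda>t. - f' t", OF _ g _ _ t])
    show "((\<lambda>t. - f t) has_real_derivative - f' t) (at t within {0..T})" if "t \<in> {0..T}" for t
      by (rule DERIV_minus[OF f[OF that]])
    show "- f' t \<le> g' t" if "t \<in> {0..T}" for t using le[OF that] by simp
  qed (use assms(4) in simp_all)
  ultimately show ?thesis by simp
qed

text \<open>
  The solution of \<open>y'' = - l\<^sup>2 a y\<close> with data \<open>\<alpha>, \<beta>\<close> is expanded as \<open>\<Sum>\<^sub>k (- l\<^sup>2)\<^bsup>k\<^esup> y\<^sub>k\<close>, where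
  \<open>y\<^sub>0 = \<alpha> + \<beta> t\<close> and \<open>y\<^sub>k'' = a y\<^bsub>k - 1\<^esub>\<close> with zero data. The functions \<open>iter_vel\<close> and \<open>iter_acc\<close>
  are the first two derivatives of the terms.
\<close>

primrec iter_pos :: "(real \<Rightarrow> real) \<Rightarrow> real \<Rightarrow> real \<Rightarrow> nat \<Rightarrow> real \<Rightarrow> real" where
  "iter_pos a \<alpha> \<beta> 0 = (\<lambda>t. \<alpha> + \<beta> * t)"
| "iter_pos a \<alpha> \<beta> (Suc k) = (\<lambda>t. integral {0..t} (\<lambda>r. integral {0..r} (\<lambda>s. a s * iter_pos a \<alpha> \<beta> k s)))"

definition iter_vel :: "(real \<Rightarrow> real) \<Rightarrow> real \<Rightarrow> real \<Rightarrow> nat \<Rightarrow> real \<Rightarrow> real" where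
  "iter_vel a \<alpha> \<beta> k = (case k of 0 \<Rightarrow> (\<lambda>_. \<beta>) | Suc j \<Rightarrow> (\<lambda>r. integral {0..r} (\<lambda>s. a s * iter_pos a \<alpha> \<beta> j s)))"

definition iter_acc :: "(real \<Rightarrow> real) \<Rightarrow> real \<Rightarrow> real \<Rightarrow> nat \<Rightarrow> real \<Rightarrow> real" where
  "iter_acc a \<alpha> \<beta> k = (case k of 0 \<Rightarrow> (\<lambda>_. 0) | Suc j \<Rightarrow> (\<lambda>s. a s * iter_pos a \<alpha> \<beta> j s))"

lemma iter_derivatives:
  assumes a: "continuous_on {0..T} a"
  shows iter_pos_continuous: "continuous_on {0..T} (iter_pos a \<alpha> \<beta> k)"
    and iter_pos_deriv: "t \<in> {0..T} \<Longrightarrow> (iter_pos a \<alpha> \<beta> k has_real_derivative iter_vel a \<alpha> \<beta> k t) (at t within {0..T})"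
    and iter_vel_deriv: "t \<in> {0..T} \<Longrightarrow> (iter_vel a \<alpha> \<beta> k has_real_derivative iter_acc a \<alpha> \<beta> k t) (at t within {0..T})"
proof -
  have v: "(iter_vel a \<alpha> \<beta> k has_real_derivative iter_acc a \<alpha> \<beta> k t) (at t within {0..T})"
    if c: "\<And>j. k = Suc j \<Longrightarrow> continuous_on {0..T} (iter_pos a \<alpha> \<beta> j)" and t: "t \<in> {0..T}" for k t
  proof (cases k)
    case 0 then show ?thesis by (simp add: iter_vel_def iter_acc_def)
  next
    case (Suc j)
    have "continuous_on {0..T} (\<lambda>s. a s * iter_pos a \<alpha> \<beta> j s)" by (intro continuous_intros a c Suc)
    from integral_has_real_derivative[OF this t] show ?thesis by (simp add: iter_vel_def iter_acc_def Suc)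
  qed
  have p: "(iter_pos a \<alpha> \<beta> k has_real_derivative iter_vel a \<alpha> \<beta> k t) (at t within {0..T})"
    if c: "\<And>j. k = Suc j \<Longrightarrow> continuous_on {0..T} (iter_pos a \<alpha> \<beta> j)" and t: "t \<in> {0..T}" for k t
  proof (cases k)
    case 0
    have "((\<lambda>t. \<alpha> + \<beta> * t) has_real_derivative \<beta>) (at t within {0..T})" by (auto intro!: derivative_eq_intros)
    then show ?thesis by (simp add: iter_vel_def 0)
  next
    case (Suc j)
    have "continuous_on {0..T} (iter_vel a \<alpha> \<beta> k)" by (rule DERIV_continuous_on[OF v[OF c]])
    from integral_has_real_derivative[OF this t] show ?thesis by (simp add: iter_vel_def Suc)
  qed
  have c: "continuous_on {0..T} (iter_pos a \<alpha> \<beta> k)" for k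
  proof (induction k)
    case 0 then show ?case by (auto intro!: continuous_intros)
  next
    case (Suc k)
    show ?case by (rule DERIV_continuous_on[OF p]) (use Suc in auto)
  qed
  show "continuous_on {0..T} (iter_pos a \<alpha> \<beta> k)" by (rule c)
  show "t \<in> {0..T} \<Longrightarrow> (iter_pos a \<alpha> \<beta> k has_real_derivative iter_vel a \<alpha> \<beta> k t) (at t within {0..T})" by (rule p[OF c])
  show "t \<in> {0..T} \<Longrightarrow> (iter_vel a \<alpha> \<beta> k has_real_derivative iter_acc a \<alpha> \<beta> k t) (at t within {0..T})" by (rule v[OF c])
qed

lemma iter_at_0: "iter_pos a \<alpha> \<beta> k 0 = (if k = 0 then \<alpha> else 0)" "iter_vel a \<alpha> \<beta> k 0 = (if k = 0 then \<beta> else 0)"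
  by (cases k; simp add: iter_vel_def)+

lemma power_fact_deriv: "((\<lambda>t. c * (t ^ Suc k / fact (Suc k))) has_real_derivative c * (t ^ k / fact k)) (at t within S)"
proof -
  have "((\<lambda>t. c * (t ^ Suc k / fact (Suc k))) has_real_derivative c * ((real (Suc k) * t ^ k) / fact (Suc k))) (at t within S)"
    by (rule derivative_eq_intros refl | simp)+
  moreover have "(real (Suc k) * t ^ k) / fact (Suc k) = t ^ k / fact k" by (simp add: fact_Suc del: of_nat_Suc)
  ultimately show ?thesis by simp
qed

text \<open>
  Each step integrates twice. One integration supplies the factorial, the other one is estimated by
  the factor \<open>T\<close>.
\<close>

lemma iter_bounds:
  fixes \<alpha> \<beta> :: real
  assumes a: "continuous_on {0..T} a" and A: "\<And>t. t \<in> {0..T} \<Longrightarrow> \<bar>a t\<bar> \<le> A" and A0: "A \<ge> 0" and T: "T \<ge> 0"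
  defines "C \<equiv> \<bar>\<alpha>\<bar> + \<bar>\<beta>\<bar> * T"
  shows iter_pos_bound: "t \<in> {0..T} \<Longrightarrow> \<bar>iter_pos a \<alpha> \<beta> k t\<bar> \<le> C * (A * T) ^ k * (t ^ k / fact k)"
    and iter_vel_bound: "t \<in> {0..T} \<Longrightarrow> \<bar>iter_vel a \<alpha> \<beta> (Suc k) t\<bar> \<le> A * C * (A * T) ^ k * (t ^ Suc k / fact (Suc k))"
proof -
  have C0: "C \<ge> 0" using T by (simp add: C_def)
  have v: "\<bar>iter_vel a \<alpha> \<beta> (Suc k) t\<bar> \<le> A * C * (A * T) ^ k * (t ^ Suc k / fact (Suc k))"
    if p: "\<And>t. t \<in> {0..T} \<Longrightarrow> \<bar>iter_pos a \<alpha> \<beta> k t\<bar> \<le> C * (A * T) ^ k * (t ^ k / fact k)" and t: "t \<in> {0..T}" for k t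
  proof (rule derivative_comparison_abs[OF iter_vel_deriv[OF a] power_fact_deriv _ _ t])
    show "\<bar>iter_acc a \<alpha> \<beta> (Suc k) t\<bar> \<le> A * C * (A * T) ^ k * (t ^ k / fact k)" if "t \<in> {0..T}" for t
    proof -
      have "\<bar>a t\<bar> * \<bar>iter_pos a \<alpha> \<beta> k t\<bar> \<le> A * (C * (A * T) ^ k * (t ^ k / fact k))"
        by (rule mult_mono[OF A[OF that] p[OF that] A0]) simp
      then show ?thesis by (simp add: iter_acc_def abs_mult mult.assoc)
    qed
  qed (simp_all add: iter_at_0)
  have p: "\<bar>iter_pos a \<alpha> \<beta> k t\<bar> \<le> C * (A * T) ^ k * (t ^ k / fact k)" if "t \<in> {0..T}" for k t
    using that
  proof (induction k arbitrary: t)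
    case 0
    have "\<bar>\<beta> * t\<bar> \<le> \<bar>\<beta>\<bar> * T" using 0 by (simp add: abs_mult mult_left_mono)
    then show ?case using abs_triangle_ineq[of \<alpha> "\<beta> * t"] by (simp add: C_def)
  next
    case (Suc k)
    show ?case
    proof (rule derivative_comparison_abs[OF iter_pos_deriv[OF a] power_fact_deriv _ _ Suc.prems])
      fix t assume t: "t \<in> {0..T}"
      have "\<bar>iter_vel a \<alpha> \<beta> (Suc k) t\<bar> \<le> A * C * (A * T) ^ k * (t ^ Suc k / fact (Suc k))"
        by (rule v[OF Suc.IH t])
      also have "\<dots> \<le> A * C * (A * T) ^ k * (T * (t ^ k / fact k))"
      proof (rule mult_left_mono)
        have "t ^ Suc k / fact (Suc k) \<le> t ^ Suc k / fact k"
          using t by (intro divide_left_mono fact_mono) auto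
        also have "\<dots> = t * (t ^ k / fact k)" by simp
        also have "\<dots> \<le> T * (t ^ k / fact k)" using t by (intro mult_right_mono) auto
        finally show "t ^ Suc k / fact (Suc k) \<le> T * (t ^ k / fact k)" .
      qed (use A0 C0 T in simp)
      finally show "\<bar>iter_vel a \<alpha> \<beta> (Suc k) t\<bar> \<le> C * (A * T) ^ Suc k * (t ^ k / fact k)" by (simp add: mult_ac)
    next
      show "\<bar>iter_pos a \<alpha> \<beta> (Suc k) 0\<bar> \<le> C * (A * T) ^ Suc k * (0 ^ Suc k / fact (Suc k))"
        unfolding iter_at_0 by simp
    qed
  qed
  show "t \<in> {0..T} \<Longrightarrow> \<bar>iter_pos a \<alpha> \<beta> k t\<bar> \<le> C * (A * T) ^ k * (t ^ k / fact k)" by (rule p)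
  show "t \<in> {0..T} \<Longrightarrow> \<bar>iter_vel a \<alpha> \<beta> (Suc k) t\<bar> \<le> A * C * (A * T) ^ k * (t ^ Suc k / fact (Suc k))" by (rule v[OF p])
qed

lemma suminf_has_real_derivative:
  fixes f f' :: "nat \<Rightarrow> real \<Rightarrow> real"
  assumes T: "0 \<le> T" and d: "\<And>k t. t \<in> {0..T} \<Longrightarrow> (f k has_real_derivative f' k t) (at t within {0..T})"
    and M: "\<And>k t. t \<in> {0..T} \<Longrightarrow> \<bar>f' k t\<bar> \<le> M k" "summable M" and s: "summable (\<lambda>k. f k 0)" and t: "t \<in> {0..T}"
  shows "((\<lambda>t. \<Sum>k. f k t) has_real_derivative (\<Sum>k. f' k t)) (at t within {0..T})"
proof -
  have "uniform_limit {0..T} (\<lambda>n t. \<Sum>i<n. f' i t) (\<lambda>t. \<Sum>i. f' i t) sequentially"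
    by (rule Weierstrass_m_test[OF _ M(2)]) (use M(1) in simp)
  from has_field_derivative_series[OF convex_real_interval(5) d this _ s] T
  obtain g where g: "\<forall>t\<in>{0..T}. (\<lambda>n. f n t) sums g t \<and> (g has_real_derivative (\<Sum>k. f' k t)) (at t within {0..T})"
    by auto
  then have "(g has_real_derivative (\<Sum>k. f' k t)) (at t within {0..T})" using t by blast
  then show ?thesis
    by (rule has_field_derivative_transform_within[of _ _ _ _ 1]) (use g t in \<open>auto simp: sums_iff\<close>)
qed

text \<open>
  The expansion in powers of \<open>- l\<^sup>2\<close> converges for every \<open>l\<close>, like an exponential series. Solving the
  equation for all \<open>l\<close> at once by a power series makes measurability in \<open>l\<close> evident.
\<close>

lemma wave_fundamental_solution:
  fixes a :: "real \<Rightarrow> real" and \<alpha> \<beta> :: real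
  assumes a: "continuous_on {0..T} a" and T: "T \<ge> 0"
  obtains Y Z :: "real \<Rightarrow> real \<Rightarrow> real" where
    "\<And>l t. t \<in> {0..T} \<Longrightarrow> (Y l has_real_derivative Z l t) (at t within {0..T})"
    "\<And>l t. t \<in> {0..T} \<Longrightarrow> (Z l has_real_derivative - (a t * l\<^sup>2 * Y l t)) (at t within {0..T})"
    "\<And>l. Y l 0 = \<alpha>" "\<And>l. Z l 0 = \<beta>"
    "\<And>t. (\<lambda>l. Y l t) \<in> borel_measurable borel" "\<And>t. (\<lambda>l. Z l t) \<in> borel_measurable borel"
proof -
  obtain A where A: "\<And>x. x \<in> a ` {0..T} \<Longrightarrow> norm x \<le> A"
    using compact_imp_bounded[OF compact_continuous_image[OF a compact_Icc]] unfolding bounded_iff by blast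
  have A1: "\<bar>a t\<bar> \<le> A" if "t \<in> {0..T}" for t using A[OF imageI[OF that]] by simp
  have A0: "A \<ge> 0" using A1[of 0] T by auto
  define C where "C = \<bar>\<alpha>\<bar> + \<bar>\<beta>\<bar> * T"
  have C0: "C \<ge> 0" using T by (simp add: C_def)
  define Y Z where "Y l t = (\<Sum>k. (- (l\<^sup>2)) ^ k * iter_pos a \<alpha> \<beta> k t)"
    and "Z l t = (\<Sum>k. (- (l\<^sup>2)) ^ k * iter_vel a \<alpha> \<beta> k t)" for l t
  define p where "p l k = C * ((l\<^sup>2 * (A * T) * T) ^ k / fact k)" for l :: real and k :: nat
  have sp: "summable (p l)" for l unfolding p_def
    using summable_exp_generic[of "l\<^sup>2 * (A * T) * T"] by (intro summable_mult) (simp add: divide_inverse mult.commute)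
  have tk: "t ^ k \<le> T ^ k" if "t \<in> {0..T}" for t k using that by (intro power_mono) auto
  have pb: "\<bar>(- (l\<^sup>2)) ^ k * iter_pos a \<alpha> \<beta> k t\<bar> \<le> p l k" if t: "t \<in> {0..T}" for l k t
  proof -
    have "\<bar>(- (l\<^sup>2)) ^ k * iter_pos a \<alpha> \<beta> k t\<bar> = (l\<^sup>2) ^ k * \<bar>iter_pos a \<alpha> \<beta> k t\<bar>" by (simp add: abs_mult power_abs)
    also have "\<dots> \<le> (l\<^sup>2) ^ k * (C * (A * T) ^ k * (t ^ k / fact k))"
      using iter_pos_bound[OF a A1 A0 T t, of \<alpha> \<beta> k] by (intro mult_left_mono) (auto simp: C_def)
    also have "\<dots> \<le> (l\<^sup>2) ^ k * (C * (A * T) ^ k * (T ^ k / fact k))"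
      using tk[OF t] A0 T C0 by (intro mult_left_mono divide_right_mono) auto
    also have "\<dots> = p l k" by (simp add: p_def power_mult_distrib mult_ac)
    finally show ?thesis .
  qed
  define v where "v l k = (case k of 0 \<Rightarrow> \<bar>\<beta>\<bar> | Suc j \<Rightarrow> l\<^sup>2 * A * T * p l j)" for l k
  have sv: "summable (v l)" for l
    by (subst summable_Suc_iff[symmetric]) (use sp in \<open>simp add: v_def summable_mult\<close>)
  have vb: "\<bar>(- (l\<^sup>2)) ^ k * iter_vel a \<alpha> \<beta> k t\<bar> \<le> v l k" if t: "t \<in> {0..T}" for l k t
  proof (cases k)
    case 0 then show ?thesis by (simp add: iter_vel_def v_def)
  next
    case (Suc j)
    have "\<bar>iter_vel a \<alpha> \<beta> (Suc j) t\<bar> \<le> A * C * (A * T) ^ j * (t ^ Suc j / fact (Suc j))"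
      using iter_vel_bound[OF a A1 A0 T t, of \<alpha> \<beta> j] by (simp add: C_def)
    also have "\<dots> \<le> A * C * (A * T) ^ j * (T ^ Suc j / fact j)"
      using tk[OF t, of "Suc j"] A0 T C0 t by (intro mult_left_mono frac_le fact_mono) auto
    finally have "(l\<^sup>2) ^ Suc j * \<bar>iter_vel a \<alpha> \<beta> (Suc j) t\<bar> \<le> (l\<^sup>2) ^ Suc j * (A * C * (A * T) ^ j * (T ^ Suc j / fact j))"
      by (rule mult_left_mono) simp
    also have "\<dots> = v l k" by (simp add: v_def p_def Suc power_mult_distrib mult_ac)
    finally show ?thesis by (simp add: Suc abs_mult power_abs)
  qed
  define w where "w l k = (case k of 0 \<Rightarrow> 0 | Suc j \<Rightarrow> l\<^sup>2 * A * p l j)" for l k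
  have sw: "summable (w l)" for l
    by (subst summable_Suc_iff[symmetric]) (use sp in \<open>simp add: w_def summable_mult\<close>)
  have wb: "\<bar>(- (l\<^sup>2)) ^ k * iter_acc a \<alpha> \<beta> k t\<bar> \<le> w l k" if t: "t \<in> {0..T}" for l k t
  proof (cases k)
    case 0 then show ?thesis by (simp add: iter_acc_def w_def)
  next
    case (Suc j)
    have "\<bar>(- (l\<^sup>2)) ^ k * iter_acc a \<alpha> \<beta> k t\<bar> = l\<^sup>2 * (\<bar>a t\<bar> * \<bar>(- (l\<^sup>2)) ^ j * iter_pos a \<alpha> \<beta> j t\<bar>)"
      by (simp add: Suc iter_acc_def abs_mult mult_ac)
    also have "\<dots> \<le> l\<^sup>2 * (A * p l j)" using A1[OF t] pb[OF t] A0 by (intro mult_left_mono mult_mono) auto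
    finally show ?thesis by (simp add: Suc w_def mult.assoc)
  qed
  have s0: "summable (\<lambda>k. (- (l\<^sup>2)) ^ k * iter_pos a \<alpha> \<beta> k 0)" "summable (\<lambda>k. (- (l\<^sup>2)) ^ k * iter_vel a \<alpha> \<beta> k 0)" for l
    by (rule summable_comparison_test'[OF sp[of l], of 0], use pb T in simp,
        rule summable_comparison_test'[OF sv[of l], of 0], use vb T in simp)
  show ?thesis
  proof (rule that)
    fix l t :: real assume t: "t \<in> {0..T}"
    show "(Y l has_real_derivative Z l t) (at t within {0..T})"
      unfolding Y_def[abs_def] Z_def
      by (rule suminf_has_real_derivative[where M = "v l"]) (use t in \<open>auto intro!: DERIV_cmult iter_pos_deriv[OF a] T sv s0 vb\<close>)
    have "(Z l has_real_derivative (\<Sum>k. (- (l\<^sup>2)) ^ k * iter_acc a \<alpha> \<beta> k t)) (at t within {0..T})"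
      unfolding Z_def[abs_def]
      by (rule suminf_has_real_derivative[where M = "w l"]) (use t in \<open>auto intro!: DERIV_cmult iter_vel_deriv[OF a] T sw s0 wb\<close>)
    also have "(\<Sum>k. (- (l\<^sup>2)) ^ k * iter_acc a \<alpha> \<beta> k t) = (\<Sum>k. (- (l\<^sup>2)) ^ Suc k * iter_acc a \<alpha> \<beta> (Suc k) t)"
      using suminf_split_head[of "\<lambda>k. (- (l\<^sup>2)) ^ k * iter_acc a \<alpha> \<beta> k t"]
        summable_comparison_test'[OF sw[of l], of 0 "\<lambda>k. (- (l\<^sup>2)) ^ k * iter_acc a \<alpha> \<beta> k t"] wb[OF t]
      by (simp add: iter_acc_def)
    also have "\<dots> = (\<Sum>k. - (l\<^sup>2 * a t) * ((- (l\<^sup>2)) ^ k * iter_pos a \<alpha> \<beta> k t))"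
      by (simp add: iter_acc_def mult_ac)
    also have "\<dots> = - (l\<^sup>2 * a t) * Y l t"
      unfolding Y_def by (rule suminf_mult) (rule summable_comparison_test'[OF sp[of l], of 0], use pb[OF t] in simp)
    finally show "(Z l has_real_derivative - (a t * l\<^sup>2 * Y l t)) (at t within {0..T})" by (simp add: mult_ac)
  next
    fix l :: real
    have 1: "(\<lambda>k. (- (l\<^sup>2)) ^ k * iter_pos a \<alpha> \<beta> k 0) = (\<lambda>k. if k = 0 then \<alpha> else 0)"
      "(\<lambda>k. (- (l\<^sup>2)) ^ k * iter_vel a \<alpha> \<beta> k 0) = (\<lambda>k. if k = 0 then \<beta> else 0)" by (auto simp: iter_at_0)
    show "Y l 0 = \<alpha>" "Z l 0 = \<beta>" unfolding Y_def Z_def 1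
      using sums_unique[OF sums_single[of 0 "\<lambda>_. \<alpha>"]] sums_unique[OF sums_single[of 0 "\<lambda>_. \<beta>"]] by simp_all
  next
    fix t :: real
    show "(\<lambda>l. Y l t) \<in> borel_measurable borel" "(\<lambda>l. Z l t) \<in> borel_measurable borel"
      unfolding Y_def Z_def by measurable
  qed
qed

definition wave_ode :: "real \<Rightarrow> (real \<Rightarrow> real) \<Rightarrow> real \<Rightarrow> (real \<Rightarrow> complex) \<Rightarrow> (real \<Rightarrow> complex) \<Rightarrow> bool" where
  "wave_ode T a l y z \<longleftrightarrow> (\<forall>t\<in>{0..T}. (y has_vector_derivative z t) (at t within {0..T}) \<and>
     (z has_vector_derivative (- (complex_of_real (a t * l\<^sup>2) * y t))) (at t within {0..T}))"

text \<open>
  By linearity the solution with data \<open>\<phi>(\<xi>), \<psi>(\<xi>)\<close> is a combination of the two real fundamental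
  solutions at \<open>l = |\<xi>|\<close>.
\<close>

lemma wave_ode_exists:
  fixes \<phi> \<psi> :: "'n::finite cfun"
  assumes a: "continuous_on {0..T} a" and T: "T \<ge> 0"
    and [measurable]: "\<phi> \<in> borel_measurable borel" "\<psi> \<in> borel_measurable borel"
  shows "\<exists>y z. (\<forall>\<xi>. wave_ode T a (norm \<xi>) (\<lambda>t. y t \<xi>) (\<lambda>t. z t \<xi>)) \<and> y 0 = \<phi> \<and> z 0 = \<psi> \<and>
     (\<forall>t. y t \<in> borel_measurable borel \<and> z t \<in> borel_measurable borel)"
proof -
  obtain Y1 Z1 :: "real \<Rightarrow> real \<Rightarrow> real" where 1:
    "\<And>l t. t \<in> {0..T} \<Longrightarrow> (Y1 l has_real_derivative Z1 l t) (at t within {0..T})"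
    "\<And>l t. t \<in> {0..T} \<Longrightarrow> (Z1 l has_real_derivative - (a t * l\<^sup>2 * Y1 l t)) (at t within {0..T})"
    "\<And>l. Y1 l 0 = 1" "\<And>l. Z1 l 0 = 0"
    "\<And>t. (\<lambda>l. Y1 l t) \<in> borel_measurable borel" "\<And>t. (\<lambda>l. Z1 l t) \<in> borel_measurable borel"
    by (rule wave_fundamental_solution[OF a T, of 1 0]) metis
  obtain Y2 Z2 :: "real \<Rightarrow> real \<Rightarrow> real" where 2:
    "\<And>l t. t \<in> {0..T} \<Longrightarrow> (Y2 l has_real_derivative Z2 l t) (at t within {0..T})"
    "\<And>l t. t \<in> {0..T} \<Longrightarrow> (Z2 l has_real_derivative - (a t * l\<^sup>2 * Y2 l t)) (at t within {0..T})"
    "\<And>l. Y2 l 0 = 0" "\<And>l. Z2 l 0 = 1"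
    "\<And>t. (\<lambda>l. Y2 l t) \<in> borel_measurable borel" "\<And>t. (\<lambda>l. Z2 l t) \<in> borel_measurable borel"
    by (rule wave_fundamental_solution[OF a T, of 0 1]) metis
  note [measurable] = 1(5,6) 2(5,6)
  define y z where "y t \<xi> = complex_of_real (Y1 (norm \<xi>) t) * \<phi> \<xi> + complex_of_real (Y2 (norm \<xi>) t) * \<psi> \<xi>"
    and "z t \<xi> = complex_of_real (Z1 (norm \<xi>) t) * \<phi> \<xi> + complex_of_real (Z2 (norm \<xi>) t) * \<psi> \<xi>" for t \<xi>
  have nm: "(norm :: real^'n \<Rightarrow> real) \<in> borel_measurable borel" by simp
  have m: "(\<lambda>\<xi>::real^'n. Y1 (norm \<xi>) t) \<in> borel_measurable borel" "(\<lambda>\<xi>::real^'n. Z1 (norm \<xi>) t) \<in> borel_measurable borel"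
    "(\<lambda>\<xi>::real^'n. Y2 (norm \<xi>) t) \<in> borel_measurable borel" "(\<lambda>\<xi>::real^'n. Z2 (norm \<xi>) t) \<in> borel_measurable borel" for t
    using measurable_compose[OF nm 1(5)] measurable_compose[OF nm 1(6)]
      measurable_compose[OF nm 2(5)] measurable_compose[OF nm 2(6)] by simp_all
  note [measurable] = m
  have vd: "((\<lambda>t. complex_of_real (f t) * c + complex_of_real (g t) * d) has_vector_derivative complex_of_real f' * c + complex_of_real g' * d) (at t within {0..T})"
    if "(f has_real_derivative f') (at t within {0..T})" "(g has_real_derivative g') (at t within {0..T})" for f g f' g' c d t
    using that by (intro has_vector_derivative_add has_vector_derivative_mult_left has_vector_derivative_of_real)
  have "wave_ode T a (norm \<xi>) (\<lambda>t. y t \<xi>) (\<lambda>t. z t \<xi>)" for \<xi>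
    unfolding wave_ode_def
  proof (intro ballI conjI)
    fix t assume t: "t \<in> {0..T}"
    show "((\<lambda>t. y t \<xi>) has_vector_derivative z t \<xi>) (at t within {0..T})"
      unfolding y_def z_def by (rule vd[OF 1(1)[OF t] 2(1)[OF t]])
    have "((\<lambda>t. z t \<xi>) has_vector_derivative complex_of_real (- (a t * (norm \<xi>)\<^sup>2 * Y1 (norm \<xi>) t)) * \<phi> \<xi>
        + complex_of_real (- (a t * (norm \<xi>)\<^sup>2 * Y2 (norm \<xi>) t)) * \<psi> \<xi>) (at t within {0..T})"
      unfolding z_def by (rule vd[OF 1(2)[OF t] 2(2)[OF t]])
    then show "((\<lambda>t. z t \<xi>) has_vector_derivative (- (complex_of_real (a t * (norm \<xi>)\<^sup>2) * y t \<xi>))) (at t within {0..T})"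
      by (rule has_vector_derivative_eq_rhs) (simp add: y_def algebra_simps)
  qed
  moreover have "y 0 = \<phi>" "z 0 = \<psi>" by (auto simp: y_def z_def fun_eq_iff 1 2)
  moreover have "y t \<in> borel_measurable borel" "z t \<in> borel_measurable borel" for t
    unfolding y_def z_def by measurable
  ultimately show ?thesis by blast
qed

section \<open>Energy estimates for one frequency\<close>

lemma cmod_sq_has_derivative:
  assumes "(f has_vector_derivative f') (at t within S)"
  shows "((\<lambda>t. (cmod (f t))\<^sup>2) has_real_derivative 2 * Re (f' * cnj (f t))) (at t within S)"
proof -
  have "((\<lambda>t. f t \<bullet> f t) has_vector_derivative f t \<bullet> f' + f' \<bullet> f t) (at t within S)"
    by (rule bounded_bilinear.has_vector_derivative[OF bounded_bilinear_inner assms assms])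
  then have "((\<lambda>t. (cmod (f t))\<^sup>2) has_vector_derivative 2 * (f' \<bullet> f t)) (at t within S)"
    by (simp add: power2_norm_eq_inner inner_commute)
  then show ?thesis
    by (simp add: has_real_derivative_iff_has_vector_derivative inner_complex_def)
qed

lemma wave_ode_sq_derivs:
  assumes "wave_ode T a l y z" "t \<in> {0..T}"
  shows "((\<lambda>t. (cmod (y t))\<^sup>2) has_real_derivative 2 * Re (z t * cnj (y t))) (at t within {0..T})"
    and "((\<lambda>t. (cmod (z t))\<^sup>2) has_real_derivative 2 * Re (- (complex_of_real (a t * l\<^sup>2) * y t) * cnj (z t))) (at t within {0..T})"
  using assms unfolding wave_ode_def by (blast intro: cmod_sq_has_derivative)+

lemma abs_Re_mult_cnj_le: "\<bar>Re (p * cnj w)\<bar> \<le> cmod p * cmod w"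
  using abs_Re_le_cmod[of "p * cnj w"] by (simp add: norm_mult)

definition mode_energy :: "real \<Rightarrow> complex \<Rightarrow> complex \<Rightarrow> real" where
  "mode_energy l y z = (cmod z)\<^sup>2 + l\<^sup>2 * (cmod y)\<^sup>2"

lemma mode_energy_nonneg [simp]: "0 \<le> mode_energy l y z" by (simp add: mode_energy_def)

lemma Re_mult_cnj_le: "2 * \<bar>Re (z * cnj w)\<bar> * l \<le> mode_energy l w z" if "l \<ge> 0"
proof -
  have "\<bar>Re (z * cnj w)\<bar> \<le> cmod z * cmod w"
    using abs_Re_le_cmod[of "z * cnj w"] by (simp add: norm_mult)
  then have "2 * \<bar>Re (z * cnj w)\<bar> * l \<le> 2 * (cmod z * cmod w) * l" using that by (intro mult_right_mono) auto
  also have "\<dots> = 2 * cmod z * (l * cmod w)" by simp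
  also have "\<dots> \<le> (cmod z)\<^sup>2 + (l * cmod w)\<^sup>2" by (rule sum_squares_bound)
  finally show ?thesis by (simp add: mode_energy_def power_mult_distrib)
qed

text \<open>
  The hyperbolic estimate. In the derivative of \<open>|z|\<^sup>2 + a l\<^sup>2 |y|\<^sup>2\<close> all terms cancel but
  \<open>a' l\<^sup>2 |y|\<^sup>2\<close>, so the growth does not depend on the frequency.
\<close>

lemma mode_energy_lipschitz_bound:
  assumes w: "wave_ode T a l y z"
    and a': "\<And>t. t \<in> {0..T} \<Longrightarrow> (a has_real_derivative a' t) (at t within {0..T})"
    and K: "\<And>t. t \<in> {0..T} \<Longrightarrow> \<bar>a' t\<bar> \<le> K" and A: "\<And>t. t \<in> {0..T} \<Longrightarrow> 1 \<le> a t \<and> a t \<le> A" and t: "t \<in> {0..T}"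
  shows "mode_energy l (y t) (z t) \<le> A * exp (K * t) * mode_energy l (y 0) (z 0)"
proof -
  define E where "E t = (cmod (z t))\<^sup>2 + a t * (l\<^sup>2 * (cmod (y t))\<^sup>2)" for t
  have T0: "0 \<in> {0..T}" using t by auto
  have dy: "((\<lambda>t. (cmod (y t))\<^sup>2) has_real_derivative 2 * Re (z t * cnj (y t))) (at t within {0..T})"
    and dz: "((\<lambda>t. (cmod (z t))\<^sup>2) has_real_derivative 2 * Re (- (complex_of_real (a t * l\<^sup>2) * y t) * cnj (z t))) (at t within {0..T})"
    if "t \<in> {0..T}" for t using wave_ode_sq_derivs[OF w that] by blast+
  have E0: "E t \<ge> l\<^sup>2 * (cmod (y t))\<^sup>2" if "t \<in> {0..T}" for t
  proof -
    have "1 * (l\<^sup>2 * (cmod (y t))\<^sup>2) \<le> a t * (l\<^sup>2 * (cmod (y t))\<^sup>2)" using A[OF that] by (intro mult_right_mono) auto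
    then show ?thesis unfolding E_def by (simp add: add_increasing)
  qed
  have "E t \<le> E 0 * exp (K * t)"
  proof (rule gronwall[where T = T, OF _ _ t])
    fix t assume t: "t \<in> {0..T}"
    show "(E has_real_derivative a' t * (l\<^sup>2 * (cmod (y t))\<^sup>2)) (at t within {0..T})"
      unfolding E_def
      by (rule derivative_eq_intros dy[OF t] dz[OF t] a'[OF t] refl | simp add: algebra_simps)+
    have "a' t * (l\<^sup>2 * (cmod (y t))\<^sup>2) \<le> K * (l\<^sup>2 * (cmod (y t))\<^sup>2)" using K[OF t] by (intro mult_right_mono) auto
    also have "\<dots> \<le> K * E t" using E0[OF t] K[OF t] by (intro mult_left_mono) auto
    finally show "a' t * (l\<^sup>2 * (cmod (y t))\<^sup>2) \<le> K * E t" .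
  qed
  moreover have "mode_energy l (y t) (z t) \<le> E t"
  proof -
    have "1 * (l\<^sup>2 * (cmod (y t))\<^sup>2) \<le> a t * (l\<^sup>2 * (cmod (y t))\<^sup>2)" using A[OF t] by (intro mult_right_mono) auto
    then show ?thesis by (simp add: E_def mode_energy_def)
  qed
  moreover
  have "E 0 \<le> A * mode_energy l (y 0) (z 0)"
  proof -
    have "a 0 * (l\<^sup>2 * (cmod (y 0))\<^sup>2) \<le> A * (l\<^sup>2 * (cmod (y 0))\<^sup>2)" using A[OF T0] by (intro mult_right_mono) auto
    moreover have "1 * (cmod (z 0))\<^sup>2 \<le> A * (cmod (z 0))\<^sup>2" using A[OF T0] by (intro mult_right_mono) auto
    ultimately show ?thesis by (simp add: E_def mode_energy_def distrib_left)
  qed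
  then have "E 0 * exp (K * t) \<le> A * mode_energy l (y 0) (z 0) * exp (K * t)" by (intro mult_right_mono) auto
  ultimately have "mode_energy l (y t) (z t) \<le> A * mode_energy l (y 0) (z 0) * exp (K * t)" by linarith
  then show ?thesis by (simp add: mult_ac)
qed

text \<open>
  The derivative of \<open>|z|\<^sup>2 + l\<^sup>2 |y|\<^sup>2\<close> is \<open>2 (1 - a) l\<^sup>2 Re (z y\<^sup>*)\<close>, at most \<open>(A - 1) l\<close> times
  the energy. The growth depends on the frequency but not on the derivative of \<open>a\<close>, and it is
  harmless for \<open>l T \<le> 1\<close>.
\<close>

lemma mode_energy_elliptic_bound:
  assumes w: "wave_ode T a l y z" and l: "l \<ge> 0"
    and A: "\<And>t. t \<in> {0..T} \<Longrightarrow> 1 \<le> a t \<and> a t \<le> A" and t: "t \<in> {0..T}"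
  shows "mode_energy l (y t) (z t) \<le> mode_energy l (y 0) (z 0) * exp ((A - 1) * l * t)"
proof (rule gronwall[where T = T and f = "\<lambda>t. mode_energy l (y t) (z t)", OF _ _ t])
  fix t assume t: "t \<in> {0..T}"
  have dy: "((\<lambda>t. (cmod (y t))\<^sup>2) has_real_derivative 2 * Re (z t * cnj (y t))) (at t within {0..T})"
    and dz: "((\<lambda>t. (cmod (z t))\<^sup>2) has_real_derivative 2 * Re (- (complex_of_real (a t * l\<^sup>2) * y t) * cnj (z t))) (at t within {0..T})"
    using wave_ode_sq_derivs[OF w t] by blast+
  show "((\<lambda>t. mode_energy l (y t) (z t)) has_real_derivative 2 * (1 - a t) * l\<^sup>2 * Re (z t * cnj (y t))) (at t within {0..T})"
    unfolding mode_energy_def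
    by (rule derivative_eq_intros dy dz refl | simp add: algebra_simps)+
  have "2 * (1 - a t) * l\<^sup>2 * Re (z t * cnj (y t)) \<le> (a t - 1) * l * (2 * \<bar>Re (z t * cnj (y t))\<bar> * l)"
  proof -
    have "- ((a t - 1) * l\<^sup>2 * Re (z t * cnj (y t))) \<le> (a t - 1) * l\<^sup>2 * \<bar>Re (z t * cnj (y t))\<bar>"
      using A[OF t] abs_ge_minus_self[of "Re (z t * cnj (y t))"] mult_left_mono[of "- Re (z t * cnj (y t))" "\<bar>Re (z t * cnj (y t))\<bar>" "(a t - 1) * l\<^sup>2"]
      by (simp del: times_complex.sel)
    then show ?thesis by (simp add: power2_eq_square algebra_simps del: times_complex.sel)
  qed
  also have "\<dots> \<le> (a t - 1) * l * mode_energy l (y t) (z t)"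
    using A[OF t] l by (intro mult_left_mono Re_mult_cnj_le) auto
  also have "\<dots> \<le> (A - 1) * l * mode_energy l (y t) (z t)"
    using A[OF t] l by (intro mult_right_mono) auto
  finally show "2 * (1 - a t) * l\<^sup>2 * Re (z t * cnj (y t)) \<le> (A - 1) * l * mode_energy l (y t) (z t)" .
qed

text \<open>
  The difference of the two modes solves the equation with coefficient \<open>a\<close> and right-hand side
  \<open>(b - a) l\<^sup>2 p\<close>. Splitting the product of this term with \<open>z - q\<close> by the inequality
  \<open>2 x y \<le> x\<^sup>2 + y\<^sup>2\<close> costs the 1 in \<open>K + 1\<close>. The second coefficient is only assumed to be continuous, because
  the limit of the iteration will take its place.
\<close>

lemma mode_energy_difference_bound:
  assumes w1: "wave_ode T a l y z" and w2: "wave_ode T b l p q" and i: "y 0 = p 0" "z 0 = q 0"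
    and a': "\<And>t. t \<in> {0..T} \<Longrightarrow> (a has_real_derivative a' t) (at t within {0..T})"
    and K: "\<And>t. t \<in> {0..T} \<Longrightarrow> \<bar>a' t\<bar> \<le> K" and A: "\<And>t. t \<in> {0..T} \<Longrightarrow> 1 \<le> a t"
    and b: "continuous_on {0..T} b" and G: "\<And>t. t \<in> {0..T} \<Longrightarrow> mode_energy l (p t) (q t) \<le> G" and t: "t \<in> {0..T}"
  shows "mode_energy l (y t - p t) (z t - q t) \<le> exp ((K + 1) * t) * (l\<^sup>2 * G * integral {0..t} (\<lambda>s. (a s - b s)\<^sup>2))"
proof -
  define D where "D t = (cmod (z t - q t))\<^sup>2 + a t * (l\<^sup>2 * (cmod (y t - p t))\<^sup>2)" for t
  define D' where "D' t = a' t * (l\<^sup>2 * (cmod (y t - p t))\<^sup>2) - 2 * (a t - b t) * l\<^sup>2 * Re (p t * cnj (z t - q t))" for t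
  define h where "h t = l\<^sup>2 * G * (a t - b t)\<^sup>2" for t
  have T0: "0 \<in> {0..T}" using t by auto
  have ca: "continuous_on {0..T} a" by (rule DERIV_continuous_on[OF a'])
  have K0: "K \<ge> 0" using K[OF T0] by linarith
  have dD: "(D has_real_derivative D' t) (at t within {0..T})" if t: "t \<in> {0..T}" for t
  proof -
    have "((\<lambda>t. y t - p t) has_vector_derivative z t - q t) (at t within {0..T})"
      using w1 w2 t by (auto simp: wave_ode_def intro!: has_vector_derivative_diff)
    note dy = cmod_sq_has_derivative[OF this]
    have "((\<lambda>t. z t - q t) has_vector_derivative (- (complex_of_real (a t * l\<^sup>2) * y t)) - (- (complex_of_real (b t * l\<^sup>2) * p t))) (at t within {0..T})"
      using w1 w2 t by (intro has_vector_derivative_diff) (auto simp: wave_ode_def)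
    note dz = cmod_sq_has_derivative[OF this]
    show ?thesis unfolding D_def D'_def
      by (rule derivative_eq_intros dy dz a'[OF t] refl | simp add: algebra_simps)+
  qed
  have le: "D' t \<le> (K + 1) * D t + h t" if t: "t \<in> {0..T}" for t
  proof -
    have y: "l\<^sup>2 * (cmod (y t - p t))\<^sup>2 \<le> a t * (l\<^sup>2 * (cmod (y t - p t))\<^sup>2)"
      using mult_right_mono[OF A[OF t], of "l\<^sup>2 * (cmod (y t - p t))\<^sup>2"] by simp
    have "a' t * (l\<^sup>2 * (cmod (y t - p t))\<^sup>2) \<le> K * (l\<^sup>2 * (cmod (y t - p t))\<^sup>2)"
      using K[OF t] by (intro mult_right_mono) auto
    also have "\<dots> \<le> K * D t" using K0 y by (intro mult_left_mono) (auto simp: D_def add_increasing)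
    finally have 1: "a' t * (l\<^sup>2 * (cmod (y t - p t))\<^sup>2) \<le> K * D t" .
    have "- (2 * (a t - b t) * l\<^sup>2 * Re (p t * cnj (z t - q t))) \<le> 2 * (\<bar>a t - b t\<bar> * l\<^sup>2 * cmod (p t)) * cmod (z t - q t)"
    proof -
      have "- ((a t - b t) * l\<^sup>2 * Re (p t * cnj (z t - q t))) \<le> \<bar>(a t - b t) * l\<^sup>2 * Re (p t * cnj (z t - q t))\<bar>" by (rule abs_ge_minus_self)
      also have "\<dots> = \<bar>a t - b t\<bar> * l\<^sup>2 * \<bar>Re (p t * cnj (z t - q t))\<bar>" by (simp add: abs_mult del: times_complex.sel)
      also have "\<dots> \<le> \<bar>a t - b t\<bar> * l\<^sup>2 * (cmod (p t) * cmod (z t - q t))"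
        by (intro mult_left_mono abs_Re_mult_cnj_le) simp
      finally have "2 * - ((a t - b t) * l\<^sup>2 * Re (p t * cnj (z t - q t))) \<le> 2 * (\<bar>a t - b t\<bar> * l\<^sup>2 * (cmod (p t) * cmod (z t - q t)))"
        by (rule mult_left_mono) simp
      then show ?thesis by (simp only: mult.assoc mult_minus_right)
    qed
    also have "\<dots> \<le> (\<bar>a t - b t\<bar> * l\<^sup>2 * cmod (p t))\<^sup>2 + (cmod (z t - q t))\<^sup>2" by (rule sum_squares_bound)
    also have "(\<bar>a t - b t\<bar> * l\<^sup>2 * cmod (p t))\<^sup>2 = l\<^sup>2 * (a t - b t)\<^sup>2 * (l\<^sup>2 * (cmod (p t))\<^sup>2)"
      by (simp add: power_mult_distrib power2_eq_square mult_ac abs_mult_self_eq)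
    also have "\<dots> \<le> l\<^sup>2 * (a t - b t)\<^sup>2 * G"
      using G[OF t] unfolding mode_energy_def
      by (intro mult_left_mono order_trans[OF _ G[OF t, unfolded mode_energy_def]]) auto
    also have "(cmod (z t - q t))\<^sup>2 \<le> D t" using y by (auto simp: D_def intro: order_trans[OF _ y])
    finally show ?thesis using 1 by (simp add: D'_def h_def algebra_simps del: times_complex.sel)
  qed
  have hc: "continuous_on {0..T} h" unfolding h_def by (intro continuous_intros ca b)
  have h0: "h t \<ge> 0" for t
  proof -
    have "0 \<le> G" using order_trans[OF mode_energy_nonneg G[OF T0]] .
    then show ?thesis by (simp add: h_def)
  qed
  \<comment> \<open>Gronwall's lemma with an inhomogeneous term, by comparison with a primitive of \<open>h\<close>.\<close>
  define e where "e t = D t * exp (- ((K + 1) * t))" for t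
  have "e t \<le> integral {0..t} h"
  proof (rule derivative_comparison[where T = T, OF _ integral_has_real_derivative[OF hc] _ _ t])
    fix t assume t: "t \<in> {0..T}"
    show "(e has_real_derivative (D' t - (K + 1) * D t) * exp (- ((K + 1) * t))) (at t within {0..T})"
      unfolding e_def by (rule derivative_eq_intros dD[OF t] refl | simp add: algebra_simps)+
    have "(D' t - (K + 1) * D t) * exp (- ((K + 1) * t)) \<le> h t * exp (- ((K + 1) * t))"
      using le[OF t] by (intro mult_right_mono) auto
    also have "\<dots> \<le> h t * 1" using h0[of t] K0 t by (intro mult_left_mono) auto
    finally show "(D' t - (K + 1) * D t) * exp (- ((K + 1) * t)) \<le> h t" by simp
  next
    have "e 0 = 0" by (simp add: e_def D_def i)
    moreover have "integral {0..0} h = 0" using integral_refl[of 0 h] by (simp only: box_real(2))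
    ultimately show "e 0 \<le> integral {0..0} h" by simp
  qed
  then have "e t * exp ((K + 1) * t) \<le> integral {0..t} h * exp ((K + 1) * t)" by (intro mult_right_mono) auto
  then have "D t \<le> integral {0..t} h * exp ((K + 1) * t)" by (simp add: e_def mult.assoc flip: exp_add)
  moreover have "integral {0..t} h = l\<^sup>2 * G * integral {0..t} (\<lambda>s. (a s - b s)\<^sup>2)" unfolding h_def by simp
  moreover have "mode_energy l (y t - p t) (z t - q t) \<le> D t"
    using mult_right_mono[OF A[OF t], of "l\<^sup>2 * (cmod (y t - p t))\<^sup>2"] by (simp add: mode_energy_def D_def)
  ultimately show ?thesis by (simp add: mult.commute)
qed

text \<open>
  The two estimates complement each other. For \<open>l T \<ge> 1\<close> one has
  \<open>K t \<le> K T\<^bsup>1 + 1/s\<^esup> (1/T)\<^bsup>1/s\<^esup> \<le> \<eta> l\<^bsup>1/s\<^esup>\<close>, and for \<open>l T \<le> 1\<close> the elliptic estimate gives the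
  factor \<open>e\<^bsup>A\<^esup>\<close>.
\<close>

lemma mode_energy_gevrey_bound:
  assumes w: "wave_ode T a l y z" and l: "l \<ge> 0" and T: "T > 0" and s: "s > 0"
    and a': "\<And>t. t \<in> {0..T} \<Longrightarrow> (a has_real_derivative a' t) (at t within {0..T})"
    and K: "\<And>t. t \<in> {0..T} \<Longrightarrow> \<bar>a' t\<bar> \<le> K" and A: "\<And>t. t \<in> {0..T} \<Longrightarrow> 1 \<le> a t \<and> a t \<le> A"
    and \<eta>: "K * T powr (1 + 1 / s) \<le> \<eta>" and t: "t \<in> {0..T}"
  shows "mode_energy l (y t) (z t) \<le> A * exp A * (exp (\<eta> * l powr (1 / s)) * mode_energy l (y 0) (z 0))"
proof -
  have T0: "0 \<in> {0..T}" using t by auto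
  have K0: "K \<ge> 0" using K[OF T0] by linarith
  have A1: "1 \<le> A" using A[OF T0] by linarith
  have \<eta>0: "0 \<le> \<eta>" using \<eta> K0 by (meson mult_nonneg_nonneg order_trans powr_ge_zero)
  have E1: "1 \<le> exp (\<eta> * l powr (1 / s))" using \<eta>0 by simp
  have "1 \<le> exp A" using A1 by simp
  let ?F = "mode_energy l (y 0) (z 0)"
  show ?thesis
  proof (cases "l * T \<le> 1")
    case True
    have "mode_energy l (y t) (z t) \<le> ?F * exp ((A - 1) * l * t)" by (rule mode_energy_elliptic_bound[OF w l A t])
    also have "(A - 1) * l * t \<le> A"
    proof -
      have "l * t \<le> l * T" using t l by (intro mult_left_mono) auto
      then have "(A - 1) * (l * t) \<le> (A - 1) * 1" using A1 True by (intro mult_left_mono) auto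
      then show ?thesis by (simp add: mult.assoc)
    qed
    also have "?F * exp A = 1 * exp A * (1 * ?F)" by simp
    also have "\<dots> \<le> A * exp A * (exp (\<eta> * l powr (1 / s)) * ?F)"
      using A1 E1 by (intro mult_mono) auto
    finally show ?thesis by (simp add: mult_left_mono)
  next
    case False
    have "mode_energy l (y t) (z t) \<le> A * exp (K * t) * ?F" by (rule mode_energy_lipschitz_bound[OF w a' K A t])
    also have "K * t \<le> \<eta> * l powr (1 / s)"
    proof -
      have "K * t \<le> K * T" using K0 t by (intro mult_left_mono) auto
      also have "\<dots> = K * T powr (1 + 1 / s) * (1 / T) powr (1 / s)"
        using T by (simp add: powr_add powr_divide)
      also have "\<dots> \<le> \<eta> * l powr (1 / s)"
        using \<eta> \<eta>0 False T s by (intro mult_mono powr_mono2) (auto simp: field_simps)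
      finally show ?thesis .
    qed
    also have "A * exp (\<eta> * l powr (1 / s)) * ?F = A * 1 * (exp (\<eta> * l powr (1 / s)) * ?F)" by simp
    also have "\<dots> \<le> A * exp A * (exp (\<eta> * l powr (1 / s)) * ?F)"
      using A1 \<open>1 \<le> exp A\<close> by (intro mult_mono) auto
    finally show ?thesis using A1 by (simp add: mult_left_mono mult_right_mono)
  qed
qed

lemma deriv_under_integral:
  fixes g g' :: "real \<Rightarrow> 'a \<Rightarrow> real"
  assumes m: "\<And>t. t \<in> {0..T} \<Longrightarrow> integrable M (g t)" "\<And>t. t \<in> {0..T} \<Longrightarrow> g' t \<in> borel_measurable M"
    and d: "\<And>t x. t \<in> {0..T} \<Longrightarrow> ((\<lambda>t. g t x) has_real_derivative g' t x) (at t within {0..T})"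
    and B: "integrable M B" "\<And>t x. t \<in> {0..T} \<Longrightarrow> \<bar>g' t x\<bar> \<le> B x" and t: "t \<in> {0..T}"
  shows "((\<lambda>t. \<integral>x. g t x \<partial>M) has_real_derivative (\<integral>x. g' t x \<partial>M)) (at t within {0..T})"
  unfolding has_field_derivative_iff tendsto_at_iff_sequentially o_def
proof (intro allI impI)
  fix \<tau> :: "nat \<Rightarrow> real" assume \<tau>: "\<forall>i. \<tau> i \<in> {0..T} - {t}" and lim: "\<tau> \<longlonglongrightarrow> t"
  have \<tau>T: "\<tau> i \<in> {0..T}" "\<tau> i \<noteq> t" for i using \<tau> by auto
  have eq: "((\<integral>x. g (\<tau> i) x \<partial>M) - (\<integral>x. g t x \<partial>M)) / (\<tau> i - t) = (\<integral>x. (g (\<tau> i) x - g t x) / (\<tau> i - t) \<partial>M)" for i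
    using m(1)[OF \<tau>T(1)] m(1)[OF t] by simp
  have gm: "g u \<in> borel_measurable M" if "u \<in> {0..T}" for u using m(1)[OF that] by auto
  have "(\<lambda>i. \<integral>x. (g (\<tau> i) x - g t x) / (\<tau> i - t) \<partial>M) \<longlonglongrightarrow> (\<integral>x. g' t x \<partial>M)"
  proof (rule integral_dominated_convergence[OF m(2)[OF t] _ B(1)])
    show "(\<lambda>x. (g (\<tau> i) x - g t x) / (\<tau> i - t)) \<in> borel_measurable M" for i
      using gm[OF \<tau>T(1)] gm[OF t] by measurable
    show "AE x in M. (\<lambda>i. (g (\<tau> i) x - g t x) / (\<tau> i - t)) \<longlonglongrightarrow> g' t x"
    proof (rule AE_I2)
      fix x
      show "(\<lambda>i. (g (\<tau> i) x - g t x) / (\<tau> i - t)) \<longlonglongrightarrow> g' t x"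
        using d[OF t, of x] \<tau> lim unfolding has_field_derivative_iff tendsto_at_iff_sequentially o_def by blast
    qed
    show "AE x in M. norm ((g (\<tau> i) x - g t x) / (\<tau> i - t)) \<le> B x" for i
    proof (rule AE_I2)
      fix x
      have "norm (g (\<tau> i) x - g t x) \<le> B x * norm (\<tau> i - t)"
        by (rule field_differentiable_bound[where S = "{0..T}" and f' = "\<lambda>t. g' t x"])
          (use d B(2) \<tau>T t in auto)
      then show "norm ((g (\<tau> i) x - g t x) / (\<tau> i - t)) \<le> B x"
        using \<tau>T(2)[of i] by (simp add: pos_divide_le_eq)
    qed
  qed
  then show "(\<lambda>i. ((\<integral>x. g (\<tau> i) x \<partial>M) - (\<integral>x. g t x \<partial>M)) / (\<tau> i - t)) \<longlonglongrightarrow> (\<integral>x. g' t x \<partial>M)"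
    unfolding eq .
qed

section \<open>A smooth truncation\<close>

text \<open>
  A continuously differentiable function that is the identity up to \<open>b\<close>, has slope between 0 and 1,
  and approaches \<open>A\<close> from below at infinity. Its derivative must exist everywhere, since the modified
  coefficient is differentiated in time.
\<close>

definition cutoff :: "real \<Rightarrow> real \<Rightarrow> real \<Rightarrow> real" where
  "cutoff b A r = b + (A - b) * (r - b) / (A - b + max (r - b) 0)"

lemma cutoff_id: "b < A \<Longrightarrow> r \<le> b \<Longrightarrow> cutoff b A r = r"
  by (simp add: cutoff_def)

lemma cutoff_bounds:
  assumes "b < A" "1 \<le> b" "1 \<le> r" shows "1 \<le> cutoff b A r" "cutoff b A r \<le> A"
proof -
  show "1 \<le> cutoff b A r"
  proof (cases "r \<le> b")
    case True then show ?thesis using assms by (simp add: cutoff_id)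
  next
    case False
    then have "0 \<le> (A - b) * (r - b) / (A - b + max (r - b) 0)" using assms by simp
    then show ?thesis using assms unfolding cutoff_def by linarith
  qed
  show "cutoff b A r \<le> A"
  proof (cases "r \<le> b")
    case True then show ?thesis using assms by (simp add: cutoff_id)
  next
    case False
    then have "(A - b) * (r - b) / (A - b + (r - b)) \<le> A - b"
      using assms by (simp add: pos_divide_le_eq mult_left_mono)
    then show ?thesis using False by (simp add: cutoff_def max_def)
  qed
qed

lemma cutoff_deriv:
  assumes bA: "b < A"
  shows "(cutoff b A has_real_derivative ((A - b) / (A - b + max (r - b) 0))\<^sup>2) (at r)"
proof -
  consider "r < b" | "r > b" | "r = b" by linarith
  then show ?thesis
  proof cases
    case 1
    have "((\<lambda>r. r) has_real_derivative 1) (at r)" by simp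
    then have "(cutoff b A has_real_derivative 1) (at r)"
      by (rule has_field_derivative_transform_within_open[of _ _ _ "{..<b}"]) (use 1 bA in \<open>auto simp: cutoff_id\<close>)
    then show ?thesis using 1 bA by (simp add: max_def)
  next
    case 2
    have "((\<lambda>r. b + (A - b) * (r - b) / (A - b + (r - b))) has_real_derivative ((A - b) / (A - b + (r - b)))\<^sup>2) (at r)"
      by (rule derivative_eq_intros refl | use 2 bA in \<open>simp add: field_simps power2_eq_square\<close>)+
    then have "(cutoff b A has_real_derivative ((A - b) / (A - b + (r - b)))\<^sup>2) (at r)"
      by (rule has_field_derivative_transform_within_open[of _ _ _ "{b<..}"]) (use 2 in \<open>auto simp: cutoff_def max_def\<close>)
    then show ?thesis using 2 by (simp add: max_def)
  next
    case 3
    have "((\<lambda>x. (A - b) / (A - b + max (x - b) 0)) \<longlongrightarrow> (A - b) / (A - b + max (b - b) 0)) (at b)"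
      using bA by (intro tendsto_intros) auto
    moreover have "\<forall>\<^sub>F x in at b. (A - b) / (A - b + max (x - b) 0) = (cutoff b A x - cutoff b A b) / (x - b)"
      unfolding eventually_at_filter using bA by (intro always_eventually) (auto simp: cutoff_def)
    ultimately have "((\<lambda>x. (cutoff b A x - cutoff b A b) / (x - b)) \<longlongrightarrow> (A - b) / (A - b + max (b - b) 0)) (at b)"
      by (rule Lim_transform_eventually)
    then show ?thesis using 3 bA by (simp add: has_field_derivative_iff)
  qed
qed

lemma cutoff_deriv_bound: "b < A \<Longrightarrow> \<bar>((A - b) / (A - b + max (r - b) 0))\<^sup>2\<bar> \<le> (1::real)"
proof -
  assume "b < A"
  then have "0 \<le> (A - b) / (A - b + max (r - b) 0)" "(A - b) / (A - b + max (r - b) 0) \<le> 1"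
    by (auto intro!: divide_nonneg_nonneg simp: divide_le_eq_1)
  then show ?thesis by (simp add: power_le_one)
qed

lemma cutoff_lipschitz: assumes "b < A" shows "\<bar>cutoff b A r - cutoff b A r'\<bar> \<le> \<bar>r - r'\<bar>"
  using field_differentiable_bound[of UNIV "cutoff b A" "\<lambda>r. ((A - b) / (A - b + max (r - b) 0))\<^sup>2" 1 r r']
    cutoff_deriv[OF assms] cutoff_deriv_bound[OF assms] by simp

lemma cutoff_continuous: "b < A \<Longrightarrow> continuous_on S (cutoff b A)"
  using cutoff_deriv by (meson DERIV_continuous_on has_field_derivative_at_within)

section \<open>The fixed point\<close>

text \<open>
  \<open>\<phi>\<close> and \<open>\<psi>\<close> are the transforms of the initial data, \<open>R\<close> bounds the Gevrey norm in the theorem,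
  \<open>A\<close> is the upper bound for the coefficient in the iteration, and \<open>b\<close> is the smaller bound that
  conservation of energy provides.
\<close>

locale kirchhoff_data =
  fixes T s \<eta> A b R :: real and \<phi> \<psi> :: "'n::finite cfun"
  assumes T: "T > 0" and s: "s > 0" and b: "1 \<le> b" "b < A"
    and meas [measurable]: "\<phi> \<in> borel_measurable borel" "\<psi> \<in> borel_measurable borel"
    and energy_integrable: "integrable lborel (\<lambda>\<xi>. mode_energy (norm \<xi>) (\<phi> \<xi>) (\<psi> \<xi>))"
    and weight_integrable: "integrable lborel (\<lambda>\<xi>. exp (\<eta> * norm \<xi> powr (1 / s)) * (norm \<xi> * mode_energy (norm \<xi>) (\<phi> \<xi>) (\<psi> \<xi>)))"
    and weight_le: "(\<integral>\<xi>. exp (\<eta> * norm \<xi> powr (1 / s)) * (norm \<xi> * mode_energy (norm \<xi>) (\<phi> \<xi>) (\<psi> \<xi>)) \<partial>lborel) \<le> R"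
    and \<eta>: "A * exp A * R * T powr (1 + 1 / s) \<le> \<eta>"
begin

text \<open>
  \<open>E0\<close> is the initial energy of the modes, and \<open>W0\<close> the density of the squared Gevrey norm of the data.
\<close>

definition E0 :: "real^'n \<Rightarrow> real" where "E0 \<xi> = mode_energy (norm \<xi>) (\<phi> \<xi>) (\<psi> \<xi>)"
definition W0 :: "real^'n \<Rightarrow> real" where "W0 \<xi> = exp (\<eta> * norm \<xi> powr (1 / s)) * (norm \<xi> * E0 \<xi>)"
text \<open>
  The bound for the derivative of the coefficients that reproduces itself.
\<close>

definition K :: real where "K = A * exp A * R"

lemma E0_nonneg [simp]: "0 \<le> E0 \<xi>" by (simp add: E0_def)
lemma W0_nonneg [simp]: "0 \<le> W0 \<xi>" by (simp add: W0_def)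
lemma E0_integrable: "integrable lborel E0" using energy_integrable by (simp add: E0_def[abs_def])
lemma W0_integrable: "integrable lborel W0" using weight_integrable by (simp add: W0_def[abs_def] E0_def)
lemma W0_le: "(\<integral>\<xi>. W0 \<xi> \<partial>lborel) \<le> R" using weight_le by (simp add: W0_def E0_def)
lemma R_nonneg: "0 \<le> R" using order_trans[OF Bochner_Integration.integral_nonneg W0_le] by simp
lemma A1: "1 \<le> A" using b by simp
lemma K_nonneg: "0 \<le> K" using R_nonneg A1 by (simp add: K_def)
lemma \<eta>_nonneg: "0 \<le> \<eta>" using \<eta> K_nonneg unfolding K_def by (meson mult_nonneg_nonneg order_trans powr_ge_zero)
lemma norm_E0_le: "norm \<xi> * E0 \<xi> \<le> W0 \<xi>"
  using \<eta>_nonneg mult_right_mono[of 1 "exp (\<eta> * norm \<xi> powr (1 / s))" "norm \<xi> * E0 \<xi>"] by (simp add: W0_def)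

lemma E0_measurable [measurable]: "E0 \<in> borel_measurable borel"
  using E0_integrable by auto

definition is_wave :: "(real \<Rightarrow> real) \<Rightarrow> (real \<Rightarrow> 'n cfun) \<times> (real \<Rightarrow> 'n cfun) \<Rightarrow> bool" where
  "is_wave a p \<longleftrightarrow> (\<forall>\<xi>. wave_ode T a (norm \<xi>) (\<lambda>t. fst p t \<xi>) (\<lambda>t. snd p t \<xi>)) \<and> fst p 0 = \<phi> \<and> snd p 0 = \<psi> \<and>
     (\<forall>t. fst p t \<in> borel_measurable borel \<and> snd p t \<in> borel_measurable borel)"

text \<open>
  Positions and velocities of all modes driven by the coefficient \<open>a\<close>; the choice is from
  \<open>wave_ode_exists\<close>.
\<close>

definition wave :: "(real \<Rightarrow> real) \<Rightarrow> (real \<Rightarrow> 'n cfun) \<times> (real \<Rightarrow> 'n cfun)" where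
  "wave a = (SOME p. is_wave a p)"

lemma is_wave: assumes "continuous_on {0..T} a" shows "is_wave a (wave a)"
proof -
  from wave_ode_exists[OF assms _ meas] T have "\<exists>p. is_wave a p" unfolding is_wave_def by force
  then show ?thesis unfolding wave_def by (rule someI_ex)
qed

text \<open>
  The square of the \<open>L2\<close> norm of the gradient, for a function with transform \<open>y t\<close>.
\<close>

definition grad_sq :: "(real \<Rightarrow> 'n cfun) \<Rightarrow> real \<Rightarrow> real" where
  "grad_sq y t = (\<integral>\<xi>. (norm \<xi>)\<^sup>2 * (cmod (y t \<xi>))\<^sup>2 \<partial>lborel)"

text \<open>
  Bounds of the two kinds needed: without weight, to dominate the energy, and with one more factor
  \<open>|\<xi>|\<close>, which costs the Gevrey weight of the data, to dominate its time derivative.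
\<close>

definition bounded_wave :: "real \<Rightarrow> real \<Rightarrow> (real \<Rightarrow> 'n cfun) \<times> (real \<Rightarrow> 'n cfun) \<Rightarrow> bool" where
  "bounded_wave C1 C2 p \<longleftrightarrow> (\<forall>t\<in>{0..T}. \<forall>\<xi>. mode_energy (norm \<xi>) (fst p t \<xi>) (snd p t \<xi>) \<le> C1 * E0 \<xi> \<and>
     norm \<xi> * mode_energy (norm \<xi>) (fst p t \<xi>) (snd p t \<xi>) \<le> C2 * W0 \<xi>)"

lemma potential_le_mode_energy: "l\<^sup>2 * (cmod y)\<^sup>2 \<le> mode_energy l y z" by (simp add: mode_energy_def)
lemma kinetic_le_mode_energy: "(cmod z)\<^sup>2 \<le> mode_energy l y z" by (simp add: mode_energy_def)

text \<open>
  The squared norms of gradient and velocity are differentiated under the integral; the integrands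
  \<open>|\<xi>|\<^sup>2 2 Re (z y\<^sup>*)\<close> are dominated through \<open>2 |\<xi>| |Re (z y\<^sup>*)| \<le> mode_energy\<close>. The statement is
  about any bounded family of modes, because it is applied to the iterates and to their limit.
\<close>

lemma wave_energies:
  assumes w: "is_wave a p" and B: "bounded_wave C1 C2 p" and C: "0 \<le> C1" "0 \<le> C2" and t: "t \<in> {0..T}"
  shows "integrable lborel (\<lambda>\<xi>. (norm \<xi>)\<^sup>2 * (cmod (fst p t \<xi>))\<^sup>2)" "integrable lborel (\<lambda>\<xi>. (cmod (snd p t \<xi>))\<^sup>2)"
    "0 \<le> grad_sq (fst p) t" "grad_sq (fst p) t \<le> C1 * (\<integral>\<xi>. E0 \<xi> \<partial>lborel)"
    "(grad_sq (fst p) has_real_derivative (\<integral>\<xi>. (norm \<xi>)\<^sup>2 * (2 * Re (snd p t \<xi> * cnj (fst p t \<xi>))) \<partial>lborel)) (at t within {0..T})"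
    "\<bar>\<integral>\<xi>. (norm \<xi>)\<^sup>2 * (2 * Re (snd p t \<xi> * cnj (fst p t \<xi>))) \<partial>lborel\<bar> \<le> C2 * R"
    "(\<And>t. t \<in> {0..T} \<Longrightarrow> \<bar>a t\<bar> \<le> A) \<Longrightarrow> ((\<lambda>t. \<integral>\<xi>. (cmod (snd p t \<xi>))\<^sup>2 \<partial>lborel) has_real_derivative
       - a t * (\<integral>\<xi>. (norm \<xi>)\<^sup>2 * (2 * Re (snd p t \<xi> * cnj (fst p t \<xi>))) \<partial>lborel)) (at t within {0..T})"
proof -
  define y z where "y = fst p" and "z = snd p"
  have m: "y t \<in> borel_measurable borel" "z t \<in> borel_measurable borel" for t
    using w by (auto simp: is_wave_def y_def z_def)
  note [measurable] = m
  have B1: "mode_energy (norm \<xi>) (y t \<xi>) (z t \<xi>) \<le> C1 * E0 \<xi>"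
    and B2: "norm \<xi> * mode_energy (norm \<xi>) (y t \<xi>) (z t \<xi>) \<le> C2 * W0 \<xi>" if "t \<in> {0..T}" for t \<xi>
    using B that by (auto simp: bounded_wave_def y_def z_def)
  have ode: "wave_ode T a (norm \<xi>) (\<lambda>t. y t \<xi>) (\<lambda>t. z t \<xi>)" for \<xi> using w by (simp add: is_wave_def y_def z_def)
  have i1: "integrable lborel (\<lambda>\<xi>. C1 * E0 \<xi>)" and i2: "integrable lborel (\<lambda>\<xi>. C2 * W0 \<xi>)"
    by (intro integrable_mult_right E0_integrable W0_integrable)+
  have py: "(norm \<xi>)\<^sup>2 * (cmod (y t \<xi>))\<^sup>2 \<le> C1 * E0 \<xi>" and pz: "(cmod (z t \<xi>))\<^sup>2 \<le> C1 * E0 \<xi>" if "t \<in> {0..T}" for t \<xi>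
    using order_trans[OF potential_le_mode_energy B1[OF that]] order_trans[OF kinetic_le_mode_energy B1[OF that]] by auto
  have iy: "integrable lborel (\<lambda>\<xi>. (norm \<xi>)\<^sup>2 * (cmod (y t \<xi>))\<^sup>2)" if "t \<in> {0..T}" for t
    by (rule Bochner_Integration.integrable_bound[OF i1]) (use py[OF that] C in \<open>auto intro!: AE_I2\<close>)
  have iz: "integrable lborel (\<lambda>\<xi>. (cmod (z t \<xi>))\<^sup>2)" if "t \<in> {0..T}" for t
    by (rule Bochner_Integration.integrable_bound[OF i1]) (use pz[OF that] C in \<open>auto intro!: AE_I2\<close>)
  show "integrable lborel (\<lambda>\<xi>. (norm \<xi>)\<^sup>2 * (cmod (fst p t \<xi>))\<^sup>2)" using iy[OF t] by (simp add: y_def)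
  show "integrable lborel (\<lambda>\<xi>. (cmod (snd p t \<xi>))\<^sup>2)" using iz[OF t] by (simp add: z_def)
  show "0 \<le> grad_sq (fst p) t" unfolding grad_sq_def by (intro Bochner_Integration.integral_nonneg) simp
  have "grad_sq y t \<le> (\<integral>\<xi>. C1 * E0 \<xi> \<partial>lborel)"
    unfolding grad_sq_def by (rule integral_mono[OF iy[OF t] i1]) (rule py[OF t])
  then show "grad_sq (fst p) t \<le> C1 * (\<integral>\<xi>. E0 \<xi> \<partial>lborel)" by (simp add: y_def)
  have Re_le: "\<bar>(norm \<xi>)\<^sup>2 * (2 * Re (z t \<xi> * cnj (y t \<xi>)))\<bar> \<le> norm \<xi> * mode_energy (norm \<xi>) (y t \<xi>) (z t \<xi>)" for t \<xi>
  proof -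
    have "\<bar>(norm \<xi>)\<^sup>2 * (2 * Re (z t \<xi> * cnj (y t \<xi>)))\<bar> = norm \<xi> * (2 * \<bar>Re (z t \<xi> * cnj (y t \<xi>))\<bar> * norm \<xi>)"
      by (simp add: abs_mult power2_eq_square mult_ac del: times_complex.sel)
    also have "\<dots> \<le> norm \<xi> * mode_energy (norm \<xi>) (y t \<xi>) (z t \<xi>)"
      by (intro mult_left_mono Re_mult_cnj_le) auto
    finally show ?thesis .
  qed
  have le2: "\<bar>(norm \<xi>)\<^sup>2 * (2 * Re (z t \<xi> * cnj (y t \<xi>)))\<bar> \<le> C2 * W0 \<xi>" if "t \<in> {0..T}" for t \<xi>
    using order_trans[OF Re_le B2[OF that]] .
  have dm: "(\<lambda>\<xi>. (norm \<xi>)\<^sup>2 * (2 * Re (z t \<xi> * cnj (y t \<xi>)))) \<in> borel_measurable lborel" for t by measurable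
  have "((\<lambda>t. \<integral>\<xi>. (norm \<xi>)\<^sup>2 * (cmod (y t \<xi>))\<^sup>2 \<partial>lborel) has_real_derivative (\<integral>\<xi>. (norm \<xi>)\<^sup>2 * (2 * Re (z t \<xi> * cnj (y t \<xi>))) \<partial>lborel)) (at t within {0..T})"
    by (rule deriv_under_integral[OF iy dm DERIV_cmult[OF wave_ode_sq_derivs(1)[OF ode]] i2 le2 t])
  then show "(grad_sq (fst p) has_real_derivative (\<integral>\<xi>. (norm \<xi>)\<^sup>2 * (2 * Re (snd p t \<xi> * cnj (fst p t \<xi>))) \<partial>lborel)) (at t within {0..T})"
    by (simp add: grad_sq_def[abs_def] y_def z_def del: times_complex.sel)
  have "\<bar>\<integral>\<xi>. (norm \<xi>)\<^sup>2 * (2 * Re (z t \<xi> * cnj (y t \<xi>))) \<partial>lborel\<bar> \<le> (\<integral>\<xi>. C2 * W0 \<xi> \<partial>lborel)"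
    by (rule order_trans[OF integral_abs_bound integral_mono[OF _ i2 le2[OF t]]])
       (rule integrable_abs, rule Bochner_Integration.integrable_bound[OF i2], use dm le2[OF t] C in \<open>auto intro!: AE_I2 simp del: times_complex.sel\<close>)
  also have "\<dots> \<le> C2 * R" using W0_le C by (simp add: mult_left_mono)
  finally show "\<bar>\<integral>\<xi>. (norm \<xi>)\<^sup>2 * (2 * Re (snd p t \<xi> * cnj (fst p t \<xi>))) \<partial>lborel\<bar> \<le> C2 * R" by (simp only: y_def z_def)
  assume aA: "\<And>t. t \<in> {0..T} \<Longrightarrow> \<bar>a t\<bar> \<le> A"
  have eq: "2 * Re (- (complex_of_real (a t * (norm \<xi>)\<^sup>2) * y t \<xi>) * cnj (z t \<xi>)) = - a t * ((norm \<xi>)\<^sup>2 * (2 * Re (z t \<xi> * cnj (y t \<xi>))))" for t \<xi>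
    by (simp add: algebra_simps)
  have "((\<lambda>t. \<integral>\<xi>. (cmod (z t \<xi>))\<^sup>2 \<partial>lborel) has_real_derivative (\<integral>\<xi>. - a t * ((norm \<xi>)\<^sup>2 * (2 * Re (z t \<xi> * cnj (y t \<xi>)))) \<partial>lborel)) (at t within {0..T})"
  proof (rule deriv_under_integral[OF iz _ wave_ode_sq_derivs(2)[OF ode, unfolded eq] _ _ t])
    show "integrable lborel (\<lambda>\<xi>. A * (C2 * W0 \<xi>))" by (rule integrable_mult_right[OF i2])
    show "(\<lambda>\<xi>. - a t * ((norm \<xi>)\<^sup>2 * (2 * Re (z t \<xi> * cnj (y t \<xi>))))) \<in> borel_measurable lborel" for t by measurable
    show "\<bar>- a t * ((norm \<xi>)\<^sup>2 * (2 * Re (z t \<xi> * cnj (y t \<xi>))))\<bar> \<le> A * (C2 * W0 \<xi>)" if "t \<in> {0..T}" for t \<xi>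
      unfolding abs_mult[of "- a t"] abs_minus_cancel using aA[OF that] le2[OF that] A1 by (intro mult_mono) auto
  qed
  then show "((\<lambda>t. \<integral>\<xi>. (cmod (snd p t \<xi>))\<^sup>2 \<partial>lborel) has_real_derivative
       - a t * (\<integral>\<xi>. (norm \<xi>)\<^sup>2 * (2 * Re (snd p t \<xi> * cnj (fst p t \<xi>))) \<partial>lborel)) (at t within {0..T})"
    by (simp only: integral_mult_right_zero y_def z_def)
qed

definition admissible :: "(real \<Rightarrow> real) \<Rightarrow> bool" where
  "admissible a \<longleftrightarrow> (\<exists>a'. \<forall>t\<in>{0..T}. (a has_real_derivative a' t) (at t within {0..T}) \<and> \<bar>a' t\<bar> \<le> K) \<and>
     (\<forall>t\<in>{0..T}. 1 \<le> a t \<and> a t \<le> A)"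

text \<open>
  The growth factors of the mode energy, the first from \<open>mode_energy_lipschitz_bound\<close> and the second,
  relative to the Gevrey weight, from \<open>mode_energy_gevrey_bound\<close>.
\<close>

definition C1 :: real where "C1 = A * exp (K * T)"
definition C2 :: real where "C2 = A * exp A"

lemma C_nonneg: "0 \<le> C1" "0 \<le> C2" using A1 by (simp_all add: C1_def C2_def)

lemma admissible_continuous: "admissible a \<Longrightarrow> continuous_on {0..T} a"
  unfolding admissible_def by (blast intro: DERIV_continuous_on)

lemma admissible_wave:
  assumes a: "admissible a"
  shows "is_wave a (wave a)" "bounded_wave C1 C2 (wave a)"
proof -
  show w: "is_wave a (wave a)" by (rule is_wave[OF admissible_continuous[OF a]])
  obtain a' where a': "\<And>t. t \<in> {0..T} \<Longrightarrow> (a has_real_derivative a' t) (at t within {0..T})" "\<And>t. t \<in> {0..T} \<Longrightarrow> \<bar>a' t\<bar> \<le> K"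
    and aA: "\<And>t. t \<in> {0..T} \<Longrightarrow> 1 \<le> a t \<and> a t \<le> A" using a unfolding admissible_def by blast
  have ode: "wave_ode T a (norm \<xi>) (\<lambda>t. fst (wave a) t \<xi>) (\<lambda>t. snd (wave a) t \<xi>)"
    and i: "fst (wave a) 0 = \<phi>" "snd (wave a) 0 = \<psi>" for \<xi> using w by (auto simp: is_wave_def)
  show "bounded_wave C1 C2 (wave a)" unfolding bounded_wave_def
  proof (intro ballI allI conjI)
    fix t \<xi> assume t: "t \<in> {0..T}"
    have "mode_energy (norm \<xi>) (fst (wave a) t \<xi>) (snd (wave a) t \<xi>) \<le> A * exp (K * t) * E0 \<xi>"
      using mode_energy_lipschitz_bound[OF ode a' aA t] by (simp add: i E0_def)
    also have "\<dots> \<le> C1 * E0 \<xi>" unfolding C1_def using A1 t K_nonneg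
      by (intro mult_right_mono mult_left_mono) (simp_all add: mult_left_mono)
    finally show "mode_energy (norm \<xi>) (fst (wave a) t \<xi>) (snd (wave a) t \<xi>) \<le> C1 * E0 \<xi>" .
    have "mode_energy (norm \<xi>) (fst (wave a) t \<xi>) (snd (wave a) t \<xi>) \<le> A * exp A * (exp (\<eta> * norm \<xi> powr (1 / s)) * E0 \<xi>)"
      using mode_energy_gevrey_bound[OF ode _ T s a' aA _ t] \<eta> by (simp add: i E0_def K_def)
    then have "norm \<xi> * mode_energy (norm \<xi>) (fst (wave a) t \<xi>) (snd (wave a) t \<xi>) \<le> norm \<xi> * (A * exp A * (exp (\<eta> * norm \<xi> powr (1 / s)) * E0 \<xi>))"
      by (rule mult_left_mono) simp
    then show "norm \<xi> * mode_energy (norm \<xi>) (fst (wave a) t \<xi>) (snd (wave a) t \<xi>) \<le> C2 * W0 \<xi>"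
      by (simp add: C2_def W0_def mult_ac)
  qed
qed

text \<open>
  The map whose fixed points are sought.
\<close>

definition update :: "(real \<Rightarrow> real) \<Rightarrow> real \<Rightarrow> real" where
  "update a t = cutoff b A (1 + grad_sq (fst (wave a)) t)"

text \<open>
  The step in which the constants close up: the modes driven by an admissible coefficient have
  \<open>|(grad_sq)'| \<le> C2 R\<close>, which equals \<open>K\<close>, and the cut-off does not increase the derivative.
\<close>

lemma admissible_update:
  assumes a: "admissible a" shows "admissible (update a)"
proof -
  note w = wave_energies[OF admissible_wave[OF a] C_nonneg]
  define r' where "r' t = (\<integral>\<xi>. (norm \<xi>)\<^sup>2 * (2 * Re (snd (wave a) t \<xi> * cnj (fst (wave a) t \<xi>))) \<partial>lborel)" for t
  define m' where "m' r = ((A - b) / (A - b + max (r - b) 0))\<^sup>2" for r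
  have d: "(update a has_real_derivative m' (1 + grad_sq (fst (wave a)) t) * r' t) (at t within {0..T}) \<and> \<bar>m' (1 + grad_sq (fst (wave a)) t) * r' t\<bar> \<le> K"
    if t: "t \<in> {0..T}" for t
  proof
    have "((\<lambda>t. 1 + grad_sq (fst (wave a)) t) has_real_derivative r' t) (at t within {0..T})"
      using DERIV_add[OF DERIV_const[of 1] w(5)[OF t]] by (simp add: r'_def del: times_complex.sel)
    from DERIV_chain2[OF cutoff_deriv[OF b(2)] this]
    show "(update a has_real_derivative m' (1 + grad_sq (fst (wave a)) t) * r' t) (at t within {0..T})"
      by (simp add: update_def[abs_def] m'_def)
    have "\<bar>m' (1 + grad_sq (fst (wave a)) t) * r' t\<bar> \<le> 1 * (C2 * R)"
      unfolding abs_mult using cutoff_deriv_bound[OF b(2)] w(6)[OF t] unfolding m'_def r'_def by (intro mult_mono) auto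
    then show "\<bar>m' (1 + grad_sq (fst (wave a)) t) * r' t\<bar> \<le> K" by (simp add: C2_def K_def)
  qed
  have "1 \<le> update a t \<and> update a t \<le> A" if "t \<in> {0..T}" for t
    using cutoff_bounds[OF b(2,1)] w(3)[OF that] by (simp add: update_def)
  moreover have "\<exists>a'. \<forall>t\<in>{0..T}. (update a has_real_derivative a' t) (at t within {0..T}) \<and> \<bar>a' t\<bar> \<le> K"
    using d by (intro exI[of _ "\<lambda>t. m' (1 + grad_sq (fst (wave a)) t) * r' t"] ballI)
  ultimately show ?thesis unfolding admissible_def by simp
qed

text \<open>
  The Lipschitz constant of \<open>update\<close> in \<open>update_contraction\<close>; the summand 1 makes it positive, as it is
  used as a divisor.
\<close>

definition CL :: real where "CL = 1 + 4 * exp ((K + 1) * T) * (C1 * R)\<^sup>2"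

lemma CL_pos: "CL > 0" by (simp add: CL_def add_pos_nonneg)

lemma norm_E0_integrable: "integrable lborel (\<lambda>\<xi>. norm \<xi> * E0 \<xi>)"
proof (rule Bochner_Integration.integrable_bound[OF W0_integrable])
  show "AE \<xi> in lborel. norm (norm \<xi> * E0 \<xi>) \<le> norm (W0 \<xi>)" using norm_E0_le by (simp add: abs_mult)
qed measurable

text \<open>
  For each mode, \<open>||y\<^sub>a|\<^sup>2 - |y\<^sub>c|\<^sup>2|\<close> is the product of the difference, bounded by
  \<open>mode_energy_difference_bound\<close>, and the sum, bounded by the energy. The difference estimate carries one
  more factor \<open>|\<xi>|\<close>, and this makes the integrand comparable to \<open>|\<xi>| E0\<close>, which is integrable.
\<close>

lemma update_contraction:
  assumes a: "admissible a" and c: "admissible c" and t: "t \<in> {0..T}"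
  shows "(update a t - update c t)\<^sup>2 \<le> CL * integral {0..t} (\<lambda>s. (a s - c s)\<^sup>2)"
proof -
  obtain a' where a': "\<And>t. t \<in> {0..T} \<Longrightarrow> (a has_real_derivative a' t) (at t within {0..T})" "\<And>t. t \<in> {0..T} \<Longrightarrow> \<bar>a' t\<bar> \<le> K"
    and aA: "\<And>t. t \<in> {0..T} \<Longrightarrow> 1 \<le> a t" using a unfolding admissible_def by blast
  define d where "d = integral {0..t} (\<lambda>s. (a s - c s)\<^sup>2)"
  have cont: "continuous_on {0..t} (\<lambda>s. (a s - c s)\<^sup>2)"
    using t by (intro continuous_intros continuous_on_subset[OF admissible_continuous[OF a]] continuous_on_subset[OF admissible_continuous[OF c]]) auto
  have d0: "0 \<le> d" unfolding d_def by (intro integral_nonneg integrable_continuous_real cont) auto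
  define e where "e = exp ((K + 1) * T) * d"
  have e0: "0 \<le> e" using d0 by (simp add: e_def)
  define ya za yc zc where "ya = fst (wave a)" and "za = snd (wave a)" and "yc = fst (wave c)" and "zc = snd (wave c)"
  note wa = admissible_wave[OF a] and wc = admissible_wave[OF c]
  have pt: "\<bar>(norm \<xi>)\<^sup>2 * (cmod (ya t \<xi>))\<^sup>2 - (norm \<xi>)\<^sup>2 * (cmod (yc t \<xi>))\<^sup>2\<bar> \<le> 2 * sqrt e * C1 * (norm \<xi> * E0 \<xi>)" for \<xi>
  proof -
    define l G where "l = norm \<xi>" and "G = C1 * E0 \<xi>"
    have G0: "0 \<le> G" using C_nonneg by (simp add: G_def)
    have l0: "0 \<le> l" by (simp add: l_def)
    have Ga: "mode_energy l (ya t \<xi>) (za t \<xi>) \<le> G" and Gc: "\<And>t. t \<in> {0..T} \<Longrightarrow> mode_energy l (yc t \<xi>) (zc t \<xi>) \<le> G"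
      using wa(2) wc(2) t by (auto simp: bounded_wave_def G_def l_def ya_def za_def yc_def zc_def)
    have odea: "wave_ode T a l (\<lambda>t. ya t \<xi>) (\<lambda>t. za t \<xi>)" and odec: "wave_ode T c l (\<lambda>t. yc t \<xi>) (\<lambda>t. zc t \<xi>)"
      and ic: "ya 0 \<xi> = yc 0 \<xi>" "za 0 \<xi> = zc 0 \<xi>"
      using wa(1) wc(1) by (auto simp: is_wave_def l_def ya_def za_def yc_def zc_def)
    have "mode_energy l (ya t \<xi> - yc t \<xi>) (za t \<xi> - zc t \<xi>) \<le> exp ((K + 1) * t) * (l\<^sup>2 * G * d)"
      unfolding d_def by (rule mode_energy_difference_bound[OF odea odec ic a' aA admissible_continuous[OF c] Gc t])
    also have "\<dots> \<le> exp ((K + 1) * T) * (l\<^sup>2 * G * d)"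
      using t K_nonneg G0 d0 by (intro mult_right_mono) (auto intro!: mult_left_mono)
    finally have "l\<^sup>2 * (cmod (ya t \<xi> - yc t \<xi>))\<^sup>2 \<le> l\<^sup>2 * (e * G)"
      using order_trans[OF potential_le_mode_energy] by (fastforce simp: e_def mult_ac)
    then have "(l * cmod (ya t \<xi> - yc t \<xi>))\<^sup>2 \<le> (l * sqrt (e * G))\<^sup>2" using e0 G0 by (simp add: power_mult_distrib)
    then have 1: "l * cmod (ya t \<xi> - yc t \<xi>) \<le> l * sqrt (e * G)"
      by (rule power2_le_imp_le) (use l0 e0 G0 in simp)
    have sq: "l * cmod y \<le> sqrt G" if "mode_energy l y z \<le> G" for y z
      using order_trans[OF potential_le_mode_energy that] by (intro real_le_rsqrt) (simp add: power_mult_distrib)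
    have 2: "l * (cmod (ya t \<xi>) + cmod (yc t \<xi>)) \<le> 2 * sqrt G"
      using sq[OF Ga] sq[OF Gc[OF t]] by (simp add: distrib_left)
    have "\<bar>l\<^sup>2 * (cmod (ya t \<xi>))\<^sup>2 - l\<^sup>2 * (cmod (yc t \<xi>))\<^sup>2\<bar> = (l * \<bar>cmod (ya t \<xi>) - cmod (yc t \<xi>)\<bar>) * (l * (cmod (ya t \<xi>) + cmod (yc t \<xi>)))"
    proof -
      have "l\<^sup>2 * (cmod (ya t \<xi>))\<^sup>2 - l\<^sup>2 * (cmod (yc t \<xi>))\<^sup>2 = (l * (cmod (ya t \<xi>) - cmod (yc t \<xi>))) * (l * (cmod (ya t \<xi>) + cmod (yc t \<xi>)))"
        by (simp add: power2_eq_square algebra_simps)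
      then show ?thesis using l0 by (simp add: abs_mult)
    qed
    also have "\<dots> \<le> (l * sqrt (e * G)) * (2 * sqrt G)"
    proof (rule mult_mono[OF _ 2])
      show "l * \<bar>cmod (ya t \<xi>) - cmod (yc t \<xi>)\<bar> \<le> l * sqrt (e * G)"
        using 1 l0 norm_triangle_ineq3[of "ya t \<xi>" "yc t \<xi>"] by (meson mult_left_mono order_trans)
    qed (use l0 e0 G0 in auto)
    also have "\<dots> = 2 * sqrt e * (l * G)" using G0 by (simp add: real_sqrt_mult mult_ac)
    finally show ?thesis by (simp add: l_def G_def mult_ac)
  qed
  have ia: "integrable lborel (\<lambda>\<xi>. (norm \<xi>)\<^sup>2 * (cmod (ya t \<xi>))\<^sup>2)" and ic: "integrable lborel (\<lambda>\<xi>. (norm \<xi>)\<^sup>2 * (cmod (yc t \<xi>))\<^sup>2)"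
    unfolding ya_def yc_def by (rule wave_energies(1)[OF wa C_nonneg t] wave_energies(1)[OF wc C_nonneg t])+
  have "grad_sq ya t - grad_sq yc t = (\<integral>\<xi>. (norm \<xi>)\<^sup>2 * (cmod (ya t \<xi>))\<^sup>2 - (norm \<xi>)\<^sup>2 * (cmod (yc t \<xi>))\<^sup>2 \<partial>lborel)"
    unfolding grad_sq_def using ia ic by simp
  also have "\<bar>\<dots>\<bar> \<le> (\<integral>\<xi>. 2 * sqrt e * C1 * (norm \<xi> * E0 \<xi>) \<partial>lborel)"
    by (rule order_trans[OF integral_abs_bound integral_mono[OF _ integrable_mult_right[OF norm_E0_integrable] pt]])
      (intro integrable_abs Bochner_Integration.integrable_diff ia ic)
  also have "\<dots> = 2 * sqrt e * C1 * (\<integral>\<xi>. norm \<xi> * E0 \<xi> \<partial>lborel)" by simp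
  also have "\<dots> \<le> 2 * sqrt e * C1 * R"
  proof (rule mult_left_mono)
    have "(\<integral>\<xi>. norm \<xi> * E0 \<xi> \<partial>lborel) \<le> (\<integral>\<xi>. W0 \<xi> \<partial>lborel)"
      by (rule integral_mono[OF norm_E0_integrable W0_integrable norm_E0_le])
    then show "(\<integral>\<xi>. norm \<xi> * E0 \<xi> \<partial>lborel) \<le> R" using W0_le by linarith
  qed (use C_nonneg e0 in simp)
  finally have rr: "\<bar>grad_sq ya t - grad_sq yc t\<bar> \<le> 2 * sqrt e * C1 * R" .
  have "\<bar>update a t - update c t\<bar> \<le> \<bar>grad_sq ya t - grad_sq yc t\<bar>"
    using cutoff_lipschitz[OF b(2), of "1 + grad_sq ya t" "1 + grad_sq yc t"] by (simp add: update_def ya_def yc_def)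
  with rr have "\<bar>update a t - update c t\<bar> \<le> 2 * sqrt e * C1 * R" by linarith
  then have "(update a t - update c t)\<^sup>2 \<le> (2 * sqrt e * C1 * R)\<^sup>2"
    by (metis abs_ge_zero power2_abs power_mono)
  also have "\<dots> = 4 * exp ((K + 1) * T) * (C1 * R)\<^sup>2 * d" using e0 by (simp add: power_mult_distrib e_def mult_ac)
  also have "\<dots> \<le> CL * d" using d0 by (intro mult_right_mono) (auto simp: CL_def)
  finally show ?thesis by (simp add: d_def)
qed

primrec iterate :: "nat \<Rightarrow> real \<Rightarrow> real" where
  "iterate 0 = (\<lambda>_. 1)"
| "iterate (Suc k) = update (iterate k)"

lemma admissible_iterate: "admissible (iterate k)"
proof (induction k)
  case 0
  have "((\<lambda>_. 1) has_real_derivative 0) (at t within {0..T}) \<and> \<bar>0\<bar> \<le> K" for t using K_nonneg by simp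
  then show ?case using A1 unfolding admissible_def by (intro conjI exI[of _ "\<lambda>_. 0"]) auto
next
  case (Suc k) then show ?case by (simp add: admissible_update)
qed

text \<open>
  In the norm with weight \<open>e\<^bsup>- 4 CL t\<^esup>\<close> the Volterra estimate becomes a contraction with factor 1/4
  for squares.
\<close>

lemma iterate_increment: "t \<in> {0..T} \<Longrightarrow> (iterate (Suc k) t - iterate k t)\<^sup>2 \<le> A\<^sup>2 * (1/4)^k * exp (4 * CL * t)"
proof (induction k arbitrary: t)
  case 0
  have "1 \<le> iterate 1 t \<and> iterate 1 t \<le> A" using admissible_iterate[of 1] 0 by (auto simp: admissible_def)
  then have "(iterate 1 t - 1)\<^sup>2 \<le> A\<^sup>2" by (intro power_mono) auto
  also have "\<dots> \<le> A\<^sup>2 * exp (4 * CL * t)" using CL_pos 0 mult_left_mono[of 1 "exp (4 * CL * t)" "A\<^sup>2"] by simp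
  finally show ?case by simp
next
  case (Suc k)
  define e where "e s = (iterate (Suc k) s - iterate k s)\<^sup>2" for s
  define B where "B = A\<^sup>2 * (1/4)^k"
  have cont: "continuous_on {0..T} e"
    unfolding e_def by (intro continuous_intros admissible_continuous admissible_iterate)
  have "integral {0..t} e \<le> B / (4 * CL) * exp (4 * CL * t)"
  proof (rule derivative_comparison[OF integral_has_real_derivative[OF cont] _ _ _ Suc.prems])
    show "((\<lambda>t. B / (4 * CL) * exp (4 * CL * t)) has_real_derivative B * exp (4 * CL * t)) (at t within {0..T})" for t
      by (rule derivative_eq_intros refl | use CL_pos in simp)+
    show "e t \<le> B * exp (4 * CL * t)" if "t \<in> {0..T}" for t using Suc.IH[OF that] by (simp add: e_def B_def)
    have "integral {0..0} e = 0" using integral_refl[of 0 e] by (simp only: box_real(2))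
    then show "integral {0..0} e \<le> B / (4 * CL) * exp (4 * CL * 0)" using CL_pos by (simp add: B_def)
  qed
  then have "CL * integral {0..t} e \<le> CL * (B / (4 * CL) * exp (4 * CL * t))" using CL_pos by (intro mult_left_mono) auto
  also have "\<dots> = A\<^sup>2 * (1/4)^Suc k * exp (4 * CL * t)" using CL_pos by (simp add: B_def)
  finally show ?case
    using update_contraction[OF admissible_iterate admissible_iterate Suc.prems, of "Suc k" k]
    unfolding e_def iterate.simps(2)[of "Suc k", symmetric] iterate.simps(2)[of k, symmetric] by linarith
qed

definition fixed_coeff :: "real \<Rightarrow> real" where
  "fixed_coeff t = 1 + (\<Sum>k. iterate (Suc k) t - iterate k t)"

lemma iterate_uniform_limit: "uniform_limit {0..T} iterate fixed_coeff sequentially"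
proof -
  define M where "M k = A * exp (2 * CL * T) * (1/2)^k" for k :: nat
  have le: "norm (iterate (Suc k) t - iterate k t) \<le> M k" if t: "t \<in> {0..T}" for k t
  proof -
    have 1: "(iterate (Suc k) t - iterate k t)\<^sup>2 \<le> A\<^sup>2 * (1/4)^k * exp (4 * CL * t)" by (rule iterate_increment[OF t])
    have 2: "A\<^sup>2 * (1/4)^k * exp (4 * CL * t) \<le> A\<^sup>2 * (1/4)^k * exp (4 * CL * T)"
      using t CL_pos by (intro mult_left_mono) auto
    have "4 * CL * T = 2 * (2 * CL * T)" by simp
    then have "exp (4 * CL * T) = (exp (2 * CL * T))\<^sup>2" by (simp only: exp_double)
    moreover have "(1/4::real)^k = ((1/2)^k)\<^sup>2"
      by (simp only: power2_eq_square power_mult_distrib[symmetric]) simp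
    ultimately have 3: "A\<^sup>2 * (1/4)^k * exp (4 * CL * T) = (M k)\<^sup>2"
      by (simp only: M_def power_mult_distrib mult_ac)
    have "\<bar>iterate (Suc k) t - iterate k t\<bar>\<^sup>2 \<le> (M k)\<^sup>2"
      unfolding power2_abs 3[symmetric] by (rule order_trans[OF 1 2])
    then show ?thesis unfolding real_norm_def by (rule power2_le_imp_le) (use A1 in \<open>simp add: M_def\<close>)
  qed
  have sM: "summable M" unfolding M_def by (intro summable_mult summable_geometric) simp
  have "uniform_limit {0..T} (\<lambda>n t. \<Sum>k<n. iterate (Suc k) t - iterate k t) (\<lambda>t. \<Sum>k. iterate (Suc k) t - iterate k t) sequentially"
    by (rule Weierstrass_m_test[where f = "\<lambda>k t. iterate (Suc k) t - iterate k t" and M = M, OF _ sM]) (rule le)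
  then have "uniform_limit {0..T} (\<lambda>n t. 1 + (\<Sum>k<n. iterate (Suc k) t - iterate k t)) (\<lambda>t. 1 + (\<Sum>k. iterate (Suc k) t - iterate k t)) sequentially"
    by (intro uniform_limit_add uniform_limit_const)
  moreover have "(\<lambda>n t. 1 + (\<Sum>k<n. iterate (Suc k) t - iterate k t)) = iterate"
  proof (intro ext)
    fix n t show "1 + (\<Sum>k<n. iterate (Suc k) t - iterate k t) = iterate n t"
      using sum_lessThan_telescope[of "\<lambda>k. iterate k t" n] by simp
  qed
  ultimately show ?thesis by (simp add: fixed_coeff_def[abs_def])
qed

lemma fixed_coeff_continuous: "continuous_on {0..T} fixed_coeff"
  by (rule uniform_limit_theorem[OF _ iterate_uniform_limit])
    (simp_all add: admissible_continuous admissible_iterate)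

lemma iterate_tendsto: "t \<in> {0..T} \<Longrightarrow> (\<lambda>k. iterate k t) \<longlonglongrightarrow> fixed_coeff t"
  using iterate_uniform_limit by (rule tendsto_uniform_limitI)

lemma fixed_coeff_bounds: assumes "t \<in> {0..T}" shows "1 \<le> fixed_coeff t" "fixed_coeff t \<le> A"
  using admissible_iterate assms
  by (auto intro!: LIMSEQ_le_const[OF iterate_tendsto[OF assms]] LIMSEQ_le_const2[OF iterate_tendsto[OF assms]] simp: admissible_def)

lemma is_wave_coeff: "is_wave fixed_coeff (wave fixed_coeff)"
  by (rule is_wave[OF fixed_coeff_continuous])

lemma mode_energy_tendsto:
  assumes "(\<lambda>k. mode_energy l (y k - y') (z k - z')) \<longlonglongrightarrow> 0"
  shows "(\<lambda>k. mode_energy l (y k) (z k)) \<longlonglongrightarrow> mode_energy l y' z'" "(\<lambda>k. l\<^sup>2 * (cmod (y k))\<^sup>2) \<longlonglongrightarrow> l\<^sup>2 * (cmod y')\<^sup>2"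
proof -
  have z: "(\<lambda>k. z k) \<longlonglongrightarrow> z'"
  proof -
    have "(\<lambda>k. (cmod (z k - z'))\<^sup>2) \<longlonglongrightarrow> 0"
      by (rule Lim_null_comparison[OF _ assms]) (simp add: mode_energy_def)
    then have "(\<lambda>k. cmod (z k - z')) \<longlonglongrightarrow> 0" using tendsto_real_sqrt by fastforce
    then show ?thesis by (simp add: tendsto_norm_zero_iff LIM_zero_iff)
  qed
  have y: "(\<lambda>k. complex_of_real l * y k) \<longlonglongrightarrow> complex_of_real l * y'"
  proof -
    have "(\<lambda>k. (cmod (complex_of_real l * y k - complex_of_real l * y'))\<^sup>2) \<longlonglongrightarrow> 0"
      by (rule Lim_null_comparison[OF _ assms])
        (simp add: mode_energy_def norm_mult power_mult_distrib flip: right_diff_distrib)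
    then have "(\<lambda>k. cmod (complex_of_real l * y k - complex_of_real l * y')) \<longlonglongrightarrow> 0" using tendsto_real_sqrt by fastforce
    then show ?thesis by (simp add: tendsto_norm_zero_iff LIM_zero_iff)
  qed
  have "(\<lambda>k. (cmod (complex_of_real l * y k))\<^sup>2) \<longlonglongrightarrow> (cmod (complex_of_real l * y'))\<^sup>2"
    by (intro tendsto_intros y)
  then show y2: "(\<lambda>k. l\<^sup>2 * (cmod (y k))\<^sup>2) \<longlonglongrightarrow> l\<^sup>2 * (cmod y')\<^sup>2" by (simp add: norm_mult power_mult_distrib)
  show "(\<lambda>k. mode_energy l (y k) (z k)) \<longlonglongrightarrow> mode_energy l y' z'"
    unfolding mode_energy_def by (intro tendsto_intros y2 z)
qed

text \<open>
  The limit coefficient is continuous but not yet known to be differentiable. Its modes are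
  therefore bounded by the elliptic estimate, which suffices as \<open>\<xi>\<close> is fixed, and the difference
  estimate takes the derivative of the iterate.
\<close>

lemma wave_iterate_tendsto:
  assumes t: "t \<in> {0..T}"
  shows "(\<lambda>k. mode_energy (norm \<xi>) (fst (wave (iterate k)) t \<xi> - fst (wave fixed_coeff) t \<xi>) (snd (wave (iterate k)) t \<xi> - snd (wave fixed_coeff) t \<xi>)) \<longlonglongrightarrow> 0"
proof -
  define l where "l = norm \<xi>"
  define G where "G = E0 \<xi> * exp ((A - 1) * l * T)"
  have l: "l \<ge> 0" by (simp add: l_def)
  have G0: "G \<ge> 0" by (simp add: G_def)
  have ode: "wave_ode T fixed_coeff l (\<lambda>t. fst (wave fixed_coeff) t \<xi>) (\<lambda>t. snd (wave fixed_coeff) t \<xi>)"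
    and i: "fst (wave fixed_coeff) 0 = \<phi>" "snd (wave fixed_coeff) 0 = \<psi>"
    using is_wave_coeff by (auto simp: is_wave_def l_def)
  have cb: "1 \<le> fixed_coeff t \<and> fixed_coeff t \<le> A" if "t \<in> {0..T}" for t using fixed_coeff_bounds[OF that] by simp
  have G: "mode_energy l (fst (wave fixed_coeff) t \<xi>) (snd (wave fixed_coeff) t \<xi>) \<le> G" if t: "t \<in> {0..T}" for t
  proof -
    have "mode_energy l (fst (wave fixed_coeff) t \<xi>) (snd (wave fixed_coeff) t \<xi>) \<le> E0 \<xi> * exp ((A - 1) * l * t)"
      using mode_energy_elliptic_bound[OF ode l cb t] by (simp add: i E0_def l_def)
    also have "\<dots> \<le> G" unfolding G_def using t l A1 by (intro mult_left_mono) (auto intro!: mult_left_mono)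
    finally show ?thesis .
  qed
  define d where "d k = integral {0..t} (\<lambda>s. (iterate k s - fixed_coeff s)\<^sup>2)" for k
  have cont: "continuous_on {0..t} (\<lambda>s. (iterate k s - fixed_coeff s)\<^sup>2)" for k
    using t by (intro continuous_intros continuous_on_subset[OF admissible_continuous[OF admissible_iterate]] continuous_on_subset[OF fixed_coeff_continuous]) auto
  have d0: "d \<longlonglongrightarrow> 0"
  proof (rule LIMSEQ_I)
    fix e :: real assume e: "e > 0"
    define r where "r = sqrt (e / (2 * T))"
    have r: "r > 0" using e T by (simp add: r_def)
    have "\<forall>\<^sub>F k in sequentially. \<forall>s\<in>{0..T}. dist (iterate k s) (fixed_coeff s) < r"
      by (rule uniform_limitD[OF iterate_uniform_limit r])
    then obtain N where N: "\<forall>k\<ge>N. \<forall>s\<in>{0..T}. \<bar>iterate k s - fixed_coeff s\<bar> < r"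
      by (auto simp: eventually_sequentially dist_real_def)
    have "norm (d k - 0) < e" if "k \<ge> N" for k
    proof -
      have sq: "norm ((iterate k s - fixed_coeff s)\<^sup>2) \<le> e / (2 * T)" if "s \<in> {0..t}" for s
      proof -
        have "s \<in> {0..T}" using that t by auto
        with N \<open>k \<ge> N\<close> have "\<bar>iterate k s - fixed_coeff s\<bar> < r" by blast
        then have "\<bar>iterate k s - fixed_coeff s\<bar>\<^sup>2 \<le> r\<^sup>2" by (intro power_mono) auto
        then show ?thesis using e T by (simp add: r_def)
      qed
      have "norm (integral (cbox 0 t) (\<lambda>s. (iterate k s - fixed_coeff s)\<^sup>2)) \<le> e / (2 * T) * measure lborel (cbox 0 t)"
        using sq e T by (intro has_integral_bound[OF _ integrable_integral[OF integrable_continuous[OF cont[of k, folded box_real(2)]]]]) auto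
      also have "measure lborel (cbox 0 t) = t" using t by simp
      also have "e / (2 * T) * t \<le> e / (2 * T) * T" using e T t by (intro mult_left_mono) auto
      also have "\<dots> < e" using e T by simp
      finally show ?thesis by (simp add: d_def)
    qed
    then show "\<exists>N. \<forall>k\<ge>N. norm (d k - 0) < e" by blast
  qed
  have le: "mode_energy l (fst (wave (iterate k)) t \<xi> - fst (wave fixed_coeff) t \<xi>) (snd (wave (iterate k)) t \<xi> - snd (wave fixed_coeff) t \<xi>)
      \<le> exp ((K + 1) * t) * (l\<^sup>2 * G * d k)" for k
  proof -
    obtain a' where a': "\<And>t. t \<in> {0..T} \<Longrightarrow> (iterate k has_real_derivative a' t) (at t within {0..T})" "\<And>t. t \<in> {0..T} \<Longrightarrow> \<bar>a' t\<bar> \<le> K"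
      and aA: "\<And>t. t \<in> {0..T} \<Longrightarrow> 1 \<le> iterate k t" using admissible_iterate[of k] unfolding admissible_def by blast
    have odek: "wave_ode T (iterate k) l (\<lambda>t. fst (wave (iterate k)) t \<xi>) (\<lambda>t. snd (wave (iterate k)) t \<xi>)"
      and ik: "fst (wave (iterate k)) 0 \<xi> = fst (wave fixed_coeff) 0 \<xi>" "snd (wave (iterate k)) 0 \<xi> = snd (wave fixed_coeff) 0 \<xi>"
      using admissible_wave(1)[OF admissible_iterate[of k]] i by (auto simp: is_wave_def l_def)
    show ?thesis unfolding d_def
      by (rule mode_energy_difference_bound[OF odek ode ik a' aA fixed_coeff_continuous G t])
  qed
  have "(\<lambda>k. exp ((K + 1) * t) * (l\<^sup>2 * G * d k)) \<longlonglongrightarrow> exp ((K + 1) * t) * (l\<^sup>2 * G * 0)" by (intro tendsto_intros d0)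
  then have "(\<lambda>k. exp ((K + 1) * t) * (l\<^sup>2 * G * d k)) \<longlonglongrightarrow> 0" by simp
  then show ?thesis
    by (rule Lim_null_comparison[rotated]) (use le in \<open>simp add: l_def\<close>)
qed

text \<open>
  The bounds for the iterates are inherited by the limit, mode by mode.
\<close>

lemma bounded_wave_coeff: "bounded_wave C1 C2 (wave fixed_coeff)"
  unfolding bounded_wave_def
proof (intro ballI allI conjI)
  fix t \<xi> assume t: "t \<in> {0..T}"
  note lim = mode_energy_tendsto(1)[OF wave_iterate_tendsto[OF t, of \<xi>]]
  have B: "bounded_wave C1 C2 (wave (iterate k))" for k by (rule admissible_wave(2)[OF admissible_iterate])
  show "mode_energy (norm \<xi>) (fst (wave fixed_coeff) t \<xi>) (snd (wave fixed_coeff) t \<xi>) \<le> C1 * E0 \<xi>"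
    by (rule LIMSEQ_le_const2[OF lim]) (use B t in \<open>auto simp: bounded_wave_def\<close>)
  show "norm \<xi> * mode_energy (norm \<xi>) (fst (wave fixed_coeff) t \<xi>) (snd (wave fixed_coeff) t \<xi>) \<le> C2 * W0 \<xi>"
    by (rule LIMSEQ_le_const2[OF tendsto_mult_left[OF lim]]) (use B t in \<open>auto simp: bounded_wave_def\<close>)
qed

lemma fixed_coeff_eq: assumes t: "t \<in> {0..T}" shows "fixed_coeff t = cutoff b A (1 + grad_sq (fst (wave fixed_coeff)) t)"
proof -
  have B: "bounded_wave C1 C2 (wave (iterate k))" for k by (rule admissible_wave(2)[OF admissible_iterate])
  have m: "fst (wave (iterate k)) t \<in> borel_measurable borel" "fst (wave fixed_coeff) t \<in> borel_measurable borel" for k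
    using admissible_wave(1)[OF admissible_iterate[of k]] is_wave_coeff by (auto simp: is_wave_def)
  note [measurable] = m
  have "(\<lambda>k. grad_sq (fst (wave (iterate k))) t) \<longlonglongrightarrow> grad_sq (fst (wave fixed_coeff)) t"
    unfolding grad_sq_def
  proof (rule integral_dominated_convergence)
    show "integrable lborel (\<lambda>\<xi>. C1 * E0 \<xi>)" by (rule integrable_mult_right[OF E0_integrable])
    show "AE \<xi> in lborel. (\<lambda>k. (norm \<xi>)\<^sup>2 * (cmod (fst (wave (iterate k)) t \<xi>))\<^sup>2) \<longlonglongrightarrow> (norm \<xi>)\<^sup>2 * (cmod (fst (wave fixed_coeff) t \<xi>))\<^sup>2"
      using mode_energy_tendsto(2)[OF wave_iterate_tendsto[OF t]] by blast
    show "AE \<xi> in lborel. norm ((norm \<xi>)\<^sup>2 * (cmod (fst (wave (iterate k)) t \<xi>))\<^sup>2) \<le> C1 * E0 \<xi>" for k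
    proof (rule AE_I2)
      fix \<xi>
      have "mode_energy (norm \<xi>) (fst (wave (iterate k)) t \<xi>) (snd (wave (iterate k)) t \<xi>) \<le> C1 * E0 \<xi>"
        using B[of k] t by (auto simp: bounded_wave_def)
      from order_trans[OF potential_le_mode_energy this]
      show "norm ((norm \<xi>)\<^sup>2 * (cmod (fst (wave (iterate k)) t \<xi>))\<^sup>2) \<le> C1 * E0 \<xi>" by simp
    qed
  qed measurable
  then have "(\<lambda>k. 1 + grad_sq (fst (wave (iterate k))) t) \<longlonglongrightarrow> 1 + grad_sq (fst (wave fixed_coeff)) t" by (intro tendsto_intros)
  then have "(\<lambda>k. cutoff b A (1 + grad_sq (fst (wave (iterate k))) t)) \<longlonglongrightarrow> cutoff b A (1 + grad_sq (fst (wave fixed_coeff)) t)"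
    by (rule continuous_on_tendsto_compose[OF cutoff_continuous[OF b(2), of UNIV]]) simp_all
  then have "(\<lambda>k. iterate (Suc k) t) \<longlonglongrightarrow> cutoff b A (1 + grad_sq (fst (wave fixed_coeff)) t)" by (simp add: update_def)
  with LIMSEQ_Suc[OF iterate_tendsto[OF t]] show ?thesis by (rule LIMSEQ_unique)
qed

text \<open>
  Let \<open>r\<close> and \<open>P\<close> be the squared norms of gradient and velocity, and let \<open>G\<close> be the primitive of
  \<open>x \<mapsto> cutoff b A (1 + x)\<close>. Then \<open>P + G(r)\<close> is conserved. As the cut-off is at least 1,
  \<open>r \<le> G(r) \<le> P(0) + G(r(0))\<close>; as it lies below the identity on the range of the initial value,
  \<open>G(r(0)) \<le> r(0) + r(0)\<^sup>2 / 2\<close>. The right-hand side is the conserved energy of the data.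
\<close>

lemma grad_sq_bound:
  assumes small: "(\<integral>\<xi>. (cmod (\<psi> \<xi>))\<^sup>2 \<partial>lborel) + (\<integral>\<xi>. (norm \<xi>)\<^sup>2 * (cmod (\<phi> \<xi>))\<^sup>2 \<partial>lborel)
      + (\<integral>\<xi>. (norm \<xi>)\<^sup>2 * (cmod (\<phi> \<xi>))\<^sup>2 \<partial>lborel)\<^sup>2 / 2 \<le> b - 1"
    and t: "t \<in> {0..T}"
  shows "1 + grad_sq (fst (wave fixed_coeff)) t \<le> b"
proof -
  define r P where "r = grad_sq (fst (wave fixed_coeff))" and "P t = (\<integral>\<xi>. (cmod (snd (wave fixed_coeff) t \<xi>))\<^sup>2 \<partial>lborel)" for t
  define r' where "r' t = (\<integral>\<xi>. (norm \<xi>)\<^sup>2 * (2 * Re (snd (wave fixed_coeff) t \<xi> * cnj (fst (wave fixed_coeff) t \<xi>))) \<partial>lborel)" for t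
  have T0: "0 \<in> {0..T}" using t by auto
  note W = wave_energies[OF is_wave_coeff bounded_wave_coeff C_nonneg]
  have ca: "\<bar>fixed_coeff t\<bar> \<le> A" if "t \<in> {0..T}" for t using fixed_coeff_bounds[OF that] by simp
  have dr: "(r has_real_derivative r' t) (at t within {0..T})" if "t \<in> {0..T}" for t
    unfolding r_def r'_def by (rule W(5)[OF that])
  have dP: "(P has_real_derivative - fixed_coeff t * r' t) (at t within {0..T})" if "t \<in> {0..T}" for t
    unfolding P_def[abs_def] r'_def by (rule W(7)[OF that ca])
  define L where "L = C1 * (\<integral>\<xi>. E0 \<xi> \<partial>lborel)"
  have rL: "r t \<in> {0..L}" if "t \<in> {0..T}" for t using W(3,4)[OF that] by (simp add: r_def L_def)
  define G where "G = (\<lambda>x. integral {0..x} (\<lambda>y. cutoff b A (1 + y)))"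
  have cc: "continuous_on {0..L} (\<lambda>y. cutoff b A (1 + y))"
    by (rule continuous_on_compose2[OF cutoff_continuous[OF b(2), of UNIV]]) (auto intro!: continuous_intros)
  have dG: "(G has_real_derivative cutoff b A (1 + x)) (at x within {0..L})" if "x \<in> {0..L}" for x
    unfolding G_def by (rule integral_has_real_derivative[OF cc that])
  have G0: "G 0 = 0" unfolding G_def using integral_refl[of 0 "\<lambda>y. cutoff b A (1 + y)"] by (simp only: box_real(2))
  have dGr: "((\<lambda>t. G (r t)) has_real_derivative fixed_coeff t * r' t) (at t within {0..T})" if t: "t \<in> {0..T}" for t
  proof -
    have "(G has_real_derivative cutoff b A (1 + r t)) (at (r t) within r ` {0..T})"
      by (rule has_field_derivative_subset[OF dG[OF rL[OF t]]]) (use rL in blast)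
    from DERIV_image_chain[OF this dr[OF t]] show ?thesis
      using fixed_coeff_eq[OF t] by (simp add: r_def o_def)
  qed
  have "P t + G (r t) \<le> P 0 + G (r 0)"
  proof (rule derivative_comparison[where f = "\<lambda>t. P t + G (r t)" and f' = "\<lambda>_. 0" and g = "\<lambda>_. P 0 + G (r 0)" and g' = "\<lambda>_. 0" and T = T])
    show "((\<lambda>t. P t + G (r t)) has_real_derivative 0) (at t within {0..T})" if "t \<in> {0..T}" for t
      using DERIV_add[OF dP[OF that] dGr[OF that]] by simp
  qed (use t in simp_all)
  moreover have "0 \<le> P t" unfolding P_def by (intro Bochner_Integration.integral_nonneg) simp
  moreover have "x \<le> G x" if x: "x \<in> {0..L}" for x
  proof (rule derivative_comparison[where f = "\<lambda>x. x" and f' = "\<lambda>_. 1" and g = G and g' = "\<lambda>x. cutoff b A (1 + x)" and T = L])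
    show "(G has_real_derivative cutoff b A (1 + x)) (at x within {0..L})" if "x \<in> {0..L}" for x by (rule dG[OF that])
    show "1 \<le> cutoff b A (1 + x)" if "x \<in> {0..L}" for x using that by (intro cutoff_bounds(1)[OF b(2,1)]) simp
  qed (use G0 x in simp_all)
  then have "r t \<le> G (r t)" using rL[OF t] by blast
  moreover have i0: "fst (wave fixed_coeff) 0 = \<phi>" "snd (wave fixed_coeff) 0 = \<psi>" using is_wave_coeff by (auto simp: is_wave_def)
  have s0: "P 0 + r 0 + (r 0)\<^sup>2 / 2 \<le> b - 1" using small by (simp add: P_def r_def grad_sq_def i0)
  have P0: "0 \<le> P 0" unfolding P_def by (intro Bochner_Integration.integral_nonneg) simp
  have r0: "0 \<le> r 0" using rL[OF T0] by simp
  have r1: "1 + r 0 \<le> b" using s0 P0 zero_le_power2[of "r 0"] by linarith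
  moreover have "G (r 0) \<le> r 0 + (r 0)\<^sup>2 / 2"
  proof (rule derivative_comparison[where T = "r 0" and f = G and f' = "\<lambda>x. cutoff b A (1 + x)" and g = "\<lambda>x. x + x\<^sup>2 / 2" and g' = "\<lambda>x. 1 + x"])
    fix x assume x: "x \<in> {0..r 0}"
    have "x \<in> {0..L}" using x rL[OF T0] by auto
    then show "(G has_real_derivative cutoff b A (1 + x)) (at x within {0..r 0})"
      by (rule has_field_derivative_subset[OF dG]) (use rL[OF T0] in auto)
    show "((\<lambda>x. x + x\<^sup>2 / 2) has_real_derivative 1 + x) (at x within {0..r 0})"
      by (rule derivative_eq_intros refl | simp)+
    show "cutoff b A (1 + x) \<le> 1 + x" using x r1 b by (simp add: cutoff_id)
  qed (use r0 G0 in auto)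
  ultimately have "r t \<le> b - 1" using s0 by linarith
  then show ?thesis by (simp add: r_def)
qed

theorem kirchhoff_fourier_exists:
  assumes small: "(\<integral>\<xi>. (cmod (\<psi> \<xi>))\<^sup>2 \<partial>lborel) + (\<integral>\<xi>. (norm \<xi>)\<^sup>2 * (cmod (\<phi> \<xi>))\<^sup>2 \<partial>lborel)
      + (\<integral>\<xi>. (norm \<xi>)\<^sup>2 * (cmod (\<phi> \<xi>))\<^sup>2 \<partial>lborel)\<^sup>2 / 2 \<le> b - 1"
  shows "\<exists>y z C. C \<ge> 0 \<and> (\<forall>\<xi>. wave_ode T (\<lambda>t. 1 + (\<integral>\<xi>. (norm \<xi>)\<^sup>2 * (cmod (y t \<xi>))\<^sup>2 \<partial>lborel)) (norm \<xi>) (\<lambda>t. y t \<xi>) (\<lambda>t. z t \<xi>)) \<and>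
    y 0 = \<phi> \<and> z 0 = \<psi> \<and> (\<forall>t. y t \<in> borel_measurable borel \<and> z t \<in> borel_measurable borel) \<and>
    (\<forall>t\<in>{0..T}. (\<integral>\<xi>. (norm \<xi>)\<^sup>2 * (cmod (y t \<xi>))\<^sup>2 \<partial>lborel) \<le> C) \<and>
    (\<forall>t\<in>{0..T}. \<forall>\<xi>. mode_energy (norm \<xi>) (y t \<xi>) (z t \<xi>) \<le> C * mode_energy (norm \<xi>) (\<phi> \<xi>) (\<psi> \<xi>))"
proof -
  have eq: "fixed_coeff t = 1 + (\<integral>\<xi>. (norm \<xi>)\<^sup>2 * (cmod (fst (wave fixed_coeff) t \<xi>))\<^sup>2 \<partial>lborel)" if t: "t \<in> {0..T}" for t
    using fixed_coeff_eq[OF t] cutoff_id[OF b(2) grad_sq_bound[OF small t]] by (simp add: grad_sq_def)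
  define C where "C = max C1 A"
  have "wave_ode T (\<lambda>t. 1 + (\<integral>\<xi>. (norm \<xi>)\<^sup>2 * (cmod (fst (wave fixed_coeff) t \<xi>))\<^sup>2 \<partial>lborel)) (norm \<xi>) (\<lambda>t. fst (wave fixed_coeff) t \<xi>) (\<lambda>t. snd (wave fixed_coeff) t \<xi>)" for \<xi>
  proof -
    have "wave_ode T fixed_coeff (norm \<xi>) (\<lambda>t. fst (wave fixed_coeff) t \<xi>) (\<lambda>t. snd (wave fixed_coeff) t \<xi>)"
      using is_wave_coeff by (simp add: is_wave_def)
    then show ?thesis unfolding wave_ode_def using eq by simp
  qed
  moreover have "(\<integral>\<xi>. (norm \<xi>)\<^sup>2 * (cmod (fst (wave fixed_coeff) t \<xi>))\<^sup>2 \<partial>lborel) \<le> C" if "t \<in> {0..T}" for t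
    using eq[OF that] fixed_coeff_bounds[OF that] by (simp add: C_def)
  moreover have "mode_energy (norm \<xi>) (fst (wave fixed_coeff) t \<xi>) (snd (wave fixed_coeff) t \<xi>) \<le> C * mode_energy (norm \<xi>) (\<phi> \<xi>) (\<psi> \<xi>)"
    if "t \<in> {0..T}" for t \<xi>
  proof -
    have "mode_energy (norm \<xi>) (fst (wave fixed_coeff) t \<xi>) (snd (wave fixed_coeff) t \<xi>) \<le> C1 * E0 \<xi>"
      using bounded_wave_coeff that by (auto simp: bounded_wave_def)
    also have "\<dots> \<le> C * E0 \<xi>" by (intro mult_right_mono) (auto simp: C_def)
    finally show ?thesis by (simp add: E0_def)
  qed
  moreover have "C \<ge> 0" using C_nonneg by (simp add: C_def)
  ultimately show ?thesis using is_wave_coeff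
    by (intro exI[of _ "fst (wave fixed_coeff)"] exI[of _ "snd (wave fixed_coeff)"] exI[of _ C]) (auto simp: is_wave_def)
qed

end

section \<open>From modes to a Gevrey solution\<close>

lemma weighted_dominated_tendsto_0:
  fixes G :: "real \<Rightarrow> ('n::finite) cfun" and w B :: "real^'n \<Rightarrow> real"
  assumes m: "\<And>\<tau>. \<tau> \<in> S \<Longrightarrow> \<tau> \<noteq> t \<Longrightarrow> G \<tau> \<in> borel_measurable borel"
    and w: "\<And>\<xi>. 0 \<le> w \<xi>" "w \<in> borel_measurable borel"
    and B: "\<And>\<tau> \<xi>. \<tau> \<in> S \<Longrightarrow> \<tau> \<noteq> t \<Longrightarrow> (cmod (G \<tau> \<xi>))\<^sup>2 \<le> B \<xi>" "integrable lborel (\<lambda>\<xi>. w \<xi> * B \<xi>)"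
    and lim: "\<And>\<xi>. ((\<lambda>\<tau>. G \<tau> \<xi>) \<longlongrightarrow> 0) (at t within S)"
  shows "((\<lambda>\<tau>. \<integral>\<xi>. w \<xi> * (cmod (G \<tau> \<xi>))\<^sup>2 \<partial>lborel) \<longlongrightarrow> 0) (at t within S)"
  unfolding tendsto_at_iff_sequentially o_def
proof (intro allI impI)
  fix \<tau> :: "nat \<Rightarrow> real" assume \<tau>: "\<forall>i. \<tau> i \<in> S - {t}" and \<tau>t: "\<tau> \<longlonglongrightarrow> t"
  have \<tau>S: "\<tau> i \<in> S" "\<tau> i \<noteq> t" for i using \<tau> by auto
  note [measurable] = m[OF \<tau>S] w(2)
  have "(\<lambda>i. \<integral>\<xi>. w \<xi> * (cmod (G (\<tau> i) \<xi>))\<^sup>2 \<partial>lborel) \<longlonglongrightarrow> (\<integral>\<xi>. 0 \<partial>(lborel :: (real^'n) measure))"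
  proof (rule integral_dominated_convergence[OF _ _ B(2)])
    show "AE \<xi> in lborel. (\<lambda>i. w \<xi> * (cmod (G (\<tau> i) \<xi>))\<^sup>2) \<longlonglongrightarrow> 0"
    proof (rule AE_I2)
      fix \<xi>
      have "(\<lambda>i. G (\<tau> i) \<xi>) \<longlonglongrightarrow> 0"
        using lim[of \<xi>] \<tau> \<tau>t unfolding tendsto_at_iff_sequentially o_def by blast
      then have "(\<lambda>i. w \<xi> * (cmod (G (\<tau> i) \<xi>))\<^sup>2) \<longlonglongrightarrow> w \<xi> * (cmod 0)\<^sup>2" by (intro tendsto_intros)
      then show "(\<lambda>i. w \<xi> * (cmod (G (\<tau> i) \<xi>))\<^sup>2) \<longlonglongrightarrow> 0" by simp
    qed
    show "AE \<xi> in lborel. norm (w \<xi> * (cmod (G (\<tau> i) \<xi>))\<^sup>2) \<le> w \<xi> * B \<xi>" for i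
      using B(1)[OF \<tau>S] w(1) by (intro AE_I2) (simp add: mult_left_mono)
  qed measurable
  then show "(\<lambda>i. \<integral>\<xi>. w \<xi> * (cmod (G (\<tau> i) \<xi>))\<^sup>2 \<partial>lborel) \<longlonglongrightarrow> 0" by simp
qed

lemma gevrey_etaI:
  fixes f :: "'n::finite cfun"
  assumes f: "f \<in> L2" and eq: "AE \<xi> in lborel. fourier f \<xi> = g \<xi>" and B: "\<And>\<xi>. (cmod (g \<xi>))\<^sup>2 \<le> B \<xi>"
    and i: "integrable lborel (\<lambda>\<xi>. gevrey_weight s \<eta> \<xi> * B \<xi>)"
  shows "f \<in> gevrey_eta s \<eta>"
proof -
  have [measurable]: "fourier f \<in> borel_measurable borel" by (rule L2_measurable[OF fourier_L2[OF f]])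
  have "integrable lborel (\<lambda>\<xi>. gevrey_weight s \<eta> \<xi> * (cmod (fourier f \<xi>))\<^sup>2)"
  proof (rule Bochner_Integration.integrable_bound[OF i])
    show "AE \<xi> in lborel. norm (gevrey_weight s \<eta> \<xi> * (cmod (fourier f \<xi>))\<^sup>2) \<le> norm (gevrey_weight s \<eta> \<xi> * B \<xi>)"
      using eq
    proof eventually_elim
      case (elim \<xi>)
      have "0 \<le> B \<xi>" by (rule order_trans[OF zero_le_power2 B])
      then show ?case using elim B[of \<xi>] by (simp add: abs_mult mult_left_mono)
    qed
  qed measurable
  then show ?thesis using f by (simp add: gevrey_eta_def)
qed

text \<open>
  Pointwise convergence of the transforms with a Gevrey-integrable majorant gives convergence in
  the inductive limit topology.
\<close>

lemma limitin_gevrey_dominated: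
  fixes f :: "real \<Rightarrow> 'n::finite cfun"
  assumes \<eta>: "\<eta> > 0" and l: "l \<in> gevrey s" and f: "\<And>\<tau>. \<tau> \<in> S \<Longrightarrow> \<tau> \<noteq> t \<Longrightarrow> f \<tau> \<in> L2"
    and G: "\<And>\<tau>. \<tau> \<in> S \<Longrightarrow> \<tau> \<noteq> t \<Longrightarrow> AE \<xi> in lborel. fourier (f \<tau>) \<xi> - fourier l \<xi> = G \<tau> \<xi>"
    and m: "\<And>\<tau>. \<tau> \<in> S \<Longrightarrow> \<tau> \<noteq> t \<Longrightarrow> G \<tau> \<in> borel_measurable borel"
    and B: "\<And>\<tau> \<xi>. \<tau> \<in> S \<Longrightarrow> \<tau> \<noteq> t \<Longrightarrow> (cmod (G \<tau> \<xi>))\<^sup>2 \<le> B \<xi>"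
      "integrable lborel (\<lambda>\<xi>. gevrey_weight s \<eta> \<xi> * B \<xi>)"
    and lim: "\<And>\<xi>. ((\<lambda>\<tau>. G \<tau> \<xi>) \<longlongrightarrow> 0) (at t within S)"
  shows "limitin (gevrey_topology s) f l (at t within S)"
proof (rule limitin_gevrey_eta[OF \<eta> l])
  have l2: "l \<in> L2" by (rule gevrey_L2[OF l])
  have h: "(\<lambda>x. f \<tau> x - l x) \<in> L2" if "\<tau> \<in> S" "\<tau> \<noteq> t" for \<tau> by (rule L2_diff[OF f[OF that] l2])
  have F: "AE \<xi> in lborel. fourier (\<lambda>x. f \<tau> x - l x) \<xi> = G \<tau> \<xi>" if "\<tau> \<in> S" "\<tau> \<noteq> t" for \<tau>
    using fourier_lincomb[OF f[OF that] l2, of 1 "-1"] G[OF that] by eventually_elim simp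
  have "(\<lambda>x. f \<tau> x - l x) \<in> gevrey_eta s \<eta>" if "\<tau> \<in> S" "\<tau> \<noteq> t" for \<tau>
    by (rule gevrey_etaI[OF h[OF that] F[OF that] B(1)[OF that] B(2)])
  then show "\<forall>\<^sub>F \<tau> in at t within S. (\<lambda>x. f \<tau> x - l x) \<in> gevrey_eta s \<eta>"
    by (auto simp: eventually_at_filter)
  have eq: "(gevrey_norm s \<eta> (\<lambda>x. f \<tau> x - l x))\<^sup>2 = (\<integral>\<xi>. gevrey_weight s \<eta> \<xi> * (cmod (G \<tau> \<xi>))\<^sup>2 \<partial>lborel)"
    if \<tau>: "\<tau> \<in> S" "\<tau> \<noteq> t" for \<tau>
  proof -
    have [measurable]: "fourier (\<lambda>x. f \<tau> x - l x) \<in> borel_measurable borel" "G \<tau> \<in> borel_measurable borel"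
      using fourier_L2[OF h[OF \<tau>]] m[OF \<tau>] by (auto intro: L2_measurable)
    show ?thesis unfolding gevrey_norm_sq
      using F[OF \<tau>] by (intro integral_cong_AE) (auto elim!: eventually_mono)
  qed
  show "((\<lambda>\<tau>. (gevrey_norm s \<eta> (\<lambda>x. f \<tau> x - l x))\<^sup>2) \<longlongrightarrow> 0) (at t within S)"
  proof (rule Lim_transform_eventually)
    show "((\<lambda>\<tau>. \<integral>\<xi>. gevrey_weight s \<eta> \<xi> * (cmod (G \<tau> \<xi>))\<^sup>2 \<partial>lborel) \<longlongrightarrow> 0) (at t within S)"
      by (rule weighted_dominated_tendsto_0[where B = B]) (use m B lim in auto)
    show "\<forall>\<^sub>F \<tau> in at t within S. (\<integral>\<xi>. gevrey_weight s \<eta> \<xi> * (cmod (G \<tau> \<xi>))\<^sup>2 \<partial>lborel) = (gevrey_norm s \<eta> (\<lambda>x. f \<tau> x - l x))\<^sup>2"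
      using eq by (auto simp: eventually_at_filter)
  qed
qed

lemma vector_derivative_mean_value:
  fixes f f' :: "real \<Rightarrow> complex"
  assumes d: "\<And>t. t \<in> {0..T} \<Longrightarrow> (f has_vector_derivative f' t) (at t within {0..T})"
    and B: "\<And>t. t \<in> {0..T} \<Longrightarrow> cmod (f' t) \<le> B" and "t \<in> {0..T}" "\<tau> \<in> {0..T}"
  shows "cmod (f \<tau> - f t) \<le> B * \<bar>\<tau> - t\<bar>"
proof -
  have "norm (f \<tau> - f t) \<le> B * norm (\<tau> - t)"
  proof (rule differentiable_bound[of "{0..T}"])
    show "(f has_derivative (\<lambda>h. h *\<^sub>R f' t)) (at t within {0..T})" if "t \<in> {0..T}" for t
      using d[OF that] by (simp add: has_vector_derivative_def)
    show "onorm (\<lambda>h. h *\<^sub>R f' t) \<le> B" if "t \<in> {0..T}" for t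
      using B[OF that] by (intro onorm_le) (simp add: mult_left_mono mult.commute[of B])
  qed (use assms(3,4) in auto)
  then show ?thesis by simp
qed

text \<open>
  By the mean value inequality difference quotients obey the same bound as the derivative, so a
  majorant for the squared derivative provides one for the error of the quotient.
\<close>

lemma diff_quot_mean_value:
  fixes f f' :: "real \<Rightarrow> complex"
  assumes d: "\<And>t. t \<in> {0..T} \<Longrightarrow> (f has_vector_derivative f' t) (at t within {0..T})"
    and B: "\<And>t. t \<in> {0..T} \<Longrightarrow> (cmod (f' t))\<^sup>2 \<le> B" and t: "t \<in> {0..T}" and \<tau>: "\<tau> \<in> {0..T}" "\<tau> \<noteq> t"
  shows "(cmod ((f \<tau> - f t) / complex_of_real (\<tau> - t) - f' t))\<^sup>2 \<le> 4 * B"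
proof -
  have B0: "0 \<le> B" by (rule order_trans[OF zero_le_power2 B[OF t]])
  have "cmod (f \<tau> - f t) \<le> sqrt B * \<bar>\<tau> - t\<bar>"
    by (rule vector_derivative_mean_value[OF d _ t \<tau>(1)]) (simp_all add: real_le_rsqrt B)
  then have "cmod ((f \<tau> - f t) / complex_of_real (\<tau> - t)) \<le> sqrt B"
    using \<tau>(2) by (simp add: norm_divide pos_divide_le_eq flip: of_real_diff)
  then have "(cmod ((f \<tau> - f t) / complex_of_real (\<tau> - t)))\<^sup>2 \<le> (sqrt B)\<^sup>2" by (intro power_mono) auto
  then have 1: "(cmod ((f \<tau> - f t) / complex_of_real (\<tau> - t)))\<^sup>2 \<le> B" using B0 by simp
  have "(cmod ((f \<tau> - f t) / complex_of_real (\<tau> - t) + - f' t))\<^sup>2 \<le> 2 * (cmod ((f \<tau> - f t) / complex_of_real (\<tau> - t)))\<^sup>2 + 2 * (cmod (- f' t))\<^sup>2"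
    by (rule cmod_add_sq_le)
  also have "\<dots> \<le> 2 * B + 2 * B" using 1 B[OF t] by (intro add_mono mult_left_mono) auto
  finally show ?thesis by simp
qed

lemma diff_quot_tendsto:
  fixes f f' :: "real \<Rightarrow> complex"
  assumes "(f has_vector_derivative D) (at t within S)"
  shows "((\<lambda>\<tau>. (f \<tau> - f t) / complex_of_real (\<tau> - t) - D) \<longlongrightarrow> 0) (at t within S)"
  using has_vector_derivative_slope[OF assms]
  by (intro LIM_zero) (simp add: scaleR_conv_of_real divide_inverse mult.commute)

text \<open>
  The energy of every mode is at most a constant times its initial value, so \<open>y\<close> and \<open>z\<close> have a
  majorant that is independent of time and consists of the data multiplied by a polynomial in
  \<open>|\<xi>|\<close>. Halving the Gevrey exponent \<open>\<eta>\<close> of the data absorbs this polynomial, and all limits follow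
  by dominated convergence.
\<close>

lemma kirchhoff_solution_from_fourier:
  fixes y z :: "real \<Rightarrow> 'n::finite cfun" and u0 u1 :: "'n cfun"
  assumes s: "s > 0" and T: "T > 0" and u: "u0 \<in> gevrey s" "u1 \<in> gevrey s" and C: "C \<ge> 0"
    and ode: "\<And>\<xi>. wave_ode T (\<lambda>t. 1 + (\<integral>\<xi>. (norm \<xi>)\<^sup>2 * (cmod (y t \<xi>))\<^sup>2 \<partial>lborel)) (norm \<xi>) (\<lambda>t. y t \<xi>) (\<lambda>t. z t \<xi>)"
    and i: "y 0 = fourier u0" "z 0 = fourier u1"
    and m: "\<And>t. y t \<in> borel_measurable borel" "\<And>t. z t \<in> borel_measurable borel"
    and aC: "\<And>t. t \<in> {0..T} \<Longrightarrow> (\<integral>\<xi>. (norm \<xi>)\<^sup>2 * (cmod (y t \<xi>))\<^sup>2 \<partial>lborel) \<le> C"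
    and E: "\<And>t \<xi>. t \<in> {0..T} \<Longrightarrow> mode_energy (norm \<xi>) (y t \<xi>) (z t \<xi>) \<le> C * mode_energy (norm \<xi>) (fourier u0 \<xi>) (fourier u1 \<xi>)"
  shows "kirchhoff_solution s T u0 u1 (\<lambda>t. inv_fourier (y t))"
proof -
  note [measurable] = m
  define a where "a t = 1 + (\<integral>\<xi>. (norm \<xi>)\<^sup>2 * (cmod (y t \<xi>))\<^sup>2 \<partial>lborel)" for t
  have a0: "0 \<le> a t" for t unfolding a_def by (intro add_nonneg_nonneg Bochner_Integration.integral_nonneg) auto
  have a_le: "a t \<le> 1 + C" if "t \<in> {0..T}" for t using aC[OF that] by (simp add: a_def)
  have T0: "0 \<in> {0..T}" using T by simp
  have dy: "((\<lambda>t. y t \<xi>) has_vector_derivative z t \<xi>) (at t within {0..T})"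
    and dz: "((\<lambda>t. z t \<xi>) has_vector_derivative - (complex_of_real (a t * (norm \<xi>)\<^sup>2) * y t \<xi>)) (at t within {0..T})"
    if "t \<in> {0..T}" for t \<xi> using ode[of \<xi>] that by (auto simp: wave_ode_def a_def)
  obtain \<eta>1 \<eta>2 where e: "\<eta>1 > 0" "\<eta>2 > 0" "u0 \<in> gevrey_eta s \<eta>1" "u1 \<in> gevrey_eta s \<eta>2"
    using u by (auto simp: gevrey_def)
  \<comment> \<open>The data lie in the step \<open>2 \<eta>\<close>, the solution will be in the step \<open>\<eta>\<close>.\<close>
  define \<eta> where "\<eta> = min \<eta>1 \<eta>2 / 2"
  have \<eta>: "\<eta> > 0" using e by (simp add: \<eta>_def)
  have ug: "u0 \<in> gevrey_eta s (2 * \<eta>)" "u1 \<in> gevrey_eta s (2 * \<eta>)"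
    by (rule gevrey_eta_mono[OF _ e(3)], simp add: \<eta>_def, rule gevrey_eta_mono[OF _ e(4)], simp add: \<eta>_def)
  define Q where "Q \<xi> = (cmod (fourier u0 \<xi>))\<^sup>2 + (cmod (fourier u1 \<xi>))\<^sup>2" for \<xi>
  have Q0: "0 \<le> Q \<xi>" for \<xi> by (simp add: Q_def)
  have [measurable]: "fourier u0 \<in> borel_measurable borel" "fourier u1 \<in> borel_measurable borel"
    by (rule L2_measurable[OF fourier_L2[OF gevrey_L2[OF u(1)]]], rule L2_measurable[OF fourier_L2[OF gevrey_L2[OF u(2)]]])
  have [measurable]: "Q \<in> borel_measurable borel" unfolding Q_def[abs_def] by measurable
  have Qint: "integrable lborel (\<lambda>\<xi>. gevrey_weight s \<eta> \<xi> * (norm \<xi> ^ k * Q \<xi>))" for k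
  proof -
    obtain c where c: "c > 0" "\<And>\<xi>::real^'n. norm \<xi> ^ k \<le> c * gevrey_weight s \<eta> \<xi>"
      using power_le_gevrey_weight[OF s \<eta>, of k] by blast
    have w2: "gevrey_weight s \<eta> \<xi> * gevrey_weight s \<eta> \<xi> = gevrey_weight s (2 * \<eta>) \<xi>" for \<xi> :: "real^'n"
      by (simp add: gevrey_weight_def flip: exp_add)
    have I: "integrable lborel (\<lambda>\<xi>. c * (gevrey_weight s (2 * \<eta>) \<xi> * Q \<xi>))"
      using gevrey_etaD(2)[OF ug(1)] gevrey_etaD(2)[OF ug(2)] by (simp add: Q_def distrib_left)
    show ?thesis
    proof (rule Bochner_Integration.integrable_bound[OF I])
      show "AE \<xi> in lborel. norm (gevrey_weight s \<eta> \<xi> * (norm \<xi> ^ k * Q \<xi>)) \<le> norm (c * (gevrey_weight s (2 * \<eta>) \<xi> * Q \<xi>))"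
      proof (rule AE_I2)
        fix \<xi> :: "real^'n"
        have "gevrey_weight s \<eta> \<xi> * (norm \<xi> ^ k * Q \<xi>) \<le> gevrey_weight s \<eta> \<xi> * ((c * gevrey_weight s \<eta> \<xi>) * Q \<xi>)"
          using c(2)[of \<xi>] Q0 by (intro mult_left_mono mult_right_mono) auto
        also have "\<dots> = c * (gevrey_weight s (2 * \<eta>) \<xi> * Q \<xi>)" unfolding w2[symmetric] by (simp only: mult_ac)
        finally show "norm (gevrey_weight s \<eta> \<xi> * (norm \<xi> ^ k * Q \<xi>)) \<le> norm (c * (gevrey_weight s (2 * \<eta>) \<xi> * Q \<xi>))"
          using Q0[of \<xi>] c(1) by (simp add: abs_mult)
      qed
    qed measurable
  qed
  \<comment> \<open>The factor for \<open>y\<close> comes from \<open>y(t) = y(0) + (y(t) - y(0))\<close> and the bound for \<open>z\<close>; the energy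
    alone does not control \<open>y\<close> at low frequencies.\<close>
  define N where "N = 2 + (2 * T\<^sup>2 + 1) * C"
  define D where "D \<xi> = N * ((1 + (norm \<xi>)\<^sup>2) * Q \<xi>)" for \<xi>
  have N: "2 \<le> N" "C \<le> N" "2 + 2 * T\<^sup>2 * C \<le> N" using C by (auto simp: N_def algebra_simps)
  have EQ: "mode_energy (norm \<xi>) (fourier u0 \<xi>) (fourier u1 \<xi>) \<le> (1 + (norm \<xi>)\<^sup>2) * Q \<xi>" for \<xi>
    by (simp add: mode_energy_def Q_def algebra_simps)
  have Q1: "Q \<xi> \<le> (1 + (norm \<xi>)\<^sup>2) * Q \<xi>" for \<xi>
    using mult_right_mono[of 1 "1 + (norm \<xi>)\<^sup>2" "Q \<xi>"] Q0 by simp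
  have zE: "(cmod (z t \<xi>))\<^sup>2 \<le> C * ((1 + (norm \<xi>)\<^sup>2) * Q \<xi>)" if "t \<in> {0..T}" for t \<xi>
  proof -
    have "(cmod (z t \<xi>))\<^sup>2 \<le> mode_energy (norm \<xi>) (y t \<xi>) (z t \<xi>)" by (simp add: mode_energy_def)
    also note E[OF that]
    also have "C * mode_energy (norm \<xi>) (fourier u0 \<xi>) (fourier u1 \<xi>) \<le> C * ((1 + (norm \<xi>)\<^sup>2) * Q \<xi>)"
      by (rule mult_left_mono[OF EQ C])
    finally show ?thesis .
  qed
  have zD: "(cmod (z t \<xi>))\<^sup>2 \<le> D \<xi>" if "t \<in> {0..T}" for t \<xi>
  proof -
    have "C * ((1 + (norm \<xi>)\<^sup>2) * Q \<xi>) \<le> D \<xi>" unfolding D_def using N Q0[of \<xi>] by (intro mult_right_mono) auto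
    then show ?thesis using zE[OF that, of \<xi>] by linarith
  qed
  have yD: "(cmod (y t \<xi>))\<^sup>2 \<le> D \<xi>" if t: "t \<in> {0..T}" for t \<xi>
  proof -
    define q where "q = (1 + (norm \<xi>)\<^sup>2) * Q \<xi>"
    have q0: "0 \<le> q" using Q0[of \<xi>] by (simp add: q_def)
    have "cmod (y t \<xi> - y 0 \<xi>) \<le> sqrt (C * q) * \<bar>t - 0\<bar>"
      by (rule vector_derivative_mean_value[OF dy _ T0 t]) (use zE in \<open>simp_all add: real_le_rsqrt q_def\<close>)
    also have "\<dots> \<le> sqrt (C * q) * T" using t C q0 by (intro mult_left_mono) auto
    finally have "(cmod (y t \<xi> - y 0 \<xi>))\<^sup>2 \<le> (sqrt (C * q) * T)\<^sup>2" by (intro power_mono) auto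
    also have "\<dots> = T\<^sup>2 * C * q" using C q0 by (simp add: power_mult_distrib)
    finally have 1: "(cmod (y t \<xi> - y 0 \<xi>))\<^sup>2 \<le> T\<^sup>2 * C * q" .
    have 2: "(cmod (y 0 \<xi>))\<^sup>2 \<le> q"
    proof -
      have "(cmod (y 0 \<xi>))\<^sup>2 \<le> Q \<xi>" by (simp add: i Q_def)
      then show ?thesis using Q1[of \<xi>] unfolding q_def by linarith
    qed
    have "(cmod (y t \<xi>))\<^sup>2 \<le> 2 * (cmod (y t \<xi> - y 0 \<xi>))\<^sup>2 + 2 * (cmod (y 0 \<xi>))\<^sup>2"
      using cmod_add_sq_le[of "y t \<xi> - y 0 \<xi>" "y 0 \<xi>"] by simp
    also have "\<dots> \<le> (2 + 2 * T\<^sup>2 * C) * q" using 1 2 by (simp add: algebra_simps)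
    also have "\<dots> \<le> N * q" by (rule mult_right_mono[OF N(3) q0])
    finally show ?thesis by (simp add: D_def q_def)
  qed
  have D0: "0 \<le> D \<xi>" for \<xi> using yD[OF T0] by (rule order_trans[OF zero_le_power2])
  have Dint: "integrable lborel (\<lambda>\<xi>. gevrey_weight s \<eta> \<xi> * (norm \<xi> ^ k * D \<xi>))" for k
  proof -
    have "gevrey_weight s \<eta> \<xi> * (norm \<xi> ^ k * D \<xi>) = N * (gevrey_weight s \<eta> \<xi> * (norm \<xi> ^ k * Q \<xi>)) + N * (gevrey_weight s \<eta> \<xi> * (norm \<xi> ^ (k + 2) * Q \<xi>))" for \<xi> :: "real^'n"
      by (simp add: D_def power_add power2_eq_square algebra_simps)
    then show ?thesis using Qint[of k] Qint[of "k + 2"] by simp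
  qed
  have Dm [measurable]: "D \<in> borel_measurable borel" unfolding D_def by measurable
  have Dint1: "integrable lborel (\<lambda>\<xi>. norm \<xi> ^ k * D \<xi>)" for k
  proof (rule Bochner_Integration.integrable_bound[OF Dint[of k]])
    show "AE \<xi> in lborel. norm (norm \<xi> ^ k * D \<xi>) \<le> norm (gevrey_weight s \<eta> \<xi> * (norm \<xi> ^ k * D \<xi>))"
    proof (rule AE_I2)
      fix \<xi> :: "real^'n"
      have "1 * (norm \<xi> ^ k * D \<xi>) \<le> gevrey_weight s \<eta> \<xi> * (norm \<xi> ^ k * D \<xi>)"
        using gevrey_weight_ge_1[of \<eta> s \<xi>] \<eta> D0[of \<xi>] by (intro mult_right_mono) auto
      then show "norm (norm \<xi> ^ k * D \<xi>) \<le> norm (gevrey_weight s \<eta> \<xi> * (norm \<xi> ^ k * D \<xi>))"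
        using D0[of \<xi>] by (simp add: abs_mult)
    qed
  qed measurable
  have DI: "integrable lborel D" "integrable lborel (\<lambda>\<xi>. gevrey_weight s \<eta> \<xi> * D \<xi>)"
    using Dint1[of 0] Dint[of 0] by simp_all
  have L: "y t \<in> L2" "z t \<in> L2" if "t \<in> {0..T}" for t
    using yD[OF that] zD[OF that] by (auto intro!: L2_bound[OF DI(1)] m)
  have fL: "freq k (y t) \<in> L2" if t: "t \<in> {0..T}" for k t
  proof (rule L2_bound[OF Dint1[of "2 * k"]])
    show "AE \<xi> in lborel. (cmod (freq k (y t) \<xi>))\<^sup>2 \<le> norm \<xi> ^ (2 * k) * D \<xi>"
      using yD[OF t] by (intro AE_I2) (simp add: freq_def norm_mult norm_power power_mult_distrib mult_left_mono mult.commute[of 2 k] flip: power_mult)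
  qed (use m in measurable)
  define u u' where "u t = inv_fourier (y t)" and "u' t = inv_fourier (z t)" for t
  have uL: "u t \<in> L2" "u' t \<in> L2" if "t \<in> {0..T}" for t
    unfolding u_def u'_def by (rule inv_fourier_L2[OF L(1)[OF that]], rule inv_fourier_L2[OF L(2)[OF that]])
  have Fu: "AE \<xi> in lborel. fourier (u t) \<xi> = y t \<xi>" "AE \<xi> in lborel. fourier (u' t) \<xi> = z t \<xi>" if "t \<in> {0..T}" for t
    unfolding u_def u'_def by (rule fourier_inv_fourier[OF L(1)[OF that]], rule fourier_inv_fourier[OF L(2)[OF that]])
  have ug: "u t \<in> gevrey s" "u' t \<in> gevrey s" if t: "t \<in> {0..T}" for t
    using gevrey_etaI[OF uL(1)[OF t] Fu(1)[OF t] yD[OF t] DI(2)] gevrey_etaI[OF uL(2)[OF t] Fu(2)[OF t] zD[OF t] DI(2)] \<eta>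
    by (auto simp: gevrey_def)
  have D4: "integrable lborel (\<lambda>\<xi>. gevrey_weight s \<eta> \<xi> * (4 * D \<xi>))"
    using integrable_mult_right[OF DI(2), of 4] by (simp add: mult.left_commute)
  have sqd: "(cmod (p - q))\<^sup>2 \<le> 4 * B" if "(cmod p)\<^sup>2 \<le> B" "(cmod q)\<^sup>2 \<le> B" for p q B
    using cmod_add_sq_le[of p "- q"] that by simp
  have c1: "C1_gevrey s T u u'"
    unfolding C1_gevrey_def continuous_map_real_set
  proof (intro conjI ballI)
    fix t assume t: "t \<in> {0..T}"
    show "limitin (gevrey_topology s) u (u t) (at t within {0..T})"
    proof (rule limitin_gevrey_dominated[where G = "\<lambda>\<tau> \<xi>. y \<tau> \<xi> - y t \<xi>" and B = "\<lambda>\<xi>. 4 * D \<xi>", OF \<eta> ug(1)[OF t] uL(1) _ _ _ D4])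
      show "AE \<xi> in lborel. fourier (u \<tau>) \<xi> - fourier (u t) \<xi> = y \<tau> \<xi> - y t \<xi>" if "\<tau> \<in> {0..T}" for \<tau>
        using Fu(1)[OF that] Fu(1)[OF t] by eventually_elim simp
      show "((\<lambda>\<tau>. y \<tau> \<xi> - y t \<xi>) \<longlongrightarrow> 0) (at t within {0..T})" for \<xi>
        using has_vector_derivative_continuous[OF dy[OF t]] by (intro LIM_zero) (simp add: continuous_within)
    qed (use yD t sqd in auto)
    show "limitin (gevrey_topology s) u' (u' t) (at t within {0..T})"
    proof (rule limitin_gevrey_dominated[where G = "\<lambda>\<tau> \<xi>. z \<tau> \<xi> - z t \<xi>" and B = "\<lambda>\<xi>. 4 * D \<xi>", OF \<eta> ug(2)[OF t] uL(2) _ _ _ D4])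
      show "AE \<xi> in lborel. fourier (u' \<tau>) \<xi> - fourier (u' t) \<xi> = z \<tau> \<xi> - z t \<xi>" if "\<tau> \<in> {0..T}" for \<tau>
        using Fu(2)[OF that] Fu(2)[OF t] by eventually_elim simp
      show "((\<lambda>\<tau>. z \<tau> \<xi> - z t \<xi>) \<longlongrightarrow> 0) (at t within {0..T})" for \<xi>
        using has_vector_derivative_continuous[OF dz[OF t]] by (intro LIM_zero) (simp add: continuous_within)
    qed (use zD t sqd in auto)
    show "limitin (gevrey_topology s) (diff_quot u t) (u' t) (at t within {0..T})"
    proof (rule limitin_gevrey_dominated[where G = "\<lambda>\<tau> \<xi>. (y \<tau> \<xi> - y t \<xi>) / complex_of_real (\<tau> - t) - z t \<xi>" and B = "\<lambda>\<xi>. 4 * D \<xi>", OF \<eta> ug(2)[OF t] _ _ _ _ D4])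
      show "diff_quot u t \<tau> \<in> L2" if "\<tau> \<in> {0..T}" for \<tau> by (rule diff_quot_L2[OF uL(1)[OF that] uL(1)[OF t]])
      show "AE \<xi> in lborel. fourier (diff_quot u t \<tau>) \<xi> - fourier (u' t) \<xi> = (y \<tau> \<xi> - y t \<xi>) / complex_of_real (\<tau> - t) - z t \<xi>" if "\<tau> \<in> {0..T}" for \<tau>
        using fourier_diff_quot[OF uL(1)[OF that] uL(1)[OF t]] Fu(1)[OF that] Fu(1)[OF t] Fu(2)[OF t]
        by eventually_elim (simp add: diff_quot_def)
      show "(cmod ((y \<tau> \<xi> - y t \<xi>) / complex_of_real (\<tau> - t) - z t \<xi>))\<^sup>2 \<le> 4 * D \<xi>" if "\<tau> \<in> {0..T}" "\<tau> \<noteq> t" for \<tau> \<xi>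
        by (rule diff_quot_mean_value[where f = "\<lambda>t. y t \<xi>" and f' = "\<lambda>t. z t \<xi>", OF dy zD t that])
      show "((\<lambda>\<tau>. (y \<tau> \<xi> - y t \<xi>) / complex_of_real (\<tau> - t) - z t \<xi>) \<longlongrightarrow> 0) (at t within {0..T})" for \<xi>
        by (rule diff_quot_tendsto[OF dy[OF t]])
    qed measurable
  qed
  have eqn: "has_L2_derivative u' (\<lambda>x. of_real (1 + (\<integral>y. (norm (gradient (u t) y))\<^sup>2 \<partial>lborel)) * laplacian (u t) x) t {0..T}"
    if t: "t \<in> {0..T}" for t
  proof -
    have F: "freq k (fourier (u t)) \<in> L2" for k by (rule gevrey_freq[OF s ug(1)[OF t]])
    note w = kirchhoff_rhs_fourier[OF uL(1)[OF t] F F]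
    have Fy: "sq_norm (freq 1 (fourier (u t))) = sq_norm (freq 1 (y t))"
      using freq_L2_AE_cong(2)[OF F m(1) Fu(1)[OF t]] .
    have ay: "1 + sq_norm (freq 1 (fourier (u t))) = a t"
      unfolding Fy by (simp add: a_def sq_norm_def freq_def norm_mult power_mult_distrib)
    define Z where "Z \<xi> = - (complex_of_real (a t * (norm \<xi>)\<^sup>2) * y t \<xi>)" for \<xi>
    have [measurable]: "Z \<in> borel_measurable borel" unfolding Z_def by measurable
    let ?w = "\<lambda>x. complex_of_real (1 + (\<integral>y. (norm (gradient (u t) y))\<^sup>2 \<partial>lborel)) * laplacian (u t) x"
    have wZ: "AE \<xi> in lborel. fourier ?w \<xi> = Z \<xi>"
      using w(2) Fu(1)[OF t] unfolding ay by eventually_elim (simp add: Z_def freq_def)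
    have Zb: "(cmod (- (complex_of_real (a t * (norm \<xi>)\<^sup>2) * y t \<xi>)))\<^sup>2 \<le> (1 + C)\<^sup>2 * (norm \<xi> ^ 4 * D \<xi>)" if t: "t \<in> {0..T}" for t \<xi>
    proof -
      have "(cmod (- (complex_of_real (a t * (norm \<xi>)\<^sup>2) * y t \<xi>)))\<^sup>2 = (a t)\<^sup>2 * (norm \<xi> ^ 4 * (cmod (y t \<xi>))\<^sup>2)"
        using a0[of t] by (simp add: norm_mult norm_power power_mult_distrib abs_mult flip: power_mult)
      also have "\<dots> \<le> (1 + C)\<^sup>2 * (norm \<xi> ^ 4 * D \<xi>)"
        using a_le[OF t] a0[of t] yD[OF t] D0 by (intro mult_mono power_mono) auto
      finally show ?thesis .
    qed
    have D4i: "integrable lborel (\<lambda>\<xi>. 1 * (4 * ((1 + C)\<^sup>2 * (norm \<xi> ^ 4 * D \<xi>))))" using Dint1[of 4] by simp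
    have "L2_deriv (\<lambda>t. fourier (u' t)) (fourier ?w) t {0..T}"
      unfolding L2_deriv_def
    proof (rule Lim_transform_eventually)
      show "((\<lambda>\<tau>. \<integral>\<xi>. 1 * (cmod ((z \<tau> \<xi> - z t \<xi>) / complex_of_real (\<tau> - t) - Z \<xi>))\<^sup>2 \<partial>lborel) \<longlongrightarrow> 0) (at t within {0..T})"
      proof (rule weighted_dominated_tendsto_0[OF _ _ _ _ D4i])
        show "(cmod ((z \<tau> \<xi> - z t \<xi>) / complex_of_real (\<tau> - t) - Z \<xi>))\<^sup>2 \<le> 4 * ((1 + C)\<^sup>2 * (norm \<xi> ^ 4 * D \<xi>))" if "\<tau> \<in> {0..T}" "\<tau> \<noteq> t" for \<tau> \<xi>
          unfolding Z_def
          by (rule diff_quot_mean_value[where f = "\<lambda>t. z t \<xi>" and f' = "\<lambda>t. - (complex_of_real (a t * (norm \<xi>)\<^sup>2) * y t \<xi>)", OF dz Zb t that])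
        show "((\<lambda>\<tau>. (z \<tau> \<xi> - z t \<xi>) / complex_of_real (\<tau> - t) - Z \<xi>) \<longlongrightarrow> 0) (at t within {0..T})" for \<xi>
          unfolding Z_def by (rule diff_quot_tendsto[OF dz[OF t]])
      qed auto
      show "\<forall>\<^sub>F \<tau> in at t within {0..T}. (\<integral>\<xi>. 1 * (cmod ((z \<tau> \<xi> - z t \<xi>) / complex_of_real (\<tau> - t) - Z \<xi>))\<^sup>2 \<partial>lborel)
         = sq_norm (\<lambda>\<xi>. diff_quot (\<lambda>t. fourier (u' t)) t \<tau> \<xi> - fourier ?w \<xi>)"
        using eventually_at_within_in
      proof eventually_elim
        case (elim \<tau>)
        have "(\<lambda>\<xi>. diff_quot (\<lambda>t. fourier (u' t)) t \<tau> \<xi> - fourier ?w \<xi>) \<in> L2"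
          using elim by (intro L2_diff diff_quot_L2 fourier_L2 uL t w) auto
        moreover have "(\<lambda>\<xi>. (z \<tau> \<xi> - z t \<xi>) / complex_of_real (\<tau> - t) - Z \<xi>) \<in> borel_measurable borel" by measurable
        moreover have "AE \<xi> in lborel. diff_quot (\<lambda>t. fourier (u' t)) t \<tau> \<xi> - fourier ?w \<xi> = (z \<tau> \<xi> - z t \<xi>) / complex_of_real (\<tau> - t) - Z \<xi>"
          using Fu(2)[of \<tau>] Fu(2)[OF t] wZ elim by (auto elim!: eventually_elim2 simp: diff_quot_def)
        ultimately have "sq_norm (\<lambda>\<xi>. diff_quot (\<lambda>t. fourier (u' t)) t \<tau> \<xi> - fourier ?w \<xi>) = sq_norm (\<lambda>\<xi>. (z \<tau> \<xi> - z t \<xi>) / complex_of_real (\<tau> - t) - Z \<xi>)"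
          by (rule sq_norm_AE_cong)
        then show ?case by (simp add: sq_norm_def)
      qed
    qed
    then show ?thesis using has_L2_derivative_fourier[of "{0..T}" u' t ?w, OF uL(2) t w(1)] by simp
  qed
  have init: "AE x in lborel. u 0 x = u0 x" "AE x in lborel. u' 0 x = u1 x"
    unfolding u_def u'_def i by (rule inv_fourier_fourier[OF gevrey_L2[OF u(1)]], rule inv_fourier_fourier[OF gevrey_L2[OF u(2)]])
  have "kirchhoff_solution s T u0 u1 u"
    unfolding kirchhoff_solution_def using c1 eqn init by (intro exI[of _ u']) simp
  then show ?thesis by (simp add: u_def[abs_def])
qed

text \<open>
  For \<open>a = 3/4\<close> and \<open>a = 1/4\<close> this gives the weights \<open>|\<xi>|\<^sup>3\<close> and \<open>|\<xi>|\<close> of the two terms of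
  \<open>|\<xi>|\<close> times the mode energy. The bound \<open>k \<le> 4\<close> serves to place the multiplier between those
  of orders 0 and 2.
\<close>

lemma frac_laplacian_gevrey:
  fixes f :: "'n::finite cfun"
  assumes s: "s > 0" and f: "f \<in> gevrey s" and a: "0 < a" "4 * a = real k" "k \<le> 4"
  shows "AE \<xi> in lborel. (cmod (fourier (frac_laplacian a f) \<xi>))\<^sup>2 = norm \<xi> ^ k * (cmod (fourier f \<xi>))\<^sup>2"
proof -
  have k0: "k > 0" using a by (cases k) auto
  have sq: "(x powr (2 * a))\<^sup>2 = x ^ k" if "x \<ge> 0" for x :: real
  proof (cases "x = 0")
    case False
    then have "(x powr (2 * a))\<^sup>2 = x powr (2 * a) * x powr (2 * a)" by (simp add: power2_eq_square)
    also have "\<dots> = x powr real k" using a(2) by (simp flip: powr_add)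
    finally show ?thesis using that False by (simp add: powr_realpow)
  qed (use k0 in simp)
  have [measurable]: "fourier f \<in> borel_measurable borel" by (rule L2_measurable[OF fourier_L2[OF gevrey_L2[OF f]]])
  have B: "integrable lborel (\<lambda>\<xi>. (cmod (fourier f \<xi>))\<^sup>2 + (cmod (freq 2 (fourier f) \<xi>))\<^sup>2)"
    by (intro Bochner_Integration.integrable_add L2_integrable fourier_L2 gevrey_L2[OF f] gevrey_freq[OF s f])
  have "(\<lambda>\<xi>. complex_of_real (norm \<xi> powr (2 * a)) * fourier f \<xi>) \<in> L2"
  proof (rule L2_bound[OF B])
    show "AE \<xi> in lborel. (cmod (complex_of_real (norm \<xi> powr (2 * a)) * fourier f \<xi>))\<^sup>2 \<le> (cmod (fourier f \<xi>))\<^sup>2 + (cmod (freq 2 (fourier f) \<xi>))\<^sup>2"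
    proof (rule AE_I2)
      fix \<xi> :: "real^'n"
      have "norm \<xi> ^ k \<le> 1 + norm \<xi> ^ 4"
      proof (cases "norm \<xi> \<le> 1")
        case True then show ?thesis using power_le_one[of "norm \<xi>" k] by (simp add: add_increasing2)
      next
        case False
        then have "norm \<xi> ^ k \<le> norm \<xi> ^ 4" using a(3) by (intro power_increasing) auto
        then show ?thesis by linarith
      qed
      then have "norm \<xi> ^ k * (cmod (fourier f \<xi>))\<^sup>2 \<le> (1 + norm \<xi> ^ 4) * (cmod (fourier f \<xi>))\<^sup>2" by (rule mult_right_mono) simp
      then show "(cmod (complex_of_real (norm \<xi> powr (2 * a)) * fourier f \<xi>))\<^sup>2 \<le> (cmod (fourier f \<xi>))\<^sup>2 + (cmod (freq 2 (fourier f) \<xi>))\<^sup>2"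
        by (simp only: norm_mult power_mult_distrib norm_of_real abs_of_nonneg[OF powr_ge_zero] sq[OF norm_ge_zero] freq_def norm_power
            abs_norm_cancel distrib_right mult_1_left flip: power_mult) simp
    qed
  qed measurable
  from frac_laplacian_fourier(2)[OF gevrey_L2[OF f] this] show ?thesis
    by eventually_elim (simp add: norm_mult power_mult_distrib sq)
qed

section \<open>Existence and uniqueness for the Kirchhoff equation\<close>

theorem theorem1p1:
  fixes T s M R \<eta> :: real and u0 u1 :: "real^'n \<Rightarrow> complex"
  assumes "T > 0" and "s > 1" and "M > 2" and "R > 0"
    and "u0 \<in> gevrey s" and "u1 \<in> gevrey s"
    and "\<eta> > eta_0 s M R T"
    and "2 * kirchhoff_energy u0 u1 < M\<^sup>2 / 4 - 1"
    and "(frac_laplacian (3/4) u0, frac_laplacian (1/4) u1) \<in> gevrey_eta s \<eta> \<times> gevrey_eta s \<eta>"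
    and "(gevrey_pair_norm s \<eta> (frac_laplacian (3/4) u0, frac_laplacian (1/4) u1))\<^sup>2 \<le> R"
  shows "(\<exists>u. kirchhoff_solution s T u0 u1 u) \<and>
         (\<forall>u v. kirchhoff_solution s T u0 u1 u \<and> kirchhoff_solution s T u0 u1 v \<longrightarrow>
            (\<forall>t\<in>{0..T}. AE x in lborel. u t x = v t x))"
proof
  have s: "s > 0" using assms(2) by simp
  show "\<forall>u v. kirchhoff_solution s T u0 u1 u \<and> kirchhoff_solution s T u0 u1 v \<longrightarrow>
            (\<forall>t\<in>{0..T}. AE x in lborel. u t x = v t x)"
    using kirchhoff_unique[OF s] by blast
  \<comment> \<open>The hypothesis on the energy says exactly that \<open>b < A\<close>.\<close>
  define A where "A = M\<^sup>2 / 4"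
  define b where "b = 1 + 2 * kirchhoff_energy u0 u1"
  note u0 = assms(5) and u1 = assms(6)
  note L = gevrey_L2[OF u0] gevrey_L2[OF u1]
  have F1: "freq 1 (fourier u0) \<in> L2" by (rule gevrey_freq[OF s u0])
  have f1: "(cmod (freq 1 (fourier u0) \<xi>))\<^sup>2 = (norm \<xi>)\<^sup>2 * (cmod (fourier u0 \<xi>))\<^sup>2" for \<xi>
    by (simp add: freq_def norm_mult power_mult_distrib)
  note en = energy_fourier[OF L(1) F1 L(2)]
  have b1: "1 \<le> b" unfolding b_def en by simp
  have bA: "b < A" using assms(8) by (simp add: b_def A_def)
  have [measurable]: "fourier u0 \<in> borel_measurable borel" "fourier u1 \<in> borel_measurable borel"
    by (rule L2_measurable[OF fourier_L2[OF L(1)]], rule L2_measurable[OF fourier_L2[OF L(2)]])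
  define w where "w \<xi> = gevrey_weight s \<eta> \<xi> * ((cmod (fourier (frac_laplacian (3/4) u0) \<xi>))\<^sup>2 + (cmod (fourier (frac_laplacian (1/4) u1) \<xi>))\<^sup>2)" for \<xi> :: "real^'n"
  \<comment> \<open>\<open>w\<close> is the density of the squared Gevrey norm in the hypothesis, \<open>W\<close> the form of it in which the
    mode energy of the data appears.\<close>
  define W where "W \<xi> = exp (\<eta> * norm \<xi> powr (1 / s)) * (norm \<xi> * mode_energy (norm \<xi>) (fourier u0 \<xi>) (fourier u1 \<xi>))" for \<xi> :: "real^'n"
  have g: "frac_laplacian (3/4) u0 \<in> gevrey_eta s \<eta>" "frac_laplacian (1/4) u1 \<in> gevrey_eta s \<eta>" using assms(9) by auto
  have wi: "integrable lborel w"
    unfolding w_def[abs_def] using gevrey_etaD(2)[OF g(1)] gevrey_etaD(2)[OF g(2)] by (simp add: distrib_left)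
  have wW: "AE \<xi> in lborel. w \<xi> = W \<xi>"
    using frac_laplacian_gevrey[OF s u0, of "3/4" 3] frac_laplacian_gevrey[OF s u1, of "1/4" 1]
    unfolding w_def W_def gevrey_weight_def mode_energy_def
    by (auto elim!: eventually_elim2 simp: power2_eq_square power3_eq_cube algebra_simps)
  have Wm: "W \<in> borel_measurable lborel" unfolding W_def[abs_def] mode_energy_def by measurable
  have Wi: "integrable lborel W" using wi wW Wm integrable_cong_AE[of w lborel W] by auto
  have "(\<integral>\<xi>. w \<xi> \<partial>lborel) = (gevrey_pair_norm s \<eta> (frac_laplacian (3/4) u0, frac_laplacian (1/4) u1))\<^sup>2"
    unfolding gevrey_pair_norm_def w_def
    by (subst prod.case, rule real_sqrt_pow2[symmetric], rule Bochner_Integration.integral_nonneg) simp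
  then have WR: "(\<integral>\<xi>. W \<xi> \<partial>lborel) \<le> R"
    using assms(10) integral_cong_AE[of w lborel W] wi Wm wW by auto
  interpret kirchhoff_data T s \<eta> A b R "fourier u0" "fourier u1"
  proof
    show "integrable lborel (\<lambda>\<xi>. mode_energy (norm \<xi>) (fourier u0 \<xi>) (fourier u1 \<xi>))"
      using L2_integrable[OF F1] L2_integrable[OF fourier_L2[OF L(2)]] unfolding mode_energy_def f1 by simp
    show "integrable lborel (\<lambda>\<xi>. exp (\<eta> * norm \<xi> powr (1 / s)) * (norm \<xi> * mode_energy (norm \<xi>) (fourier u0 \<xi>) (fourier u1 \<xi>)))"
      "(\<integral>\<xi>. exp (\<eta> * norm \<xi> powr (1 / s)) * (norm \<xi> * mode_energy (norm \<xi>) (fourier u0 \<xi>) (fourier u1 \<xi>)) \<partial>lborel) \<le> R"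
      using Wi WR unfolding W_def by auto
    have M0: "0 \<le> M\<^sup>2" by simp
    \<comment> \<open>The constant \<open>A e\<^bsup>A\<^esup> R\<close> is smaller than the one in \<open>eta_0\<close>, since \<open>1/4 \<le> 2 s\<close>.\<close>
    have A_le: "M\<^sup>2 / 4 \<le> 2 * s * M\<^sup>2" using mult_right_mono[of "1/4" "2 * s" "M\<^sup>2"] assms(2) by simp
    then have "M\<^sup>2 / 4 * exp (M\<^sup>2 / 4) \<le> 2 * s * M\<^sup>2 * exp (4 * M\<^sup>2)" using s by (intro mult_mono A_le) auto
    then have "A * exp A * R * T powr (1 + 1 / s) \<le> 2 * s * M\<^sup>2 * exp (4 * M\<^sup>2) * R * T powr (1 + 1 / s)"
      unfolding A_def using assms(4) by (intro mult_right_mono) auto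
    also have "\<dots> \<le> \<eta>" using assms(7) unfolding eta_0_def using M0 by linarith
    finally show "A * exp A * R * T powr (1 + 1 / s) \<le> \<eta>" .
  qed (use assms(1) s b1 bA in simp_all)
  have small: "(\<integral>\<xi>. (cmod (fourier u1 \<xi>))\<^sup>2 \<partial>lborel) + (\<integral>\<xi>. (norm \<xi>)\<^sup>2 * (cmod (fourier u0 \<xi>))\<^sup>2 \<partial>lborel)
      + (\<integral>\<xi>. (norm \<xi>)\<^sup>2 * (cmod (fourier u0 \<xi>))\<^sup>2 \<partial>lborel)\<^sup>2 / 2 \<le> b - 1"
    unfolding b_def en sq_norm_def f1 by simp
  from kirchhoff_fourier_exists[OF small] obtain y z C where K: "C \<ge> 0"
    "\<forall>\<xi>. wave_ode T (\<lambda>t. 1 + (\<integral>\<xi>. (norm \<xi>)\<^sup>2 * (cmod (y t \<xi>))\<^sup>2 \<partial>lborel)) (norm \<xi>) (\<lambda>t. y t \<xi>) (\<lambda>t. z t \<xi>)"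
    "y 0 = fourier u0" "z 0 = fourier u1" "\<forall>t. y t \<in> borel_measurable borel \<and> z t \<in> borel_measurable borel"
    "\<forall>t\<in>{0..T}. (\<integral>\<xi>. (norm \<xi>)\<^sup>2 * (cmod (y t \<xi>))\<^sup>2 \<partial>lborel) \<le> C"
    "\<forall>t\<in>{0..T}. \<forall>\<xi>. mode_energy (norm \<xi>) (y t \<xi>) (z t \<xi>) \<le> C * mode_energy (norm \<xi>) (fourier u0 \<xi>) (fourier u1 \<xi>)"
    by (elim exE conjE) (rule that)
  have "kirchhoff_solution s T u0 u1 (\<lambda>t. inv_fourier (y t))"
    by (rule kirchhoff_solution_from_fourier[OF s assms(1) u0 u1 K(1) K(2)[rule_format] K(3,4)])
      (use K(5-7) in blast)+
  then show "\<exists>u. kirchhoff_solution s T u0 u1 u" by blast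
qed

end
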